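(* Let $(A,b,a,K,\eta)$ and $(A^n,b^n,a^n,K^n,\eta^n)$, $n\in\mathbb{N}$, be parameters of martingale problems on $\mathbb{B}$ (in the sense of the context, i.e. all coefficients satisfy assumptions (i)--(v) there). Let $\mathcal{K}$, $\mathcal{D}$ be the operator and the test function set associated with $(A,b,a,K)$ and let $\mathcal{K}^n$, $\mathcal{B}^n$ be the operator and the set of functions associated with $(A^n,b^n,a^n,K^n)$ (see context). For all $n\in\mathbb{N}$ let $P^n$ be a solution to the MP $(A^n,b^n,a^n,K^n,\eta^n)$ and assume that the following hold: (M1) The map $x\mapsto\mathcal{K}f(x)$ is continuous for all $f\in\mathcal{D}$. (M2) For all $f\in\mathcal{D}$ there exists a sequence $(f^n)_{n\in\mathbb{N}}$ with $f^n\in\mathcal{B}^n$ such that for all $m\in\mathbb{N}$ $$\sup_{n\in\mathbb{N}}\sup_{x\in\mathbb{B}}|f^n(x)|+\sup_{n\in\mathbb{N}}\sup_{\|x\|\le m}|\mathcal{K}^nf^n(x)|<\infty,$$ and $|f^n-f|+|\mathcal{K}^nf^n-\mathcal{K}f|\to0$ as $n\to\infty$ uniformly on compact subsets of $\mathbb{B}$. (M3) $\eta^n\to\eta$ weakly as $n\to\infty$. If $P$ is a probability measure on $(\Omega,\mathscr{F})$ such that $P^n\to P$ weakly as $n\to\infty$, then $P$ solves the MP $(A,b,a,K,\eta)$.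
   Context: Let $(\mathbb{B},\|\cdot\|)$ be a real separable reflexive Banach space with topological dual $\mathbb{B}^*$ (with operator norm); write $\langle x,x^*\rangle=x^*(x)$. $\Omega$ is the Skorokhod space of all càdlàg functions $\mathbb{R}_+\to\mathbb{B}$ with the Skorokhod topology (a Polish space), $X_t(\alpha)=\alpha(t)$ is the coordinate process, $\mathscr{F}=\sigma(X_s,s\ge0)$ (the Borel $\sigma$-field of $\Omega$), $\mathscr{F}_t=\sigma(X_s,s\in[0,t])$. Stopping times, martingales, local martingales refer to the filtration $(\mathscr{F}_t)_{t\ge0}$. $S^+(\mathbb{B}^*,\mathbb{B})$ is the set of linear bounded operators $Q:\mathbb{B}^*\to\mathbb{B}$ with $\langle Qx^*,x^*\rangle\ge0$ and $\langle Qx^*,y^*\rangle=\langle Qy^*,x^*\rangle$ for all $x^*,y^*$. Parameters of a martingale problem $(A,b,a,K,\eta)$: (i) $A:D(A)\subset\mathbb{B}\to\mathbb{B}$ is linear, densely defined and closed, with Banach adjoint $A^*$. (ii) $b:\mathbb{B}\to\mathbb{B}$ is Borel and $\sup_n\sup_{x\in G}|\langle b(x),y_n^*\rangle|<\infty$ for all bounded sequences $(y^*_n)\subset\mathbb{B}^*$ and bounded $G\subset\mathbb{B}$. (iii) $a:\mathbb{B}\to S^+(\mathbb{B}^*,\mathbb{B})$ is bounded (in operator norm) on bounded sets and Borel, i.e. $x\mapsto a(x)y^*$ is Borel for all $y^*\in\mathbb{B}^*$. (iv) $K$ is a Borel transition kernel from $\mathbb{B}$ into $\mathbb{B}$ such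 that for all bounded sequences $(y_n^* )\subset\mathbb{B}^*$, bounded $G\subset\mathbb{B}$ and $\epsilon>0$: $\sup_n\sup_{x\in G}\int\mathbf{1}_{\{\|y\|\le\epsilon\}}|\langle y,y_n^*\rangle|^2K(x,dy)<\infty$, $\sup_{x\in G}K(x,\{z:\|z\|\ge\epsilon\})<\infty$, and $K(\cdot,\{0\})=0$. (v) $\eta$ is a Borel probability measure on $\mathbb{B}$. A truncation function is a bounded Borel $h:\mathbb{B}\to\mathbb{B}$ such that for some $\epsilon>0$, $h(x)=x$ whenever $\|x\|\le\epsilon$; one such $h$ is fixed throughout. Let $\mathcal{C}=\{g(\langle\cdot,y_1^*\rangle,\dots,\langle\cdot,y_d^*\rangle):g\in C_c^2(\mathbb{R}^d),\,y_1^*,\dots,y_d^*\in D(A^* ),\,d\in\mathbb{N}\}$, $\mathcal{D}=\{g(\langle\cdot,y^*\rangle):g\in C_c^2(\mathbb{R}),\,y^*\in D(A^* )\}$, $\mathcal{B}=\{g(\langle\cdot,y^*\rangle):g\in C_b^2(\mathbb{R}),\,y^*\in D(A^* )\}$, where $C_c^2$ denotes compactly supported $C^2$ functions and $C_b^2$ bounded $C^2$ functions with bounded first and second derivatives. For $f=g(\langle\cdot,y_1^*\rangle,\dots,\langle\cdot,y_d^*\rangle)$ in $\mathcal{C}$ or $\mathcal{B}$, with $\partial_if=(\partial_ig)(\langle\cdot,y_1^*\rangle,\dots,\langle\cdot,y_d^*\rangle)$ and similarly $\partial^2_{ij}f$, set $$\mathcal{K}f(x)=\sum_{i=1}^d(\langle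 x,A^*y_i^*\rangle+\langle b(x),y_i^*\rangle)\partial_if(x)+\tfrac12\sum_{i,j=1}^d\langle a(x)y_i^*,y_j^*\rangle\partial^2_{ij}f(x)+\int_{\mathbb{B}}\Big(f(x+y)-f(x)-\sum_{i=1}^d\langle h(y),y_i^*\rangle\partial_if(x)\Big)K(x,dy).$$ A probability measure $P$ on $(\Omega,\mathscr{F})$ is a solution to the MP $(A,b,a,K,\eta)$ if $P\circ X_0^{-1}=\eta$ and for all $f\in\mathcal{C}$ the process $f(X)-f(X_0)-\int_0^\cdot\mathcal{K}f(X_{s-})\,ds$ is a local $P$-martingale. $\mathcal{B}^n$ is defined as $\mathcal{B}$ with $A^*$ replaced by $(A^n)^*$, and $\mathcal{K}^n$ as $\mathcal{K}$ with $(A,b,a,K)$ replaced by $(A^n,b^n,a^n,K^n)$. *)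

theory Defs
  imports "HOL-Probability.Probability"
begin

section \<open>Banach space preliminaries\<close>

definition reflexive_space :: "'b::real_normed_vector itself \<Rightarrow> bool" where
  "reflexive_space _ \<longleftrightarrow>
     (\<forall>\<Phi> :: ('b \<Rightarrow>\<^sub>L real) \<Rightarrow>\<^sub>L real. \<exists>x. \<forall>\<phi>. blinfun_apply \<Phi> \<phi> = blinfun_apply \<phi> x)"

abbreviation dual_pair :: "'b::real_normed_vector \<Rightarrow> ('b \<Rightarrow>\<^sub>L real) \<Rightarrow> real" where
  "dual_pair x \<phi> \<equiv> blinfun_apply \<phi> x"

definition nonneg_sym_ops :: "(('b::real_normed_vector \<Rightarrow>\<^sub>L real) \<Rightarrow>\<^sub>L 'b) set" where
  "nonneg_sym_ops = {Q. (\<forall>\<phi>. 0 \<le> dual_pair (blinfun_apply Q \<phi>) \<phi>) \<and>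
     (\<forall>\<phi> \<psi>. dual_pair (blinfun_apply Q \<phi>) \<psi> = dual_pair (blinfun_apply Q \<psi>) \<phi>)}"

text \<open>An unbounded operator is a pair of a domain and a total function whose values outside the
  domain are irrelevant.\<close>

definition densely_defined_closed_op ::
    "'b::real_normed_vector set \<Rightarrow> ('b \<Rightarrow> 'b) \<Rightarrow> bool" where
  "densely_defined_closed_op D A \<longleftrightarrow>
     subspace D \<and>
     (\<forall>x\<in>D. \<forall>y\<in>D. A (x + y) = A x + A y) \<and>
     (\<forall>c. \<forall>x\<in>D. A (c *\<^sub>R x) = c *\<^sub>R A x) \<and>
     closure D = UNIV \<and>
     closed {(x, A x) | x. x \<in> D}"

definition adjoint_dom ::
    "'b::real_normed_vector set \<Rightarrow> ('b \<Rightarrow> 'b) \<Rightarrow> ('b \<Rightarrow>\<^sub>L real) set" where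
  "adjoint_dom D A = {\<phi>. \<exists>\<psi>. \<forall>x\<in>D. dual_pair (A x) \<phi> = dual_pair x \<psi>}"

text \<open>For dense \<open>D\<close> the functional below is unique.\<close>

definition adjoint_op ::
    "'b::real_normed_vector set \<Rightarrow> ('b \<Rightarrow> 'b) \<Rightarrow> ('b \<Rightarrow>\<^sub>L real) \<Rightarrow> ('b \<Rightarrow>\<^sub>L real)" where
  "adjoint_op D A \<phi> = (THE \<psi>. \<forall>x\<in>D. dual_pair (A x) \<phi> = dual_pair x \<psi>)"

definition truncation_function :: "('b::real_normed_vector \<Rightarrow> 'b) \<Rightarrow> bool" where
  "truncation_function h \<longleftrightarrow>
     bounded (range h) \<and> h \<in> borel_measurable borel \<and>
     (\<exists>\<epsilon>>0. \<forall>x. norm x \<le> \<epsilon> \<longrightarrow> h x = x)"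


section \<open>The Skorokhod space\<close>

definition cadlag :: "(real \<Rightarrow> 'b::topological_space) \<Rightarrow> bool" where
  "cadlag \<alpha> \<longleftrightarrow>
     (\<forall>t\<ge>0. (\<alpha> \<longlongrightarrow> \<alpha> t) (at_right t)) \<and>
     (\<forall>t>0. \<exists>l. (\<alpha> \<longlongrightarrow> l) (at_left t))"

text \<open>A path on the half-line is represented by its constant extension to the negative reals;
  in particular its left limit at time 0 is its value at time 0.\<close>

typedef (overloaded) 'b cadlag_path =
    "{\<alpha> :: real \<Rightarrow> 'b::topological_space. cadlag \<alpha> \<and> (\<forall>t<0. \<alpha> t = \<alpha> 0)}"
  morphisms path_at Abs_cadlag_path
  by (rule exI[of _ "\<lambda>_. undefined"]) (auto simp: cadlag_def)

definition coord :: "real \<Rightarrow> 'b::topological_space cadlag_path \<Rightarrow> 'b" where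
  "coord t \<alpha> = path_at \<alpha> t"

definition coord_left :: "real \<Rightarrow> 'b::t2_space cadlag_path \<Rightarrow> 'b" where
  "coord_left t \<alpha> = Lim (at_left t) (path_at \<alpha>)"

definition time_changes :: "(real \<Rightarrow> real) set" where
  "time_changes = {\<theta>. continuous_on {0..} \<theta> \<and> strict_mono_on {0..} \<theta> \<and> \<theta> 0 = 0 \<and>
     filterlim \<theta> at_top at_top}"

text \<open>Convergence in the Skorokhod J1 sense. The Skorokhod topology is the metrizable topology
  with exactly these convergent sequences; being metrizable, it is determined by them, and its
  open sets are the sequentially open ones.\<close>

definition skorokhod_conv ::
    "(nat \<Rightarrow> 'b::metric_space cadlag_path) \<Rightarrow> 'b cadlag_path \<Rightarrow> bool" where
  "skorokhod_conv \<alpha>n \<alpha> \<longleftrightarrow>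
     (\<exists>\<theta>. (\<forall>n. \<theta> n \<in> time_changes) \<and>
       uniform_limit {0..} \<theta> (\<lambda>s. s) sequentially \<and>
       (\<forall>N::nat. uniform_limit {0..real N} (\<lambda>n s. coord (\<theta> n s) (\<alpha>n n)) (\<lambda>s. coord s \<alpha>)
          sequentially))"

instantiation cadlag_path :: (metric_space) topological_space
begin

definition open_cadlag_path :: "'a cadlag_path set \<Rightarrow> bool" where
  "open_cadlag_path U \<longleftrightarrow>
     (\<forall>\<alpha>\<in>U. \<forall>\<alpha>n. skorokhod_conv \<alpha>n \<alpha> \<longrightarrow> eventually (\<lambda>n. \<alpha>n n \<in> U) sequentially)"

instance
proof
  show "open (UNIV :: 'a cadlag_path set)"
    by (simp add: open_cadlag_path_def)
next
  fix S T :: "'a cadlag_path set"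
  assume "open S" "open T"
  then show "open (S \<inter> T)"
    by (auto simp: open_cadlag_path_def eventually_conj_iff)
next
  fix K :: "'a cadlag_path set set"
  assume K: "\<forall>S\<in>K. open S"
  show "open (\<Union>K)"
    unfolding open_cadlag_path_def
  proof (intro ballI allI impI)
    fix \<alpha> \<alpha>n assume "\<alpha> \<in> \<Union>K" and c: "skorokhod_conv \<alpha>n \<alpha>"
    then obtain S where S: "S \<in> K" "\<alpha> \<in> S" by blast
    with K c have "eventually (\<lambda>n. \<alpha>n n \<in> S) sequentially"
      unfolding open_cadlag_path_def by blast
    then show "eventually (\<lambda>n. \<alpha>n n \<in> \<Union>K) sequentially"
      by (rule eventually_mono) (use S in blast)
  qed
qed

end

text \<open>The index \<open>\<infinity>\<close> gives the \<open>\<sigma>\<close>-field generated by the whole coordinate process.\<close>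

definition path_filtration ::
    "ennreal \<Rightarrow> 'b::topological_space cadlag_path measure" where
  "path_filtration t =
     sigma UNIV {coord s -` G | s G. 0 \<le> s \<and> ennreal s \<le> t \<and> G \<in> sets borel}"

lemma filtration_path_filtration: "filtration UNIV path_filtration"
proof
  show "space (path_filtration t) = UNIV" for t
    by (simp add: path_filtration_def space_measure_of_conv)
  fix s t :: ennreal assume "s \<le> t"
  then show "sets (path_filtration s) \<subseteq> sets (path_filtration t)"
    unfolding path_filtration_def
    by (subst (1 2) sets_measure_of; (intro sigma_sets_mono')?) (auto intro: order_trans)
qed


section \<open>Weak convergence and local martingales\<close>

definition weakly_converges ::
    "(nat \<Rightarrow> 'a::topological_space measure) \<Rightarrow> 'a measure \<Rightarrow> bool" where
  "weakly_converges Pn P \<longleftrightarrow>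
     (\<forall>F :: 'a \<Rightarrow> real. continuous_on UNIV F \<and> bounded (range F) \<longrightarrow>
        (\<lambda>n. integral\<^sup>L (Pn n) F) \<longlonglongrightarrow> integral\<^sup>L P F)"

text \<open>Processes are indexed by the nonnegative reals; filtrations are indexed by the extended
  half-line so that stopping times may be infinite.\<close>

definition martingale ::
    "'a measure \<Rightarrow> (ennreal \<Rightarrow> 'a measure) \<Rightarrow> (real \<Rightarrow> 'a \<Rightarrow> real) \<Rightarrow> bool" where
  "martingale P F M \<longleftrightarrow>
     (\<forall>t\<ge>0. M t \<in> borel_measurable (F (ennreal t)) \<and> integrable P (M t)) \<and>
     (\<forall>s t. 0 \<le> s \<and> s \<le> t \<longrightarrow>
        (AE \<omega> in P. real_cond_exp P (F (ennreal s)) (M t) \<omega> = M s \<omega>))"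

definition stopped ::
    "(real \<Rightarrow> 'a \<Rightarrow> real) \<Rightarrow> ('a \<Rightarrow> ennreal) \<Rightarrow> real \<Rightarrow> 'a \<Rightarrow> real" where
  "stopped M \<tau> t \<omega> = M (enn2real (min (ennreal t) (\<tau> \<omega>))) \<omega>"

definition local_martingale ::
    "'a measure \<Rightarrow> (ennreal \<Rightarrow> 'a measure) \<Rightarrow> (real \<Rightarrow> 'a \<Rightarrow> real) \<Rightarrow> bool" where
  "local_martingale P F M \<longleftrightarrow>
     (\<forall>t\<ge>0. M t \<in> borel_measurable (F (ennreal t))) \<and>
     (\<forall>\<omega>\<in>space P. cadlag (\<lambda>t. M t \<omega>)) \<and>
     (\<exists>\<tau> :: nat \<Rightarrow> 'a \<Rightarrow> ennreal.
        (\<forall>n. stopping_time F (\<tau> n)) \<and>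
        (\<forall>\<omega>\<in>space P. incseq (\<lambda>n. \<tau> n \<omega>)) \<and>
        (AE \<omega> in P. (\<lambda>n. \<tau> n \<omega>) \<longlonglongrightarrow> \<infinity>) \<and>
        (\<forall>n. martingale P F (stopped M (\<tau> n))))"


section \<open>Parameters of martingale problems\<close>

record (overloaded) ('b::real_normed_vector) mp_params =
  lin_dom :: "'b set"
  lin_op :: "'b \<Rightarrow> 'b"
  drift :: "'b \<Rightarrow> 'b"
  diffusion :: "'b \<Rightarrow> ('b \<Rightarrow>\<^sub>L real) \<Rightarrow>\<^sub>L 'b"
  jump :: "'b \<Rightarrow> 'b measure"
  init :: "'b measure"

definition valid_drift :: "('b::real_normed_vector \<Rightarrow> 'b) \<Rightarrow> bool" where
  "valid_drift b \<longleftrightarrow>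
     b \<in> borel_measurable borel \<and>
     (\<forall>(\<phi> :: nat \<Rightarrow> 'b \<Rightarrow>\<^sub>L real) G. bounded (range \<phi>) \<and> bounded G \<longrightarrow>
        (SUP n. SUP x\<in>G. ennreal \<bar>dual_pair (b x) (\<phi> n)\<bar>) < \<infinity>)"

definition valid_diffusion ::
    "('b::real_normed_vector \<Rightarrow> ('b \<Rightarrow>\<^sub>L real) \<Rightarrow>\<^sub>L 'b) \<Rightarrow> bool" where
  "valid_diffusion a \<longleftrightarrow>
     (\<forall>x. a x \<in> nonneg_sym_ops) \<and>
     (\<forall>G. bounded G \<longrightarrow> bounded (a ` G)) \<and>
     (\<forall>\<phi>. (\<lambda>x. blinfun_apply (a x) \<phi>) \<in> borel_measurable borel)"

definition valid_jump :: "('b::real_normed_vector \<Rightarrow> 'b measure) \<Rightarrow> bool" where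
  "valid_jump K \<longleftrightarrow>
     (\<forall>x. sets (K x) = sets borel) \<and>
     (\<forall>G\<in>sets borel. (\<lambda>x. emeasure (K x) G) \<in> borel_measurable borel) \<and>
     (\<forall>(\<phi> :: nat \<Rightarrow> 'b \<Rightarrow>\<^sub>L real) G (\<epsilon>::real).
        bounded (range \<phi>) \<and> bounded G \<and> \<epsilon> > 0 \<longrightarrow>
          (SUP n. SUP x\<in>G.
             (\<integral>\<^sup>+ y\<in>{y. norm y \<le> \<epsilon>}. ennreal (\<bar>dual_pair y (\<phi> n)\<bar>\<^sup>2) \<partial>K x)) < \<infinity> \<and>
          (SUP x\<in>G. emeasure (K x) {z. \<epsilon> \<le> norm z}) < \<infinity>) \<and>
     (\<forall>x. emeasure (K x) {0} = 0)"

definition valid_params :: "'b::real_normed_vector mp_params \<Rightarrow> bool" where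
  "valid_params p \<longleftrightarrow>
     densely_defined_closed_op (lin_dom p) (lin_op p) \<and>
     valid_drift (drift p) \<and> valid_diffusion (diffusion p) \<and> valid_jump (jump p) \<and>
     prob_space (init p) \<and> sets (init p) = sets borel"


section \<open>Test functions and generators\<close>

text \<open>Since the number \<open>d\<close> of functionals varies, a function on \<open>d\<close>-dimensional Euclidean space is
  encoded as a function of real sequences that depends on the coordinates \<open>0, ..., d - 1\<close> only.
  For such functions, continuity in the product topology on \<^typ>\<open>nat \<Rightarrow> real\<close> is continuity
  on Euclidean space.\<close>

definition depends_on_first :: "nat \<Rightarrow> ((nat \<Rightarrow> real) \<Rightarrow> real) \<Rightarrow> bool" where
  "depends_on_first d g \<longleftrightarrow> (\<forall>u v. (\<forall>i<d. u i = v i) \<longrightarrow> g u = g v)"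

definition partial :: "nat \<Rightarrow> ((nat \<Rightarrow> real) \<Rightarrow> real) \<Rightarrow> (nat \<Rightarrow> real) \<Rightarrow> real" where
  "partial i g u = deriv (\<lambda>t. g (u(i := t))) (u i)"

definition C1_fun :: "nat \<Rightarrow> ((nat \<Rightarrow> real) \<Rightarrow> real) \<Rightarrow> bool" where
  "C1_fun d g \<longleftrightarrow>
     depends_on_first d g \<and> continuous_on UNIV g \<and>
     (\<forall>i<d. (\<forall>u. (\<lambda>t. g (u(i := t))) differentiable (at (u i))) \<and>
            continuous_on UNIV (partial i g))"

definition C2_fun :: "nat \<Rightarrow> ((nat \<Rightarrow> real) \<Rightarrow> real) \<Rightarrow> bool" where
  "C2_fun d g \<longleftrightarrow> C1_fun d g \<and> (\<forall>i<d. C1_fun d (partial i g))"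

definition Cc2_fun :: "nat \<Rightarrow> ((nat \<Rightarrow> real) \<Rightarrow> real) \<Rightarrow> bool" where
  "Cc2_fun d g \<longleftrightarrow> C2_fun d g \<and> (\<exists>R. \<forall>u. g u \<noteq> 0 \<longrightarrow> (\<forall>i<d. \<bar>u i\<bar> \<le> R))"

definition Cb2_fun :: "nat \<Rightarrow> ((nat \<Rightarrow> real) \<Rightarrow> real) \<Rightarrow> bool" where
  "Cb2_fun d g \<longleftrightarrow> C2_fun d g \<and> bounded (range g) \<and>
     (\<forall>i<d. bounded (range (partial i g))) \<and>
     (\<forall>i<d. \<forall>j<d. bounded (range (partial i (partial j g))))"

text \<open>A test function is handled through its data: the number \<open>d\<close> of functionals, the outer
  function and the functionals (those with index at least \<open>d\<close> are irrelevant). The generator below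
  is defined by a formula in these data; its value depends on the represented function only.\<close>

type_synonym 'b test_data = "nat \<times> ((nat \<Rightarrow> real) \<Rightarrow> real) \<times> (nat \<Rightarrow> 'b \<Rightarrow>\<^sub>L real)"

definition test_fun :: "'b::real_normed_vector test_data \<Rightarrow> 'b \<Rightarrow> real" where
  "test_fun f x = (case f of (d, g, \<phi>) \<Rightarrow> g (\<lambda>i. dual_pair x (\<phi> i)))"

definition test_C :: "'b::real_normed_vector mp_params \<Rightarrow> 'b test_data set" where
  "test_C p = {(d, g, \<phi>). 1 \<le> d \<and> Cc2_fun d g \<and>
     (\<forall>i<d. \<phi> i \<in> adjoint_dom (lin_dom p) (lin_op p))}"

definition test_D :: "'b::real_normed_vector mp_params \<Rightarrow> 'b test_data set" where
  "test_D p = {(d, g, \<phi>). d = 1 \<and> Cc2_fun d g \<and>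
     \<phi> 0 \<in> adjoint_dom (lin_dom p) (lin_op p)}"

definition test_B :: "'b::real_normed_vector mp_params \<Rightarrow> 'b test_data set" where
  "test_B p = {(d, g, \<phi>). d = 1 \<and> Cb2_fun d g \<and>
     \<phi> 0 \<in> adjoint_dom (lin_dom p) (lin_op p)}"

definition generator ::
    "('b::real_normed_vector \<Rightarrow> 'b) \<Rightarrow> 'b mp_params \<Rightarrow> 'b test_data \<Rightarrow> 'b \<Rightarrow> real" where
  "generator h p f x = (case f of (d, g, \<phi>) \<Rightarrow>
     let u = (\<lambda>i. dual_pair x (\<phi> i)) in
       (\<Sum>i<d. (dual_pair x (adjoint_op (lin_dom p) (lin_op p) (\<phi> i)) + dual_pair (drift p x) (\<phi> i))
                * partial i g u)
     + 1 / 2 * (\<Sum>i<d. \<Sum>j<d. dual_pair (blinfun_apply (diffusion p x) (\<phi> i)) (\<phi> j)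
                * partial i (partial j g) u)
     + (\<integral>y. (test_fun f (x + y) - test_fun f x
                - (\<Sum>i<d. dual_pair (h y) (\<phi> i) * partial i g u)) \<partial>(jump p x)))"


section \<open>Solutions of martingale problems\<close>

definition mp_process ::
    "('b::real_normed_vector \<Rightarrow> 'b) \<Rightarrow> 'b mp_params \<Rightarrow> 'b test_data \<Rightarrow>
     real \<Rightarrow> 'b cadlag_path \<Rightarrow> real" where
  "mp_process h p f t \<alpha> =
     test_fun f (coord t \<alpha>) - test_fun f (coord 0 \<alpha>)
     - (LINT s:{0..t}|lborel. generator h p f (coord_left s \<alpha>))"

definition path_prob :: "'b::topological_space cadlag_path measure \<Rightarrow> bool" where
  "path_prob P \<longleftrightarrow> prob_space P \<and> sets P = sets (path_filtration \<infinity>)"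

definition solves_mp ::
    "('b::real_normed_vector \<Rightarrow> 'b) \<Rightarrow> 'b mp_params \<Rightarrow> 'b cadlag_path measure \<Rightarrow> bool" where
  "solves_mp h p P \<longleftrightarrow>
     path_prob P \<and> distr P borel (coord 0) = init p \<and>
     (\<forall>f\<in>test_C p. local_martingale P path_filtration (mp_process h p f))"

end

theory Submission
  imports Defs
begin

text \<open>
  Three difficulties stand between weak convergence and the martingale property of the limit: the
  laws \<open>P\<^sup>n\<close> have the martingale property only up to localizing stopping times, which may differ from
  \<open>n\<close> to \<open>n\<close>; evaluation of a path at a fixed time is not Skorokhod continuous; and the generators
  converge uniformly on compact sets only, which the paths need not respect.

  \<^emph>\<open>Localization.\<close> Functions that are bounded on bounded sets, uniformly along a sequence, lie below one
  continuous, locally bounded function \<open>c \<ge> 1\<close>, the clock (\<open>exists_clock\<close>). Let \<open>F\<close> be bounded,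
  \<open>M = F(X) - \<integral>\<kappa>(X)\<close> with \<open>|\<kappa>| \<le> c\<close>, and let \<open>V\<^sub>t\<close> be a continuously differentiable cutoff of
  \<open>\<integral>\<^sub>0\<^sup>t c(X)\<close> that falls from \<open>1\<close> to \<open>0\<close> just after level \<open>k\<close>. The damped process \<open>V M - \<integral>M dV\<close> is bounded, and it is a martingale if \<open>M\<close> is a local martingale
  (\<open>damped_martingale\<close>). Conversely, for steeper and steeper cutoffs it tends to \<open>M\<close> stopped when the
  clock shows \<open>k\<close>, so that \<open>M\<close> is a local martingale if all damped processes are martingales
  (\<open>local_martingale_of_damped\<close>). Thus the local martingale property is a family of identities between
  expectations of bounded path functionals in which no stopping times occur. In particular the pairs
  \<open>(F, \<kappa>)\<close> with this property are closed under linear combinations and bounded pointwise limits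
  (\<open>compensates_linear\<close>, \<open>compensates_bounded_limit\<close>).

  \<^emph>\<open>Weak limits.\<close> Averages over short time windows of the damped process of the limit pair and of
  past observations are Skorokhod continuous, so that their expectations converge, and afterwards the
  windows can be shrunk (\<open>weak_limit_identity\<close>). Under \<open>P\<^sup>n\<close> the damped process of the limit pair has
  to be compared with that of the \<open>n\<close>-th pair. The difference is controlled by the clock time spent
  where the errors are not small. This time is small in expectation by an argument that uses
  compact sets only in the state space (\<open>vanishing_errors\<close>): the open sets on which all errors from
  some index on are small exhaust the space, and the clock time spent outside of one of them is
  controlled by a continuous functional of the path. The result is \<open>compensates_weak_limit\<close>.

  \<^emph>\<open>Several functionals.\<close> The assumptions thus give the martingale property for compactly supported,
  and then for bounded, functions of one functional, in particular for plane waves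
  \<open>cos(\<langle>x, \<Sum>\<lambda>\<^sub>i y\<^sub>i\<rangle> + b)\<close>. Linear combinations of these contain all products of the sines of the
  coordinates. Bernstein approximation, which converges
  together with two derivatives, leads from there to \<open>C\<^sup>2\<close> functions of the sines, and
  \<open>sin(a s) / a \<rightarrow> s\<close> to all bounded \<open>C\<^sup>2\<close> functions (\<open>solves_for_several\<close>); each limit is one under
  which the generators converge pointwise and boundedly on bounded sets (\<open>generator_tendsto\<close>).

  The initial law is the limit of the given initial laws because evaluation at time \<open>0\<close> is Skorokhod
  continuous.
\<close>

section \<open>Right-continuous paths with left limits\<close>

text \<open>Unlike the defining property of a path this concerns all real times. Paths have it because they
  are constant before time \<open>0\<close>.\<close>

definition rcll :: "(real \<Rightarrow> 'a::topological_space) \<Rightarrow> bool" where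
  "rcll y \<longleftrightarrow> (\<forall>t. (y \<longlongrightarrow> y t) (at_right t) \<and> (\<exists>l. (y \<longlongrightarrow> l) (at_left t)))"

lemma rcll_right: "rcll y \<Longrightarrow> (y \<longlongrightarrow> y t) (at_right t)"
  by (simp add: rcll_def)

lemma rcll_left: "rcll y \<Longrightarrow> \<exists>l. (y \<longlongrightarrow> l) (at_left t)"
  by (simp add: rcll_def)

lemma rcll_coord: "rcll (\<lambda>t. coord t \<alpha>)"
proof -
  have c: "cadlag (path_at \<alpha>)" and neg: "\<And>t. t < 0 \<Longrightarrow> path_at \<alpha> t = path_at \<alpha> 0"
    using path_at[of \<alpha>] by auto
  have "(path_at \<alpha> \<longlongrightarrow> path_at \<alpha> t) (at_right t)" for t
  proof (cases "t \<ge> 0")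
    case True then show ?thesis using c by (simp add: cadlag_def)
  next
    case False
    have "\<forall>\<^sub>F s in at_right t. path_at \<alpha> s = path_at \<alpha> t"
      unfolding eventually_at_right_field using False neg
      by (intro exI[of _ 0]) auto
    then show ?thesis by (rule tendsto_eventually)
  qed
  moreover have "\<exists>l. (path_at \<alpha> \<longlongrightarrow> l) (at_left t)" for t
  proof (cases "t > 0")
    case True then show ?thesis using c by (simp add: cadlag_def)
  next
    case False
    have "\<forall>\<^sub>F s in at_left t. path_at \<alpha> s = path_at \<alpha> 0"
      unfolding eventually_at_left_field using False neg
      by (intro exI[of _ "t - 1"]) auto
    then show ?thesis by (blast intro: tendsto_eventually)
  qed
  ultimately show ?thesis by (simp add: rcll_def coord_def)
qed

lemma rcll_compose:
  assumes "rcll y" "continuous_on UNIV z" shows "rcll (\<lambda>t. z (y t))"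
  unfolding rcll_def
proof (intro allI conjI)
  have z: "(z \<longlongrightarrow> z l) (nhds l)" for l
    using assms(2) unfolding tendsto_at_iff_tendsto_nhds[symmetric]
    by (simp add: continuous_on_def)
  have c: "((\<lambda>t. z (y t)) \<longlongrightarrow> z l) G" if "(y \<longlongrightarrow> l) G" for l G
    using filterlim_compose[OF z that] .
  fix t
  show "((\<lambda>t. z (y t)) \<longlongrightarrow> z (y t)) (at_right t)" using c rcll_right[OF assms(1)] by blast
  show "\<exists>l. ((\<lambda>t. z (y t)) \<longlongrightarrow> l) (at_left t)" using c rcll_left[OF assms(1)] by blast
qed

lemma rcll_bounded:
  fixes y :: "real \<Rightarrow> 'a::metric_space"
  assumes "rcll y" shows "bounded (y ` {a..b})"
proof -
  have "\<exists>U. open U \<and> t \<in> U \<and> bounded (y ` U)" for t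
  proof -
    obtain l where l: "(y \<longlongrightarrow> l) (at_left t)" using rcll_left[OF assms] by blast
    have "\<forall>\<^sub>F s in at_left t. dist (y s) l < 1" using l by (rule tendstoD) simp
    then obtain p where p: "p < t" "\<And>s. p < s \<Longrightarrow> s < t \<Longrightarrow> dist (y s) l < 1"
      unfolding eventually_at_left_field by blast
    have "\<forall>\<^sub>F s in at_right t. dist (y s) (y t) < 1"
      using rcll_right[OF assms] by (rule tendstoD) simp
    then obtain q where q: "q > t" "\<And>s. t < s \<Longrightarrow> s < q \<Longrightarrow> dist (y s) (y t) < 1"
      unfolding eventually_at_right_field by blast
    have "y ` {p<..<q} \<subseteq> ball l 1 \<union> ball (y t) 1"
    proof
      fix x assume "x \<in> y ` {p<..<q}"
      then obtain s where s: "p < s" "s < q" "x = y s" by auto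
      consider "s < t" | "s = t" | "s > t" by linarith
      then show "x \<in> ball l 1 \<union> ball (y t) 1"
        by cases (use p(2)[of s] q(2)[of s] s in \<open>auto simp: dist_commute\<close>)
    qed
    then have "bounded (y ` {p<..<q})"
      by (meson bounded_Un bounded_ball bounded_subset)
    then show ?thesis using p(1) q(1) by (intro exI[of _ "{p<..<q}"]) auto
  qed
  then obtain U where U: "\<And>t. open (U t)" "\<And>t. t \<in> U t" "\<And>t. bounded (y ` U t)" by metis
  obtain T where T: "finite T" "{a..b} \<subseteq> (\<Union>t\<in>T. U t)"
  proof (rule compactE_image[OF compact_Icc[of a b], of UNIV U])
    show "{a..b} \<subseteq> (\<Union>t\<in>UNIV. U t)" using U(2) by blast
  qed (use U(1) in auto)
  have "bounded (\<Union>t\<in>T. y ` U t)" using T(1) U(3) by (auto intro: bounded_UN)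
  then show ?thesis by (rule bounded_subset) (use T(2) in blast)
qed

text \<open>A set of reals in which no point is a limit from the right of other points is countable:
  pick a rational in each of the disjoint gaps to the right.\<close>

lemma countable_right_isolated:
  fixes S :: "real set"
  assumes "\<And>t. t \<in> S \<Longrightarrow> \<exists>d>t. S \<inter> {t<..<d} = {}"
  shows "countable S"
proof -
  obtain d where d: "\<And>t. t \<in> S \<Longrightarrow> d t > t \<and> S \<inter> {t<..<d t} = {}" using assms by metis
  have "\<exists>q::rat. t < of_rat q \<and> of_rat q < d t" if "t \<in> S" for t
    using d[OF that] of_rat_dense by blast
  then obtain q :: "real \<Rightarrow> rat" where q: "\<And>t. t \<in> S \<Longrightarrow> t < of_rat (q t) \<and> of_rat (q t) < d t" by metis
  have "q s \<noteq> q t" if "s \<in> S" "t \<in> S" "s < t" for s t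
  proof -
    have "t \<ge> d s" using d[OF that(1)] that by auto
    then show ?thesis using q[OF that(1)] q[OF that(2)] by auto
  qed
  then have "inj_on q S" by (metis inj_onI linorder_neqE_linordered_idom)
  then show ?thesis by (rule countable_image_inj_on[rotated]) (rule countableI_type)
qed

lemma rcll_countable_discontinuities:
  fixes y :: "real \<Rightarrow> 'a::metric_space"
  assumes "rcll y" shows "countable {t. \<not> isCont y t}"
proof -
  obtain l where l: "\<And>t. (y \<longlongrightarrow> l t) (at_left t)" using rcll_left[OF assms] by metis
  define S where "S e = {t. dist (l t) (y t) > e}" for e
  have "countable (S e)" if "e > 0" for e
  proof (rule countable_right_isolated)
    fix t assume "t \<in> S e"
    have "\<forall>\<^sub>F s in at_right t. dist (y s) (y t) < e/3"
      using rcll_right[OF assms] by (rule tendstoD) (use that in simp)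
    then obtain q where q: "q > t" "\<And>s. t < s \<Longrightarrow> s < q \<Longrightarrow> dist (y s) (y t) < e/3"
      unfolding eventually_at_right_field by blast
    have "s \<notin> S e" if s: "t < s" "s < q" for s
    proof -
      have "\<forall>\<^sub>F r in at_left s. dist (y r) (y t) \<le> e/3"
        unfolding eventually_at_left_field using s q(2)
        by (intro exI[of _ t]) (auto intro: less_imp_le)
      moreover have "((\<lambda>r. dist (y r) (y t)) \<longlongrightarrow> dist (l s) (y t)) (at_left s)"
        by (intro tendsto_intros l)
      ultimately have "dist (l s) (y t) \<le> e/3"
        by (intro tendsto_upperbound) auto
      moreover have "dist (y s) (y t) < e/3" using q(2) s by blast
      ultimately have "dist (l s) (y s) < e"
        using dist_triangle2[of "l s" "y s" "y t"] \<open>e > 0\<close> by linarith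
      then show ?thesis by (simp add: S_def)
    qed
    then show "\<exists>d>t. S e \<inter> {t<..<d} = {}" using q(1) by (intro exI[of _ q]) auto
  qed
  then have "countable (\<Union>n. S (1 / Suc n))" by simp
  moreover have "{t. \<not> isCont y t} \<subseteq> (\<Union>n. S (1 / Suc n))"
  proof
    fix t assume t: "t \<in> {t. \<not> isCont y t}"
    have "l t \<noteq> y t"
    proof
      assume "l t = y t"
      then have "(y \<longlongrightarrow> y t) (at t)"
        using l[of t] rcll_right[OF assms, of t] by (simp add: filterlim_split_at)
      then show False using t by (simp add: isCont_def)
    qed
    then have "dist (l t) (y t) > 0" by simp
    then obtain n where "1 / Suc n < dist (l t) (y t)" using nat_approx_posE by metis
    then show "t \<in> (\<Union>n. S (1 / Suc n))" by (auto simp: S_def)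
  qed
  ultimately show ?thesis by (rule countable_subset[rotated])
qed

lemma rcll_borel_measurable:
  fixes y :: "real \<Rightarrow> 'a::metric_space"
  assumes "rcll y" shows "y \<in> borel_measurable borel"
  by (rule borel_measurable_continuous_countable_exceptions[OF rcll_countable_discontinuities[OF assms]])
     (auto simp: continuous_on_eq_continuous_within intro: continuous_at_imp_continuous_at_within)

lemma coord_left_eq:
  fixes \<alpha> :: "'a::metric_space cadlag_path"
  assumes "isCont (\<lambda>t. coord t \<alpha>) t" shows "coord_left t \<alpha> = coord t \<alpha>"
proof -
  have "((\<lambda>t. coord t \<alpha>) \<longlongrightarrow> coord t \<alpha>) (at_left t)"
    using assms filterlim_at_split[of "\<lambda>t. coord t \<alpha>"] by (simp add: isCont_def filterlim_split_at filterlim_at_split)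
  then show ?thesis unfolding coord_left_def coord_def by (intro tendsto_Lim) auto
qed

text \<open>The process is the limit of its values at the next point to the right in a grid of mesh
  \<open>1 / (n + 1)\<close>, and a grid is countable.\<close>

lemma right_continuous_joint_measurable:
  fixes Y :: "real \<Rightarrow> 'a \<Rightarrow> 'c::metric_space"
  assumes meas: "\<And>s. Y s \<in> borel_measurable G"
    and right: "\<And>s \<omega>. \<omega> \<in> space G \<Longrightarrow> ((\<lambda>s. Y s \<omega>) \<longlongrightarrow> Y s \<omega>) (at_right s)"
  shows "(\<lambda>p. Y (snd p) (fst p)) \<in> borel_measurable (G \<Otimes>\<^sub>M borel)"
proof (rule borel_measurable_LIMSEQ_metric)
  define r where "r n s = (of_int \<lfloor>real (Suc n) * s\<rfloor> + 1) / real (Suc n)" for n and s :: real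
  show "(\<lambda>p. Y (r n (snd p)) (fst p)) \<in> borel_measurable (G \<Otimes>\<^sub>M borel)" for n
  proof -
    have 1: "(\<lambda>p. Y ((of_int i + 1) / real (Suc n)) (fst p)) \<in> borel_measurable (G \<Otimes>\<^sub>M borel)" for i :: int
      using meas by measurable
    have 2: "(\<lambda>p. \<lfloor>real (Suc n) * snd p\<rfloor>) \<in> measurable (G \<Otimes>\<^sub>M borel) (count_space UNIV)"
      by measurable
    show ?thesis unfolding r_def using measurable_compose_countable[OF 1 2] .
  qed
  fix p :: "'a \<times> real" assume "p \<in> space (G \<Otimes>\<^sub>M borel)"
  then have sp: "fst p \<in> space G" by (auto simp: space_pair_measure)
  define s where "s = snd p"
  have gt: "r n s > s" for n
  proof -
    have "real (Suc n) * s < of_int \<lfloor>real (Suc n) * s\<rfloor> + 1" by linarith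
    then show ?thesis by (simp add: r_def pos_less_divide_eq mult.commute)
  qed
  have le: "r n s \<le> s + 1 / real (Suc n)" for n
  proof -
    have "of_int \<lfloor>real (Suc n) * s\<rfloor> + 1 \<le> real (Suc n) * s + 1" by linarith
    also have "\<dots> = (s + 1 / real (Suc n)) * real (Suc n)" by (simp add: field_simps)
    finally show ?thesis unfolding r_def by (simp only: pos_divide_le_eq of_nat_0_less_iff zero_less_Suc)
  qed
  have "(\<lambda>n. r n s) \<longlonglongrightarrow> s"
  proof (rule tendsto_sandwich[OF _ _ tendsto_const])
    show "(\<lambda>n. s + 1 / real (Suc n)) \<longlonglongrightarrow> s"
      using tendsto_add[OF tendsto_const LIMSEQ_inverse_real_of_nat, of s] by (simp add: inverse_eq_divide)
  qed (use gt le in \<open>auto intro!: always_eventually less_imp_le\<close>)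
  then have "filterlim (\<lambda>n. r n s) (at_right s) sequentially"
    using gt by (auto simp: filterlim_at intro!: always_eventually less_imp_neq[symmetric])
  then show "(\<lambda>n. Y (r n (snd p)) (fst p)) \<longlonglongrightarrow> Y (snd p) (fst p)"
    using filterlim_compose[OF right[OF sp]] by (simp add: s_def)
qed

section \<open>The filtration of the coordinate process\<close>

lemma space_path_filtration [simp]: "space (path_filtration t) = UNIV"
  by (simp add: path_filtration_def space_measure_of_conv)

lemma sets_path_filtration_mono: "s \<le> t \<Longrightarrow> sets (path_filtration s) \<subseteq> sets (path_filtration t)"
  using filtration.sets_F_mono[OF filtration_path_filtration] by auto

lemma measurable_path_filtration_mono:
  "f \<in> measurable (path_filtration s) N \<Longrightarrow> s \<le> t \<Longrightarrow> f \<in> measurable (path_filtration t) N"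
  by (rule measurable_mono[THEN subsetD, rotated -1]) (auto intro: sets_path_filtration_mono[THEN subsetD])

lemma measurable_coord:
  assumes "0 \<le> s" "ennreal s \<le> t"
  shows "coord s \<in> borel_measurable (path_filtration t)"
proof (rule measurableI)
  fix A :: "'a set" assume "A \<in> sets borel"
  then have "coord s -` A \<in> {coord s -` G | s G. 0 \<le> s \<and> ennreal s \<le> t \<and> G \<in> sets borel}"
    using assms by blast
  then show "coord s -` A \<inter> space (path_filtration t) \<in> sets (path_filtration t)"
    unfolding path_filtration_def by (simp add: sets_measure_of_conv space_measure_of_conv)
qed simp

definition clip :: "real \<Rightarrow> real \<Rightarrow> real" where "clip t s = max 0 (min s t)"

lemma clip_id: "0 \<le> s \<Longrightarrow> s \<le> t \<Longrightarrow> clip t s = s" by (simp add: clip_def)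

lemma clip_bounds: "0 \<le> t \<Longrightarrow> 0 \<le> clip t s \<and> clip t s \<le> t" by (simp add: clip_def)

text \<open>Up to each time \<open>t\<close> the process is jointly measurable with respect to the
  information available at \<open>t\<close>; clipping the time variable to \<open>[0,t]\<close> avoids
  restricted measure spaces.\<close>

definition progressive :: "(real \<Rightarrow> 'b::topological_space cadlag_path \<Rightarrow> 'c::topological_space) \<Rightarrow> bool" where
  "progressive Y \<longleftrightarrow> (\<forall>t\<ge>0. (\<lambda>p. Y (clip t (snd p)) (fst p))
     \<in> borel_measurable (path_filtration (ennreal t) \<Otimes>\<^sub>M borel))"

lemma progressive_adapted:
  assumes "progressive Y" "0 \<le> t"
  shows "Y t \<in> borel_measurable (path_filtration (ennreal t))"
proof -
  have "(\<lambda>p. Y (clip t (snd p)) (fst p)) \<circ> (\<lambda>\<alpha>. (\<alpha>, t)) \<in> borel_measurable (path_filtration (ennreal t))"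
    by (rule measurable_comp[OF _ assms(1)[unfolded progressive_def, rule_format, OF assms(2)]]) measurable
  then show ?thesis using assms(2) by (simp add: o_def clip_def)
qed

lemma progressive_right_continuous:
  fixes Y :: "real \<Rightarrow> 'b::topological_space cadlag_path \<Rightarrow> 'c::metric_space"
  assumes meas: "\<And>s. 0 \<le> s \<Longrightarrow> Y s \<in> borel_measurable (path_filtration (ennreal s))"
    and right: "\<And>s \<alpha>. 0 \<le> s \<Longrightarrow> ((\<lambda>s. Y s \<alpha>) \<longlongrightarrow> Y s \<alpha>) (at_right s)"
  shows "progressive Y"
  unfolding progressive_def
proof (intro allI impI right_continuous_joint_measurable)
  fix t :: real and s assume t: "0 \<le> t"
  show "Y (clip t s) \<in> borel_measurable (path_filtration (ennreal t))"
    using clip_bounds[OF t, of s]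
    by (intro measurable_path_filtration_mono[OF meas[of "clip t s"]]) (auto intro: ennreal_leI)
next
  fix t :: real and s \<alpha> assume t: "0 \<le> t"
  consider "s < 0" | "0 \<le> s" "s < t" | "t \<le> s" using t by linarith
  then show "((\<lambda>s. Y (clip t s) \<alpha>) \<longlongrightarrow> Y (clip t s) \<alpha>) (at_right s)"
  proof cases
    case 1
    have "\<forall>\<^sub>F r in at_right s. Y (clip t r) \<alpha> = Y (clip t s) \<alpha>"
      unfolding eventually_at_right_field using 1 by (intro exI[of _ 0]) (auto simp: clip_def)
    then show ?thesis by (rule tendsto_eventually)
  next
    case 2
    have "\<forall>\<^sub>F r in at_right s. Y r \<alpha> = Y (clip t r) \<alpha>"
      unfolding eventually_at_right_field using 2 by (intro exI[of _ t]) (auto simp: clip_def)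
    then show ?thesis
      using Lim_transform_eventually[OF right[of s \<alpha>]] 2 by (simp add: clip_id)
  next
    case 3
    have "\<forall>\<^sub>F r in at_right s. Y (clip t r) \<alpha> = Y (clip t s) \<alpha>"
      unfolding eventually_at_right_field using 3 t by (intro exI[of _ "s+1"]) (auto simp: clip_def min_absorb2)
    then show ?thesis by (rule tendsto_eventually)
  qed
qed

lemma progressive_coord: "progressive (coord :: real \<Rightarrow> 'a::metric_space cadlag_path \<Rightarrow> 'a)"
  by (rule progressive_right_continuous)
     (auto intro: measurable_coord rcll_right[OF rcll_coord])

lemma progressive_compose:
  assumes "progressive Y" "f \<in> borel_measurable borel"
  shows "progressive (\<lambda>s \<alpha>. f (Y s \<alpha>))"
  unfolding progressive_def
proof (intro allI impI)
  fix t :: real assume "0 \<le> t"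
  then have Y: "(\<lambda>p. Y (clip t (snd p)) (fst p)) \<in> borel_measurable (path_filtration (ennreal t) \<Otimes>\<^sub>M borel)"
    using assms(1) by (simp add: progressive_def)
  show "(\<lambda>p. f (Y (clip t (snd p)) (fst p))) \<in> borel_measurable (path_filtration (ennreal t) \<Otimes>\<^sub>M borel)"
    by (rule measurable_compose[OF Y assms(2)])
qed

lemma progressive_mult:
  fixes Y Z :: "real \<Rightarrow> 'b::topological_space cadlag_path \<Rightarrow> real"
  assumes "progressive Y" "progressive Z"
  shows "progressive (\<lambda>s \<alpha>. Y s \<alpha> * Z s \<alpha>)"
  using assms unfolding progressive_def by (auto intro: borel_measurable_times)

lemma progressive_diff:
  fixes Y Z :: "real \<Rightarrow> 'b::topological_space cadlag_path \<Rightarrow> real"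
  assumes "progressive Y" "progressive Z"
  shows "progressive (\<lambda>s \<alpha>. Y s \<alpha> - Z s \<alpha>)"
  using assms unfolding progressive_def by (auto intro: borel_measurable_diff)

lemma progressive_integral_adapted:
  fixes Y :: "real \<Rightarrow> 'b::topological_space cadlag_path \<Rightarrow> real"
  assumes Y: "progressive Y" and "0 \<le> a" "b \<le> t" "0 \<le> t"
  shows "(\<lambda>\<alpha>. LINT s:{a..b}|lborel. Y s \<alpha>) \<in> borel_measurable (path_filtration (ennreal t))"
proof -
  have "(\<lambda>p. indicator {a..b} (snd p) *\<^sub>R Y (clip t (snd p)) (fst p))
     \<in> borel_measurable (path_filtration (ennreal t) \<Otimes>\<^sub>M borel)"
    using Y[unfolded progressive_def, rule_format, OF assms(4)] by measurable
  then have "(\<lambda>p. indicator {a..b} (snd p) *\<^sub>R Y (clip t (snd p)) (fst p))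
     \<in> borel_measurable (path_filtration (ennreal t) \<Otimes>\<^sub>M lborel)"
    by (subst measurable_cong_sets[OF sets_pair_measure_cong refl]) (auto simp: )
  then have "(\<lambda>\<alpha>. LINT s|lborel. indicator {a..b} s *\<^sub>R Y (clip t s) \<alpha>)
      \<in> borel_measurable (path_filtration (ennreal t))"
    by (intro lborel.borel_measurable_lebesgue_integral) (simp add: split_beta')
  also have "(\<lambda>\<alpha>. LINT s|lborel. indicator {a..b} s *\<^sub>R Y (clip t s) \<alpha>) = (\<lambda>\<alpha>. LINT s:{a..b}|lborel. Y s \<alpha>)"
    unfolding set_lebesgue_integral_def using assms
    by (intro ext Bochner_Integration.integral_cong refl) (auto simp: indicator_def clip_def)
  finally show ?thesis .
qed

section \<open>Integrals along paths\<close>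

text \<open>Integrability over compact intervals of times, in a form that products inherit; \<open>lbb\<close> in the names
  of lemmas.\<close>

definition locally_bounded_borel :: "(real \<Rightarrow> real) \<Rightarrow> bool" where
  "locally_bounded_borel y \<longleftrightarrow> y \<in> borel_measurable borel \<and> (\<forall>T. \<exists>B. \<forall>u\<in>{0..T}. \<bar>y u\<bar> \<le> B)"

lemma lbb_integrable:
  assumes "locally_bounded_borel y" "0 \<le> a"
  shows "set_integrable lborel {a..b} y"
proof -
  obtain B where B: "\<And>u. u \<in> {0..b} \<Longrightarrow> \<bar>y u\<bar> \<le> B"
    using assms(1) unfolding locally_bounded_borel_def by meson
  have [measurable]: "y \<in> borel_measurable borel"
    using assms(1) by (simp add: locally_bounded_borel_def)
  show ?thesis unfolding set_integrable_def
    by (rule integrableI_bounded_set_indicator[where B=B])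
       (use B assms(2) in \<open>auto intro!: AE_I2 simp: emeasure_lborel_Icc_eq\<close>)
qed

lemma lbb_HK:
  assumes "locally_bounded_borel y" "0 \<le> a"
  shows "y integrable_on {a..b}" "(LINT u:{a..b}|lborel. y u) = integral {a..b} y"
  using set_borel_integral_eq_integral[OF lbb_integrable[OF assms, of b]] by auto

lemma lbb_split:
  assumes "locally_bounded_borel y" "0 \<le> a" "a \<le> b" "b \<le> c"
  shows "(LINT u:{a..c}|lborel. y u) = (LINT u:{a..b}|lborel. y u) + (LINT u:{b..c}|lborel. y u)"
  using assms lbb_HK[OF assms(1)]
  by (simp add: Henstock_Kurzweil_Integration.integral_combine)

lemma lbb_mono:
  assumes "locally_bounded_borel y" "locally_bounded_borel z" "0 \<le> a"
    and "\<And>u. a \<le> u \<Longrightarrow> u \<le> b \<Longrightarrow> y u \<le> z u"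
  shows "(LINT u:{a..b}|lborel. y u) \<le> (LINT u:{a..b}|lborel. z u)"
  by (rule set_integral_mono) (use assms lbb_integrable in auto)

lemma set_integral_const_Icc: "a \<le> b \<Longrightarrow> (LINT u:{a..b}|lborel. (c::real)) = (b - a) * c"
  by (simp add: set_lebesgue_integral_def)

lemma lbb_abs: "locally_bounded_borel y \<Longrightarrow> locally_bounded_borel (\<lambda>u. \<bar>y u\<bar>)"
  by (auto simp: locally_bounded_borel_def)

lemma lbb_const: "locally_bounded_borel (\<lambda>u. c)"
  by (auto simp: locally_bounded_borel_def)

lemma lbb_mult:
  assumes "locally_bounded_borel y" "locally_bounded_borel z"
  shows "locally_bounded_borel (\<lambda>u. y u * z u)"
  unfolding locally_bounded_borel_def
proof (intro conjI allI)
  show "(\<lambda>u. y u * z u) \<in> borel_measurable borel"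
    using assms by (auto simp: locally_bounded_borel_def)
  fix T
  obtain B C where "\<And>u. u \<in> {0..T} \<Longrightarrow> \<bar>y u\<bar> \<le> B" "\<And>u. u \<in> {0..T} \<Longrightarrow> \<bar>z u\<bar> \<le> C"
    using assms unfolding locally_bounded_borel_def by meson
  then have "\<forall>u\<in>{0..T}. \<bar>y u * z u\<bar> \<le> B * C"
    unfolding abs_mult by (meson abs_ge_zero mult_mono order_trans)
  then show "\<exists>B. \<forall>u\<in>{0..T}. \<bar>y u * z u\<bar> \<le> B" by blast
qed

lemma lbb_add:
  assumes "locally_bounded_borel y" "locally_bounded_borel z"
  shows "locally_bounded_borel (\<lambda>u. y u + z u)"
  unfolding locally_bounded_borel_def
proof (intro conjI allI)
  show "(\<lambda>u. y u + z u) \<in> borel_measurable borel"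
    using assms by (auto simp: locally_bounded_borel_def)
  fix T
  obtain B C where "\<And>u. u \<in> {0..T} \<Longrightarrow> \<bar>y u\<bar> \<le> B" "\<And>u. u \<in> {0..T} \<Longrightarrow> \<bar>z u\<bar> \<le> C"
    using assms unfolding locally_bounded_borel_def by meson
  then have "\<forall>u\<in>{0..T}. \<bar>y u + z u\<bar> \<le> B + C"
    by (auto intro!: order_trans[OF abs_triangle_ineq] add_mono)
  then show "\<exists>B. \<forall>u\<in>{0..T}. \<bar>y u + z u\<bar> \<le> B" by blast
qed

lemma lbb_diff:
  assumes "locally_bounded_borel y" "locally_bounded_borel z"
  shows "locally_bounded_borel (\<lambda>u. y u - z u)"
  using lbb_add[OF assms(1) lbb_mult[OF lbb_const[of "-1"] assms(2)]] by simp

lemma lbb_rcll: "rcll y \<Longrightarrow> locally_bounded_borel y"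
  using rcll_bounded[of y 0] rcll_borel_measurable[of y]
  by (fastforce simp: locally_bounded_borel_def bounded_real)

lemma abs_set_integral_le:
  assumes "locally_bounded_borel y" "0 \<le> a"
  shows "\<bar>LINT u:{a..b}|lborel. y u\<bar> \<le> (LINT u:{a..b}|lborel. \<bar>y u\<bar>)"
  using set_integral_norm_bound[OF lbb_integrable[OF assms]] by simp

lemma lbb_integral_bound:
  assumes "locally_bounded_borel y" "0 \<le> a" "a \<le> b" "\<And>u. a \<le> u \<Longrightarrow> u \<le> b \<Longrightarrow> \<bar>y u\<bar> \<le> B"
  shows "\<bar>LINT u:{a..b}|lborel. y u\<bar> \<le> B * (b - a)"
proof -
  have "(LINT u:{a..b}|lborel. \<bar>y u\<bar>) \<le> (LINT u:{a..b}|lborel. B)"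
    using assms by (intro lbb_mono) (auto intro: lbb_abs lbb_const)
  then show ?thesis using abs_set_integral_le[OF assms(1,2), of b] assms(3)
    by (simp add: set_integral_const_Icc mult.commute)
qed

lemma continuous_path_integral:
  assumes "locally_bounded_borel y"
  shows "continuous_on UNIV (\<lambda>t. LINT u:{0..t}|lborel. y u)"
proof -
  have "isCont (\<lambda>t. LINT u:{0..t}|lborel. y u) t" for t
  proof (cases "t < 0")
    case True
    have "\<forall>\<^sub>F s in nhds t. (LINT u:{0..s}|lborel. y u) = 0"
      using eventually_nhds_in_open[of "{..<0}" t] True
      by (auto elim!: eventually_mono simp: set_lebesgue_integral_def)
    then have "isCont (\<lambda>t. LINT u:{0..t}|lborel. y u) t \<longleftrightarrow> isCont (\<lambda>t. 0 :: real) t"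
      by (rule isCont_cong)
    then show ?thesis by simp
  next
    case False
    have "continuous_on {-1..t+1} (\<lambda>t. LINT u:{0..t}|lborel. y u)"
    proof -
      have "continuous_on {0..t+1} (\<lambda>t. LINT u:{0..t}|lborel. y u)"
        using indefinite_integral_continuous_1[OF lbb_HK(1)[OF assms order_refl]]
        by (simp add: lbb_HK(2)[OF assms order_refl])
      moreover have "continuous_on {-1..0} (\<lambda>t. LINT u:{0..t}|lborel. y u)"
      proof -
        have "(LINT u:{0..s}|lborel. y u) = 0" if "s \<in> {-1..0}" for s
          using that lbb_HK(2)[OF assms order_refl, of s] by (cases "s = 0") auto
        then show ?thesis using continuous_on_cong[of "{-1..0}" "{-1..0}" "\<lambda>t. LINT u:{0..t}|lborel. y u" "\<lambda>t. 0"]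
          by simp
      qed
      moreover have "{-1..t+1} = {-1..0} \<union> {0..t+1}" using False by auto
      ultimately show ?thesis using continuous_on_closed_Un by (metis closed_atLeastAtMost)
    qed
    then show ?thesis
      using False by (intro continuous_on_interior[of "{-1..t+1}"]) (auto)
  qed
  then show ?thesis by (simp add: continuous_at_imp_continuous_on)
qed

lemma rcll_continuous: "continuous_on UNIV y \<Longrightarrow> rcll y"
  unfolding rcll_def continuous_on_def
  by (metis tendsto_within_subset subset_UNIV UNIV_I at_within_open)

lemma rcll_mult:
  fixes y z :: "real \<Rightarrow> real"
  assumes "rcll y" "rcll z" shows "rcll (\<lambda>t. y t * z t)"
  using assms unfolding rcll_def by (blast intro: tendsto_mult)

lemma rcll_diff:
  fixes y z :: "real \<Rightarrow> real"
  assumes "rcll y" "rcll z" shows "rcll (\<lambda>t. y t - z t)"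
  using assms unfolding rcll_def by (blast intro: tendsto_diff)

lemma path_integral_right_derivative:
  assumes y: "locally_bounded_borel y" and t: "0 \<le> t" and right: "(y \<longlongrightarrow> y t) (at_right t)"
  shows "((\<lambda>s. LINT u:{0..s}|lborel. y u) has_real_derivative y t) (at_right t)"
proof -
  have at: "at t within {t..t+1} = at_right t" by (simp add: at_within_Icc_at_right)
  have "((\<lambda>s. integral {t..s} y) has_vector_derivative y t) (at t within ({t..t+1} - {}))"
    by (rule integral_has_vector_derivative_continuous_at)
       (use lbb_HK(1)[OF y t] right in \<open>auto simp: continuous_within at\<close>)
  then have "((\<lambda>s. (LINT u:{0..t}|lborel. y u) + integral {t..s} y) has_real_derivative y t) (at t within {t..t+1})"
    by (auto simp: has_real_derivative_iff_has_vector_derivative intro!: derivative_eq_intros)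
  then have "((\<lambda>s. LINT u:{0..s}|lborel. y u) has_real_derivative y t) (at t within {t..t+1})"
  proof (rule has_field_derivative_transform_within[where d=1])
    fix s assume "s \<in> {t..t+1}" "dist s t < 1"
    then show "(LINT u:{0..t}|lborel. y u) + integral {t..s} y = (LINT u:{0..s}|lborel. y u)"
      using lbb_split[OF y order_refl t, of s] lbb_HK(2)[OF y t] by simp
  qed auto
  then show ?thesis by (simp add: at)
qed

text \<open>Let \<open>s\<close> be the last point up to which the increments of \<open>f\<close> are at most
  \<open>e\<close> times the increments of time; if \<open>s < b\<close>, the right derivative at \<open>s\<close> lets one go further.\<close>

lemma zero_right_derivative_imp_const:
  fixes f :: "real \<Rightarrow> real"
  assumes "a \<le> b" and cont: "continuous_on {a..b} f"
    and der: "\<And>t. a \<le> t \<Longrightarrow> t < b \<Longrightarrow> (f has_real_derivative 0) (at_right t)"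
  shows "f b = f a"
proof -
  have "\<bar>f b - f a\<bar> \<le> e * (b - a)" if e: "e > 0" for e
  proof -
    define S where "S = {t\<in>{a..b}. \<forall>r\<in>{a..t}. \<bar>f r - f a\<bar> \<le> e * (r - a)}"
    have aS: "a \<in> S" using assms by (auto simp: S_def)
    have bdd: "bdd_above S" by (auto simp: S_def intro!: bdd_aboveI[of _ b])
    define s where "s = Sup S"
    have as: "a \<le> s" using aS bdd by (simp add: s_def cSup_upper)
    have sb: "s \<le> b" unfolding s_def using aS by (intro cSup_least) (auto simp: S_def)
    have less: "\<bar>f r - f a\<bar> \<le> e * (r - a)" if "a \<le> r" "r < s" for r
    proof -
      obtain t where "t \<in> S" "r < t"
        using \<open>r < s\<close> aS less_cSup_iff[of S r] bdd unfolding s_def by auto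
      then show ?thesis using that by (auto simp: S_def)
    qed
    have at_s: "\<bar>f s - f a\<bar> \<le> e * (s - a)"
    proof (cases "a = s")
      case False
      have cl: "closure {a..<s} = {a..s}" using False as by simp
      have "0 \<le> e * (s - a) - \<bar>f s - f a\<bar>"
      proof (rule continuous_ge_on_closure[of "{a..<s}" "\<lambda>r. e * (r - a) - \<bar>f r - f a\<bar>"])
        have "continuous_on {a..s} f" using cont by (rule continuous_on_subset) (use sb in auto)
        then show "continuous_on (closure {a..<s}) (\<lambda>r. e * (r - a) - \<bar>f r - f a\<bar>)"
          unfolding cl by (intro continuous_intros)
      qed (use cl less as in auto)
      then show ?thesis by simp
    qed simp
    have "s = b"
    proof (rule ccontr)
      assume "s \<noteq> b"
      then have sb': "s < b" using sb by simp
      have "((\<lambda>r. (f r - f s) / (r - s)) \<longlongrightarrow> 0) (at_right s)"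
        using der[OF as sb'] by (simp add: has_field_derivative_iff)
      from tendstoD[OF this e] obtain d where d: "d > s"
        "\<And>r. s < r \<Longrightarrow> r < d \<Longrightarrow> \<bar>(f r - f s) / (r - s)\<bar> < e"
        unfolding eventually_at_right_field by (auto simp: dist_real_def)
      define p where "p = min b ((s + d) / 2)"
      have p: "s < p" "p < d" "p \<le> b" using d sb' by (auto simp: p_def min_def field_simps)
      have "\<bar>f r - f a\<bar> \<le> e * (r - a)" if "a \<le> r" "r \<le> p" for r
      proof (cases "r \<le> s")
        case True then show ?thesis using less at_s that by (cases "r = s") auto
      next
        case False
        then have "\<bar>f r - f s\<bar> < e * (r - s)"
          using d(2)[of r] that p by (auto simp: abs_divide divide_less_eq)
        then show ?thesis using at_s by (simp add: algebra_simps)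
      qed
      then have "p \<in> S" using p as by (auto simp: S_def)
      then have "p \<le> s" using bdd by (simp add: s_def cSup_upper)
      then show False using p by simp
    qed
    then show ?thesis using at_s by simp
  qed
  note le = this
  have "\<bar>f b - f a\<bar> \<le> 0"
  proof (rule field_le_epsilon)
    fix e :: real assume "e > 0"
    have "\<bar>f b - f a\<bar> \<le> e / (b - a + 1) * (b - a)" using le[of "e / (b - a + 1)"] \<open>e > 0\<close> assms(1) by simp
    also have "\<dots> \<le> e" using \<open>e > 0\<close> assms(1) by (simp add: field_simps)
    finally show "\<bar>f b - f a\<bar> \<le> 0 + e" by simp
  qed
  then show ?thesis by simp
qed

text \<open>The integrand may jump, so the integral has a derivative from the right only; this suffices
  to identify the difference of both sides as a constant.\<close>

lemma path_integral_chain_rule: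
  assumes y: "rcll y"
    and der: "\<And>r. (\<psi> has_real_derivative \<psi>' r) (at r)" and cont': "continuous_on UNIV \<psi>'"
    and "0 \<le> s" "s \<le> t"
  defines "I \<equiv> \<lambda>t. LINT u:{0..t}|lborel. y u"
  shows "\<psi> (I t) - \<psi> (I s) = (LINT u:{s..t}|lborel. \<psi>' (I u) * y u)"
proof -
  have ly: "locally_bounded_borel y" using y by (rule lbb_rcll)
  have cI: "continuous_on UNIV I" unfolding I_def by (rule continuous_path_integral[OF ly])
  have cpI: "continuous_on UNIV (\<lambda>u. \<psi>' (I u))"
    by (rule continuous_on_compose2[OF cont' cI]) auto
  have rv: "rcll (\<lambda>u. \<psi>' (I u) * y u)" by (intro rcll_mult rcll_continuous[OF cpI] y)
  have lv: "locally_bounded_borel (\<lambda>u. \<psi>' (I u) * y u)" using rv by (rule lbb_rcll)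
  have cpsi: "continuous_on UNIV \<psi>"
    using der by (auto intro: DERIV_isCont continuous_at_imp_continuous_on)
  define f where "f t = \<psi> (I t) - (LINT u:{0..t}|lborel. \<psi>' (I u) * y u)" for t
  have "f t = f s"
  proof (rule zero_right_derivative_imp_const[OF assms(5)])
    have "continuous_on UNIV f" unfolding f_def
      by (intro continuous_intros continuous_path_integral[OF lv] continuous_on_compose2[OF cpsi cI]) auto
    then show "continuous_on {s..t} f" by (rule continuous_on_subset) auto
    fix r assume r: "s \<le> r" "r < t"
    have 1: "(I has_real_derivative y r) (at_right r)"
      unfolding I_def using r assms(4) by (intro path_integral_right_derivative ly rcll_right[OF y]) auto
    have 2: "((\<lambda>t. LINT u:{0..t}|lborel. \<psi>' (I u) * y u) has_real_derivative \<psi>' (I r) * y r) (at_right r)"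
      using r assms(4) by (intro path_integral_right_derivative lv rcll_right[OF rv]) auto
    have 3: "((\<lambda>t. \<psi> (I t)) has_real_derivative \<psi>' (I r) * y r) (at_right r)"
      by (rule DERIV_chain2[OF der 1])
    show "(f has_real_derivative 0) (at_right r)"
      unfolding f_def using DERIV_diff[OF 3 2] by simp
  qed
  then show ?thesis
    using lbb_split[OF lv order_refl assms(4,5)] by (simp add: f_def)
qed

section \<open>Smooth cutoffs\<close>

text \<open>A continuously differentiable function that is \<open>1\<close> up to \<open>k\<close> and \<open>0\<close> from \<open>k + 1 / (j + 1)\<close> on.\<close>

definition cutoff :: "nat \<Rightarrow> nat \<Rightarrow> real \<Rightarrow> real" where
  "cutoff k j r = (max 0 (1 - (max 0 ((r - real k) * real (Suc j)))\<^sup>2))\<^sup>2"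

definition cutoff_deriv :: "nat \<Rightarrow> nat \<Rightarrow> real \<Rightarrow> real" where
  "cutoff_deriv k j r = - 4 * real (Suc j) * max 0 (1 - (max 0 ((r - real k) * real (Suc j)))\<^sup>2)
     * max 0 ((r - real k) * real (Suc j))"

lemma DERIV_max0_power:
  "((\<lambda>x::real. max 0 x ^ Suc (Suc n)) has_real_derivative real (Suc (Suc n)) * max 0 x ^ Suc n) (at x)"
proof (cases "x = 0")
  case True
  have "((\<lambda>h. max 0 h ^ Suc (Suc n) / h) \<longlongrightarrow> 0) (at (0::real))"
  proof (rule Lim_null_comparison)
    show "\<forall>\<^sub>F h in at (0::real). norm (max 0 h ^ Suc (Suc n) / h) \<le> \<bar>h\<bar> ^ Suc n"
    proof (intro always_eventually allI)
      fix h :: real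
      show "norm (max 0 h ^ Suc (Suc n) / h) \<le> \<bar>h\<bar> ^ Suc n"
      proof (cases "h > 0")
        case False
        then have "max 0 h = 0" by simp
        then show ?thesis by (simp only: power_0_Suc div_0 norm_zero zero_le_power abs_ge_zero)
      qed (simp add: abs_mult)
    qed
    show "((\<lambda>h. \<bar>h::real\<bar> ^ Suc n) \<longlongrightarrow> 0) (at 0)" by (intro tendsto_eq_intros | simp)+
  qed
  then show ?thesis using True by (simp add: DERIV_def)
next
  case False
  show ?thesis
  proof (cases "x > 0")
    case True
    have "((\<lambda>x. x ^ Suc (Suc n)) has_real_derivative real (Suc (Suc n)) * x ^ Suc n) (at x)"
      using DERIV_pow[of "Suc (Suc n)" x] by simp
    then have "((\<lambda>x. max 0 x ^ Suc (Suc n)) has_real_derivative real (Suc (Suc n)) * x ^ Suc n) (at x)"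
      by (rule has_field_derivative_transform_within_open[of _ _ _ "{0<..}"]) (use True in auto)
    then show ?thesis using True by simp
  next
    case x: False
    have "((\<lambda>x. 0) has_real_derivative 0) (at x)" by simp
    then have "((\<lambda>x. max 0 x ^ Suc (Suc n)) has_real_derivative 0) (at x)"
      by (rule has_field_derivative_transform_within_open[of _ _ _ "{..<0}"]) (use x False in auto)
    then show ?thesis using x by simp
  qed
qed

lemma DERIV_max0_power2: "((\<lambda>x::real. (max 0 x)\<^sup>2) has_real_derivative 2 * max 0 x) (at x)"
  using DERIV_max0_power[of 0 x] unfolding power2_eq_square by simp

lemma DERIV_max0_power3: "((\<lambda>x::real. (max 0 x)^3) has_real_derivative 3 * (max 0 x)\<^sup>2) (at x)"
  using DERIV_max0_power[of 1 x] unfolding power2_eq_square power3_eq_cube by (simp add: mult.assoc)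

lemma cutoff_DERIV: "(cutoff k j has_real_derivative cutoff_deriv k j r) (at r)"
proof -
  have 1: "((\<lambda>r. (r - real k) * real (Suc j)) has_real_derivative real (Suc j)) (at r)"
    by (auto intro!: derivative_eq_intros)
  have 2: "((\<lambda>r. 1 - (max 0 ((r - real k) * real (Suc j)))\<^sup>2) has_real_derivative
      0 - 2 * max 0 ((r - real k) * real (Suc j)) * real (Suc j)) (at r)"
    by (intro DERIV_diff DERIV_const DERIV_chain2[OF DERIV_max0_power2 1])
  show ?thesis
    unfolding cutoff_def[abs_def] cutoff_deriv_def
    by (rule DERIV_cong[OF DERIV_chain2[OF DERIV_max0_power2 2]]) (simp add: algebra_simps)
qed

lemma cutoff_deriv_continuous: "continuous_on UNIV (cutoff_deriv k j)"
  unfolding cutoff_deriv_def[abs_def] by (intro continuous_intros)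

lemma cutoff_continuous: "continuous_on UNIV (cutoff k j)"
  unfolding cutoff_def[abs_def] by (intro continuous_intros)

lemma cutoff_nonneg: "0 \<le> cutoff k j r" by (simp add: cutoff_def)

lemma cutoff_le1: "cutoff k j r \<le> 1"
  unfolding cutoff_def by (intro power_le_one) auto

lemma cutoff_eq1: assumes "r \<le> real k" shows "cutoff k j r = 1" "cutoff_deriv k j r = 0"
proof -
  have "(r - real k) * real (Suc j) \<le> 0" using assms by (intro mult_nonpos_nonneg) auto
  then have "max 0 ((r - real k) * real (Suc j)) = 0" by simp
  then show "cutoff k j r = 1" "cutoff_deriv k j r = 0" unfolding cutoff_def cutoff_deriv_def by simp_all
qed

lemma cutoff_eq0: assumes "r \<ge> real k + 1 / real (Suc j)" shows "cutoff k j r = 0" "cutoff_deriv k j r = 0"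
proof -
  have "1 \<le> (r - real k) * real (Suc j)" using assms by (simp add: field_simps)
  then have "1 \<le> (max 0 ((r - real k) * real (Suc j)))\<^sup>2" by (simp add: one_le_power)
  then show "cutoff k j r = 0" "cutoff_deriv k j r = 0" by (simp_all add: cutoff_def cutoff_deriv_def)
qed

lemma cutoff_eq0': assumes "r \<ge> real k + 1" shows "cutoff k j r = 0" "cutoff_deriv k j r = 0"
proof -
  have "1 / real (Suc j) \<le> 1" by simp
  then have "r \<ge> real k + 1 / real (Suc j)" using assms by linarith
  then show "cutoff k j r = 0" "cutoff_deriv k j r = 0" using cutoff_eq0 by blast+
qed

lemma cutoff_deriv_le0: "cutoff_deriv k j r \<le> 0"
  by (simp add: cutoff_deriv_def mult_nonneg_nonneg mult_nonpos_nonneg)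

lemma cutoff_deriv_bound: "\<bar>cutoff_deriv k j r\<bar> \<le> 4 * real (Suc j)"
proof -
  define p where "p = max 0 ((r - real k) * real (Suc j))"
  have p: "p \<ge> 0" by (simp add: p_def)
  have "max 0 (1 - p\<^sup>2) * p \<le> 1"
  proof (cases "p \<le> 1")
    case True then show ?thesis using p by (intro mult_le_one) auto
  next
    case False then have "p\<^sup>2 \<ge> 1" by (simp add: one_le_power)
    then show ?thesis by simp
  qed
  moreover have "max 0 (1 - p\<^sup>2) * p \<ge> 0" using p by simp
  moreover have "\<bar>cutoff_deriv k j r\<bar> = 4 * real (Suc j) * (max 0 (1 - p\<^sup>2) * p)"
    unfolding cutoff_deriv_def p_def[symmetric] using p by (simp add: abs_mult)
  ultimately show ?thesis by (metis mult_left_le mult_nonneg_nonneg of_nat_0_le_iff zero_le_numeral)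
qed

section \<open>Compensated and damped processes\<close>

definition locally_bounded :: "('b::real_normed_vector \<Rightarrow> real) \<Rightarrow> bool" where
  "locally_bounded \<kappa> \<longleftrightarrow> (\<forall>R. \<exists>B. \<forall>x. norm x \<le> R \<longrightarrow> \<bar>\<kappa> x\<bar> \<le> B)"

definition path_integral :: "('b::real_normed_vector \<Rightarrow> real) \<Rightarrow> real \<Rightarrow> 'b cadlag_path \<Rightarrow> real" where
  "path_integral \<kappa> t \<alpha> = (LINT s:{0..t}|lborel. \<kappa> (coord s \<alpha>))"

definition compensated ::
    "('b::real_normed_vector \<Rightarrow> real) \<Rightarrow> ('b \<Rightarrow> real) \<Rightarrow> real \<Rightarrow> 'b cadlag_path \<Rightarrow> real" where
  "compensated F \<kappa> t \<alpha> = F (coord t \<alpha>) - path_integral \<kappa> t \<alpha>"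

text \<open>The density in time of the cutoff of the clock \<open>c\<close> along the path.\<close>

definition weight :: "('b::real_normed_vector \<Rightarrow> real) \<Rightarrow> nat \<Rightarrow> nat \<Rightarrow> real \<Rightarrow> 'b cadlag_path \<Rightarrow> real" where
  "weight c k j t \<alpha> = cutoff_deriv k j (path_integral c t \<alpha>) * c (coord t \<alpha>)"

text \<open>The process \<open>V M - \<integral>M dV\<close> for the compensated process \<open>M\<close> and the cutoff \<open>V\<close> of the clock.\<close>

definition damped ::
    "('b::real_normed_vector \<Rightarrow> real) \<Rightarrow> ('b \<Rightarrow> real) \<Rightarrow> ('b \<Rightarrow> real) \<Rightarrow> nat \<Rightarrow> nat \<Rightarrow>
     real \<Rightarrow> 'b cadlag_path \<Rightarrow> real" where
  "damped c F \<kappa> k j t \<alpha> = cutoff k j (path_integral c t \<alpha>) * compensated F \<kappa> t \<alpha>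
     - (LINT u:{0..t}|lborel. weight c k j u \<alpha> * compensated F \<kappa> u \<alpha>)"

lemma locally_bounded_le:
  assumes "locally_bounded c" "\<And>x. \<bar>\<kappa> x\<bar> \<le> \<bar>c x\<bar>" shows "locally_bounded \<kappa>"
  unfolding locally_bounded_def
proof
  fix R
  obtain B where "\<And>x. norm x \<le> R \<Longrightarrow> \<bar>c x\<bar> \<le> B" using assms(1) unfolding locally_bounded_def by blast
  then have "\<forall>x. norm x \<le> R \<longrightarrow> \<bar>\<kappa> x\<bar> \<le> B" using assms(2) order_trans by blast
  then show "\<exists>B. \<forall>x. norm x \<le> R \<longrightarrow> \<bar>\<kappa> x\<bar> \<le> B" by blast
qed

lemma lbb_path:
  assumes "\<kappa> \<in> borel_measurable borel" "locally_bounded \<kappa>"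
  shows "locally_bounded_borel (\<lambda>u. \<kappa> (coord u \<alpha>))"
  unfolding locally_bounded_borel_def
proof (intro conjI allI)
  show "(\<lambda>u. \<kappa> (coord u \<alpha>)) \<in> borel_measurable borel"
    by (rule measurable_compose[OF rcll_borel_measurable[OF rcll_coord] assms(1)])
  fix T
  obtain R where R: "\<And>x. x \<in> (\<lambda>u. coord u \<alpha>) ` {0..T} \<Longrightarrow> norm x \<le> R"
    using rcll_bounded[OF rcll_coord[of \<alpha>], of 0 T] by (meson bounded_iff)
  obtain B where "\<And>x. norm x \<le> R \<Longrightarrow> \<bar>\<kappa> x\<bar> \<le> B" using assms(2) unfolding locally_bounded_def by meson
  then show "\<exists>B. \<forall>u\<in>{0..T}. \<bar>\<kappa> (coord u \<alpha>)\<bar> \<le> B" using R by (intro exI[of _ B]) auto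
qed

lemma continuous_on_path_integral:
  assumes "\<kappa> \<in> borel_measurable borel" "locally_bounded \<kappa>"
  shows "continuous_on UNIV (\<lambda>t. path_integral \<kappa> t \<alpha>)"
  unfolding path_integral_def by (intro continuous_path_integral lbb_path assms)

lemma path_integral_0 [simp]: "path_integral \<kappa> 0 \<alpha> = 0"
proof -
  have "(\<lambda>s. indicat_real {0..0} s *\<^sub>R \<kappa> (coord s \<alpha>)) = (\<lambda>s. indicator {0} s *\<^sub>R \<kappa> (coord 0 \<alpha>))"
    by (auto simp: indicator_def)
  then show ?thesis by (simp add: path_integral_def set_lebesgue_integral_def)
qed

lemma path_integral_adapted:
  assumes "\<kappa> \<in> borel_measurable borel" "0 \<le> t"
  shows "path_integral \<kappa> t \<in> borel_measurable (path_filtration (ennreal t))"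
  unfolding path_integral_def[abs_def]
  by (intro progressive_integral_adapted progressive_compose[OF progressive_coord] assms order_refl)

lemma progressive_path_integral:
  assumes "\<kappa> \<in> borel_measurable borel" "locally_bounded \<kappa>"
  shows "progressive (path_integral \<kappa>)"
  using continuous_on_path_integral[OF assms]
  by (intro progressive_right_continuous path_integral_adapted assms rcll_right rcll_continuous)

text \<open>The data of a compensated process together with a clock: a continuous, locally bounded
  function that dominates the compensator. Until the integral of the clock along the path reaches a level, the
  compensated process is bounded by a constant that depends on the level but not on the path.\<close>

locale clocked =
  fixes c F \<kappa> :: "'b::real_normed_vector \<Rightarrow> real" and B :: real
  assumes clock_continuous: "continuous_on UNIV c" and clock_bounded: "locally_bounded c"
    and clock_ge1: "\<And>x. 1 \<le> c x"
    and F_continuous: "continuous_on UNIV F" and F_bound: "\<And>x. \<bar>F x\<bar> \<le> B"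
    and compensator_borel: "\<kappa> \<in> borel_measurable borel" and compensator_bound: "\<And>x. \<bar>\<kappa> x\<bar> \<le> c x"
begin

lemma B_nonneg: "0 \<le> B" using F_bound[of 0] by linarith

lemma clock_borel: "c \<in> borel_measurable borel"
  using clock_continuous by (rule borel_measurable_continuous_onI)

lemma compensator_locally_bounded: "locally_bounded \<kappa>"
  by (rule locally_bounded_le[OF clock_bounded]) (rule order_trans[OF compensator_bound abs_ge_self])

lemmas lbb_clock = lbb_path[OF clock_borel clock_bounded]
lemmas lbb_compensator = lbb_path[OF compensator_borel compensator_locally_bounded]
lemmas clock_integral_continuous = continuous_on_path_integral[OF clock_borel clock_bounded]

lemma clock_integral_diff:
  assumes "0 \<le> s" "s \<le> t"
  shows "t - s \<le> path_integral c t \<alpha> - path_integral c s \<alpha>"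
proof -
  have "(LINT u:{s..t}|lborel. 1) \<le> (LINT u:{s..t}|lborel. c (coord u \<alpha>))"
    using assms by (intro lbb_mono lbb_clock lbb_const) (auto simp: clock_ge1)
  then show ?thesis
    using lbb_split[OF lbb_clock order_refl assms] assms(2) by (simp add: path_integral_def set_integral_const_Icc)
qed

lemma clock_integral_mono: "0 \<le> s \<Longrightarrow> s \<le> t \<Longrightarrow> path_integral c s \<alpha> \<le> path_integral c t \<alpha>"
  using clock_integral_diff[of s t \<alpha>] by linarith

lemma path_integral_bound:
  assumes "0 \<le> t" shows "\<bar>path_integral \<kappa> t \<alpha>\<bar> \<le> path_integral c t \<alpha>"
proof -
  have "(LINT u:{0..t}|lborel. \<bar>\<kappa> (coord u \<alpha>)\<bar>) \<le> (LINT u:{0..t}|lborel. c (coord u \<alpha>))"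
    using lbb_abs[OF lbb_compensator]
    by (intro lbb_mono lbb_clock) (auto simp: compensator_bound)
  then show ?thesis using abs_set_integral_le[OF lbb_compensator order_refl, of t]
    unfolding path_integral_def by (meson order_trans)
qed

lemma compensated_bound:
  assumes "0 \<le> s" "s \<le> t" "path_integral c t \<alpha> \<le> K"
  shows "\<bar>compensated F \<kappa> s \<alpha>\<bar> \<le> B + K"
  using path_integral_bound[OF assms(1), of \<alpha>] clock_integral_mono[OF assms(1,2), of \<alpha>] assms(3)
    F_bound[of "coord s \<alpha>"] by (simp add: compensated_def)

lemma rcll_compensated: "rcll (\<lambda>t. compensated F \<kappa> t \<alpha>)"
  unfolding compensated_def
  by (intro rcll_diff rcll_compose[OF rcll_coord F_continuous] rcll_continuous
      continuous_on_path_integral compensator_borel compensator_locally_bounded)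

lemma progressive_compensated: "progressive (compensated F \<kappa>)"
  unfolding compensated_def[abs_def]
  by (intro progressive_diff progressive_path_integral compensator_borel compensator_locally_bounded
      progressive_compose[OF progressive_coord] borel_measurable_continuous_onI F_continuous)

lemma rcll_weight: "rcll (\<lambda>t. weight c k j t \<alpha>)"
  unfolding weight_def
  by (intro rcll_mult rcll_compose[OF rcll_coord clock_continuous] rcll_continuous
      continuous_on_compose2[OF cutoff_deriv_continuous clock_integral_continuous]) auto

lemmas lbb_weight = lbb_rcll[OF rcll_weight]

lemma progressive_weight: "progressive (weight c k j)"
  unfolding weight_def[abs_def]
  by (intro progressive_mult progressive_compose[OF progressive_coord clock_borel]
      progressive_compose[OF progressive_path_integral] clock_borel clock_bounded
      borel_measurable_continuous_onI cutoff_deriv_continuous)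

lemma progressive_cutoff: "progressive (\<lambda>t \<alpha>. cutoff k j (path_integral c t \<alpha>))"
  by (intro progressive_compose[OF progressive_path_integral] clock_borel clock_bounded
      borel_measurable_continuous_onI cutoff_continuous)

lemma weight_le0: "weight c k j t \<alpha> \<le> 0"
  using cutoff_deriv_le0 clock_ge1 by (simp add: weight_def mult_nonpos_nonneg order_trans[OF zero_le_one])

lemma weight_eq0: "path_integral c t \<alpha> \<ge> real k + 1 \<Longrightarrow> weight c k j t \<alpha> = 0"
  by (simp add: weight_def cutoff_eq0')

lemma cutoff_diff:
  assumes "0 \<le> s" "s \<le> t"
  shows "cutoff k j (path_integral c t \<alpha>) - cutoff k j (path_integral c s \<alpha>)
    = (LINT u:{s..t}|lborel. weight c k j u \<alpha>)"
  unfolding path_integral_def weight_def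
  by (rule path_integral_chain_rule[OF rcll_compose[OF rcll_coord clock_continuous]
        cutoff_DERIV cutoff_deriv_continuous assms])

lemma cutoff_start: "cutoff k j (path_integral c 0 \<alpha>) = 1"
  by (simp add: cutoff_eq1)

text \<open>The weight is the derivative of a decreasing function with values between \<open>0\<close> and \<open>1\<close>.\<close>

lemma weight_mass:
  assumes "0 \<le> s" "s \<le> t" shows "(LINT u:{s..t}|lborel. \<bar>weight c k j u \<alpha>\<bar>) \<le> 1"
proof -
  have "(\<lambda>u. \<bar>weight c k j u \<alpha>\<bar>) = (\<lambda>u. - weight c k j u \<alpha>)" using weight_le0 by (auto simp: abs_of_nonpos)
  then have "(LINT u:{s..t}|lborel. \<bar>weight c k j u \<alpha>\<bar>) = - (LINT u:{s..t}|lborel. weight c k j u \<alpha>)"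
    using set_integral_uminus[OF lbb_integrable[OF lbb_weight assms(1)]] by simp
  also have "\<dots> \<le> 1"
    using cutoff_diff[OF assms, of k j \<alpha>] cutoff_nonneg[of k j "path_integral c t \<alpha>"]
      cutoff_le1[of k j "path_integral c s \<alpha>"] by linarith
  finally show ?thesis .
qed

text \<open>An integral against the weight is bounded by any bound for the integrand that holds while
  the clock has not passed the cutoff.\<close>

lemma weighted_integral_bound:
  assumes "0 \<le> s" "s \<le> t" "0 \<le> D" and y: "locally_bounded_borel y"
    and bd: "\<And>u. s \<le> u \<Longrightarrow> u \<le> t \<Longrightarrow> weight c k j u \<alpha> \<noteq> 0 \<Longrightarrow> \<bar>y u\<bar> \<le> D"
  shows "\<bar>LINT u:{s..t}|lborel. weight c k j u \<alpha> * y u\<bar> \<le> D"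
proof -
  have l: "locally_bounded_borel (\<lambda>u. weight c k j u \<alpha> * y u)" by (rule lbb_mult[OF lbb_weight y])
  have "\<bar>LINT u:{s..t}|lborel. weight c k j u \<alpha> * y u\<bar> \<le> (LINT u:{s..t}|lborel. \<bar>weight c k j u \<alpha> * y u\<bar>)"
    by (rule abs_set_integral_le[OF l assms(1)])
  also have "\<dots> \<le> (LINT u:{s..t}|lborel. D * \<bar>weight c k j u \<alpha>\<bar>)"
  proof (intro lbb_mono lbb_abs l lbb_mult lbb_const lbb_weight assms)
    fix u assume "s \<le> u" "u \<le> t"
    then show "\<bar>weight c k j u \<alpha> * y u\<bar> \<le> D * \<bar>weight c k j u \<alpha>\<bar>"
      using bd[of u] by (cases "weight c k j u \<alpha> = 0") (auto simp: abs_mult mult.commute intro: mult_right_mono)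
  qed
  also have "\<dots> = D * (LINT u:{s..t}|lborel. \<bar>weight c k j u \<alpha>\<bar>)" by simp
  also have "\<dots> \<le> D" using weight_mass[OF assms(1,2)] assms(3) by (intro mult_left_le) auto
  finally show ?thesis .
qed

lemma cutoff_times_bound:
  assumes "0 \<le> D" "path_integral c t \<alpha> \<le> real k + 1 \<Longrightarrow> \<bar>z\<bar> \<le> D"
  shows "\<bar>cutoff k j (path_integral c t \<alpha>) * z\<bar> \<le> D"
proof (cases "path_integral c t \<alpha> \<le> real k + 1")
  case True
  have "\<bar>cutoff k j (path_integral c t \<alpha>) * z\<bar> = cutoff k j (path_integral c t \<alpha>) * \<bar>z\<bar>"
    by (simp add: abs_mult cutoff_nonneg)
  also have "\<dots> \<le> \<bar>z\<bar>" by (intro mult_left_le_one_le cutoff_nonneg cutoff_le1 abs_ge_zero)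
  finally show ?thesis using assms(2)[OF True] by linarith
next
  case False then show ?thesis using assms(1) by (simp add: cutoff_eq0')
qed

lemma weight_nonzeroD: "weight c k j t \<alpha> \<noteq> 0 \<Longrightarrow> path_integral c t \<alpha> \<le> real k + 1"
  using weight_eq0[of k t \<alpha> j] by (cases "path_integral c t \<alpha> \<le> real k + 1") auto

lemma lbb_compensated: "locally_bounded_borel (\<lambda>u. compensated F \<kappa> u \<alpha>)"
  by (rule lbb_rcll[OF rcll_compensated])

lemma damped_bound:
  assumes "0 \<le> t" shows "\<bar>damped c F \<kappa> k j t \<alpha>\<bar> \<le> 2 * (B + real k + 1)"
proof -
  have "\<bar>cutoff k j (path_integral c t \<alpha>) * compensated F \<kappa> t \<alpha>\<bar> \<le> B + real k + 1"
    using B_nonneg compensated_bound[OF assms order_refl, of \<alpha> "real k + 1"] by (intro cutoff_times_bound) auto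
  moreover have "\<bar>LINT u:{0..t}|lborel. weight c k j u \<alpha> * compensated F \<kappa> u \<alpha>\<bar> \<le> B + real k + 1"
  proof (rule weighted_integral_bound[OF order_refl assms _ lbb_compensated])
    fix u assume u: "0 \<le> u" "weight c k j u \<alpha> \<noteq> 0"
    show "\<bar>compensated F \<kappa> u \<alpha>\<bar> \<le> B + real k + 1"
      using compensated_bound[OF u(1) order_refl weight_nonzeroD[OF u(2)]] by simp
  qed (use B_nonneg in simp)
  ultimately show ?thesis
    unfolding damped_def by (intro order_trans[OF abs_triangle_ineq4]) simp
qed

lemma rcll_damped: "rcll (\<lambda>t. damped c F \<kappa> k j t \<alpha>)"
  unfolding damped_def
  by (intro rcll_diff rcll_mult rcll_compensated rcll_continuous
      continuous_on_compose2[OF cutoff_continuous clock_integral_continuous]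
      continuous_path_integral lbb_mult lbb_weight lbb_compensated) auto

lemma damped_adapted:
  assumes "0 \<le> t" shows "damped c F \<kappa> k j t \<in> borel_measurable (path_filtration (ennreal t))"
  unfolding damped_def[abs_def]
  by (intro borel_measurable_diff borel_measurable_times progressive_adapted[OF _ assms]
      progressive_cutoff progressive_compensated progressive_integral_adapted
      progressive_mult progressive_weight assms order_refl)

lemma progressive_damped: "progressive (damped c F \<kappa> k j)"
  by (intro progressive_right_continuous damped_adapted rcll_right rcll_damped)

end

section \<open>Martingales on path space\<close>

lemma path_prob_subalgebra: "path_prob P \<Longrightarrow> subalgebra P (path_filtration t)"
  unfolding subalgebra_def path_prob_def
  using sets_eq_imp_space_eq[of P "path_filtration \<infinity>"] sets_path_filtration_mono[of t \<infinity>] by auto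

lemma path_prob_space: "path_prob P \<Longrightarrow> space P = UNIV"
  unfolding path_prob_def using sets_eq_imp_space_eq[of P "path_filtration \<infinity>"] by simp

lemma path_prob_measurable:
  "path_prob P \<Longrightarrow> f \<in> measurable (path_filtration t) N \<Longrightarrow> f \<in> measurable P N"
  by (rule measurable_from_subalg[OF path_prob_subalgebra])

lemma path_prob_sigma_finite_subalgebra:
  assumes "path_prob P" shows "sigma_finite_subalgebra P (path_filtration t)"
proof -
  interpret prob_space P using assms by (simp add: path_prob_def)
  show ?thesis
    by (rule finite_measure_subalgebra_is_sigma_finite)
       (unfold_locales, rule path_prob_subalgebra[OF assms])
qed

lemma path_prob_measurable_pair:
  assumes "path_prob P" "f \<in> measurable (path_filtration t \<Otimes>\<^sub>M borel) N"
  shows "f \<in> measurable (P \<Otimes>\<^sub>M borel) N"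
proof -
  have id: "(\<lambda>x. x) \<in> measurable P (path_filtration t)"
    by (rule path_prob_measurable[OF assms(1) measurable_ident_sets[OF refl]])
  have "(\<lambda>p. (fst p, snd p)) \<in> measurable (P \<Otimes>\<^sub>M borel) (path_filtration t \<Otimes>\<^sub>M borel)"
    by (rule measurable_Pair[OF measurable_compose[OF measurable_fst id] measurable_snd])
  from measurable_compose[OF this assms(2)] show ?thesis by simp
qed

lemma integrable_bounded_path:
  fixes f :: "'b::topological_space cadlag_path \<Rightarrow> real"
  assumes "path_prob P" "f \<in> borel_measurable P" "\<And>\<alpha>. \<bar>f \<alpha>\<bar> \<le> D"
  shows "integrable P f"
proof -
  interpret prob_space P using assms(1) by (simp add: path_prob_def)
  show ?thesis by (rule integrable_const_bound[where B=D]) (use assms in auto)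
qed

lemma martingale_integral_eq:
  assumes P: "path_prob P" and M: "martingale P path_filtration M" and st: "0 \<le> s" "s \<le> t"
    and W: "W \<in> borel_measurable (path_filtration (ennreal s))" "integrable P (\<lambda>\<alpha>. W \<alpha> * M t \<alpha>)"
  shows "(\<integral>\<alpha>. W \<alpha> * M t \<alpha> \<partial>P) = (\<integral>\<alpha>. W \<alpha> * M s \<alpha> \<partial>P)"
proof -
  interpret sigma_finite_subalgebra P "path_filtration (ennreal s)"
    by (rule path_prob_sigma_finite_subalgebra[OF P])
  have Mt: "M t \<in> borel_measurable P" "M s \<in> borel_measurable P"
    using M st unfolding martingale_def by (auto intro!: borel_measurable_integrable)
  have WP[measurable]: "W \<in> borel_measurable P" by (rule path_prob_measurable[OF P W(1)])
  have "(\<integral>\<alpha>. W \<alpha> * M t \<alpha> \<partial>P) = (\<integral>\<alpha>. W \<alpha> * real_cond_exp P (path_filtration (ennreal s)) (M t) \<alpha> \<partial>P)"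
    using real_cond_exp_intg(2)[OF W(2,1) Mt(1)] by simp
  also have "\<dots> = (\<integral>\<alpha>. W \<alpha> * M s \<alpha> \<partial>P)"
  proof (rule integral_cong_AE)
    have "AE \<alpha> in P. real_cond_exp P (path_filtration (ennreal s)) (M t) \<alpha> = M s \<alpha>"
      using M st unfolding martingale_def by blast
    then show "AE \<alpha> in P. W \<alpha> * real_cond_exp P (path_filtration (ennreal s)) (M t) \<alpha> = W \<alpha> * M s \<alpha>"
      by eventually_elim simp
  qed (use Mt in auto)
  finally show ?thesis .
qed

text \<open>Conditional expectations are characterized by the integrals over the events of the
  \<open>\<sigma>\<close>-field.\<close>

lemma martingaleI_bounded:
  fixes M :: "real \<Rightarrow> 'b::topological_space cadlag_path \<Rightarrow> real"
  assumes P: "path_prob P"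
    and meas: "\<And>t. 0 \<le> t \<Longrightarrow> M t \<in> borel_measurable (path_filtration (ennreal t))"
    and bd: "\<And>t \<alpha>. 0 \<le> t \<Longrightarrow> \<bar>M t \<alpha>\<bar> \<le> D t"
    and eq: "\<And>s t A. 0 \<le> s \<Longrightarrow> s \<le> t \<Longrightarrow> A \<in> sets (path_filtration (ennreal s)) \<Longrightarrow>
      (\<integral>\<alpha>. indicator A \<alpha> * M t \<alpha> \<partial>P) = (\<integral>\<alpha>. indicator A \<alpha> * M s \<alpha> \<partial>P)"
  shows "martingale P path_filtration M"
  unfolding martingale_def
proof (intro conjI allI impI)
  have int: "integrable P (M t)" if "0 \<le> t" for t
    by (rule integrable_bounded_path[OF P path_prob_measurable[OF P meas[OF that]] bd[OF that]])
  then show "integrable P (M t)" if "0 \<le> t" for t using that .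
  show "M t \<in> borel_measurable (path_filtration (ennreal t))" if "0 \<le> t" for t using meas[OF that] .
  fix s t :: real assume st: "0 \<le> s \<and> s \<le> t"
  interpret sigma_finite_subalgebra P "path_filtration (ennreal s)"
    by (rule path_prob_sigma_finite_subalgebra[OF P])
  show "AE \<omega> in P. real_cond_exp P (path_filtration (ennreal s)) (M t) \<omega> = M s \<omega>"
  proof (rule real_cond_exp_charact)
    fix A :: "'b cadlag_path set" assume "A \<in> sets (path_filtration (ennreal s))"
    then show "(LINT x:A|P. M t x) = (LINT x:A|P. M s x)"
      using eq[of s t A] st by (simp add: set_lebesgue_integral_def)
  qed (use int meas st in auto)
qed

lemma (in clocked) integrable_damped:
  assumes P: "path_prob P" and A: "A \<in> sets (path_filtration s)" and u: "0 \<le> u"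
  shows "integrable P (\<lambda>\<alpha>. indicator A \<alpha> * damped c F \<kappa> k j u \<alpha>)"
proof (rule integrable_bounded_path[OF P])
  show "(\<lambda>\<alpha>. indicator A \<alpha> * damped c F \<kappa> k j u \<alpha>) \<in> borel_measurable P"
    by (intro borel_measurable_times path_prob_measurable[OF P borel_measurable_indicator[OF A]]
        path_prob_measurable[OF P damped_adapted[OF u]])
  show "\<bar>indicator A \<alpha> * damped c F \<kappa> k j u \<alpha>\<bar> \<le> 2 * (B + real k + 1)" for \<alpha>
    using damped_bound[OF u, of k j \<alpha>] B_nonneg by (auto simp: indicator_def)
qed

lemma stopped_time:
  assumes "0 \<le> t"
  shows "enn2real (min (ennreal t) \<tau>) = (if \<tau> = \<infinity> then t else min t (enn2real \<tau>))"
proof (cases \<tau>)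
  case (real r)
  then have "min (ennreal t) \<tau> = ennreal (min t r)" using assms by (simp add: min_def ennreal_le_iff)
  then show ?thesis using real assms by simp
next
  case top then show ?thesis using assms by (simp add: min_absorb1)
qed

text \<open>The stopped process reads the process at the time \<open>min t \<tau>\<close>, which is continuous and
  nondecreasing in \<open>t\<close>.\<close>

lemma stopped_right_continuous:
  assumes "rcll (\<lambda>t. M t \<omega>)" "0 \<le> s"
  shows "((\<lambda>t. stopped M \<tau> t \<omega>) \<longlongrightarrow> stopped M \<tau> s \<omega>) (at_right s)"
proof (cases "\<tau> \<omega> = \<infinity> \<or> s < enn2real (\<tau> \<omega>)")
  case True
  define d where "d = (if \<tau> \<omega> = \<infinity> then s + 1 else enn2real (\<tau> \<omega>))"
  have d: "s < d" "\<And>r. s < r \<Longrightarrow> r < d \<Longrightarrow> \<tau> \<omega> = \<infinity> \<or> r \<le> enn2real (\<tau> \<omega>)"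
    using True by (cases "\<tau> \<omega> = \<infinity>"; simp add: d_def)+
  have ev: "\<forall>\<^sub>F r in at_right s. M r \<omega> = stopped M \<tau> r \<omega>"
    unfolding eventually_at_right_field using d assms(2)
    by (intro exI[of _ d]) (auto simp: stopped_def stopped_time min_absorb1)
  have "stopped M \<tau> s \<omega> = M s \<omega>"
    using True assms(2) by (auto simp: stopped_def stopped_time)
  then show ?thesis using Lim_transform_eventually[OF rcll_right[OF assms(1)] ev] by simp
next
  case False
  have "\<forall>\<^sub>F r in at_right s. stopped M \<tau> r \<omega> = stopped M \<tau> s \<omega>"
    unfolding eventually_at_right_field using False assms(2)
    by (intro exI[of _ "s+1"]) (auto simp: stopped_def stopped_time min_absorb2)
  then show ?thesis by (rule tendsto_eventually)
qed

context clocked begin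

text \<open>Multiplying a martingale by the decreasing process \<open>V = cutoff(clock)\<close> and compensating
  by the integral against \<open>dV\<close> leaves a martingale: with \<open>V\<^sub>t = V\<^sub>s + \<integral>\<^sub>s\<^sup>t dV\<close>, Fubini and the martingale
  property at each intermediate time turn \<open>E[Y\<^sub>t \<integral>\<^sub>s\<^sup>t dV]\<close> into \<open>E[\<integral>\<^sub>s\<^sup>t Y dV]\<close>.\<close>

lemma product_with_cutoff:
  assumes P: "path_prob P" and M: "martingale P path_filtration Y" and pY: "progressive Y"
    and bdY: "\<And>u \<alpha>. 0 \<le> u \<Longrightarrow> weight c k j u \<alpha> \<noteq> 0 \<Longrightarrow> \<bar>Y u \<alpha>\<bar> \<le> D"
    and lY: "\<And>\<alpha>. locally_bounded_borel (\<lambda>u. Y (max 0 u) \<alpha>)"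
    and D: "0 \<le> D" and st: "0 \<le> s" "s \<le> t"
    and Z: "Z \<in> borel_measurable (path_filtration (ennreal s))" "\<And>\<alpha>. \<bar>Z \<alpha>\<bar> \<le> E"
  shows "(\<integral>\<alpha>. Z \<alpha> * (cutoff k j (path_integral c t \<alpha>) * Y t \<alpha>
            - (LINT u:{0..t}|lborel. weight c k j u \<alpha> * Y u \<alpha>)) \<partial>P)
       = (\<integral>\<alpha>. Z \<alpha> * (cutoff k j (path_integral c s \<alpha>) * Y s \<alpha>
            - (LINT u:{0..s}|lborel. weight c k j u \<alpha> * Y u \<alpha>)) \<partial>P)"
proof -
  interpret prob_space P using P by (simp add: path_prob_def)
  interpret PL: pair_sigma_finite P lborel ..
  define V where "V u \<alpha> = cutoff k j (path_integral c u \<alpha>)" for u \<alpha>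
  define w where "w u \<alpha> = weight c k j u \<alpha>" for u \<alpha>
  define J where "J = {s..t}"
  have t0: "0 \<le> t" using st by simp
  have E: "0 \<le> E" using Z(2)[of undefined] by linarith
  have Vb: "\<bar>V u \<alpha>\<bar> \<le> 1" for u \<alpha> by (simp add: V_def cutoff_nonneg cutoff_le1)
  have ZF: "Z \<in> borel_measurable (path_filtration (ennreal u))" if "s \<le> u" for u
    using measurable_path_filtration_mono[OF Z(1)] that by (simp add: ennreal_leI)
  have [measurable]: "Z \<in> borel_measurable P" by (rule path_prob_measurable[OF P Z(1)])
  have Yint: "integrable P (Y u)" if "0 \<le> u" for u using M that by (simp add: martingale_def)
  have [measurable]: "Y s \<in> borel_measurable P" "Y t \<in> borel_measurable P"
    using Yint[OF st(1)] Yint[OF t0] by auto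
  have VF: "V u \<in> borel_measurable (path_filtration (ennreal u))" if "0 \<le> u" for u
    unfolding V_def[abs_def] using progressive_adapted[OF progressive_cutoff that] .
  have [measurable]: "V s \<in> borel_measurable P" "V t \<in> borel_measurable P"
    using path_prob_measurable[OF P VF] st t0 by auto
  have wF: "w u \<in> borel_measurable (path_filtration (ennreal u))" if "0 \<le> u" for u
    unfolding w_def[abs_def] using progressive_adapted[OF progressive_weight that] .
  have wP: "(\<lambda>p. w (clip t (snd p)) (fst p)) \<in> borel_measurable (P \<Otimes>\<^sub>M borel)"
    unfolding w_def using progressive_weight t0
    by (intro path_prob_measurable_pair[OF P, of _ "ennreal t"]) (simp add: progressive_def)
  have YP: "(\<lambda>p. Y (clip t (snd p)) (fst p)) \<in> borel_measurable (P \<Otimes>\<^sub>M borel)"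
    using pY t0 by (intro path_prob_measurable_pair[OF P, of _ "ennreal t"]) (simp add: progressive_def)
  have lw: "locally_bounded_borel (\<lambda>u. w u \<alpha>)" for \<alpha> unfolding w_def by (rule lbb_weight)
  have lwY: "locally_bounded_borel (\<lambda>u. w u \<alpha> * Y (max 0 u) \<alpha>)" for \<alpha> by (rule lbb_mult[OF lw lY])
  have Yeq: "(LINT u:{a..b}|lborel. w u \<alpha> * Y u \<alpha>) = (LINT u:{a..b}|lborel. w u \<alpha> * Y (max 0 u) \<alpha>)"
    if "0 \<le> a" for a b \<alpha>
    unfolding set_lebesgue_integral_def using that
    by (intro Bochner_Integration.integral_cong refl) (auto simp: indicator_def)
  \<comment> \<open>the two integrands on the product space; they differ in the time at which \<open>Y\<close> is read\<close>
  define f where "f \<alpha> u = indicator J u * Z \<alpha> * w (clip t u) \<alpha> * Y t \<alpha>" for \<alpha> u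
  define g where "g \<alpha> u = indicator J u * Z \<alpha> * w (clip t u) \<alpha> * Y (clip t u) \<alpha>" for \<alpha> u
  have lb: "measurable (P \<Otimes>\<^sub>M lborel) N = measurable (P \<Otimes>\<^sub>M borel) N" for N :: "real measure"
    by (intro measurable_cong_sets sets_pair_measure_cong refl) simp
  have fm: "(\<lambda>p. f (fst p) (snd p)) \<in> borel_measurable (P \<Otimes>\<^sub>M lborel)"
    unfolding f_def lb J_def using wP by measurable
  have gm: "(\<lambda>p. g (fst p) (snd p)) \<in> borel_measurable (P \<Otimes>\<^sub>M lborel)"
    unfolding g_def lb J_def using wP YP by measurable
  have fs: "f \<alpha> u = indicator J u *\<^sub>R ((Z \<alpha> * Y t \<alpha>) * w u \<alpha>)" for \<alpha> u
    using st by (auto simp: f_def J_def indicator_def clip_id)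
  have gs: "g \<alpha> u = indicator J u *\<^sub>R (Z \<alpha> * (w u \<alpha> * Y (max 0 u) \<alpha>))" for \<alpha> u
    using st by (auto simp: g_def J_def indicator_def clip_id)
  have fsi: "integrable lborel (f \<alpha>)" for \<alpha>
    unfolding fs using lbb_integrable[OF lbb_mult[OF lbb_const lw] st(1)]
    by (simp add: J_def set_integrable_def)
  have gsi: "integrable lborel (g \<alpha>)" for \<alpha>
    unfolding gs using lbb_integrable[OF lbb_mult[OF lbb_const lwY] st(1)]
    by (simp add: J_def set_integrable_def)
  have mass: "(LINT u:J|lborel. \<bar>w u \<alpha>\<bar>) \<le> 1" "0 \<le> (LINT u:J|lborel. \<bar>w u \<alpha>\<bar>)" for \<alpha>
    using weight_mass[OF st] by (auto simp: J_def w_def set_lebesgue_integral_def intro!: integral_nonneg_AE)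
  have fint: "integrable (P \<Otimes>\<^sub>M lborel) (case_prod f)"
  proof (rule PL.Fubini_integrable)
    show "case_prod f \<in> borel_measurable (P \<Otimes>\<^sub>M lborel)" using fm by (simp add: split_beta')
    have "(\<integral>u. norm (case_prod f (\<alpha>, u)) \<partial>lborel) = \<bar>Z \<alpha> * Y t \<alpha>\<bar> * (LINT u:J|lborel. \<bar>w u \<alpha>\<bar>)" for \<alpha>
      unfolding set_lebesgue_integral_def fs case_prod_conv
      by (subst integral_mult_right_zero[symmetric]) (simp add: abs_mult ac_simps)
    moreover have "integrable P (\<lambda>\<alpha>. \<bar>Z \<alpha> * Y t \<alpha>\<bar> * (LINT u:J|lborel. \<bar>w u \<alpha>\<bar>))"
    proof (rule Bochner_Integration.integrable_bound[OF integrable_mult_right[of "E" P "\<lambda>\<alpha>. Y t \<alpha>"]])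
      have "(\<lambda>\<alpha>. LINT u|lborel. indicator J u *\<^sub>R \<bar>w (clip t u) \<alpha>\<bar>) \<in> borel_measurable P"
        using wP[folded lb] unfolding J_def
        by (intro lborel.borel_measurable_lebesgue_integral) (simp add: split_beta')
      also have "(\<lambda>\<alpha>. LINT u|lborel. indicator J u *\<^sub>R \<bar>w (clip t u) \<alpha>\<bar>) = (\<lambda>\<alpha>. LINT u:J|lborel. \<bar>w u \<alpha>\<bar>)"
        unfolding set_lebesgue_integral_def using st
        by (intro ext Bochner_Integration.integral_cong refl) (auto simp: J_def indicator_def clip_id)
      finally show "(\<lambda>\<alpha>. \<bar>Z \<alpha> * Y t \<alpha>\<bar> * (LINT u:J|lborel. \<bar>w u \<alpha>\<bar>)) \<in> borel_measurable P" by measurable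
      show "AE \<alpha> in P. norm (\<bar>Z \<alpha> * Y t \<alpha>\<bar> * (LINT u:J|lborel. \<bar>w u \<alpha>\<bar>)) \<le> norm (E * Y t \<alpha>)"
      proof (rule AE_I2)
        fix \<alpha>
        have "\<bar>Z \<alpha> * Y t \<alpha>\<bar> * (LINT u:J|lborel. \<bar>w u \<alpha>\<bar>) \<le> \<bar>Z \<alpha> * Y t \<alpha>\<bar>"
          using mass[of \<alpha>] by (intro mult_left_le) auto
        also have "\<dots> \<le> E * \<bar>Y t \<alpha>\<bar>" unfolding abs_mult by (intro mult_right_mono Z(2)) auto
        finally show "norm (\<bar>Z \<alpha> * Y t \<alpha>\<bar> * (LINT u:J|lborel. \<bar>w u \<alpha>\<bar>)) \<le> norm (E * Y t \<alpha>)"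
          using mass(2)[of \<alpha>] E by (simp add: abs_mult)
      qed
    qed (use Yint[OF t0] in auto)
    ultimately show "integrable P (\<lambda>\<alpha>. \<integral>u. norm (case_prod f (\<alpha>, u)) \<partial>lborel)" by simp
    show "AE \<alpha> in P. integrable lborel (\<lambda>u. case_prod f (\<alpha>, u))" using fsi by simp
  qed
  have gb: "\<bar>g \<alpha> u\<bar> \<le> (E * D) * (indicator J u * \<bar>w u \<alpha>\<bar>)" for \<alpha> u
  proof (cases "u \<in> J \<and> w u \<alpha> \<noteq> 0")
    case True
    then have "0 \<le> u" using st by (auto simp: J_def)
    then have "\<bar>Y u \<alpha>\<bar> \<le> D" using bdY[of u \<alpha>] True by (simp add: w_def)
    then have "\<bar>Z \<alpha>\<bar> * (\<bar>w u \<alpha>\<bar> * \<bar>Y u \<alpha>\<bar>) \<le> E * (\<bar>w u \<alpha>\<bar> * D)"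
      using E by (intro mult_mono Z(2) order_refl) auto
    then show ?thesis using True \<open>0 \<le> u\<close> unfolding gs by (simp add: abs_mult ac_simps)
  next
    case False then show ?thesis unfolding gs by auto
  qed
  have gint: "integrable (P \<Otimes>\<^sub>M lborel) (case_prod g)"
  proof (rule PL.Fubini_integrable)
    show "case_prod g \<in> borel_measurable (P \<Otimes>\<^sub>M lborel)" using gm by (simp add: split_beta')
    show "integrable P (\<lambda>\<alpha>. \<integral>u. norm (case_prod g (\<alpha>, u)) \<partial>lborel)"
    proof (rule integrable_bounded_path[OF P])
      show "(\<lambda>\<alpha>. \<integral>u. norm (case_prod g (\<alpha>, u)) \<partial>lborel) \<in> borel_measurable P"
        using gm by (intro lborel.borel_measurable_lebesgue_integral) (simp add: split_beta')
      fix \<alpha>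
      have "(\<integral>u. norm (case_prod g (\<alpha>, u)) \<partial>lborel) \<le> (\<integral>u. (E * D) * (indicator J u * \<bar>w u \<alpha>\<bar>) \<partial>lborel)"
        using gsi[of \<alpha>] lbb_integrable[OF lbb_mult[OF lbb_const[of "E*D"] lbb_abs[OF lw]] st(1), of t \<alpha>] gb
        by (intro integral_mono) (auto simp: J_def set_integrable_def ac_simps)
      also have "\<dots> = (E * D) * (LINT u:J|lborel. \<bar>w u \<alpha>\<bar>)" by (simp add: set_lebesgue_integral_def)
      also have "\<dots> \<le> E * D" using mass(1)[of \<alpha>] E D by (intro mult_left_le) auto
      finally show "\<bar>\<integral>u. norm (case_prod g (\<alpha>, u)) \<partial>lborel\<bar> \<le> E * D" by simp
    qed
    show "AE \<alpha> in P. integrable lborel (\<lambda>u. case_prod g (\<alpha>, u))" using gsi by simp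
  qed
  have swap: "(\<integral>\<alpha>. (\<integral>u. f \<alpha> u \<partial>lborel) \<partial>P) = (\<integral>\<alpha>. (\<integral>u. g \<alpha> u \<partial>lborel) \<partial>P)"
  proof -
    have "(\<integral>\<alpha>. (\<integral>u. f \<alpha> u \<partial>lborel) \<partial>P) = (\<integral>u. (\<integral>\<alpha>. f \<alpha> u \<partial>P) \<partial>lborel)"
      using PL.Fubini_integral[OF fint] by simp
    also have "\<dots> = (\<integral>u. (\<integral>\<alpha>. g \<alpha> u \<partial>P) \<partial>lborel)"
    proof (rule integral_cong_AE)
      show "(\<lambda>u. \<integral>\<alpha>. f \<alpha> u \<partial>P) \<in> borel_measurable lborel" using PL.integrable_snd[OF fint] by auto
      show "(\<lambda>u. \<integral>\<alpha>. g \<alpha> u \<partial>P) \<in> borel_measurable lborel" using PL.integrable_snd[OF gint] by auto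
      show "AE u in lborel. (\<integral>\<alpha>. f \<alpha> u \<partial>P) = (\<integral>\<alpha>. g \<alpha> u \<partial>P)"
        using PL.AE_integrable_snd[OF fint]
      proof eventually_elim
        fix u assume int: "integrable P (\<lambda>\<alpha>. f \<alpha> u)"
        show "(\<integral>\<alpha>. f \<alpha> u \<partial>P) = (\<integral>\<alpha>. g \<alpha> u \<partial>P)"
        proof (cases "u \<in> J")
          case True
          then have u: "s \<le> u" "u \<le> t" "0 \<le> u" using st by (auto simp: J_def)
          have "(\<integral>\<alpha>. (Z \<alpha> * w u \<alpha>) * Y t \<alpha> \<partial>P) = (\<integral>\<alpha>. (Z \<alpha> * w u \<alpha>) * Y u \<alpha> \<partial>P)"
          proof (rule martingale_integral_eq[OF P M u(3,2)])
            show "(\<lambda>\<alpha>. Z \<alpha> * w u \<alpha>) \<in> borel_measurable (path_filtration (ennreal u))"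
              using ZF[OF u(1)] wF[OF u(3)] by simp
            show "integrable P (\<lambda>\<alpha>. Z \<alpha> * w u \<alpha> * Y t \<alpha>)" using int True by (simp add: fs ac_simps)
          qed
          then show ?thesis using True u by (simp add: fs gs ac_simps)
        qed (simp add: fs gs)
      qed
    qed
    also have "\<dots> = (\<integral>\<alpha>. (\<integral>u. g \<alpha> u \<partial>lborel) \<partial>P)" using PL.Fubini_integral[OF gint] by simp
    finally show ?thesis .
  qed
  have f_int: "(\<integral>u. f \<alpha> u \<partial>lborel) = Z \<alpha> * (V t \<alpha> - V s \<alpha>) * Y t \<alpha>" for \<alpha>
    using cutoff_diff[OF st, of k j \<alpha>]
    unfolding fs V_def w_def J_def by (simp add: set_lebesgue_integral_def algebra_simps flip: integral_mult_right_zero)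
  have g_int: "(\<integral>u. g \<alpha> u \<partial>lborel) = Z \<alpha> * ((LINT u:{0..t}|lborel. w u \<alpha> * Y u \<alpha>) - (LINT u:{0..s}|lborel. w u \<alpha> * Y u \<alpha>))" for \<alpha>
  proof -
    have "(\<integral>u. g \<alpha> u \<partial>lborel) = Z \<alpha> * (LINT u:{s..t}|lborel. w u \<alpha> * Y (max 0 u) \<alpha>)"
      unfolding gs J_def by (simp add: set_lebesgue_integral_def algebra_simps flip: integral_mult_right_zero)
    then show ?thesis
      using lbb_split[OF lwY order_refl st, of \<alpha>] by (simp add: Yeq)
  qed
  have bddint: "integrable P (\<lambda>\<alpha>. h \<alpha> * Y u \<alpha>)"
    if "h \<in> borel_measurable P" "\<And>\<alpha>. \<bar>h \<alpha>\<bar> \<le> E" "0 \<le> u" for h u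
    by (rule Bochner_Integration.integrable_bound[OF integrable_mult_right[of E P "Y u"]])
       (use Yint[OF that(3)] that E in \<open>auto simp: abs_mult intro!: mult_right_mono\<close>)
  have ZVb: "\<bar>Z \<alpha> * V u \<alpha>\<bar> \<le> E" for \<alpha> u
    using mult_mono[OF Z(2)[of \<alpha>] Vb[of u \<alpha>]] E by (simp add: abs_mult)
  have i1: "integrable P (\<lambda>\<alpha>. (Z \<alpha> * V t \<alpha>) * Y t \<alpha>)" by (intro bddint ZVb t0) measurable
  have i2: "integrable P (\<lambda>\<alpha>. (Z \<alpha> * V s \<alpha>) * Y t \<alpha>)" by (intro bddint ZVb t0) measurable
  have i3: "integrable P (\<lambda>\<alpha>. (Z \<alpha> * V s \<alpha>) * Y s \<alpha>)" by (intro bddint ZVb st) measurable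
  define I where "I u \<alpha> = (LINT r:{0..u}|lborel. w r \<alpha> * Y r \<alpha>)" for u \<alpha>
  have i4: "integrable P (\<lambda>\<alpha>. Z \<alpha> * I u \<alpha>)" if u: "0 \<le> u" for u
  proof (rule integrable_bounded_path[OF P])
    have "I u \<in> borel_measurable (path_filtration (ennreal u))"
      unfolding I_def[abs_def] w_def
      by (intro progressive_integral_adapted progressive_mult progressive_weight pY order_refl u)
    then have "I u \<in> borel_measurable P" by (rule path_prob_measurable[OF P])
    then show "(\<lambda>\<alpha>. Z \<alpha> * I u \<alpha>) \<in> borel_measurable P" by measurable
    fix \<alpha>
    have "\<bar>LINT r:{0..u}|lborel. w r \<alpha> * Y (max 0 r) \<alpha>\<bar> \<le> D"
      unfolding w_def
    proof (rule weighted_integral_bound[OF order_refl u D lY])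
      fix r :: real assume "0 \<le> r" "weight c k j r \<alpha> \<noteq> 0"
      then show "\<bar>Y (max 0 r) \<alpha>\<bar> \<le> D" using bdY[of r \<alpha>] by simp
    qed
    then have "\<bar>I u \<alpha>\<bar> \<le> D" by (simp add: I_def Yeq)
    then show "\<bar>Z \<alpha> * I u \<alpha>\<bar> \<le> E * D" unfolding abs_mult by (intro mult_mono Z(2) E) auto
  qed
  have ms: "(\<integral>\<alpha>. (Z \<alpha> * V s \<alpha>) * Y t \<alpha> \<partial>P) = (\<integral>\<alpha>. (Z \<alpha> * V s \<alpha>) * Y s \<alpha> \<partial>P)"
    by (rule martingale_integral_eq[OF P M st borel_measurable_times[OF Z(1) VF[OF st(1)]] i2])
  have "(\<integral>\<alpha>. (Z \<alpha> * V t \<alpha>) * Y t \<alpha> \<partial>P) - (\<integral>\<alpha>. (Z \<alpha> * V s \<alpha>) * Y t \<alpha> \<partial>P) = (\<integral>\<alpha>. (\<integral>u. f \<alpha> u \<partial>lborel) \<partial>P)"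
    unfolding f_int Bochner_Integration.integral_diff[OF i1 i2, symmetric] by (simp add: algebra_simps)
  also have "\<dots> = (\<integral>\<alpha>. Z \<alpha> * I t \<alpha> \<partial>P) - (\<integral>\<alpha>. Z \<alpha> * I s \<alpha> \<partial>P)"
    unfolding swap g_int Bochner_Integration.integral_diff[OF i4[OF t0] i4[OF st(1)], symmetric]
    by (simp add: I_def algebra_simps)
  finally have "(\<integral>\<alpha>. (Z \<alpha> * V t \<alpha>) * Y t \<alpha> \<partial>P) - (\<integral>\<alpha>. Z \<alpha> * I t \<alpha> \<partial>P)
     = (\<integral>\<alpha>. (Z \<alpha> * V s \<alpha>) * Y s \<alpha> \<partial>P) - (\<integral>\<alpha>. Z \<alpha> * I s \<alpha> \<partial>P)" using ms by linarith
  then have "(\<integral>\<alpha>. (Z \<alpha> * V t \<alpha>) * Y t \<alpha> - Z \<alpha> * I t \<alpha> \<partial>P) = (\<integral>\<alpha>. (Z \<alpha> * V s \<alpha>) * Y s \<alpha> - Z \<alpha> * I s \<alpha> \<partial>P)"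
    using Bochner_Integration.integral_diff[OF i1 i4[OF t0]]
      Bochner_Integration.integral_diff[OF i3 i4[OF st(1)]] by linarith
  then show ?thesis unfolding V_def w_def I_def by (simp add: right_diff_distrib mult.assoc)
qed

text \<open>Here the localizing sequence disappears: below the cutoff level the clock bounds the
  stopped process uniformly, so the stopping can be removed by dominated convergence.\<close>

theorem damped_martingale:
  assumes P: "path_prob P"
    and M: "local_martingale P path_filtration (\<lambda>t \<alpha>. compensated F \<kappa> t \<alpha> - F (coord 0 \<alpha>))"
    and st: "0 \<le> s" "s \<le> t"
    and Z: "Z \<in> borel_measurable (path_filtration (ennreal s))" "\<And>\<alpha>. \<bar>Z \<alpha>\<bar> \<le> E"
  shows "(\<integral>\<alpha>. Z \<alpha> * damped c F \<kappa> k j t \<alpha> \<partial>P) = (\<integral>\<alpha>. Z \<alpha> * damped c F \<kappa> k j s \<alpha> \<partial>P)"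
proof -
  interpret prob_space P using P by (simp add: path_prob_def)
  define M where "M t \<alpha> = compensated F \<kappa> t \<alpha> - F (coord 0 \<alpha>)" for t \<alpha>
  obtain \<tau> where lim: "AE \<alpha> in P. (\<lambda>n. \<tau> n \<alpha>) \<longlonglongrightarrow> \<infinity>"
    and mart: "\<And>n::nat. martingale P path_filtration (stopped M (\<tau> n))"
    using M unfolding local_martingale_def M_def by blast
  have F0: "(\<lambda>\<alpha>. F (coord 0 \<alpha>)) \<in> borel_measurable (path_filtration (ennreal u))" if "0 \<le> u" for u
    using that by (intro measurable_compose[OF measurable_coord] borel_measurable_continuous_onI F_continuous) auto
  have F0P: "integrable P (\<lambda>\<alpha>. F (coord 0 \<alpha>))"
    by (rule integrable_bounded_path[OF P path_prob_measurable[OF P F0[OF order_refl]] F_bound])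
  \<comment> \<open>the initial value is added back so that \<open>Y n\<close> is the stopped compensated process itself\<close>
  define Y where "Y n u \<alpha> = stopped M (\<tau> n) u \<alpha> + F (coord 0 \<alpha>)" for n u \<alpha>
  have Yeq: "Y n u \<alpha> = stopped (compensated F \<kappa>) (\<tau> n) u \<alpha>" for n u \<alpha>
    by (simp add: Y_def stopped_def M_def)
  have martY: "martingale P path_filtration (Y n)" for n
    unfolding martingale_def
  proof (intro conjI allI impI)
    fix u :: real assume u: "0 \<le> u"
    show "Y n u \<in> borel_measurable (path_filtration (ennreal u))"
      unfolding Y_def[abs_def] using mart[of n] u F0[OF u] by (intro borel_measurable_add) (auto simp: martingale_def)
    show "integrable P (Y n u)"
      unfolding Y_def[abs_def] using mart[of n] u F0P by (auto simp: martingale_def)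
  next
    fix r u :: real assume ru: "0 \<le> r \<and> r \<le> u"
    interpret sigma_finite_subalgebra P "path_filtration (ennreal r)"
      by (rule path_prob_sigma_finite_subalgebra[OF P])
    have "AE \<alpha> in P. real_cond_exp P (path_filtration (ennreal r)) (Y n u) \<alpha> =
       real_cond_exp P (path_filtration (ennreal r)) (stopped M (\<tau> n) u) \<alpha>
       + real_cond_exp P (path_filtration (ennreal r)) (\<lambda>\<alpha>. F (coord 0 \<alpha>)) \<alpha>"
      unfolding Y_def[abs_def] using mart[of n] ru F0P by (intro real_cond_exp_add) (auto simp: martingale_def)
    moreover have "AE \<alpha> in P. real_cond_exp P (path_filtration (ennreal r)) (\<lambda>\<alpha>. F (coord 0 \<alpha>)) \<alpha> = F (coord 0 \<alpha>)"
      using ru by (intro real_cond_exp_F_meas F0P F0) auto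
    moreover have "AE \<alpha> in P. real_cond_exp P (path_filtration (ennreal r)) (stopped M (\<tau> n) u) \<alpha> = stopped M (\<tau> n) r \<alpha>"
      using mart[of n] ru by (auto simp: martingale_def)
    ultimately show "AE \<alpha> in P. real_cond_exp P (path_filtration (ennreal r)) (Y n u) \<alpha> = Y n r \<alpha>"
      by eventually_elim (simp add: Y_def)
  qed
  have Yt: "Y n u \<alpha> = compensated F \<kappa> (if \<tau> n \<alpha> = \<infinity> then u else min u (enn2real (\<tau> n \<alpha>))) \<alpha>"
    if "0 \<le> u" for n u \<alpha> using that by (simp add: Yeq stopped_def stopped_time)
  have Yrc: "((\<lambda>u. Y n u \<alpha>) \<longlongrightarrow> Y n u \<alpha>) (at_right u)" if "0 \<le> u" for n u \<alpha>
    unfolding Yeq by (rule stopped_right_continuous[OF rcll_compensated that])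
  have pY: "progressive (Y n)" for n
    using martY[of n] Yrc by (intro progressive_right_continuous) (auto simp: martingale_def)
  have lY: "locally_bounded_borel (\<lambda>u. Y n (max 0 u) \<alpha>)" for n \<alpha>
  proof -
    define r where "r = enn2real (\<tau> n \<alpha>)"
    have "(\<lambda>u. Y n (max 0 u) \<alpha>) = (\<lambda>u. compensated F \<kappa> (if \<tau> n \<alpha> = \<infinity> then max 0 u else min (max 0 u) r) \<alpha>)"
      by (auto simp: Yt r_def)
    moreover have "(\<lambda>u. compensated F \<kappa> (if \<tau> n \<alpha> = \<infinity> then max 0 u else min (max 0 u) r) \<alpha>) \<in> borel_measurable borel"
      by (rule measurable_compose[OF _ rcll_borel_measurable[OF rcll_compensated]]) measurable
    moreover have "\<exists>D. \<forall>u\<in>{0..T}. \<bar>compensated F \<kappa> (if \<tau> n \<alpha> = \<infinity> then max 0 u else min (max 0 u) r) \<alpha>\<bar> \<le> D" for T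
    proof -
      obtain D where D: "\<And>u. u \<in> {0..T} \<Longrightarrow> \<bar>compensated F \<kappa> u \<alpha>\<bar> \<le> D"
        using lbb_compensated[of \<alpha>] unfolding locally_bounded_borel_def by meson
      have "r \<ge> 0" by (simp add: r_def)
      then have "(if \<tau> n \<alpha> = \<infinity> then max 0 u else min (max 0 u) r) \<in> {0..T}" if "u \<in> {0..T}" for u
        using that by auto
      then show ?thesis using D by (intro exI[of _ D]) blast
    qed
    ultimately show ?thesis by (simp add: locally_bounded_borel_def)
  qed
  define D where "D = B + real k + 1"
  have D: "0 \<le> D" using B_nonneg by (simp add: D_def)
  have Yb: "\<bar>Y n u \<alpha>\<bar> \<le> D" if u: "0 \<le> u" "path_integral c u \<alpha> \<le> real k + 1" for n u \<alpha>
    unfolding Yt[OF u(1)] D_def using u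
    by (intro order_trans[OF compensated_bound[of _ u \<alpha> "real k + 1"]]) auto
  define N where "N n u \<alpha> = cutoff k j (path_integral c u \<alpha>) * Y n u \<alpha>
            - (LINT r:{0..u}|lborel. weight c k j r \<alpha> * Y n r \<alpha>)" for n u \<alpha>
  have Yw: "(LINT r:{0..u}|lborel. weight c k j r \<alpha> * Y n r \<alpha>) = (LINT r:{0..u}|lborel. weight c k j r \<alpha> * Y n (max 0 r) \<alpha>)" for n u \<alpha>
    unfolding set_lebesgue_integral_def
    by (intro Bochner_Integration.integral_cong refl) (auto simp: indicator_def)
  have Nb: "\<bar>N n u \<alpha>\<bar> \<le> 2 * D" if u: "0 \<le> u" for n u \<alpha>
  proof -
    have "\<bar>LINT r:{0..u}|lborel. weight c k j r \<alpha> * Y n (max 0 r) \<alpha>\<bar> \<le> D"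
    proof (rule weighted_integral_bound[OF order_refl u D lY])
      fix r :: real assume "0 \<le> r" "weight c k j r \<alpha> \<noteq> 0"
      then show "\<bar>Y n (max 0 r) \<alpha>\<bar> \<le> D" using Yb[of r \<alpha> n] weight_nonzeroD[of k j r \<alpha>] by simp
    qed
    moreover have "\<bar>cutoff k j (path_integral c u \<alpha>) * Y n u \<alpha>\<bar> \<le> D"
      by (rule cutoff_times_bound[OF D Yb[OF u]])
    ultimately show ?thesis
      unfolding N_def Yw by (intro order_trans[OF abs_triangle_ineq4]) simp
  qed
  have NF: "N n u \<in> borel_measurable (path_filtration (ennreal u))" if u: "0 \<le> u" for n u
    unfolding N_def[abs_def]
    by (intro borel_measurable_diff borel_measurable_times progressive_adapted[OF _ u]
      progressive_cutoff pY progressive_integral_adapted progressive_mult progressive_weight u order_refl)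
  have N_lim: "AE \<alpha> in P. (\<lambda>n. N n u \<alpha>) \<longlonglongrightarrow> damped c F \<kappa> k j u \<alpha>" if u: "0 \<le> u" for u
    using lim
  proof eventually_elim
    fix \<alpha> assume "(\<lambda>n. \<tau> n \<alpha>) \<longlonglongrightarrow> \<infinity>"
    then have "\<forall>\<^sub>F n in sequentially. ennreal u < \<tau> n \<alpha>" by (simp add: order_tendstoD(1))
    then have "\<forall>\<^sub>F n in sequentially. N n u \<alpha> = damped c F \<kappa> k j u \<alpha>"
    proof eventually_elim
      fix n assume n: "ennreal u < \<tau> n \<alpha>"
      have "Y n r \<alpha> = compensated F \<kappa> r \<alpha>" if r: "0 \<le> r" "r \<le> u" for r
      proof -
        have "ennreal r \<le> \<tau> n \<alpha>" using n r by (meson ennreal_leI le_less_trans less_imp_le)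
        then show ?thesis using r by (simp add: Yeq stopped_def min_absorb1)
      qed
      then have "(LINT r:{0..u}|lborel. weight c k j r \<alpha> * Y n r \<alpha>) = (LINT r:{0..u}|lborel. weight c k j r \<alpha> * compensated F \<kappa> r \<alpha>)"
        "Y n u \<alpha> = compensated F \<kappa> u \<alpha>"
        unfolding set_lebesgue_integral_def using u
        by (auto intro!: Bochner_Integration.integral_cong simp: indicator_def)
      then show "N n u \<alpha> = damped c F \<kappa> k j u \<alpha>" by (simp add: N_def damped_def)
    qed
    then show "(\<lambda>n. N n u \<alpha>) \<longlonglongrightarrow> damped c F \<kappa> k j u \<alpha>" by (rule tendsto_eventually)
  qed
  have E: "0 \<le> E" using Z(2)[of undefined] by linarith
  have ZP: "Z \<in> borel_measurable P" by (rule path_prob_measurable[OF P Z(1)])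
  have conv: "(\<lambda>n. \<integral>\<alpha>. Z \<alpha> * N n u \<alpha> \<partial>P) \<longlonglongrightarrow> (\<integral>\<alpha>. Z \<alpha> * damped c F \<kappa> k j u \<alpha> \<partial>P)" if u: "0 \<le> u" for u
  proof (rule integral_dominated_convergence[where w="\<lambda>_. E * (2 * D)"])
    show "(\<lambda>\<alpha>. Z \<alpha> * damped c F \<kappa> k j u \<alpha>) \<in> borel_measurable P"
      using ZP path_prob_measurable[OF P damped_adapted[OF u]] by (rule borel_measurable_times)
    show "(\<lambda>\<alpha>. Z \<alpha> * N n u \<alpha>) \<in> borel_measurable P" for n
      using ZP path_prob_measurable[OF P NF[OF u]] by (rule borel_measurable_times)
    show "AE \<alpha> in P. (\<lambda>n. Z \<alpha> * N n u \<alpha>) \<longlonglongrightarrow> Z \<alpha> * damped c F \<kappa> k j u \<alpha>"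
      using N_lim[OF u] by eventually_elim (rule tendsto_mult_left)
    show "AE \<alpha> in P. norm (Z \<alpha> * N n u \<alpha>) \<le> E * (2 * D)" for n
      using Nb[OF u] Z(2) E by (auto simp: abs_mult intro!: mult_mono)
  qed simp
  have "(\<integral>\<alpha>. Z \<alpha> * N n t \<alpha> \<partial>P) = (\<integral>\<alpha>. Z \<alpha> * N n s \<alpha> \<partial>P)" for n
    unfolding N_def
  proof (rule product_with_cutoff[OF P martY pY _ lY D st Z])
    fix u \<alpha> assume "0 \<le> u" "weight c k j u \<alpha> \<noteq> 0"
    then show "\<bar>Y n u \<alpha>\<bar> \<le> D" using Yb[of u \<alpha> n] weight_nonzeroD[of k j u \<alpha>] by simp
  qed
  then show ?thesis using LIMSEQ_unique[OF conv[of t] ] conv[OF st(1)] st by simp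
qed

text \<open>The time at which the clock shows \<open>k\<close>. As the clock advances at least at unit speed, it is
  a stopping time of the raw filtration.\<close>

definition clock_time :: "nat \<Rightarrow> 'b cadlag_path \<Rightarrow> real" where
  "clock_time k \<alpha> = (SOME t. 0 \<le> t \<and> path_integral c t \<alpha> = real k)"

lemma clock_time: "0 \<le> clock_time k \<alpha>" "path_integral c (clock_time k \<alpha>) \<alpha> = real k"
proof -
  have "\<exists>t\<ge>0. t \<le> real k \<and> path_integral c t \<alpha> = real k"
  proof (rule IVT')
    show "path_integral c 0 \<alpha> \<le> real k" by simp
    show "real k \<le> path_integral c (real k) \<alpha>" using clock_integral_diff[of 0 "real k" \<alpha>] by simp
    show "continuous_on {0..real k} (\<lambda>t. path_integral c t \<alpha>)"
      by (rule continuous_on_subset[OF clock_integral_continuous]) simp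
  qed simp
  then have "\<exists>t. 0 \<le> t \<and> path_integral c t \<alpha> = real k" by blast
  from someI_ex[OF this] show "0 \<le> clock_time k \<alpha>" "path_integral c (clock_time k \<alpha>) \<alpha> = real k"
    by (auto simp: clock_time_def)
qed

lemma clock_time_le_iff: "0 \<le> t \<Longrightarrow> clock_time k \<alpha> \<le> t \<longleftrightarrow> real k \<le> path_integral c t \<alpha>"
  using clock_integral_mono[of "clock_time k \<alpha>" t \<alpha>] clock_integral_diff[of t "clock_time k \<alpha>" \<alpha>]
    clock_time[of k \<alpha>] by force

text \<open>For steeper and steeper cutoffs, the measure \<open>-dV\<close> concentrates immediately after the time at
  which the clock shows \<open>k\<close>.\<close>

lemma damped_tendsto_stopped:
  assumes t: "0 \<le> t"
  shows "(\<lambda>j. damped c F \<kappa> k j t \<alpha>) \<longlonglongrightarrow> compensated F \<kappa> (min t (clock_time k \<alpha>)) \<alpha>"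
proof (cases "t \<le> clock_time k \<alpha>")
  case True
  have le: "path_integral c u \<alpha> \<le> real k" if "0 \<le> u" "u \<le> t" for u
    using clock_integral_mono[of u "clock_time k \<alpha>" \<alpha>] clock_time[of k \<alpha>] that True by simp
  have "damped c F \<kappa> k j t \<alpha> = compensated F \<kappa> t \<alpha>" for j
  proof -
    have "(LINT u:{0..t}|lborel. weight c k j u \<alpha> * compensated F \<kappa> u \<alpha>) = (LINT u:{0..t}|lborel. 0)"
      unfolding set_lebesgue_integral_def
      by (intro Bochner_Integration.integral_cong refl) (auto simp: indicator_def weight_def cutoff_eq1 le)
    then show ?thesis using le[OF t order_refl] by (simp add: damped_def cutoff_eq1 set_lebesgue_integral_def)
  qed
  then show ?thesis using True by (simp add: min_absorb1)
next
  case False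
  define \<rho> where "\<rho> = clock_time k \<alpha>"
  have rho: "0 \<le> \<rho>" "path_integral c \<rho> \<alpha> = real k" "\<rho> < t"
    using clock_time False by (auto simp: \<rho>_def)
  define m where "m u = compensated F \<kappa> u \<alpha>" for u
  have lm: "locally_bounded_borel m" unfolding m_def[abs_def] by (rule lbb_compensated)
  have "(\<lambda>j. damped c F \<kappa> k j t \<alpha>) \<longlonglongrightarrow> m \<rho>"
  proof (rule tendstoI)
    fix e :: real assume e: "e > 0"
    have "(m \<longlongrightarrow> m \<rho>) (at_right \<rho>)" unfolding m_def[abs_def] using rcll_right[OF rcll_compensated] .
    from tendstoD[OF this, of "e/2"] e obtain d where d: "\<rho> < d" "\<And>u. \<rho> < u \<Longrightarrow> u < d \<Longrightarrow> dist (m u) (m \<rho>) < e/2"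
      unfolding eventually_at_right_field by auto
    have "(\<lambda>j. 1 / real (Suc j)) \<longlonglongrightarrow> 0" using LIMSEQ_inverse_real_of_nat by (simp add: inverse_eq_divide)
    then have "\<forall>\<^sub>F j in sequentially. 1 / real (Suc j) < min (d - \<rho>) (t - \<rho>)"
      using d(1) rho(3) by (intro order_tendstoD(2)) auto
    then show "\<forall>\<^sub>F j in sequentially. dist (damped c F \<kappa> k j t \<alpha>) (m \<rho>) < e"
    proof eventually_elim
      fix j assume j: "1 / real (Suc j) < min (d - \<rho>) (t - \<rho>)"
      define w where "w u = weight c k j u \<alpha>" for u
      have lw: "locally_bounded_borel w" unfolding w_def[abs_def] by (rule lbb_weight)
      \<comment> \<open>the clock advances at least at unit speed, so at time \<open>t\<close> the cutoff is over and the weight has total mass \<open>-1\<close>\<close>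
      have "path_integral c t \<alpha> \<ge> real k + 1 / real (Suc j)"
        using clock_integral_diff[OF rho(1) less_imp_le[OF rho(3)], of \<alpha>] j rho(2) by simp
      then have V0: "cutoff k j (path_integral c t \<alpha>) = 0" by (rule cutoff_eq0)
      then have w1: "(LINT u:{0..t}|lborel. w u) = - 1"
        using cutoff_diff[OF order_refl t, of k j \<alpha>] cutoff_start[of k j \<alpha>] by (simp add: w_def)
      have "damped c F \<kappa> k j t \<alpha> - m \<rho> = - (LINT u:{0..t}|lborel. w u * m u) + (LINT u:{0..t}|lborel. w u * m \<rho>)"
        using w1 by (simp add: damped_def V0 w_def m_def)
      also have "\<dots> = - (LINT u:{0..t}|lborel. w u * (m u - m \<rho>))"
        unfolding right_diff_distrib
        by (subst set_integral_diff) (auto intro!: lbb_integrable lbb_mult lw lm lbb_const)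
      finally have eq: "dist (damped c F \<kappa> k j t \<alpha>) (m \<rho>) = \<bar>LINT u:{0..t}|lborel. w u * (m u - m \<rho>)\<bar>"
        by (simp add: dist_real_def)
      have "\<bar>LINT u:{0..t}|lborel. w u * (m u - m \<rho>)\<bar> \<le> e/2"
        unfolding w_def
      proof (rule weighted_integral_bound[OF order_refl t])
        fix u assume u: "0 \<le> u" "weight c k j u \<alpha> \<noteq> 0"
        have "real k < path_integral c u \<alpha>"
          using u(2) cutoff_eq1(2)[of "path_integral c u \<alpha>" k j] by (force simp: weight_def)
        then have "\<rho> < u" using clock_integral_mono[of u \<rho> \<alpha>] u rho by force
        moreover have "path_integral c u \<alpha> < real k + 1 / real (Suc j)"
          using u(2) cutoff_eq0(2)[of k j "path_integral c u \<alpha>"] by (force simp: weight_def)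
        then have "u - \<rho> < 1 / real (Suc j)"
          using clock_integral_diff[of \<rho> u \<alpha>] rho \<open>\<rho> < u\<close> by simp
        ultimately show "\<bar>m u - m \<rho>\<bar> \<le> e/2" using d(2)[of u] j by (simp add: dist_real_def)
      qed (use e in \<open>auto intro!: lbb_diff lm lbb_const\<close>)
      then show "dist (damped c F \<kappa> k j t \<alpha>) (m \<rho>) < e" using eq e by simp
    qed
  qed
  then show ?thesis using rho by (simp add: m_def \<rho>_def[symmetric] min_absorb2)
qed

text \<open>The localizing sequence consists of the times at which the clock shows \<open>k\<close>. They depend on the
  clock alone, hence are the same for all measures.\<close>

theorem local_martingale_of_damped:
  assumes P: "path_prob P"
    and eq: "\<And>k j s t A. 0 \<le> s \<Longrightarrow> s \<le> t \<Longrightarrow> A \<in> sets (path_filtration (ennreal s)) \<Longrightarrow>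
      (\<integral>\<alpha>. indicator A \<alpha> * damped c F \<kappa> k j t \<alpha> \<partial>P) = (\<integral>\<alpha>. indicator A \<alpha> * damped c F \<kappa> k j s \<alpha> \<partial>P)"
  shows "local_martingale P path_filtration (\<lambda>t \<alpha>. compensated F \<kappa> t \<alpha> - F (coord 0 \<alpha>))"
proof -
  interpret prob_space P using P by (simp add: path_prob_def)
  define M where "M t \<alpha> = compensated F \<kappa> t \<alpha> - F (coord 0 \<alpha>)" for t \<alpha>
  have F0: "(\<lambda>\<alpha>. F (coord 0 \<alpha>)) \<in> borel_measurable (path_filtration (ennreal u))" if "0 \<le> u" for u
    using that by (intro measurable_compose[OF measurable_coord] borel_measurable_continuous_onI F_continuous) auto
  have M_adapted: "M t \<in> borel_measurable (path_filtration (ennreal t))" if "0 \<le> t" for t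
    unfolding M_def[abs_def]
    by (intro borel_measurable_diff progressive_adapted[OF progressive_compensated that] F0 that)
  have M_cadlag: "cadlag (\<lambda>t. M t \<alpha>)" for \<alpha>
  proof -
    have "rcll (\<lambda>t. M t \<alpha>)" unfolding M_def
      by (intro rcll_diff rcll_compensated rcll_continuous continuous_on_const)
    then show ?thesis by (auto simp: cadlag_def rcll_def)
  qed
  define \<tau> where "\<tau> k \<alpha> = ennreal (clock_time k \<alpha>)" for k \<alpha>
  have stopM: "stopped M (\<tau> k) t \<alpha> = compensated F \<kappa> (min t (clock_time k \<alpha>)) \<alpha> - F (coord 0 \<alpha>)"
    if "0 \<le> t" for k t \<alpha>
    using that clock_time(1) by (simp add: stopped_def stopped_time \<tau>_def M_def)
  have "stopping_time path_filtration (\<tau> k)" for k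
    unfolding stopping_time_def
  proof
    fix t :: ennreal
    show "Measurable.pred (path_filtration t) (\<lambda>\<alpha>. \<tau> k \<alpha> \<le> t)"
    proof (cases t)
      case (real r)
      have "(\<lambda>\<alpha>. \<tau> k \<alpha> \<le> t) = (\<lambda>\<alpha>. real k \<le> path_integral c r \<alpha>)"
        using real clock_time_le_iff[of r k] by (auto simp: \<tau>_def ennreal_le_iff)
      moreover have [measurable]: "path_integral c r \<in> borel_measurable (path_filtration t)"
        using path_integral_adapted[OF clock_borel] real by simp
      ultimately show ?thesis by simp
    qed simp
  qed
  moreover have "incseq (\<lambda>k. \<tau> k \<alpha>)" for \<alpha>
    unfolding incseq_def \<tau>_def using clock_time clock_time_le_iff by (auto intro!: ennreal_leI)
  moreover have "(\<lambda>k. \<tau> k \<alpha>) \<longlonglongrightarrow> \<infinity>" for \<alpha>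
  proof -
    have "LIM k sequentially. clock_time k \<alpha> :> at_top"
      unfolding filterlim_at_top_gt[of _ _ 0]
    proof (intro allI impI)
      fix T :: real assume "T > 0"
      obtain k0 where k0: "path_integral c T \<alpha> < real k0" using reals_Archimedean2 by blast
      have "T \<le> clock_time k \<alpha>" if "k0 \<le> k" for k
        using clock_time_le_iff[of T k \<alpha>] \<open>T > 0\<close> k0 that by force
      then show "\<forall>\<^sub>F k in sequentially. T \<le> clock_time k \<alpha>" unfolding eventually_sequentially by blast
    qed
    then show ?thesis by (simp add: \<tau>_def ennreal_tendsto_top_eq_at_top)
  qed
  moreover have "martingale P path_filtration (stopped M (\<tau> k))" for k
  proof -
    define m where "m t \<alpha> = compensated F \<kappa> (min t (clock_time k \<alpha>)) \<alpha>" for t \<alpha>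
    have m_lim: "(\<lambda>j. damped c F \<kappa> k j t \<alpha>) \<longlonglongrightarrow> m t \<alpha>" if "0 \<le> t" for t \<alpha>
      unfolding m_def by (rule damped_tendsto_stopped[OF that])
    have m_meas: "m t \<in> borel_measurable (path_filtration (ennreal t))" if "0 \<le> t" for t
      by (rule borel_measurable_LIMSEQ_real[OF m_lim[OF that] damped_adapted[OF that]])
    have eqM: "stopped M (\<tau> k) t = (\<lambda>\<alpha>. m t \<alpha> - F (coord 0 \<alpha>))" if "0 \<le> t" for t
      using stopM[OF that] by (auto simp: m_def)
    have m_bound: "\<bar>m t \<alpha>\<bar> \<le> B + real k" if "0 \<le> t" for t \<alpha>
      unfolding m_def using clock_time[of k \<alpha>] that
      by (intro compensated_bound[of _ "clock_time k \<alpha>"]) auto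
    show ?thesis
    proof (rule martingaleI_bounded[OF P])
    fix t :: real assume t: "0 \<le> t"
    show "stopped M (\<tau> k) t \<in> borel_measurable (path_filtration (ennreal t))"
      unfolding eqM[OF t] by (intro borel_measurable_diff m_meas F0 t)
    show "\<bar>stopped M (\<tau> k) t \<alpha>\<bar> \<le> (B + real k) + B" for \<alpha>
      unfolding eqM[OF t] by (rule order_trans[OF abs_triangle_ineq4 add_mono[OF m_bound[OF t] F_bound]])
    next
    fix s t :: real and A :: "'b cadlag_path set"
    assume s: "0 \<le> s" "s \<le> t" and A: "A \<in> sets (path_filtration (ennreal s))"
    then have t: "0 \<le> t" by simp
    have AP: "indicat_real A \<in> borel_measurable P"
      by (rule path_prob_measurable[OF P borel_measurable_indicator[OF A]])
    have conv: "(\<lambda>j. \<integral>\<alpha>. indicator A \<alpha> * damped c F \<kappa> k j u \<alpha> \<partial>P) \<longlonglongrightarrow> (\<integral>\<alpha>. indicator A \<alpha> * m u \<alpha> \<partial>P)" if u: "0 \<le> u" for u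
    proof (rule integral_dominated_convergence[where w="\<lambda>_. 2 * (B + real k + 1)"])
      show "(\<lambda>\<alpha>. indicator A \<alpha> * m u \<alpha>) \<in> borel_measurable P"
        using AP path_prob_measurable[OF P m_meas[OF u]] by (rule borel_measurable_times)
      show "(\<lambda>\<alpha>. indicator A \<alpha> * damped c F \<kappa> k j u \<alpha>) \<in> borel_measurable P" for j
        using AP path_prob_measurable[OF P damped_adapted[OF u]] by (rule borel_measurable_times)
      show "AE \<alpha> in P. (\<lambda>j. indicat_real A \<alpha> * damped c F \<kappa> k j u \<alpha>) \<longlonglongrightarrow> indicat_real A \<alpha> * m u \<alpha>"
        using m_lim[OF u] by (intro AE_I2 tendsto_mult_left)
      show "AE \<alpha> in P. norm (indicat_real A \<alpha> * damped c F \<kappa> k j u \<alpha>) \<le> 2 * (B + real k + 1)" for j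
        using damped_bound[OF u] B_nonneg by (auto simp: abs_mult indicator_def)
    qed simp
    have "(\<integral>\<alpha>. indicator A \<alpha> * m t \<alpha> \<partial>P) = (\<integral>\<alpha>. indicator A \<alpha> * m s \<alpha> \<partial>P)"
      using LIMSEQ_unique[OF conv[OF t]] conv[OF s(1)] eq[OF s A] by simp
    moreover have "(\<integral>\<alpha>. indicator A \<alpha> * stopped M (\<tau> k) u \<alpha> \<partial>P)
       = (\<integral>\<alpha>. indicator A \<alpha> * m u \<alpha> \<partial>P) - (\<integral>\<alpha>. indicator A \<alpha> * F (coord 0 \<alpha>) \<partial>P)" if u: "0 \<le> u" for u
    proof -
      have "integrable P (\<lambda>\<alpha>. indicator A \<alpha> * m u \<alpha>)"
        by (rule integrable_bounded_path[OF P borel_measurable_times[OF AP path_prob_measurable[OF P m_meas[OF u]]], of "B + real k"])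
           (use m_bound[OF u] B_nonneg in \<open>auto simp: indicator_def\<close>)
      moreover have "integrable P (\<lambda>\<alpha>. indicator A \<alpha> * F (coord 0 \<alpha>))"
        by (rule integrable_bounded_path[OF P borel_measurable_times[OF AP path_prob_measurable[OF P F0[OF u]]], of B])
           (use F_bound B_nonneg in \<open>auto simp: indicator_def\<close>)
      ultimately show ?thesis unfolding eqM[OF u] by (simp add: right_diff_distrib)
    qed
    ultimately show "(\<integral>\<alpha>. indicator A \<alpha> * stopped M (\<tau> k) t \<alpha> \<partial>P) = (\<integral>\<alpha>. indicator A \<alpha> * stopped M (\<tau> k) s \<alpha> \<partial>P)"
      using t s by simp
    qed
  qed
  ultimately show ?thesis
    unfolding local_martingale_def M_def[symmetric]
    using M_adapted M_cadlag by (intro conjI exI[of _ \<tau>]) auto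
qed

end

section \<open>Pairs of functions with a local martingale\<close>

definition admissible_pair :: "('b::real_normed_vector \<Rightarrow> real) \<Rightarrow> ('b \<Rightarrow> real) \<Rightarrow> bool" where
  "admissible_pair F \<kappa> \<longleftrightarrow> continuous_on UNIV F \<and> bounded (range F) \<and>
     \<kappa> \<in> borel_measurable borel \<and> locally_bounded \<kappa>"

definition compensates ::
    "'b::real_normed_vector cadlag_path measure \<Rightarrow> ('b \<Rightarrow> real) \<Rightarrow> ('b \<Rightarrow> real) \<Rightarrow> bool" where
  "compensates P F \<kappa> \<longleftrightarrow>
     local_martingale P path_filtration (\<lambda>t \<alpha>. compensated F \<kappa> t \<alpha> - F (coord 0 \<alpha>))"

text \<open>Every locally bounded function lies below a clock: bounds on the balls of integer radius
  are interpolated by a locally finite sum of ramps in the norm.\<close>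

lemma exists_clock:
  fixes c0 :: "'b::real_normed_vector \<Rightarrow> real"
  assumes "locally_bounded c0"
  obtains c where "continuous_on UNIV c" "locally_bounded c" "\<And>x. 1 \<le> c x" "\<And>x. \<bar>c0 x\<bar> \<le> c x"
proof -
  obtain A where A: "\<And>m::nat. \<And>x. norm x \<le> real m + 1 \<Longrightarrow> \<bar>c0 x\<bar> \<le> A m"
  proof -
    have "\<forall>m::nat. \<exists>B. \<forall>x. norm x \<le> real m + 1 \<longrightarrow> \<bar>c0 x\<bar> \<le> B"
      using assms unfolding locally_bounded_def by blast
    from choice[OF this] that show thesis by blast
  qed
  have A0: "0 \<le> A m" for m using A[of 0 m] by (simp add: order_trans[OF abs_ge_zero])
  define ramp where "ramp m x = A m * max 0 (min 1 (norm x - real m + 1))" for m :: nat and x :: 'b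
  have ramp0: "0 \<le> ramp m x" for m x using A0 by (simp add: ramp_def)
  have ramp_le: "ramp m x \<le> A m" for m x
    unfolding ramp_def using A0[of m] by (intro mult_left_le) auto
  define c where "c x = 1 + (\<Sum>m\<le>nat \<lceil>norm x\<rceil> + 1. ramp m x)" for x
  have c_eq: "c x = 1 + (\<Sum>m\<le>n. ramp m x)" if "norm x + 1 \<le> real n" for n x
  proof -
    have z: "ramp m x = 0" if "real m \<ge> norm x + 1" for m using that by (simp add: ramp_def)
    have "\<lceil>norm x\<rceil> \<le> int n - 1" unfolding ceiling_le_iff using that by simp
    then have le: "nat \<lceil>norm x\<rceil> + 1 \<le> n" using norm_ge_zero[of x] by linarith
    have "(\<Sum>m\<le>nat \<lceil>norm x\<rceil> + 1. ramp m x) = (\<Sum>m\<le>n. ramp m x)"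
    proof (rule sum.mono_neutral_left)
      show "\<forall>m\<in>{..n} - {..nat \<lceil>norm x\<rceil> + 1}. ramp m x = 0"
      proof
        fix m assume "m \<in> {..n} - {..nat \<lceil>norm x\<rceil> + 1}"
        then have "m \<ge> nat \<lceil>norm x\<rceil> + 1" by simp
        then have "real m \<ge> norm x + 1" by linarith
        then show "ramp m x = 0" by (rule z)
      qed
    qed (use le in auto)
    then show ?thesis by (simp add: c_def)
  qed
  have "isCont c x" for x
  proof -
    obtain n :: nat where n: "norm x + 2 < real n" using reals_Archimedean2 by blast
    have "\<forall>\<^sub>F y in nhds x. y \<in> ball x 1" by (intro eventually_nhds_in_open) auto
    then have "\<forall>\<^sub>F y in nhds x. c y = 1 + (\<Sum>m\<le>n. ramp m y)"
    proof eventually_elim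
      fix y assume "y \<in> ball x 1"
      then have "norm (y - x) < 1" by (simp add: dist_norm norm_minus_commute)
      then have "norm y < norm x + 1" using norm_triangle_sub[of y x] by linarith
      then show "c y = 1 + (\<Sum>m\<le>n. ramp m y)" using n by (intro c_eq) linarith
    qed
    then have "isCont c x \<longleftrightarrow> isCont (\<lambda>y. 1 + (\<Sum>m\<le>n. ramp m y)) x" by (rule isCont_cong)
    moreover have "isCont (\<lambda>y. 1 + (\<Sum>m\<le>n. ramp m y)) x"
      unfolding ramp_def by (intro continuous_intros)
    ultimately show ?thesis by simp
  qed
  then have "continuous_on UNIV c" by (simp add: continuous_at_imp_continuous_on)
  moreover have "locally_bounded c"
    unfolding locally_bounded_def
  proof
    fix R :: real
    obtain n :: nat where n: "R + 1 < real n" using reals_Archimedean2 by blast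
    have "\<bar>c x\<bar> \<le> 1 + (\<Sum>m\<le>n. A m)" if "norm x \<le> R" for x
    proof -
      have "c x = 1 + (\<Sum>m\<le>n. ramp m x)" using that n by (intro c_eq) linarith
      moreover have "0 \<le> (\<Sum>m\<le>n. ramp m x)" by (intro sum_nonneg ramp0)
      moreover have "(\<Sum>m\<le>n. ramp m x) \<le> (\<Sum>m\<le>n. A m)" by (intro sum_mono ramp_le)
      ultimately show ?thesis by linarith
    qed
    then show "\<exists>B. \<forall>x. norm x \<le> R \<longrightarrow> \<bar>c x\<bar> \<le> B" by blast
  qed
  moreover have "1 \<le> c x" for x unfolding c_def by (simp add: sum_nonneg ramp0)
  moreover have "\<bar>c0 x\<bar> \<le> c x" for x
  proof -
    define m where "m = nat \<lfloor>norm x\<rfloor>"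
    have m: "real m \<le> norm x" "norm x \<le> real m + 1" by (simp_all add: m_def)
    have "\<bar>c0 x\<bar> \<le> A m" using A m by blast
    also have "\<dots> = ramp m x" using m by (simp add: ramp_def)
    also have "\<dots> \<le> (\<Sum>m\<le>nat \<lceil>norm x\<rceil> + 1. ramp m x)"
    proof (rule member_le_sum)
      show "m \<in> {..nat \<lceil>norm x\<rceil> + 1}" unfolding m_def by simp linarith
    qed (auto simp: ramp0)
    finally show ?thesis by (simp add: c_def)
  qed
  ultimately show ?thesis by (rule that)
qed

lemma locally_bounded_add:
  assumes "locally_bounded f" "locally_bounded g" shows "locally_bounded (\<lambda>x. \<bar>f x\<bar> + \<bar>g x\<bar>)"
  unfolding locally_bounded_def
proof
  fix R
  obtain B C where "\<And>x. norm x \<le> R \<Longrightarrow> \<bar>f x\<bar> \<le> B" "\<And>x. norm x \<le> R \<Longrightarrow> \<bar>g x\<bar> \<le> C"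
    using assms unfolding locally_bounded_def by meson
  then have "\<forall>x. norm x \<le> R \<longrightarrow> \<bar>\<bar>f x\<bar> + \<bar>g x\<bar>\<bar> \<le> B + C" by (auto intro: add_mono)
  then show "\<exists>B. \<forall>x. norm x \<le> R \<longrightarrow> \<bar>\<bar>f x\<bar> + \<bar>g x\<bar>\<bar> \<le> B" by blast
qed

lemma locally_bounded_cmult:
  assumes "locally_bounded f" shows "locally_bounded (\<lambda>x. a * f x)"
  unfolding locally_bounded_def
proof
  fix R
  obtain B where B: "\<And>x. norm x \<le> R \<Longrightarrow> \<bar>f x\<bar> \<le> B" using assms unfolding locally_bounded_def by meson
  then have "\<forall>x. norm x \<le> R \<longrightarrow> \<bar>a * f x\<bar> \<le> \<bar>a\<bar> * B" by (auto simp: abs_mult intro: mult_left_mono)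
  then show "\<exists>B. \<forall>x. norm x \<le> R \<longrightarrow> \<bar>a * f x\<bar> \<le> B" by blast
qed

lemma clockedI:
  assumes "continuous_on UNIV c" "locally_bounded c" "\<And>x. 1 \<le> c x"
    and "continuous_on UNIV F" "\<And>x. \<bar>F x\<bar> \<le> B" "\<kappa> \<in> borel_measurable borel" "\<And>x. \<bar>\<kappa> x\<bar> \<le> c x"
  shows "clocked c F \<kappa> B"
  using assms by unfold_locales

lemma admissible_pair_bound: "admissible_pair F \<kappa> \<Longrightarrow> \<exists>B. \<forall>x. \<bar>F x\<bar> \<le> B"
  unfolding admissible_pair_def bounded_real by auto

text \<open>For a common clock the damped process is linear in the pair. Directly from the definition,
  two localizing sequences would have to be combined, which takes optional stopping.\<close>

theorem compensates_linear:
  assumes P: "path_prob P" and a1: "admissible_pair F1 \<kappa>1" and a2: "admissible_pair F2 \<kappa>2"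
    and c1: "compensates P F1 \<kappa>1" and c2: "compensates P F2 \<kappa>2"
  shows "compensates P (\<lambda>x. a * F1 x + b * F2 x) (\<lambda>x. a * \<kappa>1 x + b * \<kappa>2 x)"
proof -
  have lb: "locally_bounded \<kappa>1" "locally_bounded \<kappa>2" using a1 a2 by (auto simp: admissible_pair_def)
  obtain c where c: "continuous_on UNIV c" "locally_bounded c" "\<And>x. 1 \<le> c x"
    and cb: "\<And>x. \<bar>\<bar>\<bar>\<kappa>1 x\<bar> + \<bar>\<kappa>2 x\<bar>\<bar> + \<bar>\<bar>a * \<kappa>1 x\<bar> + \<bar>b * \<kappa>2 x\<bar>\<bar>\<bar> \<le> c x"
    using exists_clock[OF locally_bounded_add[OF locally_bounded_add[OF lb]
        locally_bounded_add[OF locally_bounded_cmult[OF lb(1), of a] locally_bounded_cmult[OF lb(2), of b]]]]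
    by metis
  obtain B1 B2 where B: "\<And>x. \<bar>F1 x\<bar> \<le> B1" "\<And>x. \<bar>F2 x\<bar> \<le> B2"
    using admissible_pair_bound[OF a1] admissible_pair_bound[OF a2] by blast
  have k1: "\<bar>\<kappa>1 x\<bar> \<le> c x" and k2: "\<bar>\<kappa>2 x\<bar> \<le> c x" and k3: "\<bar>a * \<kappa>1 x + b * \<kappa>2 x\<bar> \<le> c x" for x
  proof -
    define p q where "p = a * \<kappa>1 x" and "q = b * \<kappa>2 x"
    show "\<bar>\<kappa>1 x\<bar> \<le> c x" "\<bar>\<kappa>2 x\<bar> \<le> c x" "\<bar>a * \<kappa>1 x + b * \<kappa>2 x\<bar> \<le> c x"
      using cb[of x] unfolding p_def[symmetric] q_def[symmetric] by auto
  qed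
  interpret C1: clocked c F1 \<kappa>1 B1
    using a1 c B k1 by (intro clockedI) (auto simp: admissible_pair_def)
  interpret C2: clocked c F2 \<kappa>2 B2
    using a2 c B k2 by (intro clockedI) (auto simp: admissible_pair_def)
  interpret C3: clocked c "\<lambda>x. a * F1 x + b * F2 x" "\<lambda>x. a * \<kappa>1 x + b * \<kappa>2 x" "\<bar>a\<bar> * B1 + \<bar>b\<bar> * B2"
  proof (intro clockedI c k3)
    show "continuous_on UNIV (\<lambda>x. a * F1 x + b * F2 x)"
      by (intro continuous_intros C1.F_continuous C2.F_continuous)
    show "\<bar>a * F1 x + b * F2 x\<bar> \<le> \<bar>a\<bar> * B1 + \<bar>b\<bar> * B2" for x
      by (rule order_trans[OF abs_triangle_ineq])
         (auto simp: abs_mult intro!: add_mono mult_left_mono B)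
    show "(\<lambda>x. a * \<kappa>1 x + b * \<kappa>2 x) \<in> borel_measurable borel"
      using C1.compensator_borel C2.compensator_borel by measurable
  qed
  have comp: "compensated (\<lambda>x. a * F1 x + b * F2 x) (\<lambda>x. a * \<kappa>1 x + b * \<kappa>2 x) t \<alpha>
     = a * compensated F1 \<kappa>1 t \<alpha> + b * compensated F2 \<kappa>2 t \<alpha>" for t \<alpha>
  proof -
    have "path_integral (\<lambda>x. a * \<kappa>1 x + b * \<kappa>2 x) t \<alpha> = a * path_integral \<kappa>1 t \<alpha> + b * path_integral \<kappa>2 t \<alpha>"
      unfolding path_integral_def
      by (subst set_integral_add)
         (auto intro!: lbb_integrable[OF lbb_mult[OF lbb_const C1.lbb_compensator]]
           lbb_integrable[OF lbb_mult[OF lbb_const C2.lbb_compensator]])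
    then show ?thesis by (simp add: compensated_def algebra_simps)
  qed
  have damp: "damped c (\<lambda>x. a * F1 x + b * F2 x) (\<lambda>x. a * \<kappa>1 x + b * \<kappa>2 x) k j t \<alpha>
     = a * damped c F1 \<kappa>1 k j t \<alpha> + b * damped c F2 \<kappa>2 k j t \<alpha>" for k j t \<alpha>
  proof -
    have "(LINT u:{0..t}|lborel. weight c k j u \<alpha> * (a * compensated F1 \<kappa>1 u \<alpha> + b * compensated F2 \<kappa>2 u \<alpha>))
      = (LINT u:{0..t}|lborel. a * (weight c k j u \<alpha> * compensated F1 \<kappa>1 u \<alpha>) + b * (weight c k j u \<alpha> * compensated F2 \<kappa>2 u \<alpha>))"
      by (simp add: algebra_simps)
    also have "\<dots> = a * (LINT u:{0..t}|lborel. weight c k j u \<alpha> * compensated F1 \<kappa>1 u \<alpha>)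
        + b * (LINT u:{0..t}|lborel. weight c k j u \<alpha> * compensated F2 \<kappa>2 u \<alpha>)"
      by (subst set_integral_add)
         (auto intro!: lbb_integrable[OF lbb_mult[OF lbb_const lbb_mult[OF C1.lbb_weight C1.lbb_compensated]]]
           lbb_integrable[OF lbb_mult[OF lbb_const lbb_mult[OF C1.lbb_weight C2.lbb_compensated]]])
    finally show ?thesis by (simp add: damped_def comp algebra_simps)
  qed
  show ?thesis unfolding compensates_def
  proof (rule C3.local_martingale_of_damped[OF P])
    fix k j s t and A :: "'a cadlag_path set"
    assume st: "0 \<le> s" "s \<le> t" and A: "A \<in> sets (path_filtration (ennreal s))"
    have ind: "indicat_real A \<in> borel_measurable (path_filtration (ennreal s))" using A by simp
    have split: "(\<integral>\<alpha>. indicator A \<alpha> * damped c (\<lambda>x. a * F1 x + b * F2 x) (\<lambda>x. a * \<kappa>1 x + b * \<kappa>2 x) k j u \<alpha> \<partial>P)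
      = a * (\<integral>\<alpha>. indicator A \<alpha> * damped c F1 \<kappa>1 k j u \<alpha> \<partial>P) + b * (\<integral>\<alpha>. indicator A \<alpha> * damped c F2 \<kappa>2 k j u \<alpha> \<partial>P)"
      if u: "0 \<le> u" for u
    proof -
      have "(\<integral>\<alpha>. indicator A \<alpha> * damped c (\<lambda>x. a * F1 x + b * F2 x) (\<lambda>x. a * \<kappa>1 x + b * \<kappa>2 x) k j u \<alpha> \<partial>P)
        = (\<integral>\<alpha>. a * (indicator A \<alpha> * damped c F1 \<kappa>1 k j u \<alpha>) + b * (indicator A \<alpha> * damped c F2 \<kappa>2 k j u \<alpha>) \<partial>P)"
        unfolding damp by (intro Bochner_Integration.integral_cong refl) (simp add: algebra_simps)
      also have "\<dots> = (\<integral>\<alpha>. a * (indicator A \<alpha> * damped c F1 \<kappa>1 k j u \<alpha>) \<partial>P) + (\<integral>\<alpha>. b * (indicator A \<alpha> * damped c F2 \<kappa>2 k j u \<alpha>) \<partial>P)"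
        by (intro Bochner_Integration.integral_add integrable_mult_right C1.integrable_damped[OF P A u] C2.integrable_damped[OF P A u])
      finally show ?thesis by simp
    qed
    have d1: "(\<integral>\<alpha>. indicator A \<alpha> * damped c F1 \<kappa>1 k j t \<alpha> \<partial>P) = (\<integral>\<alpha>. indicator A \<alpha> * damped c F1 \<kappa>1 k j s \<alpha> \<partial>P)"
      by (rule C1.damped_martingale[OF P c1[unfolded compensates_def] st ind, of 1]) (simp add: indicator_def)
    have d2: "(\<integral>\<alpha>. indicator A \<alpha> * damped c F2 \<kappa>2 k j t \<alpha> \<partial>P) = (\<integral>\<alpha>. indicator A \<alpha> * damped c F2 \<kappa>2 k j s \<alpha> \<partial>P)"
      by (rule C2.damped_martingale[OF P c2[unfolded compensates_def] st ind, of 1]) (simp add: indicator_def)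
    show "(\<integral>\<alpha>. indicator A \<alpha> * damped c (\<lambda>x. a * F1 x + b * F2 x) (\<lambda>x. a * \<kappa>1 x + b * \<kappa>2 x) k j t \<alpha> \<partial>P)
      = (\<integral>\<alpha>. indicator A \<alpha> * damped c (\<lambda>x. a * F1 x + b * F2 x) (\<lambda>x. a * \<kappa>1 x + b * \<kappa>2 x) k j s \<alpha> \<partial>P)"
      using split[of t] split[of s] d1 d2 st by simp
  qed
qed

lemma set_integral_dominated_convergence:
  fixes y :: "nat \<Rightarrow> real \<Rightarrow> real"
  assumes "\<And>n. locally_bounded_borel (y n)" "locally_bounded_borel z" "locally_bounded_borel w" "0 \<le> a"
    and "AE u in lborel. u \<in> {a..b} \<longrightarrow> (\<lambda>n. y n u) \<longlonglongrightarrow> z u"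
    and "\<And>n u. a \<le> u \<Longrightarrow> u \<le> b \<Longrightarrow> \<bar>y n u\<bar> \<le> w u"
  shows "(\<lambda>n. LINT u:{a..b}|lborel. y n u) \<longlonglongrightarrow> (LINT u:{a..b}|lborel. z u)"
  unfolding set_lebesgue_integral_def
proof (rule integral_dominated_convergence[where w="\<lambda>u. indicator {a..b} u *\<^sub>R w u"])
  show "integrable lborel (\<lambda>u. indicator {a..b} u *\<^sub>R w u)"
    using lbb_integrable[OF assms(3,4)] by (simp add: set_integrable_def)
  show "AE u in lborel. (\<lambda>n. indicator {a..b} u *\<^sub>R y n u) \<longlonglongrightarrow> indicator {a..b} u *\<^sub>R z u"
    using assms(5) by eventually_elim (auto simp: indicator_def)
  show "AE u in lborel. norm (indicator {a..b} u *\<^sub>R y n u) \<le> indicator {a..b} u *\<^sub>R w u" for n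
    using assms(6) by (intro AE_I2) (auto simp: indicator_def)
next
  have [measurable]: "y n \<in> borel_measurable borel" "z \<in> borel_measurable borel" for n
    using assms by (auto simp: locally_bounded_borel_def)
  show "(\<lambda>u. indicator {a..b} u *\<^sub>R y n u) \<in> borel_measurable lborel" for n by measurable
  show "(\<lambda>u. indicator {a..b} u *\<^sub>R z u) \<in> borel_measurable lborel" by measurable
qed

text \<open>For a common clock the damped processes converge boundedly.\<close>

theorem compensates_bounded_limit:
  fixes F :: "'b::real_normed_vector \<Rightarrow> real"
  assumes P: "path_prob P"
    and adm: "\<And>l::nat. admissible_pair (Fs l) (\<kappa>s l)" and comp: "\<And>l. compensates P (Fs l) (\<kappa>s l)"
    and F: "continuous_on UNIV F" "\<And>x. (\<lambda>l. Fs l x) \<longlonglongrightarrow> F x" "\<And>l x. \<bar>Fs l x\<bar> \<le> B"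
    and k: "\<And>x. (\<lambda>l. \<kappa>s l x) \<longlonglongrightarrow> \<kappa> x" "locally_bounded c0" "\<And>l x. \<bar>\<kappa>s l x\<bar> \<le> c0 x"
  shows "compensates P F \<kappa>" "admissible_pair F \<kappa>"
proof -
  obtain c where c: "continuous_on UNIV c" "locally_bounded c" "\<And>x. 1 \<le> c x" "\<And>x. \<bar>c0 x\<bar> \<le> c x"
    using exists_clock[OF k(2)] by metis
  have kb: "\<bar>\<kappa>s l x\<bar> \<le> c x" for l x using k(3)[of l x] c(4)[of x] by linarith
  have kb': "\<bar>\<kappa> x\<bar> \<le> c x" for x
    using tendsto_rabs[OF k(1)] by (rule tendsto_upperbound) (use kb in auto)
  have Fb: "\<bar>F x\<bar> \<le> B" for x
    using tendsto_rabs[OF F(2)] by (rule tendsto_upperbound) (use F(3) in auto)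
  have kborel: "\<kappa> \<in> borel_measurable borel"
    by (rule borel_measurable_LIMSEQ_real[OF k(1)]) (use adm in \<open>auto simp: admissible_pair_def\<close>)
  have Cl: "clocked c (Fs l) (\<kappa>s l) B" for l
    using adm[of l] by (intro clockedI c kb F(3)) (auto simp: admissible_pair_def)
  interpret C: clocked c F \<kappa> B by (intro clockedI c kb' Fb kborel F(1))
  show "admissible_pair F \<kappa>"
    unfolding admissible_pair_def bounded_real
    using F(1) kborel C.compensator_locally_bounded Fb by auto
  have comp_lim: "(\<lambda>l. compensated (Fs l) (\<kappa>s l) t \<alpha>) \<longlonglongrightarrow> compensated F \<kappa> t \<alpha>" for t \<alpha>
    unfolding compensated_def path_integral_def
    by (intro tendsto_diff F(2) set_integral_dominated_convergence[where w="\<lambda>u. c (coord u \<alpha>)"]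
        clocked.lbb_compensator[OF Cl] C.lbb_compensator C.lbb_clock AE_I2 impI k(1) kb order_refl)
  have damp_lim: "(\<lambda>l. damped c (Fs l) (\<kappa>s l) i j t \<alpha>) \<longlonglongrightarrow> damped c F \<kappa> i j t \<alpha>" if t: "0 \<le> t" for i j t \<alpha>
    unfolding damped_def
  proof (intro tendsto_diff tendsto_mult_left comp_lim
      set_integral_dominated_convergence[where w="\<lambda>u. (B + real i + 1) * \<bar>weight c i j u \<alpha>\<bar>"] AE_I2 impI)
    show "locally_bounded_borel (\<lambda>u. weight c i j u \<alpha> * compensated (Fs l) (\<kappa>s l) u \<alpha>)" for l
      by (intro lbb_mult C.lbb_weight clocked.lbb_compensated[OF Cl])
    show "locally_bounded_borel (\<lambda>u. weight c i j u \<alpha> * compensated F \<kappa> u \<alpha>)"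
      by (intro lbb_mult C.lbb_weight C.lbb_compensated)
    show "locally_bounded_borel (\<lambda>u. (B + real i + 1) * \<bar>weight c i j u \<alpha>\<bar>)"
      by (intro lbb_mult lbb_const lbb_abs C.lbb_weight)
    fix l u assume u: "0 \<le> u" "u \<le> t"
    show "\<bar>weight c i j u \<alpha> * compensated (Fs l) (\<kappa>s l) u \<alpha>\<bar> \<le> (B + real i + 1) * \<bar>weight c i j u \<alpha>\<bar>"
    proof (cases "weight c i j u \<alpha> = 0")
      case False
      have "\<bar>compensated (Fs l) (\<kappa>s l) u \<alpha>\<bar> \<le> B + (real i + 1)"
        by (rule clocked.compensated_bound[OF Cl u(1) order_refl C.weight_nonzeroD[OF False]])
      then show ?thesis by (simp add: abs_mult mult.commute[of "\<bar>weight c i j u \<alpha>\<bar>"] mult_right_mono)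
    qed simp
  qed simp
  show "compensates P F \<kappa>" unfolding compensates_def
  proof (rule C.local_martingale_of_damped[OF P])
    fix i j s t and A :: "'b cadlag_path set"
    assume st: "0 \<le> s" "s \<le> t" and A: "A \<in> sets (path_filtration (ennreal s))"
    have ind: "indicat_real A \<in> borel_measurable (path_filtration (ennreal s))" using A by simp
    have lim: "(\<lambda>l. \<integral>\<alpha>. indicator A \<alpha> * damped c (Fs l) (\<kappa>s l) i j u \<alpha> \<partial>P) \<longlonglongrightarrow> (\<integral>\<alpha>. indicator A \<alpha> * damped c F \<kappa> i j u \<alpha> \<partial>P)"
      if u: "0 \<le> u" for u
    proof (rule integral_dominated_convergence[where w="\<lambda>_. 2 * (B + real i + 1)"])
      interpret prob_space P using P by (simp add: path_prob_def)
      show "integrable P (\<lambda>_. 2 * (B + real i + 1))" by simp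
      show "(\<lambda>\<alpha>. indicator A \<alpha> * damped c F \<kappa> i j u \<alpha>) \<in> borel_measurable P"
        by (intro borel_measurable_times path_prob_measurable[OF P ind] path_prob_measurable[OF P C.damped_adapted[OF u]])
      show "(\<lambda>\<alpha>. indicator A \<alpha> * damped c (Fs l) (\<kappa>s l) i j u \<alpha>) \<in> borel_measurable P" for l
        by (intro borel_measurable_times path_prob_measurable[OF P ind] path_prob_measurable[OF P clocked.damped_adapted[OF Cl u]])
      show "AE \<alpha> in P. (\<lambda>l. indicat_real A \<alpha> * damped c (Fs l) (\<kappa>s l) i j u \<alpha>) \<longlonglongrightarrow> indicat_real A \<alpha> * damped c F \<kappa> i j u \<alpha>"
        by (intro AE_I2 tendsto_mult_left damp_lim u)
      show "AE \<alpha> in P. norm (indicat_real A \<alpha> * damped c (Fs l) (\<kappa>s l) i j u \<alpha>) \<le> 2 * (B + real i + 1)" for l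
        using clocked.damped_bound[OF Cl u, of l i j] C.B_nonneg by (auto simp: indicator_def)
    qed
    have "(\<integral>\<alpha>. indicator A \<alpha> * damped c (Fs l) (\<kappa>s l) i j t \<alpha> \<partial>P) = (\<integral>\<alpha>. indicator A \<alpha> * damped c (Fs l) (\<kappa>s l) i j s \<alpha> \<partial>P)" for l
      by (rule clocked.damped_martingale[OF Cl P comp[unfolded compensates_def] st ind, of 1]) (simp add: indicator_def)
    then show "(\<integral>\<alpha>. indicator A \<alpha> * damped c F \<kappa> i j t \<alpha> \<partial>P) = (\<integral>\<alpha>. indicator A \<alpha> * damped c F \<kappa> i j s \<alpha> \<partial>P)"
      using LIMSEQ_unique[OF lim[of t]] lim[OF st(1)] st by simp
  qed
qed

section \<open>Functionals that are continuous in the Skorokhod topology\<close>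

lemma continuous_on_path_space:
  fixes H :: "'b::metric_space cadlag_path \<Rightarrow> 'c::topological_space"
  assumes "\<And>\<alpha>n \<alpha>. skorokhod_conv \<alpha>n \<alpha> \<Longrightarrow> (\<lambda>n. H (\<alpha>n n)) \<longlonglongrightarrow> H \<alpha>"
  shows "continuous_on UNIV H"
  unfolding continuous_on_open_vimage[OF open_UNIV]
proof (intro allI impI)
  fix U :: "'c set" assume "open U"
  then show "open (H -` U \<inter> UNIV)"
    unfolding open_cadlag_path_def using assms topological_tendstoD by fastforce
qed

lemma skorokhod_conv_const: "skorokhod_conv (\<lambda>_. \<alpha>) \<alpha>"
  unfolding skorokhod_conv_def
proof (intro exI[of _ "\<lambda>_ s. s"] conjI allI)
  show "(\<lambda>s. s) \<in> time_changes"
    by (auto simp: time_changes_def strict_mono_on_def filterlim_ident)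
qed (auto simp: uniform_limit_iff)

lemma time_change_surj:
  assumes "\<theta> \<in> time_changes" "0 \<le> u" obtains r where "0 \<le> r" "\<theta> r = u" "u = 0 \<Longrightarrow> r = 0"
proof (cases "u = 0")
  case True then show ?thesis using assms that[of 0] by (simp add: time_changes_def)
next
  case False
  have "\<forall>\<^sub>F b in at_top. u \<le> \<theta> b" using assms by (auto simp: time_changes_def filterlim_at_top)
  then obtain b where b: "0 \<le> b" "u \<le> \<theta> b"
    using eventually_happens'[OF _ eventually_conj[OF _ eventually_ge_at_top[of "0::real"]]]
    by (metis trivial_limit_at_top_linorder)
  have "\<exists>r\<ge>0. r \<le> b \<and> \<theta> r = u"
    using assms b by (intro IVT') (auto simp: time_changes_def intro: continuous_on_subset)
  then show ?thesis using that False by blast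
qed

text \<open>The point that the \<open>n\<close>-th time change maps to \<open>u\<close> tends to \<open>u\<close>; for \<open>u = 0\<close> it is \<open>0\<close>.\<close>

lemma skorokhod_conv_pointwise:
  fixes \<alpha> :: "'b::metric_space cadlag_path"
  assumes conv: "skorokhod_conv \<alpha>n \<alpha>" and u: "0 \<le> u" "u = 0 \<or> isCont (\<lambda>u. coord u \<alpha>) u"
  shows "(\<lambda>n. coord u (\<alpha>n n)) \<longlonglongrightarrow> coord u \<alpha>"
proof -
  obtain \<theta> where th: "\<And>n. \<theta> n \<in> time_changes" "uniform_limit {0..} \<theta> (\<lambda>s. s) sequentially"
    "\<And>N::nat. uniform_limit {0..real N} (\<lambda>n s. coord (\<theta> n s) (\<alpha>n n)) (\<lambda>s. coord s \<alpha>) sequentially"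
    using conv unfolding skorokhod_conv_def by blast
  have "\<exists>r. 0 \<le> r \<and> \<theta> n r = u \<and> (u = 0 \<longrightarrow> r = 0)" for n using time_change_surj[OF th(1) u(1)] by metis
  then obtain r where r: "\<And>n. 0 \<le> r n" "\<And>n. \<theta> n (r n) = u" "\<And>n. u = 0 \<longrightarrow> r n = 0" by metis
  have r_lim: "r \<longlonglongrightarrow> u"
  proof (rule tendstoI)
    fix e :: real assume "e > 0"
    have "\<forall>\<^sub>F n in sequentially. \<forall>s\<in>{0..}. dist (\<theta> n s) s < e" using th(2) \<open>e > 0\<close> by (simp add: uniform_limit_iff)
    then show "\<forall>\<^sub>F n in sequentially. dist (r n) u < e"
      by eventually_elim (metis r(1,2) atLeast_iff dist_commute)
  qed
  obtain N :: nat where N: "u + 1 < real N" using reals_Archimedean2 by blast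
  have d0: "(\<lambda>n. dist (coord u (\<alpha>n n)) (coord (r n) \<alpha>)) \<longlonglongrightarrow> 0"
  proof (rule tendstoI)
    fix e :: real assume "e > 0"
    have "\<forall>\<^sub>F n in sequentially. \<forall>s\<in>{0..real N}. dist (coord (\<theta> n s) (\<alpha>n n)) (coord s \<alpha>) < e"
      using th(3)[of N] \<open>e > 0\<close> by (simp add: uniform_limit_iff)
    moreover have "\<forall>\<^sub>F n in sequentially. dist (r n) u < 1" using r_lim by (rule tendstoD) simp
    ultimately show "\<forall>\<^sub>F n in sequentially. dist (dist (coord u (\<alpha>n n)) (coord (r n) \<alpha>)) 0 < e"
    proof eventually_elim
      fix n assume a: "\<forall>s\<in>{0..real N}. dist (coord (\<theta> n s) (\<alpha>n n)) (coord s \<alpha>) < e" and b: "dist (r n) u < 1"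
      have "r n \<in> {0..real N}" using b N r(1)[of n] by (auto simp: dist_real_def)
      from bspec[OF a this] show "dist (dist (coord u (\<alpha>n n)) (coord (r n) \<alpha>)) 0 < e" using r(2) by simp
    qed
  qed
  have c: "(\<lambda>n. coord (r n) \<alpha>) \<longlonglongrightarrow> coord u \<alpha>"
  proof (cases "u = 0")
    case True then show ?thesis using r(3) by simp
  next
    case False
    then show ?thesis using isCont_tendsto_compose[OF _ r_lim, of "\<lambda>u. coord u \<alpha>"] u(2) by simp
  qed
  have "(\<lambda>n. dist (coord u (\<alpha>n n)) (coord (r n) \<alpha>) + dist (coord (r n) \<alpha>) (coord u \<alpha>)) \<longlonglongrightarrow> 0 + 0"
    using c by (intro tendsto_add d0) (simp add: tendsto_dist_iff[symmetric])
  then have s: "(\<lambda>n. dist (coord u (\<alpha>n n)) (coord (r n) \<alpha>) + dist (coord (r n) \<alpha>) (coord u \<alpha>)) \<longlonglongrightarrow> 0"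
    by simp
  have "(\<lambda>n. dist (coord u (\<alpha>n n)) (coord u \<alpha>)) \<longlonglongrightarrow> 0"
  proof (rule tendsto_sandwich[OF _ _ tendsto_const s])
    show "\<forall>\<^sub>F n in sequentially. 0 \<le> dist (coord u (\<alpha>n n)) (coord u \<alpha>)"
      by (rule always_eventually) simp
    show "\<forall>\<^sub>F n in sequentially. dist (coord u (\<alpha>n n)) (coord u \<alpha>)
       \<le> dist (coord u (\<alpha>n n)) (coord (r n) \<alpha>) + dist (coord (r n) \<alpha>) (coord u \<alpha>)"
      by (rule always_eventually) (rule allI, rule dist_triangle)
  qed
  then show ?thesis by (rule tendsto_dist_iff[THEN iffD2])
qed

lemma skorokhod_conv_bounded:
  fixes \<alpha> :: "'b::real_normed_vector cadlag_path"
  assumes conv: "skorokhod_conv \<alpha>n \<alpha>"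
  shows "\<exists>R. \<forall>\<^sub>F n in sequentially. \<forall>u\<in>{0..T}. norm (coord u (\<alpha>n n)) \<le> R"
proof -
  obtain \<theta> where th: "\<And>n. \<theta> n \<in> time_changes" "uniform_limit {0..} \<theta> (\<lambda>s. s) sequentially"
    "\<And>N::nat. uniform_limit {0..real N} (\<lambda>n s. coord (\<theta> n s) (\<alpha>n n)) (\<lambda>s. coord s \<alpha>) sequentially"
    using conv unfolding skorokhod_conv_def by blast
  obtain N :: nat where N: "T + 1 < real N" using reals_Archimedean2 by blast
  obtain R where R: "\<And>u. u \<in> {0..real N} \<Longrightarrow> norm (coord u \<alpha>) \<le> R"
    using rcll_bounded[OF rcll_coord[of \<alpha>], of 0 "real N"] unfolding bounded_iff by blast
  have e1: "\<forall>\<^sub>F n in sequentially. \<forall>s\<in>{0..real N}. dist (coord (\<theta> n s) (\<alpha>n n)) (coord s \<alpha>) < 1"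
    using th(3)[of N] zero_less_one unfolding uniform_limit_iff by blast
  have e2: "\<forall>\<^sub>F n in sequentially. \<forall>s\<in>{0..}. dist (\<theta> n s) s < 1"
    using th(2) zero_less_one unfolding uniform_limit_iff by blast
  from e1 e2 have "\<forall>\<^sub>F n in sequentially. \<forall>u\<in>{0..T}. norm (coord u (\<alpha>n n)) \<le> R + 1"
  proof eventually_elim
    fix n assume a: "\<forall>s\<in>{0..real N}. dist (coord (\<theta> n s) (\<alpha>n n)) (coord s \<alpha>) < 1"
      and b: "\<forall>s\<in>{0..}. dist (\<theta> n s) s < 1"
    show "\<forall>u\<in>{0..T}. norm (coord u (\<alpha>n n)) \<le> R + 1"
    proof
      fix u assume u: "u \<in> {0..T}"
      then have "0 \<le> u" by simp
      from time_change_surj[OF th(1)[of n] this] obtain r where r: "0 \<le> r" "\<theta> n r = u" by metis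
      have "dist (\<theta> n r) r < 1" using b r(1) by auto
      then have "r \<in> {0..real N}" using r u N by (auto simp: dist_real_def)
      then have "dist (coord u (\<alpha>n n)) (coord r \<alpha>) < 1" "norm (coord r \<alpha>) \<le> R" using a r R by auto
      then show "norm (coord u (\<alpha>n n)) \<le> R + 1"
        using norm_triangle_sub[of "coord u (\<alpha>n n)" "coord r \<alpha>"] by (simp add: dist_norm)
    qed
  qed
  then show ?thesis by blast
qed

text \<open>Evaluation of a path at a fixed time is not Skorokhod continuous, but it is so at all times
  at which the limit path does not jump. Processes with this property and with locally uniform
  bounds are stable under the operations below, and their time integrals are continuous functionals.\<close>

definition skorokhod_regular :: "(real \<Rightarrow> 'b::real_normed_vector cadlag_path \<Rightarrow> real) \<Rightarrow> bool" where
  "skorokhod_regular Y \<longleftrightarrow> (\<forall>\<alpha>. (\<lambda>u. Y u \<alpha>) \<in> borel_measurable borel) \<and>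
    (\<forall>\<alpha>n \<alpha>. skorokhod_conv \<alpha>n \<alpha> \<longrightarrow>
      (\<forall>u>0. isCont (\<lambda>u. coord u \<alpha>) u \<longrightarrow> (\<lambda>n. Y u (\<alpha>n n)) \<longlonglongrightarrow> Y u \<alpha>) \<and>
      (\<forall>T. \<exists>R. \<forall>\<^sub>F n in sequentially. \<forall>u\<in>{0..T}. \<bar>Y u (\<alpha>n n)\<bar> \<le> R))"

lemma skorokhod_regularD:
  assumes "skorokhod_regular Y"
  shows "(\<lambda>u. Y u \<alpha>) \<in> borel_measurable borel"
    and "skorokhod_conv \<alpha>n \<alpha> \<Longrightarrow> u > 0 \<Longrightarrow> isCont (\<lambda>u. coord u \<alpha>) u \<Longrightarrow> (\<lambda>n. Y u (\<alpha>n n)) \<longlonglongrightarrow> Y u \<alpha>"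
    and "skorokhod_conv \<alpha>n \<alpha> \<Longrightarrow> \<exists>R. \<forall>\<^sub>F n in sequentially. \<forall>u\<in>{0..T}. \<bar>Y u (\<alpha>n n)\<bar> \<le> R"
  using assms unfolding skorokhod_regular_def by blast+

lemma skorokhod_regular_lbb:
  assumes "skorokhod_regular Y" shows "locally_bounded_borel (\<lambda>u. Y u \<alpha>)"
  unfolding locally_bounded_borel_def
proof (intro conjI allI skorokhod_regularD(1)[OF assms])
  fix T
  obtain R where "\<forall>\<^sub>F n in sequentially. \<forall>u\<in>{0..T}. \<bar>Y u \<alpha>\<bar> \<le> R"
    using skorokhod_regularD(3)[OF assms skorokhod_conv_const] by blast
  then show "\<exists>B. \<forall>u\<in>{0..T}. \<bar>Y u \<alpha>\<bar> \<le> B" by auto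
qed

lemma skorokhod_regular_coord:
  assumes "continuous_on UNIV f" "locally_bounded f"
  shows "skorokhod_regular (\<lambda>u \<alpha>. f (coord u \<alpha>))"
  unfolding skorokhod_regular_def
proof (intro allI conjI impI)
  show "(\<lambda>u. f (coord u \<alpha>)) \<in> borel_measurable borel" for \<alpha>
    by (intro rcll_borel_measurable rcll_compose[OF rcll_coord assms(1)])
  fix \<alpha>n and \<alpha> :: "'a cadlag_path" assume conv: "skorokhod_conv \<alpha>n \<alpha>"
  show "(\<lambda>n. f (coord u (\<alpha>n n))) \<longlonglongrightarrow> f (coord u \<alpha>)" if "u > 0" "isCont (\<lambda>u. coord u \<alpha>) u" for u
    by (rule continuous_on_tendsto_compose[OF assms(1) skorokhod_conv_pointwise[OF conv]]) (use that in auto)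
  fix T
  obtain R where R: "\<forall>\<^sub>F n in sequentially. \<forall>u\<in>{0..T}. norm (coord u (\<alpha>n n)) \<le> R"
    using skorokhod_conv_bounded[OF conv] by blast
  obtain B where B: "\<And>x. norm x \<le> R \<Longrightarrow> \<bar>f x\<bar> \<le> B" using assms(2) unfolding locally_bounded_def by blast
  from R have "\<forall>\<^sub>F n in sequentially. \<forall>u\<in>{0..T}. \<bar>f (coord u (\<alpha>n n))\<bar> \<le> B"
    by eventually_elim (use B in blast)
  then show "\<exists>R. \<forall>\<^sub>F n in sequentially. \<forall>u\<in>{0..T}. \<bar>f (coord u (\<alpha>n n))\<bar> \<le> R" by blast
qed

lemma skorokhod_regular_mult:
  assumes "skorokhod_regular Y" "skorokhod_regular Z" shows "skorokhod_regular (\<lambda>u \<alpha>. Y u \<alpha> * Z u \<alpha>)"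
  unfolding skorokhod_regular_def
proof (intro allI conjI impI)
  show "(\<lambda>u. Y u \<alpha> * Z u \<alpha>) \<in> borel_measurable borel" for \<alpha>
    by (intro borel_measurable_times skorokhod_regularD(1) assms)
  fix \<alpha>n and \<alpha> :: "'a cadlag_path" assume conv: "skorokhod_conv \<alpha>n \<alpha>"
  show "(\<lambda>n. Y u (\<alpha>n n) * Z u (\<alpha>n n)) \<longlonglongrightarrow> Y u \<alpha> * Z u \<alpha>" if "u > 0" "isCont (\<lambda>u. coord u \<alpha>) u" for u
    by (intro tendsto_mult skorokhod_regularD(2)[OF assms(1) conv] skorokhod_regularD(2)[OF assms(2) conv] that)
  fix T
  obtain R S where "\<forall>\<^sub>F n in sequentially. \<forall>u\<in>{0..T}. \<bar>Y u (\<alpha>n n)\<bar> \<le> R"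
    "\<forall>\<^sub>F n in sequentially. \<forall>u\<in>{0..T}. \<bar>Z u (\<alpha>n n)\<bar> \<le> S"
    using skorokhod_regularD(3)[OF assms(1) conv] skorokhod_regularD(3)[OF assms(2) conv] by blast
  then have "\<forall>\<^sub>F n in sequentially. \<forall>u\<in>{0..T}. \<bar>Y u (\<alpha>n n) * Z u (\<alpha>n n)\<bar> \<le> R * S"
  proof eventually_elim
    fix n assume a: "\<forall>u\<in>{0..T}. \<bar>Y u (\<alpha>n n)\<bar> \<le> R" and b: "\<forall>u\<in>{0..T}. \<bar>Z u (\<alpha>n n)\<bar> \<le> S"
    show "\<forall>u\<in>{0..T}. \<bar>Y u (\<alpha>n n) * Z u (\<alpha>n n)\<bar> \<le> R * S"
      unfolding abs_mult using a b by (meson abs_ge_zero mult_mono order_trans)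
  qed
  then show "\<exists>R. \<forall>\<^sub>F n in sequentially. \<forall>u\<in>{0..T}. \<bar>Y u (\<alpha>n n) * Z u (\<alpha>n n)\<bar> \<le> R" by blast
qed

lemma skorokhod_regular_diff:
  assumes "skorokhod_regular Y" "skorokhod_regular Z" shows "skorokhod_regular (\<lambda>u \<alpha>. Y u \<alpha> - Z u \<alpha>)"
  unfolding skorokhod_regular_def
proof (intro allI conjI impI)
  show "(\<lambda>u. Y u \<alpha> - Z u \<alpha>) \<in> borel_measurable borel" for \<alpha>
    by (intro borel_measurable_diff skorokhod_regularD(1) assms)
  fix \<alpha>n and \<alpha> :: "'a cadlag_path" assume conv: "skorokhod_conv \<alpha>n \<alpha>"
  show "(\<lambda>n. Y u (\<alpha>n n) - Z u (\<alpha>n n)) \<longlonglongrightarrow> Y u \<alpha> - Z u \<alpha>" if "u > 0" "isCont (\<lambda>u. coord u \<alpha>) u" for u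
    by (intro tendsto_diff skorokhod_regularD(2)[OF assms(1) conv] skorokhod_regularD(2)[OF assms(2) conv] that)
  fix T
  obtain R S where "\<forall>\<^sub>F n in sequentially. \<forall>u\<in>{0..T}. \<bar>Y u (\<alpha>n n)\<bar> \<le> R"
    "\<forall>\<^sub>F n in sequentially. \<forall>u\<in>{0..T}. \<bar>Z u (\<alpha>n n)\<bar> \<le> S"
    using skorokhod_regularD(3)[OF assms(1) conv] skorokhod_regularD(3)[OF assms(2) conv] by blast
  then have "\<forall>\<^sub>F n in sequentially. \<forall>u\<in>{0..T}. \<bar>Y u (\<alpha>n n) - Z u (\<alpha>n n)\<bar> \<le> R + S"
    by eventually_elim (force intro!: order_trans[OF abs_triangle_ineq4] add_mono)
  then show "\<exists>R. \<forall>\<^sub>F n in sequentially. \<forall>u\<in>{0..T}. \<bar>Y u (\<alpha>n n) - Z u (\<alpha>n n)\<bar> \<le> R" by blast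
qed

lemma skorokhod_regular_compose:
  assumes "skorokhod_regular Y" "continuous_on UNIV g" shows "skorokhod_regular (\<lambda>u \<alpha>. g (Y u \<alpha>))"
  unfolding skorokhod_regular_def
proof (intro allI conjI impI)
  show "(\<lambda>u. g (Y u \<alpha>)) \<in> borel_measurable borel" for \<alpha>
    by (rule measurable_compose[OF skorokhod_regularD(1)[OF assms(1)] borel_measurable_continuous_onI[OF assms(2)]])
  fix \<alpha>n and \<alpha> :: "'a cadlag_path" assume conv: "skorokhod_conv \<alpha>n \<alpha>"
  show "(\<lambda>n. g (Y u (\<alpha>n n))) \<longlonglongrightarrow> g (Y u \<alpha>)" if "u > 0" "isCont (\<lambda>u. coord u \<alpha>) u" for u
    by (rule continuous_on_tendsto_compose[OF assms(2) skorokhod_regularD(2)[OF assms(1) conv that]]) auto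
  fix T
  obtain R where R: "\<forall>\<^sub>F n in sequentially. \<forall>u\<in>{0..T}. \<bar>Y u (\<alpha>n n)\<bar> \<le> R"
    using skorokhod_regularD(3)[OF assms(1) conv] by blast
  have "compact (g ` {-R..R})" by (intro compact_continuous_image continuous_on_subset[OF assms(2)]) auto
  then have "bounded (g ` {-R..R})" by (rule compact_imp_bounded)
  then obtain S where "\<forall>y\<in>g ` {-R..R}. norm y \<le> S" unfolding bounded_iff by blast
  then have S: "\<bar>g x\<bar> \<le> S" if "\<bar>x\<bar> \<le> R" for x using that by (simp add: abs_le_iff)
  from R have "\<forall>\<^sub>F n in sequentially. \<forall>u\<in>{0..T}. \<bar>g (Y u (\<alpha>n n))\<bar> \<le> S"
    by eventually_elim (use S in blast)
  then show "\<exists>R. \<forall>\<^sub>F n in sequentially. \<forall>u\<in>{0..T}. \<bar>g (Y u (\<alpha>n n))\<bar> \<le> R" by blast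
qed

text \<open>The limit path has countably many jumps, so almost every time is one of convergence.\<close>

lemma skorokhod_regular_integral_tendsto:
  assumes Y: "skorokhod_regular Y" and conv: "skorokhod_conv \<alpha>n \<alpha>" and a: "0 \<le> a"
  shows "(\<lambda>n. LINT u:{a..b}|lborel. Y u (\<alpha>n n)) \<longlonglongrightarrow> (LINT u:{a..b}|lborel. Y u \<alpha>)"
proof -
  obtain R where "\<forall>\<^sub>F n in sequentially. \<forall>u\<in>{0..b}. \<bar>Y u (\<alpha>n n)\<bar> \<le> R"
    using skorokhod_regularD(3)[OF Y conv] by blast
  then obtain n0 where n0: "\<And>n u. n \<ge> n0 \<Longrightarrow> u \<in> {0..b} \<Longrightarrow> \<bar>Y u (\<alpha>n n)\<bar> \<le> R"
    unfolding eventually_sequentially by blast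
  have "(\<lambda>n. LINT u:{a..b}|lborel. Y u (\<alpha>n (n + n0))) \<longlonglongrightarrow> (LINT u:{a..b}|lborel. Y u \<alpha>)"
  proof (rule set_integral_dominated_convergence[where w="\<lambda>_. R"])
    have "countable (insert 0 {t. \<not> isCont (\<lambda>u. coord u \<alpha>) t})"
      using rcll_countable_discontinuities[OF rcll_coord[of \<alpha>]] by simp
    then have "AE u in lborel. u \<notin> insert 0 {t. \<not> isCont (\<lambda>u. coord u \<alpha>) t}"
      by (intro AE_not_in countable_imp_null_set_lborel)
    then show "AE u in lborel. u \<in> {a..b} \<longrightarrow> (\<lambda>n. Y u (\<alpha>n (n + n0))) \<longlonglongrightarrow> Y u \<alpha>"
    proof eventually_elim
      fix u assume u: "u \<notin> insert 0 {t. \<not> isCont (\<lambda>u. coord u \<alpha>) t}"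
      show "u \<in> {a..b} \<longrightarrow> (\<lambda>n. Y u (\<alpha>n (n + n0))) \<longlonglongrightarrow> Y u \<alpha>"
      proof
        assume "u \<in> {a..b}"
        then have "u > 0" using u a by auto
        then show "(\<lambda>n. Y u (\<alpha>n (n + n0))) \<longlonglongrightarrow> Y u \<alpha>"
          using skorokhod_regularD(2)[OF Y conv] u by (intro LIMSEQ_ignore_initial_segment) auto
      qed
    qed
    show "\<bar>Y u (\<alpha>n (n + n0))\<bar> \<le> R" if "a \<le> u" "u \<le> b" for n u
      using n0[of "n + n0" u] that a by auto
  qed (use a in \<open>auto intro: skorokhod_regular_lbb[OF Y] lbb_const\<close>)
  then show ?thesis by (rule LIMSEQ_offset)
qed

lemma skorokhod_regular_integral:
  assumes Y: "skorokhod_regular Y"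
  shows "skorokhod_regular (\<lambda>t \<alpha>. LINT u:{0..t}|lborel. Y u \<alpha>)"
proof -
  define J where "J t \<alpha> = (LINT u:{0..t}|lborel. Y u \<alpha>)" for t \<alpha>
  have "skorokhod_regular J"
  unfolding skorokhod_regular_def
proof (intro allI conjI impI)
  show "(\<lambda>t. J t \<alpha>) \<in> borel_measurable borel" for \<alpha>
    unfolding J_def by (intro borel_measurable_continuous_onI continuous_path_integral skorokhod_regular_lbb Y)
  fix \<alpha>n and \<alpha> :: "'a cadlag_path" assume conv: "skorokhod_conv \<alpha>n \<alpha>"
  show "(\<lambda>n. J t (\<alpha>n n)) \<longlonglongrightarrow> J t \<alpha>" for t
    unfolding J_def by (rule skorokhod_regular_integral_tendsto[OF Y conv order_refl])
  fix T
  obtain R where R: "\<forall>\<^sub>F n in sequentially. \<forall>u\<in>{0..T}. \<bar>Y u (\<alpha>n n)\<bar> \<le> R"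
    using skorokhod_regularD(3)[OF Y conv] by blast
  then have "\<forall>\<^sub>F n in sequentially. \<forall>t\<in>{0..T}. \<bar>J t (\<alpha>n n)\<bar> \<le> R * T"
  proof eventually_elim
    fix n assume n: "\<forall>u\<in>{0..T}. \<bar>Y u (\<alpha>n n)\<bar> \<le> R"
    show "\<forall>t\<in>{0..T}. \<bar>J t (\<alpha>n n)\<bar> \<le> R * T"
    proof
      fix t assume t: "t \<in> {0..T}"
      have R: "0 \<le> R" using n t abs_ge_zero[of "Y t (\<alpha>n n)"] by (meson order_trans)
      have "\<bar>J t (\<alpha>n n)\<bar> \<le> R * (t - 0)"
        unfolding J_def using n t by (intro lbb_integral_bound skorokhod_regular_lbb[OF Y]) auto
      also have "\<dots> \<le> R * T" using t R by (intro mult_left_mono) auto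
      finally show "\<bar>J t (\<alpha>n n)\<bar> \<le> R * T" .
    qed
  qed
  then show "\<exists>R. \<forall>\<^sub>F n in sequentially. \<forall>u\<in>{0..T}. \<bar>J u (\<alpha>n n)\<bar> \<le> R" by (rule exI)
qed
  then show ?thesis by (simp only: J_def[abs_def])
qed

lemma skorokhod_regular_path_integral:
  assumes "continuous_on UNIV f" "locally_bounded f" shows "skorokhod_regular (path_integral f)"
  unfolding path_integral_def[abs_def] by (intro skorokhod_regular_integral skorokhod_regular_coord assms)

lemma bounded_imp_locally_bounded: "(\<And>x. \<bar>f x\<bar> \<le> B) \<Longrightarrow> locally_bounded f"
  unfolding locally_bounded_def by blast

lemma (in clocked) skorokhod_regular_damped:
  assumes "continuous_on UNIV \<kappa>" shows "skorokhod_regular (damped c F \<kappa> k j)"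
proof -
  have m: "skorokhod_regular (compensated F \<kappa>)"
    unfolding compensated_def[abs_def]
    by (intro skorokhod_regular_diff skorokhod_regular_coord skorokhod_regular_path_integral assms F_continuous
        compensator_locally_bounded bounded_imp_locally_bounded[OF F_bound])
  show ?thesis
    unfolding damped_def[abs_def] weight_def
    by (intro skorokhod_regular_diff skorokhod_regular_mult skorokhod_regular_integral m
        skorokhod_regular_compose[OF skorokhod_regular_path_integral[OF clock_continuous clock_bounded]]
        cutoff_continuous cutoff_deriv_continuous skorokhod_regular_coord clock_continuous clock_bounded)
qed

section \<open>Vanishing of errors along a weakly convergent sequence\<close>

text \<open>A continuous approximation from below, increasing in \<open>l\<close>, of the indicator of an open set. The
  distance to the empty set is \<open>0\<close> by convention, hence the case distinction.\<close>

definition bump :: "'b::metric_space set \<Rightarrow> nat \<Rightarrow> 'b \<Rightarrow> real" where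
  "bump U l x = (if U = UNIV then 1 else min 1 (real l * infdist x (- U)))"

lemma bump_continuous: "continuous_on UNIV (bump U l)"
  unfolding bump_def[abs_def] by (cases "U = UNIV") (auto intro!: continuous_intros)

lemma bump_bounds: "0 \<le> bump U l x" "bump U l x \<le> 1"
  by (auto simp: bump_def infdist_nonneg)

lemma bump_outside: "x \<notin> U \<Longrightarrow> bump U l x = 0"
  by (auto simp: bump_def)

text \<open>The bound \<open>l0\<close> serves all \<open>V\<close> because the distance to the complement grows with the set.\<close>

lemma bump_eventually_1:
  assumes "open U" "x \<in> U"
  shows "\<exists>l0. \<forall>l\<ge>l0. \<forall>V. U \<subseteq> V \<longrightarrow> bump V l x = 1"
proof (cases "U = UNIV")
  case True then show ?thesis by (auto simp: bump_def)
next
  case False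
  have cl: "closed (- U)" using assms(1) by (simp add: closed_Compl)
  have ne: "- U \<noteq> {}" using False by auto
  have pos: "infdist x (- U) > 0"
    using in_closed_iff_infdist_zero[OF cl ne, of x] infdist_nonneg[of x "- U"] assms(2) by force
  obtain l0 :: nat where l0: "1 / infdist x (- U) < real l0" using reals_Archimedean2 by blast
  have "bump V l x = 1" if "l0 \<le> l" "U \<subseteq> V" for l V
  proof (cases "V = UNIV")
    case False
    have "infdist x (- U) \<le> infdist x (- V)" using that(2) False by (intro infdist_mono) auto
    moreover have "1 \<le> real l * infdist x (- U)"
    proof -
      have "1 / infdist x (- U) \<le> real l" using l0 that(1) by linarith
      then show ?thesis using pos by (simp add: pos_divide_le_eq)
    qed
    ultimately have "1 \<le> real l * infdist x (- V)"
      by (meson mult_left_mono of_nat_0_le_iff order_trans)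
    then show ?thesis using False by (simp add: bump_def)
  qed (simp add: bump_def)
  then show ?thesis by blast
qed

lemma bump_tendsto: "open U \<Longrightarrow> (\<lambda>l. bump U l x) \<longlonglongrightarrow> indicator U x"
proof (cases "x \<in> U")
  case True assume "open U"
  then obtain l0 where "\<And>l. l \<ge> l0 \<Longrightarrow> bump U l x = 1" using bump_eventually_1[OF _ True] by blast
  then have "\<forall>\<^sub>F l in sequentially. bump U l x = indicator U x"
    unfolding eventually_sequentially using True by auto
  then show ?thesis by (rule tendsto_eventually)
qed (simp add: bump_outside)

text \<open>The cutoff is at most \<open>1\<close>, and it vanishes from the time on at which the clock shows \<open>k + 1\<close>.\<close>

lemma (in clocked) cutoff_clock_mass:
  assumes T: "0 \<le> T"
  shows "(LINT u:{0..T}|lborel. cutoff k j (path_integral c u \<alpha>) * c (coord u \<alpha>)) \<le> real k + 1"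
proof -
  define \<sigma> where "\<sigma> = clock_time (k + 1) \<alpha>"
  have sig: "0 \<le> \<sigma>" "path_integral c \<sigma> \<alpha> = real k + 1" using clock_time[of "k+1" \<alpha>] by (auto simp: \<sigma>_def)
  have l: "locally_bounded_borel (\<lambda>u. cutoff k j (path_integral c u \<alpha>) * c (coord u \<alpha>))"
    by (intro lbb_mult lbb_clock lbb_rcll rcll_continuous continuous_on_compose2[OF cutoff_continuous clock_integral_continuous]) auto
  have le: "cutoff k j (path_integral c u \<alpha>) * c (coord u \<alpha>) \<le> c (coord u \<alpha>)" for u
    using cutoff_le1 cutoff_nonneg clock_ge1[of "coord u \<alpha>"] by (intro mult_left_le_one_le) auto
  have *: "(LINT u:{0..b}|lborel. cutoff k j (path_integral c u \<alpha>) * c (coord u \<alpha>)) \<le> path_integral c b \<alpha>" for b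
    unfolding path_integral_def[of c b] by (intro lbb_mono l lbb_clock order_refl le)
  show ?thesis
  proof (cases "T \<le> \<sigma>")
    case True then show ?thesis using *[of T] clock_integral_mono[OF T True, of \<alpha>] sig by linarith
  next
    case False
    have "(LINT u:{\<sigma>..T}|lborel. cutoff k j (path_integral c u \<alpha>) * c (coord u \<alpha>)) = (LINT u:{\<sigma>..T}|lborel. 0)"
    proof -
      have "cutoff k j (path_integral c u \<alpha>) = 0" if "\<sigma> \<le> u" for u
        using clock_integral_mono[OF sig(1) that, of \<alpha>] sig(2) by (simp add: cutoff_eq0')
      then show ?thesis unfolding set_lebesgue_integral_def
        by (intro Bochner_Integration.integral_cong refl) (auto simp: indicator_def)
    qed
    then show ?thesis using lbb_split[OF l order_refl sig(1), of T] False *[of \<sigma>] sig(2)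
      by (simp add: set_lebesgue_integral_def)
  qed
qed

lemma compact_range_with_limit:
  fixes y :: "nat \<Rightarrow> 'a::topological_space"
  assumes "y \<longlonglongrightarrow> x" shows "compact (insert x (range y))"
  unfolding compact_eq_Heine_Borel
proof (intro allI impI)
  fix \<C> assume "(\<forall>S\<in>\<C>. open S) \<and> insert x (range y) \<subseteq> \<Union>\<C>"
  then have C: "\<forall>S\<in>\<C>. open S" "insert x (range y) \<subseteq> \<Union>\<C>" by auto
  then obtain U where U: "U \<in> \<C>" "x \<in> U" by blast
  then obtain n0 where n0: "\<And>n. n \<ge> n0 \<Longrightarrow> y n \<in> U"
    using topological_tendstoD[OF assms] C(1) unfolding eventually_sequentially by blast
  have "\<forall>n. \<exists>S\<in>\<C>. y n \<in> S" using C(2) by blast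
  then obtain S where S: "\<And>n. S n \<in> \<C>" "\<And>n. y n \<in> S n" by metis
  have "insert x (range y) \<subseteq> \<Union>(insert U (S ` {..<n0}))"
  proof
    fix z assume "z \<in> insert x (range y)"
    then consider "z = x" | n where "z = y n" by blast
    then show "z \<in> \<Union>(insert U (S ` {..<n0}))"
    proof cases
      case 2 then show ?thesis using n0[of n] S(2)[of n] by (cases "n < n0") auto
    qed (use U in auto)
  qed
  then show "\<exists>\<C>'\<subseteq>\<C>. finite \<C>' \<and> insert x (range y) \<subseteq> \<Union>\<C>'"
    using U S by (intro exI[of _ "insert U (S ` {..<n0})"]) auto
qed

text \<open>Tightness is replaced by the following argument: the open sets on which all errors from the
  \<open>N\<close>-th on are at most \<open>\<delta>\<close> exhaust the space, and the time that a path spends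
  outside such a set, measured by the clock, is controlled by a continuous functional, whose
  expectations converge.\<close>

lemma (in clocked) vanishing_errors:
  fixes Pn :: "nat \<Rightarrow> 'b cadlag_path measure"
  assumes P: "path_prob P" "\<And>n. path_prob (Pn n)" and conv: "weakly_converges Pn P"
    and w: "\<And>n. w n \<in> borel_measurable borel" "\<And>n x. 0 \<le> w n x" "\<And>n x. w n x \<le> b * c x"
    and lim: "\<And>S. compact S \<Longrightarrow> uniform_limit S w (\<lambda>_. 0) sequentially"
    and T: "0 \<le> T"
  shows "(\<lambda>n. \<integral>\<alpha>. (LINT u:{0..T}|lborel. cutoff k j (path_integral c u \<alpha>) * w n (coord u \<alpha>)) \<partial>Pn n) \<longlonglongrightarrow> 0"
proof -
  have b: "0 \<le> b" using w(2)[of 0 0] w(3)[of 0 0] clock_ge1[of 0]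
    by (metis dual_order.trans mult_neg_pos not_less order.strict_trans2 zero_less_one)
  define V where "V u \<alpha> = cutoff k j (path_integral c u \<alpha>)" for u \<alpha>
  have V01: "0 \<le> V u \<alpha>" "V u \<alpha> \<le> 1" for u \<alpha> by (simp_all add: V_def cutoff_nonneg cutoff_le1)
  have lV: "locally_bounded_borel (\<lambda>u. V u \<alpha>)" for \<alpha> unfolding V_def
    by (intro lbb_rcll rcll_continuous continuous_on_compose2[OF cutoff_continuous clock_integral_continuous]) auto
  have wlb: "locally_bounded (w n)" for n
  proof (rule locally_bounded_le[OF locally_bounded_cmult[OF clock_bounded, of b]])
    show "\<bar>w n x\<bar> \<le> \<bar>b * c x\<bar>" for x using w(2,3)[of n x] by simp
  qed
  have lw: "locally_bounded_borel (\<lambda>u. w n (coord u \<alpha>))" for n \<alpha> by (rule lbb_path[OF w(1) wlb])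
  define G where "G n \<alpha> = (LINT u:{0..T}|lborel. V u \<alpha> * w n (coord u \<alpha>))" for n \<alpha>
  have G0: "0 \<le> G n \<alpha>" for n \<alpha> unfolding G_def set_lebesgue_integral_def
    by (intro integral_nonneg_AE AE_I2) (simp add: V01 w indicator_def)
  show ?thesis unfolding V_def[symmetric] G_def[symmetric]
  proof (rule LIMSEQ_I)
    fix e :: real assume e: "e > 0"
    define \<delta> where "\<delta> = e / (2 * (T + b + 1))"
    have den: "0 < T + b + 1" using T b by linarith
    have del: "\<delta> > 0" using e den by (simp add: \<delta>_def)
    have del2: "\<delta> * (T + b + 1) = e / 2" using den by (simp add: \<delta>_def field_simps)
    \<comment> \<open>a point outside of all \<open>U N\<close> is the limit of points \<open>y N\<close> with an error above \<open>\<delta>\<close> at some index \<open>n N \<ge> N\<close>; but these points and their limit form a compact set\<close>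
    define U where "U N = interior {x. \<forall>n\<ge>N. w n x \<le> \<delta>}" for N
    have Uo: "open (U N)" for N by (simp add: U_def)
    have Umono: "U N \<subseteq> U M" if "N \<le> M" for N M unfolding U_def using that by (intro interior_mono) auto
    have Uw: "w n x \<le> \<delta>" if "x \<in> U N" "n \<ge> N" for x n N
      using that interior_subset unfolding U_def by blast
    have cover: "\<exists>N. x \<in> U N" for x
    proof (rule ccontr)
      assume "\<nexists>N. x \<in> U N"
      have no: "\<not> ball x (1 / real (Suc N)) \<subseteq> {x. \<forall>n\<ge>N. w n x \<le> \<delta>}" for N
      proof
        assume "ball x (1 / real (Suc N)) \<subseteq> {x. \<forall>n\<ge>N. w n x \<le> \<delta>}"
        then have "x \<in> U N" unfolding U_def mem_interior by (intro exI[of _ "1 / real (Suc N)"]) simp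
        then show False using \<open>\<nexists>N. x \<in> U N\<close> by blast
      qed
      have "\<exists>y n. dist x y < 1 / real (Suc N) \<and> n \<ge> N \<and> w n y > \<delta>" for N
      proof -
        from no[of N] obtain y where "y \<in> ball x (1 / real (Suc N))" "\<not> (\<forall>n\<ge>N. w n y \<le> \<delta>)" by blast
        then show ?thesis by (auto simp: not_le)
      qed
      then obtain y n where yn: "\<And>N. dist x (y N) < 1 / real (Suc N)" "\<And>N. n N \<ge> N" "\<And>N. w (n N) (y N) > \<delta>"
        by metis
      have "y \<longlonglongrightarrow> x"
      proof (rule metric_LIMSEQ_I)
        fix r :: real assume "r > 0"
        then obtain N where N: "1 / real (Suc N) < r" using nat_approx_posE by metis
        have "dist (y m) x < r" if "m \<ge> N" for m
        proof -
          have "1 / real (Suc m) \<le> 1 / real (Suc N)" using that by (simp add: frac_le)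
          then show ?thesis using yn(1)[of m] N by (simp add: dist_commute)
        qed
        then show "\<exists>no. \<forall>n\<ge>no. dist (y n) x < r" by blast
      qed
      then have "compact (insert x (range y))" by (rule compact_range_with_limit)
      from lim[OF this] del have "\<forall>\<^sub>F m in sequentially. \<forall>z\<in>insert x (range y). dist (w m z) 0 < \<delta>"
        unfolding uniform_limit_iff by blast
      then obtain m0 where "\<And>m z. m \<ge> m0 \<Longrightarrow> z \<in> insert x (range y) \<Longrightarrow> dist (w m z) 0 < \<delta>"
        unfolding eventually_sequentially by blast
      from this[OF yn(2)[of m0], of "y m0"] yn(3)[of m0] show False by simp
    qed
    \<comment> \<open>bounds the clock time spent outside of \<open>U N\<close> before the cutoff, and is continuous in the path\<close>
    define D where "D N \<alpha> = (LINT u:{0..T}|lborel. V u \<alpha> * (c (coord u \<alpha>) * (1 - bump (U N) N (coord u \<alpha>))))" for N \<alpha>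
    have cb: "continuous_on UNIV (\<lambda>x. 1 - bump (U N) N x)" for N by (intro continuous_intros bump_continuous)
    have lbb1: "locally_bounded_borel (\<lambda>u. V u \<alpha> * (c (coord u \<alpha>) * (1 - bump (U N) N (coord u \<alpha>))))" for N \<alpha>
      by (intro lbb_mult lV lbb_clock lbb_rcll rcll_compose[OF rcll_coord cb])
    have bb: "\<bar>1 - bump (U N) N x\<bar> \<le> 1" for N x
      using bump_bounds[of "U N" N x] by linarith
    have D_cont: "continuous_on UNIV (D N)" for N
    proof (rule continuous_on_path_space)
      fix \<alpha>n and \<alpha> :: "'b cadlag_path" assume "skorokhod_conv \<alpha>n \<alpha>"
      then show "(\<lambda>n. D N (\<alpha>n n)) \<longlonglongrightarrow> D N \<alpha>"
        unfolding D_def V_def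
      proof (rule skorokhod_regular_integral_tendsto[rotated])
        show "skorokhod_regular (\<lambda>u \<alpha>. cutoff k j (path_integral c u \<alpha>) * (c (coord u \<alpha>) * (1 - bump (U N) N (coord u \<alpha>))))"
          by (intro skorokhod_regular_mult skorokhod_regular_compose[OF skorokhod_regular_path_integral[OF clock_continuous clock_bounded]]
              cutoff_continuous skorokhod_regular_coord clock_continuous clock_bounded cb bounded_imp_locally_bounded[of _ 1])
             (rule bb)
      qed simp
    qed
    have c0: "0 \<le> c x" for x using clock_ge1[of x] by linarith
    have cb0: "0 \<le> c x * (1 - bump (U N) N x)" for x N
      using c0[of x] bump_bounds(2)[of "U N" N x] by (intro mult_nonneg_nonneg) auto
    have cb1: "c x * (1 - bump (U N) N x) \<le> c x" for x N
      using c0[of x] bump_bounds[of "U N" N x] by (intro mult_left_le) auto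
    have Vcb: "0 \<le> V u \<alpha> * (c x * (1 - bump (U N) N x))" "V u \<alpha> * (c x * (1 - bump (U N) N x)) \<le> V u \<alpha> * c x"
      "V u \<alpha> * (c x * (1 - bump (U N) N x)) \<le> c x" for u \<alpha> x N
    proof -
      show "0 \<le> V u \<alpha> * (c x * (1 - bump (U N) N x))" by (intro mult_nonneg_nonneg V01 cb0)
      show 1: "V u \<alpha> * (c x * (1 - bump (U N) N x)) \<le> V u \<alpha> * c x" by (intro mult_left_mono V01 cb1)
      have "V u \<alpha> * c x \<le> c x" by (intro mult_left_le_one_le V01 c0)
      with 1 show "V u \<alpha> * (c x * (1 - bump (U N) N x)) \<le> c x" by linarith
    qed
    have D0: "0 \<le> D N \<alpha>" for N \<alpha> unfolding D_def set_lebesgue_integral_def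
      by (intro integral_nonneg_AE AE_I2) (simp add: indicator_def Vcb(1))
    have D1: "D N \<alpha> \<le> real k + 1" for N \<alpha>
    proof -
      have "D N \<alpha> \<le> (LINT u:{0..T}|lborel. V u \<alpha> * c (coord u \<alpha>))"
        unfolding D_def by (intro lbb_mono lbb1 lbb_mult lV lbb_clock order_refl Vcb(2))
      also have "\<dots> \<le> real k + 1" unfolding V_def by (rule cutoff_clock_mass[OF T])
      finally show ?thesis .
    qed
    have D_meas: "D N \<in> borel_measurable (path_filtration (ennreal T))" for N
      unfolding D_def[abs_def] V_def
      by (intro progressive_integral_adapted progressive_mult progressive_cutoff T order_refl
          progressive_compose[OF progressive_coord] clock_borel borel_measurable_continuous_onI cb)
    have "(\<lambda>N. \<integral>\<alpha>. D N \<alpha> \<partial>P) \<longlonglongrightarrow> (\<integral>\<alpha>. 0 \<partial>P)"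
    proof (rule integral_dominated_convergence[where w="\<lambda>_. real k + 1"])
      interpret prob_space P using P(1) by (simp add: path_prob_def)
      show "integrable P (\<lambda>_. real k + 1)" by simp
      show "D N \<in> borel_measurable P" for N by (rule path_prob_measurable[OF P(1) D_meas])
      show "AE \<alpha> in P. (\<lambda>N. D N \<alpha>) \<longlonglongrightarrow> 0"
      proof (rule AE_I2)
        fix \<alpha>
        have "(\<lambda>N. D N \<alpha>) \<longlonglongrightarrow> (LINT u:{0..T}|lborel. 0)"
          unfolding D_def
        proof (rule set_integral_dominated_convergence[OF lbb1 lbb_const lbb_clock order_refl])
          show "AE u in lborel. u \<in> {0..T} \<longrightarrow> (\<lambda>N. V u \<alpha> * (c (coord u \<alpha>) * (1 - bump (U N) N (coord u \<alpha>)))) \<longlonglongrightarrow> 0"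
          proof (intro AE_I2 impI tendsto_eventually)
            fix u
            obtain N0 where N0: "coord u \<alpha> \<in> U N0" using cover by blast
            obtain l0 where l0: "\<And>l V. l \<ge> l0 \<Longrightarrow> U N0 \<subseteq> V \<Longrightarrow> bump V l (coord u \<alpha>) = 1"
              using bump_eventually_1[OF Uo N0] by blast
            show "\<forall>\<^sub>F N in sequentially. V u \<alpha> * (c (coord u \<alpha>) * (1 - bump (U N) N (coord u \<alpha>))) = 0"
              unfolding eventually_sequentially using l0 Umono by (intro exI[of _ "max l0 N0"]) auto
          qed
          fix N u
          show "\<bar>V u \<alpha> * (c (coord u \<alpha>) * (1 - bump (U N) N (coord u \<alpha>)))\<bar> \<le> c (coord u \<alpha>)"
            using Vcb(1,3)[of u \<alpha> "coord u \<alpha>" N] by linarith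
        qed
        then show "(\<lambda>N. D N \<alpha>) \<longlonglongrightarrow> 0" by (simp add: set_lebesgue_integral_def)
      qed
      show "AE \<alpha> in P. norm (D N \<alpha>) \<le> real k + 1" for N using D0 D1 by simp
    qed simp
    then have "(\<lambda>N. \<integral>\<alpha>. D N \<alpha> \<partial>P) \<longlonglongrightarrow> 0" by simp
    from order_tendstoD(2)[OF this del] obtain N where N: "(\<integral>\<alpha>. D N \<alpha> \<partial>P) < \<delta>"
      unfolding eventually_sequentially by blast
    have "bounded (range (D N))" unfolding bounded_real using D0 D1 by (metis abs_of_nonneg rangeE)
    then have "(\<lambda>n. \<integral>\<alpha>. D N \<alpha> \<partial>Pn n) \<longlonglongrightarrow> (\<integral>\<alpha>. D N \<alpha> \<partial>P)"
      using conv D_cont unfolding weakly_converges_def by blast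
    from order_tendstoD(2)[OF this N] obtain n0 where n0: "\<And>n. n \<ge> n0 \<Longrightarrow> (\<integral>\<alpha>. D N \<alpha> \<partial>Pn n) < \<delta>"
      unfolding eventually_sequentially by blast
    have "norm ((\<integral>\<alpha>. G n \<alpha> \<partial>Pn n) - 0) < e" if n: "n \<ge> max N n0" for n
    proof -
      interpret Q: prob_space "Pn n" using P(2)[of n] by (simp add: path_prob_def)
      have G_le: "G n \<alpha> \<le> \<delta> * T + b * D N \<alpha>" for \<alpha>
      proof -
        have "G n \<alpha> \<le> (LINT u:{0..T}|lborel. \<delta> + b * (V u \<alpha> * (c (coord u \<alpha>) * (1 - bump (U N) N (coord u \<alpha>)))))"
          unfolding G_def
        proof (intro lbb_mono lbb_add lbb_const lbb_mult[OF lV lw] lbb_mult[OF lbb_const lbb1] order_refl)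
          fix u
          have "w n (coord u \<alpha>) \<le> \<delta> + b * (c (coord u \<alpha>) * (1 - bump (U N) N (coord u \<alpha>)))"
          proof (cases "coord u \<alpha> \<in> U N")
            case True
            have "0 \<le> b * (c (coord u \<alpha>) * (1 - bump (U N) N (coord u \<alpha>)))"
              by (intro mult_nonneg_nonneg b cb0)
            moreover have "w n (coord u \<alpha>) \<le> \<delta>" using Uw[OF True, of n] n by simp
            ultimately show ?thesis by linarith
          next
            case False then show ?thesis using w(3)[of n "coord u \<alpha>"] del by (simp add: bump_outside)
          qed
          then have "V u \<alpha> * w n (coord u \<alpha>) \<le> V u \<alpha> * (\<delta> + b * (c (coord u \<alpha>) * (1 - bump (U N) N (coord u \<alpha>))))"
            using V01 by (intro mult_left_mono)
          also have "\<dots> \<le> \<delta> + b * (V u \<alpha> * (c (coord u \<alpha>) * (1 - bump (U N) N (coord u \<alpha>))))"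
            using mult_left_le_one_le[of \<delta> "V u \<alpha>"] V01[of u \<alpha>] del by (simp add: distrib_left ac_simps)
          finally show "V u \<alpha> * w n (coord u \<alpha>) \<le> \<delta> + b * (V u \<alpha> * (c (coord u \<alpha>) * (1 - bump (U N) N (coord u \<alpha>))))" .
        qed
        also have "\<dots> = \<delta> * T + b * D N \<alpha>"
          unfolding D_def using T
          by (subst set_integral_add)
             (auto intro!: lbb_integrable lbb_const lbb_mult[OF lbb_const lbb1] simp: set_integral_const_Icc mult.commute)
        finally show ?thesis .
      qed
      have Dint: "integrable (Pn n) (D N)"
        by (rule integrable_bounded_path[where D="real k + 1", OF P(2) path_prob_measurable[OF P(2) D_meas]])
           (use D0 D1 in simp)
      have G_meas: "G n \<in> borel_measurable (Pn n)"
        unfolding G_def[abs_def] V_def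
        by (rule path_prob_measurable[OF P(2), of _ "ennreal T"])
           (intro progressive_integral_adapted progressive_mult progressive_cutoff T order_refl
          progressive_compose[OF progressive_coord] w(1))
      have Gint: "integrable (Pn n) (G n)"
        by (rule Bochner_Integration.integrable_bound[of _ "\<lambda>\<alpha>. \<delta> * T + b * D N \<alpha>"])
           (use Dint G_meas G_le G0 in \<open>auto intro!: order_trans[OF G_le abs_ge_self]\<close>)
      have "(\<integral>\<alpha>. G n \<alpha> \<partial>Pn n) \<le> (\<integral>\<alpha>. \<delta> * T + b * D N \<alpha> \<partial>Pn n)"
        using Gint Dint G_le by (intro integral_mono) auto
      also have "\<dots> = \<delta> * T + b * (\<integral>\<alpha>. D N \<alpha> \<partial>Pn n)" using Dint Q.prob_space by simp
      also have "\<dots> \<le> \<delta> * T + b * \<delta>" using n0[of n] n b by (intro add_left_mono mult_left_mono) auto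
      also have "\<dots> \<le> \<delta> * (T + b + 1)" using del by (simp add: algebra_simps)
      also have "\<dots> < e" using del2 e by simp
      finally have "(\<integral>\<alpha>. G n \<alpha> \<partial>Pn n) < e" .
      moreover have "0 \<le> (\<integral>\<alpha>. G n \<alpha> \<partial>Pn n)" by (intro integral_nonneg_AE AE_I2 G0)
      ultimately show ?thesis by simp
    qed
    then show "\<exists>no. \<forall>n\<ge>no. norm ((\<integral>\<alpha>. G n \<alpha> \<partial>Pn n) - 0) < e" by blast
  qed
qed

section \<open>Weak limits of compensated processes\<close>

context clocked begin

lemma lbb_cutoff: "locally_bounded_borel (\<lambda>u. cutoff k j (path_integral c u \<alpha>))"
  by (intro lbb_rcll rcll_continuous continuous_on_compose2[OF cutoff_continuous clock_integral_continuous]) auto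

lemma lbb_damped: "locally_bounded_borel (\<lambda>u. damped c F \<kappa> k j u \<alpha>)"
  by (rule lbb_rcll[OF rcll_damped])

text \<open>Two damped processes with the same clock differ by at most a multiple of the clock-limited time
  integral of the errors, up to the error at the present time. The error of the function has to be
  weighted with the clock, since the weight process contains the clock as a factor. The cutoff in the
  integral is one level higher, so that it is still \<open>1\<close> wherever the damping with level \<open>k\<close> is active.\<close>

lemma damped_difference:
  fixes k :: nat
  assumes C': "clocked c F' \<kappa>' B'" and u: "0 \<le> u" "u \<le> T"
  defines "w \<equiv> \<lambda>x. \<bar>\<kappa>' x - \<kappa> x\<bar> + c x * \<bar>F' x - F x\<bar>"
  defines "Q \<equiv> \<lambda>\<alpha>. LINT q:{0..T}|lborel. cutoff (k+1) 0 (path_integral c q \<alpha>) * w (coord q \<alpha>)"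
  shows "\<bar>damped c F' \<kappa>' k j u \<alpha> - damped c F \<kappa> k j u \<alpha>\<bar>
    \<le> cutoff (k+1) 0 (path_integral c u \<alpha>) * w (coord u \<alpha>) + (2 + 4 * real (Suc j)) * Q \<alpha>"
proof -
  interpret C': clocked c F' \<kappa>' B' by (rule C')
  define \<xi> where "\<xi> q = cutoff (k+1) 0 (path_integral c q \<alpha>)" for q
  define V where "V = cutoff k j (path_integral c u \<alpha>)"
  define f where "f q = F' (coord q \<alpha>) - F (coord q \<alpha>)" for q
  define g where "g q = \<kappa>' (coord q \<alpha>) - \<kappa> (coord q \<alpha>)" for q
  define I where "I r = (LINT q:{0..r}|lborel. g q)" for r
  define wt where "wt q = weight c k j q \<alpha>" for q
  have chi: "0 \<le> \<xi> q" "\<xi> q \<le> 1" for q by (simp_all add: \<xi>_def cutoff_nonneg cutoff_le1)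
  have chi1: "\<xi> q = 1" if "path_integral c q \<alpha> \<le> real k + 1" for q
    using that by (simp add: \<xi>_def cutoff_eq1)
  have c0: "0 \<le> c x" for x using clock_ge1[of x] by linarith
  have lf: "locally_bounded_borel f" unfolding f_def[abs_def]
    by (intro lbb_diff lbb_rcll rcll_compose[OF rcll_coord] F_continuous C'.F_continuous)
  have lg: "locally_bounded_borel g" unfolding g_def[abs_def]
    by (intro lbb_diff lbb_compensator C'.lbb_compensator)
  have lI: "locally_bounded_borel I" unfolding I_def[abs_def]
    by (intro lbb_rcll rcll_continuous continuous_path_integral lg)
  have lwt: "locally_bounded_borel wt" unfolding wt_def[abs_def] by (rule lbb_weight)
  have lchi: "locally_bounded_borel \<xi>" unfolding \<xi>_def[abs_def] by (rule lbb_cutoff)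
  have w_eq: "w (coord q \<alpha>) = \<bar>g q\<bar> + c (coord q \<alpha>) * \<bar>f q\<bar>" for q by (simp add: w_def g_def f_def)
  have lw: "locally_bounded_borel (\<lambda>q. \<xi> q * w (coord q \<alpha>))" unfolding w_eq
    by (intro lbb_mult lchi lbb_add lbb_abs lg lf lbb_clock)
  have w0: "0 \<le> w x" for x using c0[of x] by (simp add: w_def)
  have Q_eq: "Q \<alpha> = (LINT q:{0..T}|lborel. \<xi> q * w (coord q \<alpha>))" by (simp add: Q_def \<xi>_def)
  have sub: "(LINT q:{0..r}|lborel. \<xi> q * w (coord q \<alpha>)) \<le> Q \<alpha>" if r: "0 \<le> r" "r \<le> T" for r
  proof -
    have "0 \<le> (LINT q:{r..T}|lborel. \<xi> q * w (coord q \<alpha>))" unfolding set_lebesgue_integral_def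
      by (intro integral_nonneg_AE AE_I2) (simp add: indicator_def chi w0)
    then show ?thesis using lbb_split[OF lw order_refl r] by (simp add: Q_eq)
  qed
  have Q0: "0 \<le> Q \<alpha>" unfolding Q_eq set_lebesgue_integral_def
    by (intro integral_nonneg_AE AE_I2) (simp add: indicator_def chi w0)
  have Ib: "\<bar>I r\<bar> \<le> Q \<alpha>" if r: "0 \<le> r" "r \<le> T" "path_integral c r \<alpha> \<le> real k + 1" for r
  proof -
    have "\<bar>I r\<bar> \<le> (LINT q:{0..r}|lborel. \<bar>g q\<bar>)" unfolding I_def by (rule abs_set_integral_le[OF lg order_refl])
    also have "\<dots> \<le> (LINT q:{0..r}|lborel. \<xi> q * w (coord q \<alpha>))"
    proof (intro lbb_mono lbb_abs lg lw order_refl)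
      fix q assume q: "0 \<le> q" "q \<le> r"
      then have "\<xi> q = 1" using clock_integral_mono[of q r \<alpha>] r(3) by (intro chi1) linarith
      then show "\<bar>g q\<bar> \<le> \<xi> q * w (coord q \<alpha>)" using c0[of "coord q \<alpha>"] by (simp add: w_eq)
    qed
    also have "\<dots> \<le> Q \<alpha>" by (rule sub[OF r(1,2)])
    finally show ?thesis .
  qed
  have m: "compensated F' \<kappa>' q \<alpha> - compensated F \<kappa> q \<alpha> = f q - I q" for q
  proof -
    have "I q = path_integral \<kappa>' q \<alpha> - path_integral \<kappa> q \<alpha>"
      unfolding I_def g_def path_integral_def
      by (rule set_integral_diff(2)) (intro lbb_integrable C'.lbb_compensator lbb_compensator order_refl)+
    then show ?thesis by (simp add: compensated_def f_def)
  qed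
  have "(LINT q:{0..u}|lborel. wt q * compensated F' \<kappa>' q \<alpha>) - (LINT q:{0..u}|lborel. wt q * compensated F \<kappa> q \<alpha>)
     = (LINT q:{0..u}|lborel. wt q * compensated F' \<kappa>' q \<alpha> - wt q * compensated F \<kappa> q \<alpha>)"
    by (rule set_integral_diff(2)[symmetric])
       (intro lbb_integrable lbb_mult lwt C'.lbb_compensated lbb_compensated order_refl)+
  also have "\<dots> = (LINT q:{0..u}|lborel. wt q * f q - wt q * I q)"
    by (simp add: right_diff_distrib[symmetric] m)
  also have "\<dots> = (LINT q:{0..u}|lborel. wt q * f q) - (LINT q:{0..u}|lborel. wt q * I q)"
    by (rule set_integral_diff(2)) (intro lbb_integrable lbb_mult lwt lf lI order_refl)+
  finally have wm: "(LINT q:{0..u}|lborel. wt q * compensated F' \<kappa>' q \<alpha>) - (LINT q:{0..u}|lborel. wt q * compensated F \<kappa> q \<alpha>)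
     = (LINT q:{0..u}|lborel. wt q * f q) - (LINT q:{0..u}|lborel. wt q * I q)" .
  have Vm: "V * compensated F' \<kappa>' u \<alpha> - V * compensated F \<kappa> u \<alpha> = V * f u - V * I u"
    by (simp add: right_diff_distrib[symmetric] m)
  have eq: "damped c F' \<kappa>' k j u \<alpha> - damped c F \<kappa> k j u \<alpha>
     = V * f u - V * I u - ((LINT q:{0..u}|lborel. wt q * f q) - (LINT q:{0..u}|lborel. wt q * I q))"
    using wm Vm by (simp add: damped_def V_def wt_def)
  have 1: "\<bar>V * f u\<bar> \<le> \<xi> u * w (coord u \<alpha>)"
  proof (cases "path_integral c u \<alpha> \<le> real k + 1")
    case True
    have "\<bar>V * f u\<bar> \<le> \<bar>f u\<bar>" unfolding abs_mult V_def
      using cutoff_nonneg cutoff_le1 by (intro mult_left_le_one_le) auto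
    also have "\<dots> \<le> c (coord u \<alpha>) * \<bar>f u\<bar>" using mult_right_mono[OF clock_ge1, of "\<bar>f u\<bar>" "coord u \<alpha>"] by simp
    also have "\<dots> \<le> \<xi> u * w (coord u \<alpha>)" using chi1[OF True] by (simp add: w_eq)
    finally show ?thesis .
  next
    case False then show ?thesis using chi w0 by (simp add: V_def cutoff_eq0')
  qed
  have 2: "\<bar>V * I u\<bar> \<le> Q \<alpha>" unfolding V_def by (rule cutoff_times_bound[OF Q0 Ib[OF u]])
  have 3: "\<bar>LINT q:{0..u}|lborel. wt q * I q\<bar> \<le> Q \<alpha>"
    unfolding wt_def
  proof (rule weighted_integral_bound[OF order_refl u(1) Q0 lI])
    fix q assume "0 \<le> q" "q \<le> u" "weight c k j q \<alpha> \<noteq> 0"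
    then show "\<bar>I q\<bar> \<le> Q \<alpha>" using u weight_nonzeroD[of k j q \<alpha>] by (intro Ib) auto
  qed
  have 4: "\<bar>LINT q:{0..u}|lborel. wt q * f q\<bar> \<le> 4 * real (Suc j) * Q \<alpha>"
  proof -
    have "\<bar>LINT q:{0..u}|lborel. wt q * f q\<bar> \<le> (LINT q:{0..u}|lborel. \<bar>wt q * f q\<bar>)"
      by (intro abs_set_integral_le lbb_mult lwt lf order_refl)
    also have "\<dots> \<le> (LINT q:{0..u}|lborel. 4 * real (Suc j) * (\<xi> q * w (coord q \<alpha>)))"
    proof (intro lbb_mono lbb_abs lbb_mult[OF lwt lf] lbb_mult[OF lbb_const lw] order_refl)
      fix q
      show "\<bar>wt q * f q\<bar> \<le> 4 * real (Suc j) * (\<xi> q * w (coord q \<alpha>))"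
      proof (cases "wt q = 0")
        case True then show ?thesis using chi w0 by simp
      next
        case False
        then have "\<xi> q = 1" using weight_nonzeroD[of k j q \<alpha>] by (intro chi1) (simp add: wt_def)
        have "\<bar>wt q\<bar> = \<bar>cutoff_deriv k j (path_integral c q \<alpha>)\<bar> * c (coord q \<alpha>)"
          using c0 by (simp add: wt_def weight_def abs_mult)
        then have "\<bar>wt q\<bar> * \<bar>f q\<bar> \<le> (4 * real (Suc j) * c (coord q \<alpha>)) * \<bar>f q\<bar>"
          using cutoff_deriv_bound[of k j "path_integral c q \<alpha>"] c0 by (intro mult_right_mono) (auto intro: mult_right_mono)
        also have "\<dots> \<le> 4 * real (Suc j) * w (coord q \<alpha>)" unfolding w_eq mult.assoc
          by (intro mult_left_mono) auto
        finally show ?thesis using \<open>\<xi> q = 1\<close> by (simp add: abs_mult)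
      qed
    qed
    also have "\<dots> = 4 * real (Suc j) * (LINT q:{0..u}|lborel. \<xi> q * w (coord q \<alpha>))" by simp
    also have "\<dots> \<le> 4 * real (Suc j) * Q \<alpha>" using sub[OF u] by (intro mult_left_mono) auto
    finally show ?thesis .
  qed
  have tri: "\<bar>x - y - (z - v)\<bar> \<le> a + (2 + r) * b" if "\<bar>x\<bar> \<le> a" "\<bar>y\<bar> \<le> b" "\<bar>z\<bar> \<le> r * b" "\<bar>v\<bar> \<le> b" for x y z v a b r :: real
  proof -
    have "\<bar>x - y - (z - v)\<bar> \<le> \<bar>x\<bar> + \<bar>y\<bar> + \<bar>z\<bar> + \<bar>v\<bar>" by linarith
    then show ?thesis using that by (simp add: distrib_right)
  qed
  show ?thesis unfolding eq \<xi>_def[symmetric] by (rule tri[OF 1 2 4 3])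
qed

text \<open>The error at the present time integrates to another multiple of the clock-limited integral of
  the errors.\<close>

lemma damped_window_difference:
  fixes k :: nat
  assumes C': "clocked c F' \<kappa>' B'" and ab: "0 \<le> a" "a \<le> b" "b \<le> T"
  defines "w \<equiv> \<lambda>x. \<bar>\<kappa>' x - \<kappa> x\<bar> + c x * \<bar>F' x - F x\<bar>"
  defines "Q \<equiv> \<lambda>\<alpha>. LINT q:{0..T}|lborel. cutoff (k+1) 0 (path_integral c q \<alpha>) * w (coord q \<alpha>)"
  shows "\<bar>(LINT u:{a..b}|lborel. damped c F' \<kappa>' k j u \<alpha>) - (LINT u:{a..b}|lborel. damped c F \<kappa> k j u \<alpha>)\<bar>
    \<le> (1 + T * (2 + 4 * real (Suc j))) * Q \<alpha>"
proof -
  interpret C': clocked c F' \<kappa>' B' by (rule C')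
  define \<xi> where "\<xi> q = cutoff (k+1) 0 (path_integral c q \<alpha>)" for q
  define K where "K = (2 + 4 * real (Suc j)) * Q \<alpha>"
  have chi: "0 \<le> \<xi> q" for q by (simp add: \<xi>_def cutoff_nonneg)
  have w0: "0 \<le> w x" for x using clock_ge1[of x] by (simp add: w_def)
  have lw: "locally_bounded_borel (\<lambda>q. \<xi> q * w (coord q \<alpha>))"
    unfolding \<xi>_def[abs_def] w_def
    by (intro lbb_mult lbb_cutoff lbb_add lbb_abs lbb_diff C'.lbb_compensator lbb_compensator lbb_clock
        lbb_rcll rcll_compose[OF rcll_coord] C'.F_continuous F_continuous)
  have ld: "locally_bounded_borel (\<lambda>u. damped c F' \<kappa>' k j u \<alpha> - damped c F \<kappa> k j u \<alpha>)"
    by (intro lbb_diff C'.lbb_damped lbb_damped)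
  have Q_eq: "Q \<alpha> = (LINT q:{0..T}|lborel. \<xi> q * w (coord q \<alpha>))" by (simp add: Q_def \<xi>_def)
  have nn: "0 \<le> (LINT q:{p..r}|lborel. \<xi> q * w (coord q \<alpha>))" for p r unfolding set_lebesgue_integral_def
    by (intro integral_nonneg_AE AE_I2) (simp add: indicator_def chi w0)
  have Q0: "0 \<le> Q \<alpha>" unfolding Q_eq by (rule nn)
  have K0: "0 \<le> K" unfolding K_def using Q0 by (intro mult_nonneg_nonneg) auto
  have "(LINT u:{a..b}|lborel. damped c F' \<kappa>' k j u \<alpha>) - (LINT u:{a..b}|lborel. damped c F \<kappa> k j u \<alpha>)
     = (LINT u:{a..b}|lborel. damped c F' \<kappa>' k j u \<alpha> - damped c F \<kappa> k j u \<alpha>)"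
    by (rule set_integral_diff(2)[symmetric]) (intro lbb_integrable C'.lbb_damped lbb_damped ab)+
  then have "\<bar>(LINT u:{a..b}|lborel. damped c F' \<kappa>' k j u \<alpha>) - (LINT u:{a..b}|lborel. damped c F \<kappa> k j u \<alpha>)\<bar>
     \<le> (LINT u:{a..b}|lborel. \<bar>damped c F' \<kappa>' k j u \<alpha> - damped c F \<kappa> k j u \<alpha>\<bar>)"
    using abs_set_integral_le[OF ld ab(1), of b] by simp
  also have "\<dots> \<le> (LINT u:{a..b}|lborel. \<xi> u * w (coord u \<alpha>) + K)"
  proof (intro lbb_mono lbb_abs ld lbb_add[OF lw lbb_const] ab)
    fix u assume "a \<le> u" "u \<le> b"
    then show "\<bar>damped c F' \<kappa>' k j u \<alpha> - damped c F \<kappa> k j u \<alpha>\<bar> \<le> \<xi> u * w (coord u \<alpha>) + K"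
      unfolding \<xi>_def K_def Q_def w_def using ab by (intro damped_difference[OF C']) auto
  qed
  also have "\<dots> = (LINT u:{a..b}|lborel. \<xi> u * w (coord u \<alpha>)) + (b - a) * K"
    using ab by (subst set_integral_add) (auto intro!: lbb_integrable lw lbb_const simp: set_integral_const_Icc)
  also have "\<dots> \<le> Q \<alpha> + T * K"
  proof (rule add_mono)
    have "Q \<alpha> = (LINT u:{0..a}|lborel. \<xi> u * w (coord u \<alpha>)) + ((LINT u:{a..b}|lborel. \<xi> u * w (coord u \<alpha>))
       + (LINT u:{b..T}|lborel. \<xi> u * w (coord u \<alpha>)))"
      using lbb_split[OF lw order_refl ab(1), of T] lbb_split[OF lw ab(1) ab(2) ab(3)] ab by (simp add: Q_eq)
    then show "(LINT u:{a..b}|lborel. \<xi> u * w (coord u \<alpha>)) \<le> Q \<alpha>" using nn[of 0 a] nn[of b T] by linarith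
    show "(b - a) * K \<le> T * K" using ab K0 by (intro mult_right_mono) auto
  qed
  finally show ?thesis unfolding K_def by (simp add: algebra_simps)
qed

lemma damped_window_expectation:
  assumes P: "path_prob P" and comp: "compensates P F \<kappa>"
    and v: "0 \<le> v" "v \<le> a" "a \<le> b"
    and Z: "Z \<in> borel_measurable (path_filtration (ennreal v))" "\<And>\<alpha>. \<bar>Z \<alpha>\<bar> \<le> E"
  shows "(\<integral>\<alpha>. Z \<alpha> * (LINT u:{a..b}|lborel. damped c F \<kappa> k j u \<alpha>) \<partial>P)
     = (b - a) * (\<integral>\<alpha>. Z \<alpha> * damped c F \<kappa> k j v \<alpha> \<partial>P)"
proof -
  interpret prob_space P using P by (simp add: path_prob_def)
  interpret PL: pair_sigma_finite P lborel ..
  have b0: "0 \<le> b" using v by simp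
  have E: "0 \<le> E" using Z(2)[of undefined] by linarith
  define D where "D = 2 * (B + real k + 1)"
  have D: "0 \<le> D" using B_nonneg by (simp add: D_def)
  define N where "N u \<alpha> = damped c F \<kappa> k j u \<alpha>" for u \<alpha>
  have Nb: "\<bar>N u \<alpha>\<bar> \<le> D" if "0 \<le> u" for u \<alpha> unfolding N_def D_def by (rule damped_bound[OF that])
  define f where "f \<alpha> u = indicator {a..b} u * (Z \<alpha> * N (clip b u) \<alpha>)" for \<alpha> u
  have ZP[measurable]: "Z \<in> borel_measurable P" by (rule path_prob_measurable[OF P Z(1)])
  have NP: "(\<lambda>p. N (clip b (snd p)) (fst p)) \<in> borel_measurable (P \<Otimes>\<^sub>M borel)"
    unfolding N_def using progressive_damped b0
    by (intro path_prob_measurable_pair[OF P, of _ "ennreal b"]) (simp add: progressive_def)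
  have lb: "measurable (P \<Otimes>\<^sub>M lborel) M = measurable (P \<Otimes>\<^sub>M borel) M" for M :: "real measure"
    by (intro measurable_cong_sets sets_pair_measure_cong refl) simp
  have fm: "(\<lambda>p. f (fst p) (snd p)) \<in> borel_measurable (P \<Otimes>\<^sub>M lborel)"
    unfolding f_def lb using NP by measurable
  have fs: "f \<alpha> u = indicator {a..b} u *\<^sub>R (Z \<alpha> * N u \<alpha>)" for \<alpha> u
    using v by (auto simp: f_def indicator_def clip_id)
  have fb: "\<bar>f \<alpha> u\<bar> \<le> indicator {a..b} u *\<^sub>R (E * D)" for \<alpha> u
    unfolding fs using v Nb[of u \<alpha>] Z(2)[of \<alpha>] E by (auto simp: indicator_def abs_mult intro!: mult_mono)
  have constint: "integrable lborel (\<lambda>u. indicator {a..b} u *\<^sub>R (E * D))"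
    using lbb_integrable[OF lbb_const order_trans[OF v(1,2)], of b "E * D"] by (simp add: set_integrable_def)
  have fsi: "integrable lborel (f \<alpha>)" for \<alpha>
    unfolding fs N_def using lbb_integrable[OF lbb_mult[OF lbb_const lbb_damped] order_trans[OF v(1,2)]]
    by (simp add: set_integrable_def)
  have fint: "integrable (P \<Otimes>\<^sub>M lborel) (case_prod f)"
  proof (rule PL.Fubini_integrable)
    show "case_prod f \<in> borel_measurable (P \<Otimes>\<^sub>M lborel)" using fm by (simp add: split_beta')
    show "integrable P (\<lambda>\<alpha>. \<integral>u. norm (case_prod f (\<alpha>, u)) \<partial>lborel)"
    proof (rule integrable_bounded_path[OF P])
      show "(\<lambda>\<alpha>. \<integral>u. norm (case_prod f (\<alpha>, u)) \<partial>lborel) \<in> borel_measurable P"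
        using fm by (intro lborel.borel_measurable_lebesgue_integral) (simp add: split_beta')
      fix \<alpha>
      have "(\<integral>u. norm (case_prod f (\<alpha>, u)) \<partial>lborel) \<le> (\<integral>u. indicator {a..b} u *\<^sub>R (E * D) \<partial>lborel)"
        using fsi[of \<alpha>] constint fb by (intro integral_mono) auto
      then show "\<bar>\<integral>u. norm (case_prod f (\<alpha>, u)) \<partial>lborel\<bar> \<le> (\<integral>u. indicator {a..b} u *\<^sub>R (E * D) \<partial>lborel)" by simp
    qed
    show "AE \<alpha> in P. integrable lborel (\<lambda>u. case_prod f (\<alpha>, u))" using fsi by simp
  qed
  have "(\<integral>\<alpha>. Z \<alpha> * (LINT u:{a..b}|lborel. N u \<alpha>) \<partial>P) = (\<integral>\<alpha>. (\<integral>u. f \<alpha> u \<partial>lborel) \<partial>P)"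
    unfolding fs set_lebesgue_integral_def
    by (intro Bochner_Integration.integral_cong refl) (simp flip: integral_mult_right_zero add: ac_simps)
  also have "\<dots> = (\<integral>u. (\<integral>\<alpha>. f \<alpha> u \<partial>P) \<partial>lborel)" using PL.Fubini_integral[OF fint] by simp
  also have "\<dots> = (\<integral>u. indicator {a..b} u *\<^sub>R (\<integral>\<alpha>. Z \<alpha> * N v \<alpha> \<partial>P) \<partial>lborel)"
  proof (rule Bochner_Integration.integral_cong[OF refl])
    fix u
    show "(\<integral>\<alpha>. f \<alpha> u \<partial>P) = indicator {a..b} u *\<^sub>R (\<integral>\<alpha>. Z \<alpha> * N v \<alpha> \<partial>P)"
    proof (cases "u \<in> {a..b}")
      case True
      then have "(\<integral>\<alpha>. Z \<alpha> * N u \<alpha> \<partial>P) = (\<integral>\<alpha>. Z \<alpha> * N v \<alpha> \<partial>P)"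
        unfolding N_def using v
        by (intro damped_martingale[OF P comp[unfolded compensates_def] v(1) _ Z]) auto
      then show ?thesis using True by (simp add: fs)
    qed (simp add: fs)
  qed
  also have "\<dots> = (b - a) * (\<integral>\<alpha>. Z \<alpha> * N v \<alpha> \<partial>P)"
    using set_integral_const_Icc[OF v(3)] by (simp add: set_lebesgue_integral_def)
  finally show ?thesis by (simp add: N_def)
qed

end

text \<open>The window \<open>[a + p e, a + p e + e]\<close> has length \<open>e\<close> and opens \<open>p\<close> window lengths after \<open>a\<close>.\<close>

lemma window_average_tendsto:
  fixes y :: "real \<Rightarrow> real"
  assumes y: "rcll y" and a: "0 \<le> a" and p: "0 \<le> p"
  defines "e \<equiv> \<lambda>i. 1 / real (Suc i)"
  shows "(\<lambda>i. (LINT u:{a + p * e i..a + p * e i + e i}|lborel. y u) / e i) \<longlonglongrightarrow> y a"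
proof (rule tendstoI)
  fix r :: real assume r: "r > 0"
  from tendstoD[OF rcll_right[OF y], of "r/2" a] r obtain d where d: "a < d" "\<And>u. a < u \<Longrightarrow> u < d \<Longrightarrow> dist (y u) (y a) < r/2"
    unfolding eventually_at_right_field by auto
  have "(\<lambda>i. (p + 1) * e i) \<longlonglongrightarrow> (p + 1) * 0"
    unfolding e_def using LIMSEQ_inverse_real_of_nat by (intro tendsto_mult_left) (simp add: inverse_eq_divide)
  then have "\<forall>\<^sub>F i in sequentially. (p + 1) * e i < d - a" using d(1) by (intro order_tendstoD(2)) auto
  then show "\<forall>\<^sub>F i in sequentially. dist ((LINT u:{a + p * e i..a + p * e i + e i}|lborel. y u) / e i) (y a) < r"
  proof eventually_elim
    fix i assume i: "(p + 1) * e i < d - a"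
    have e: "e i > 0" by (simp add: e_def)
    have pe: "0 \<le> p * e i" using p e by simp
    have ly: "locally_bounded_borel y" using y by (rule lbb_rcll)
    have a0: "0 \<le> a + p * e i" using a pe by simp
    have "\<bar>LINT u:{a + p * e i..a + p * e i + e i}|lborel. y u - y a\<bar> \<le> r/2 * (a + p * e i + e i - (a + p * e i))"
    proof (rule lbb_integral_bound[OF lbb_diff[OF ly lbb_const] a0])
      fix u assume u: "a + p * e i \<le> u" "u \<le> a + p * e i + e i"
      show "\<bar>y u - y a\<bar> \<le> r/2"
      proof (cases "u = a")
        case False
        then have "a < u" "u < d" using u pe i by (auto simp: algebra_simps)
        then show ?thesis using d(2)[of u] by (simp add: dist_real_def)
      qed (use r in simp)
    qed (use e in simp)
    moreover have "(LINT u:{a + p * e i..a + p * e i + e i}|lborel. y u - y a) = (LINT u:{a + p * e i..a + p * e i + e i}|lborel. y u) - e i * y a"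
      using e by (subst set_integral_diff) (auto intro!: lbb_integrable ly lbb_const a0 simp: set_integral_const_Icc)
    ultimately have "\<bar>(LINT u:{a + p * e i..a + p * e i + e i}|lborel. y u) - e i * y a\<bar> \<le> r/2 * e i" by simp
    moreover have "(LINT u:{a + p * e i..a + p * e i + e i}|lborel. y u) / e i - y a = ((LINT u:{a + p * e i..a + p * e i + e i}|lborel. y u) - e i * y a) / e i"
      using e by (simp add: field_simps)
    ultimately have "\<bar>(LINT u:{a + p * e i..a + p * e i + e i}|lborel. y u) / e i - y a\<bar> \<le> r/2"
      using e by (simp add: abs_divide pos_divide_le_eq)
    then show "dist ((LINT u:{a + p * e i..a + p * e i + e i}|lborel. y u) / e i) (y a) < r" using r by (simp add: dist_real_def)
  qed
qed

text \<open>The events determined by finitely many evaluations in open sets generate the filtration and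
  are closed under intersection.\<close>

lemma path_filtration_dynkin:
  fixes Y :: "'b::metric_space cadlag_path \<Rightarrow> real"
  assumes P: "path_prob P" and Y: "integrable P Y" and s: "0 \<le> s"
    and eq: "\<And>J. finite J \<Longrightarrow> J \<subseteq> {0..s} \<times> {U. open U} \<Longrightarrow>
      (\<integral>\<alpha>. indicator {\<alpha>. \<forall>(r, U)\<in>J. coord r \<alpha> \<in> U} \<alpha> * Y \<alpha> \<partial>P) = 0"
    and A: "A \<in> sets (path_filtration (ennreal s))"
  shows "(\<integral>\<alpha>. indicator A \<alpha> * Y \<alpha> \<partial>P) = 0"
proof -
  define C where "C J = {\<alpha> :: 'b cadlag_path. \<forall>(r, U)\<in>J. coord r \<alpha> \<in> U}" for J :: "(real \<times> 'b set) set"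
  define G where "G = {C J | J. finite J \<and> J \<subseteq> {0..s} \<times> {U. open U}}"
  have "Int_stable G"
  proof (rule Int_stableI)
    fix a b assume "a \<in> G" "b \<in> G"
    then obtain J K where J: "a = C J" "finite J" "J \<subseteq> {0..s} \<times> {U. open U}"
      and K: "b = C K" "finite K" "K \<subseteq> {0..s} \<times> {U. open U}" by (auto simp: G_def)
    have "a \<inter> b = C (J \<union> K)" unfolding J K C_def by blast
    then show "a \<inter> b \<in> G" unfolding G_def using J K by blast
  qed
  have CF: "C J \<in> sets (path_filtration (ennreal s))" if J: "finite J" "J \<subseteq> {0..s} \<times> {U. open U}" for J
  proof -
    have "C J = (\<Inter>p\<in>J. coord (fst p) -` (snd p) \<inter> space (path_filtration (ennreal s))) \<inter> space (path_filtration (ennreal s))"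
      by (auto simp: C_def)
    also have "\<dots> \<in> sets (path_filtration (ennreal s))"
    proof (cases "J = {}")
      case False
      have "coord (fst p) -` (snd p) \<inter> space (path_filtration (ennreal s)) \<in> sets (path_filtration (ennreal s))" if "p \<in> J" for p
        using J(2) that s by (intro measurable_sets[OF measurable_coord]) (auto intro!: ennreal_leI)
      then show ?thesis using J(1) False by (intro sets.Int sets.finite_INT sets.top) auto
    qed (use sets.top[of "path_filtration (ennreal s)"] in simp)
    finally show ?thesis .
  qed
  have sub: "sets (path_filtration (ennreal s)) \<subseteq> sigma_sets UNIV G"
  proof -
    have "coord r \<in> borel_measurable (sigma UNIV G)" if r: "0 \<le> r" "r \<le> s" for r
    proof (rule borel_measurableI)
      fix U :: "'b set" assume "open U"
      then have "C {(r, U)} \<in> G" unfolding G_def using r by (intro CollectI exI[of _ "{(r, U)}"]) auto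
      then show "coord r -` U \<inter> space (sigma UNIV G) \<in> sets (sigma UNIV G)"
        by (simp add: C_def vimage_def space_measure_of_conv)
    qed
    then have "coord r -` S \<in> sigma_sets UNIV G" if "0 \<le> r" "r \<le> s" "S \<in> sets borel" for r S
      using measurable_sets[of "coord r" "sigma UNIV G" borel S] that by (simp add: space_measure_of_conv)
    then have "{coord r -` S | r S. 0 \<le> r \<and> ennreal r \<le> ennreal s \<and> S \<in> sets borel} \<subseteq> sigma_sets UNIV G"
      using s by (auto simp: ennreal_le_iff)
    from sigma_sets_mono[OF this] show ?thesis
      unfolding path_filtration_def by (subst sets_measure_of) simp_all
  qed
  have GP: "sigma_sets UNIV G \<subseteq> sets P"
  proof -
    have "G \<subseteq> sets P" unfolding G_def using CF path_prob_subalgebra[OF P] by (auto simp: subalgebra_def)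
    then show ?thesis using sets.sigma_sets_subset[of G P] path_prob_space[OF P] by simp
  qed
  have AG: "A \<in> sigma_sets UNIV G" using A sub by blast
  have G_Pow: "G \<subseteq> Pow UNIV" by simp
  have int: "integrable P (\<lambda>\<alpha>. indicator S \<alpha> * Y \<alpha>)" if "S \<in> sigma_sets UNIV G" for S
    using integrable_mult_indicator[of S P Y] that GP Y by auto
  show ?thesis
    using \<open>Int_stable G\<close> G_Pow AG
  proof (induct rule: sigma_sets_induct_disjoint)
    case (basic S)
    then show ?case using eq by (auto simp: G_def C_def)
  next
    case empty show ?case by simp
  next
    case (compl S)
    have "C {} \<in> G" unfolding G_def by blast
    then have "(\<integral>\<alpha>. indicator UNIV \<alpha> * Y \<alpha> \<partial>P) = 0" using eq[of "{}"] by simp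
    moreover have "(\<integral>\<alpha>. indicator (UNIV - S) \<alpha> * Y \<alpha> \<partial>P) = (\<integral>\<alpha>. indicator UNIV \<alpha> * Y \<alpha> - indicator S \<alpha> * Y \<alpha> \<partial>P)"
      by (intro Bochner_Integration.integral_cong refl) (auto simp: indicator_def)
    moreover have "\<dots> = (\<integral>\<alpha>. indicator UNIV \<alpha> * Y \<alpha> \<partial>P) - (\<integral>\<alpha>. indicator S \<alpha> * Y \<alpha> \<partial>P)"
      using int[OF compl(1)] Y by (intro Bochner_Integration.integral_diff) auto
    ultimately show ?case using compl(2) by simp
  next
    case (union S)
    have "set_integrable P (\<Union>i. S i) Y"
      unfolding set_integrable_def using integrable_mult_indicator[of "\<Union>i. S i" P Y] Y union(2) GP by blast
    moreover have "S i \<in> sets P" for i using union(2) GP by blast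
    ultimately have "(LINT \<alpha>:(\<Union>i. S i)|P. Y \<alpha>) = (\<Sum>i. LINT \<alpha>:S i|P. Y \<alpha>)"
      using union(1) by (intro lebesgue_integral_countable_add) (auto simp: disjoint_family_on_def)
    then show ?case using union(3) by (simp add: set_lebesgue_integral_def)
  qed
qed

lemma prod_unit_interval:
  fixes g :: "'i \<Rightarrow> real"
  assumes "\<And>i. i \<in> J \<Longrightarrow> 0 \<le> g i \<and> g i \<le> 1"
  shows "0 \<le> (\<Prod>i\<in>J. g i)" "(\<Prod>i\<in>J. g i) \<le> 1"
  using assms by (auto intro!: prod_nonneg prod_le_1)

lemma lbb_unit_integral:
  assumes "locally_bounded_borel y" "0 \<le> a" "e > 0" "\<And>u. 0 \<le> y u \<and> y u \<le> 1"
  shows "0 \<le> (LINT u:{a..a+e}|lborel. y u) / e \<and> (LINT u:{a..a+e}|lborel. y u) / e \<le> 1"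
proof -
  have "0 \<le> (LINT u:{a..a+e}|lborel. y u)"
    unfolding set_lebesgue_integral_def using assms(4) by (intro integral_nonneg_AE AE_I2) auto
  moreover have "\<bar>LINT u:{a..a+e}|lborel. y u\<bar> \<le> 1 * (a + e - a)"
    using assms by (intro lbb_integral_bound) auto
  ultimately show ?thesis using assms(3) by simp
qed

text \<open>Averages over a short time window are Skorokhod-continuous, so the martingale identity passes
  to the weak limit for averaged processes and averaged past observations; the windows of the
  observations close before those of the process open. Afterwards the windows shrink.\<close>

lemma (in clocked) weak_limit_identity:
  fixes Pn :: "nat \<Rightarrow> 'b cadlag_path measure" and f :: "'i \<Rightarrow> 'b \<Rightarrow> real"
  assumes P: "path_prob P" "\<And>n. path_prob (Pn n)" and conv: "weakly_converges Pn P"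
    and k_cont: "continuous_on UNIV \<kappa>"
    and Cn: "\<And>n. clocked c (Fn n) (\<kappa>n n) B"
    and comp: "\<And>n. compensates (Pn n) (Fn n) (\<kappa>n n)"
    and lim: "\<And>S. compact S \<Longrightarrow> uniform_limit S (\<lambda>n x. \<bar>Fn n x - F x\<bar> + \<bar>\<kappa>n n x - \<kappa> x\<bar>) (\<lambda>_. 0) sequentially"
    and st: "0 \<le> s" "s \<le> t"
    and J: "finite J" "\<And>i. i \<in> J \<Longrightarrow> 0 \<le> r i \<and> r i \<le> s"
    and f: "\<And>i. i \<in> J \<Longrightarrow> continuous_on UNIV (f i)" "\<And>i x. i \<in> J \<Longrightarrow> 0 \<le> f i x \<and> f i x \<le> 1"
  shows "(\<integral>\<alpha>. (\<Prod>i\<in>J. f i (coord (r i) \<alpha>)) * (damped c F \<kappa> k j t \<alpha> - damped c F \<kappa> k j s \<alpha>) \<partial>P) = 0"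
proof -
  define N where "N u \<alpha> = damped c F \<kappa> k j u \<alpha>" for u \<alpha>
  define D where "D = 2 * (B + real k + 1)"
  have D: "0 \<le> D" using B_nonneg by (simp add: D_def)
  have Nb: "\<bar>N u \<alpha>\<bar> \<le> D" if "0 \<le> u" for u \<alpha> unfolding N_def D_def by (rule damped_bound[OF that])
  have lN: "locally_bounded_borel (\<lambda>u. N u \<alpha>)" for \<alpha> unfolding N_def by (rule lbb_damped)
  have lf: "locally_bounded_borel (\<lambda>u. f i (coord u \<alpha>))" if "i \<in> J" for i \<alpha>
    by (rule lbb_rcll[OF rcll_compose[OF rcll_coord f(1)[OF that]]])
  have t0: "0 \<le> t" using st by simp
  define Zf where "Zf e \<alpha> = (\<Prod>i\<in>J. (LINT u:{r i..r i + e}|lborel. f i (coord u \<alpha>)) / e)" for e \<alpha>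
  have Z01: "0 \<le> Zf e \<alpha>" "Zf e \<alpha> \<le> 1" if e: "e > 0" for e \<alpha>
    unfolding Zf_def by (intro prod_unit_interval lbb_unit_integral lf e f; use J in auto)+
  have Z_meas: "Zf e \<in> borel_measurable (path_filtration (ennreal (s + e)))" if e: "e > 0" for e
    unfolding Zf_def[abs_def]
  proof (intro borel_measurable_prod borel_measurable_divide borel_measurable_const progressive_integral_adapted
      progressive_compose[OF progressive_coord] borel_measurable_continuous_onI f(1))
    fix i assume "i \<in> J"
    then show "0 \<le> r i" "r i + e \<le> s + e" using J(2) by auto
  qed (use st e in auto)
  \<comment> \<open>the delay by one window length makes the observations in \<open>Zf\<close> past events when the window opens\<close>
  define W where "W e a \<alpha> = (LINT u:{a + 1 * e..a + 1 * e + e}|lborel. N u \<alpha>)" for e a \<alpha>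
  have Wb: "\<bar>W e a \<alpha>\<bar> \<le> D * e" if e: "e > 0" and a: "0 \<le> a" for e a \<alpha>
  proof -
    have "\<bar>W e a \<alpha>\<bar> \<le> D * (a + 1 * e + e - (a + 1 * e))"
      unfolding W_def using e a by (intro lbb_integral_bound lN Nb) auto
    then show ?thesis by simp
  qed
  have W_meas: "W e a \<in> borel_measurable (path_filtration (ennreal (a + 1 * e + e)))" if e: "e > 0" and a: "0 \<le> a" for e a
    unfolding W_def[abs_def] N_def using e a by (intro progressive_integral_adapted progressive_damped) auto
  define H where "H e \<alpha> = Zf e \<alpha> * (W e t \<alpha> - W e s \<alpha>)" for e \<alpha>
  have Hb: "\<bar>H e \<alpha>\<bar> \<le> 2 * (D * e)" if e: "e > 0" for e \<alpha>
  proof -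
    have "\<bar>W e t \<alpha> - W e s \<alpha>\<bar> \<le> 2 * (D * e)" using Wb[OF e t0, of \<alpha>] Wb[OF e st(1), of \<alpha>] by linarith
    moreover have "\<bar>H e \<alpha>\<bar> \<le> \<bar>W e t \<alpha> - W e s \<alpha>\<bar>"
      unfolding H_def abs_mult using Z01[OF e, of \<alpha>] by (intro mult_left_le_one_le) auto
    ultimately show ?thesis by linarith
  qed
  have H_meas: "H e \<in> borel_measurable Q" if e: "e > 0" and Q: "path_prob Q" for e Q
    unfolding H_def[abs_def]
    by (intro borel_measurable_times borel_measurable_diff path_prob_measurable[OF Q Z_meas[OF e]]
        path_prob_measurable[OF Q W_meas[OF e t0]] path_prob_measurable[OF Q W_meas[OF e st(1)]])
  have EH: "(\<integral>\<alpha>. H e \<alpha> \<partial>P) = 0" if e: "e > 0" for e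
  proof -
    have "continuous_on UNIV (H e)"
    proof (rule continuous_on_path_space)
      fix \<alpha>n and \<alpha> :: "'b cadlag_path" assume sk: "skorokhod_conv \<alpha>n \<alpha>"
      show "(\<lambda>n. H e (\<alpha>n n)) \<longlonglongrightarrow> H e \<alpha>"
        unfolding H_def Zf_def W_def N_def
      proof (intro tendsto_mult tendsto_prod tendsto_divide tendsto_const tendsto_diff
          skorokhod_regular_integral_tendsto[OF _ sk] skorokhod_regular_damped[OF k_cont] skorokhod_regular_coord f(1))
        fix i assume i: "i \<in> J"
        show "locally_bounded (f i)" by (rule bounded_imp_locally_bounded[of _ 1]) (use f(2)[OF i] in auto)
        show "0 \<le> r i" using J(2)[OF i] by simp
      qed (use e st in auto)
    qed
    moreover have "bounded (range (H e))" unfolding bounded_real using Hb[OF e] by blast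
    ultimately have lim1: "(\<lambda>n. \<integral>\<alpha>. H e \<alpha> \<partial>Pn n) \<longlonglongrightarrow> (\<integral>\<alpha>. H e \<alpha> \<partial>P)"
      using conv unfolding weakly_converges_def by blast
    define T where "T = t + 2 * e"
    have T: "0 \<le> T" using t0 e by (simp add: T_def)
    define w where "w n x = \<bar>\<kappa>n n x - \<kappa> x\<bar> + c x * \<bar>Fn n x - F x\<bar>" for n x
    define Q where "Q n \<alpha> = (LINT q:{0..T}|lborel. cutoff (k+1) 0 (path_integral c q \<alpha>) * w n (coord q \<alpha>))" for n \<alpha>
    have c0: "0 \<le> c x" for x using clock_ge1[of x] by linarith
    have w0: "0 \<le> w n x" for n x using c0[of x] by (simp add: w_def)
    have wb: "w n x \<le> (2 + 2 * B) * c x" for n x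
    proof -
      have "\<bar>\<kappa>n n x - \<kappa> x\<bar> \<le> 2 * c x"
        using clocked.compensator_bound[OF Cn, of n x] compensator_bound[of x] by linarith
      moreover have "c x * \<bar>Fn n x - F x\<bar> \<le> c x * (2 * B)"
        using clocked.F_bound[OF Cn, of n x] F_bound[of x] by (intro mult_left_mono c0) linarith
      ultimately show ?thesis by (simp add: w_def algebra_simps)
    qed
    have w_borel: "w n \<in> borel_measurable borel" for n
      unfolding w_def[abs_def]
      using compensator_borel clocked.compensator_borel[OF Cn[of n]] clock_borel
        borel_measurable_continuous_onI[OF F_continuous] borel_measurable_continuous_onI[OF clocked.F_continuous[OF Cn[of n]]]
      by measurable
    have Q_lim: "(\<lambda>n. \<integral>\<alpha>. Q n \<alpha> \<partial>Pn n) \<longlonglongrightarrow> 0"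
      unfolding Q_def
    proof (rule vanishing_errors[OF P conv w_borel w0 wb _ T])
      fix S :: "'b set" assume S: "compact S"
      have "compact (c ` S)" by (intro compact_continuous_image continuous_on_subset[OF clock_continuous] S) auto
      then have "bounded (c ` S)" by (rule compact_imp_bounded)
      then obtain C where C0: "\<forall>y\<in>c ` S. norm y \<le> C" unfolding bounded_iff by blast
      define C1 where "C1 = max 1 C"
      have C1: "c x \<le> C1" if "x \<in> S" for x using C0 that by (auto simp: C1_def)
      have C1p: "1 \<le> C1" by (simp add: C1_def)
      show "uniform_limit S w (\<lambda>_. 0) sequentially"
        unfolding uniform_limit_iff
      proof (intro allI impI)
        fix d :: real assume "d > 0"
        then have "d / C1 > 0" using C1p by simp
        then have "\<forall>\<^sub>F n in sequentially. \<forall>x\<in>S. dist (\<bar>Fn n x - F x\<bar> + \<bar>\<kappa>n n x - \<kappa> x\<bar>) 0 < d / C1"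
          using lim[OF S] unfolding uniform_limit_iff by blast
        then show "\<forall>\<^sub>F n in sequentially. \<forall>x\<in>S. dist (w n x) 0 < d"
        proof eventually_elim
          fix n assume n: "\<forall>x\<in>S. dist (\<bar>Fn n x - F x\<bar> + \<bar>\<kappa>n n x - \<kappa> x\<bar>) 0 < d / C1"
          show "\<forall>x\<in>S. dist (w n x) 0 < d"
          proof
            fix x assume x: "x \<in> S"
            have "w n x \<le> C1 * \<bar>\<kappa>n n x - \<kappa> x\<bar> + C1 * \<bar>Fn n x - F x\<bar>"
              unfolding w_def using C1p C1[OF x] mult_right_mono[OF C1p, of "\<bar>\<kappa>n n x - \<kappa> x\<bar>"]
              by (intro add_mono mult_right_mono) auto
            also have "\<dots> < d" using bspec[OF n x] C1p by (simp add: field_simps)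
            finally show "dist (w n x) 0 < d" using c0[of x] by (simp add: w_def)
          qed
        qed
      qed
    qed
    define K where "K = 2 * (1 + T * (2 + 4 * real (Suc j)))"
    have bound: "\<bar>\<integral>\<alpha>. H e \<alpha> \<partial>Pn n\<bar> \<le> K * (\<integral>\<alpha>. Q n \<alpha> \<partial>Pn n)" for n
    proof -
      interpret Cn: clocked c "Fn n" "\<kappa>n n" B by (rule Cn)
      \<comment> \<open>the windows for the \<open>n\<close>-th pair, for which the identity holds exactly under \<open>Pn n\<close>\<close>
      define W' where "W' a \<alpha> = (LINT u:{a + 1 * e..a + 1 * e + e}|lborel. damped c (Fn n) (\<kappa>n n) k j u \<alpha>)" for a \<alpha>
      have W'_b: "\<bar>W' a \<alpha>\<bar> \<le> D * e" if a: "0 \<le> a" for a \<alpha>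
      proof -
        have "\<bar>W' a \<alpha>\<bar> \<le> D * (a + 1 * e + e - (a + 1 * e))"
          unfolding W'_def D_def using e a by (intro lbb_integral_bound Cn.lbb_damped Cn.damped_bound) auto
        then show ?thesis by simp
      qed
      have W'_meas: "W' a \<in> borel_measurable (Pn n)" if a: "0 \<le> a" for a
        unfolding W'_def[abs_def] using e a
        by (intro path_prob_measurable[OF P(2), of _ "ennreal (a + 1 * e + e)"] progressive_integral_adapted Cn.progressive_damped) auto
      have ZP: "Zf e \<in> borel_measurable (Pn n)" by (rule path_prob_measurable[OF P(2) Z_meas[OF e]])
      have ZW: "(\<integral>\<alpha>. Zf e \<alpha> * W' a \<alpha> \<partial>Pn n) = e * (\<integral>\<alpha>. Zf e \<alpha> * damped c (Fn n) (\<kappa>n n) k j (s + e) \<alpha> \<partial>Pn n)"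
        if a: "s \<le> a" for a
        unfolding W'_def
        by (subst Cn.damped_window_expectation[OF P(2) comp _ _ _ Z_meas[OF e], of _ _ 1])
           (use a e st Z01[OF e] in auto)
      have iZW: "integrable (Pn n) (\<lambda>\<alpha>. Zf e \<alpha> * W' a \<alpha>)" if a: "0 \<le> a" for a
      proof (rule integrable_bounded_path[where D="D * e", OF P(2) borel_measurable_times[OF ZP W'_meas[OF a]]])
        fix \<alpha>
        have "\<bar>Zf e \<alpha> * W' a \<alpha>\<bar> \<le> \<bar>W' a \<alpha>\<bar>"
          unfolding abs_mult using Z01[OF e, of \<alpha>] by (intro mult_left_le_one_le) auto
        then show "\<bar>Zf e \<alpha> * W' a \<alpha>\<bar> \<le> D * e" using W'_b[OF a, of \<alpha>] by linarith
      qed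
      define H' where "H' \<alpha> = Zf e \<alpha> * (W' t \<alpha> - W' s \<alpha>)" for \<alpha>
      have H'_eq: "H' \<alpha> = Zf e \<alpha> * W' t \<alpha> - Zf e \<alpha> * W' s \<alpha>" for \<alpha> by (simp add: H'_def right_diff_distrib)
      have iH': "integrable (Pn n) H'" unfolding H'_eq[abs_def] using iZW[OF t0] iZW[OF st(1)] by simp
      have EH': "(\<integral>\<alpha>. H' \<alpha> \<partial>Pn n) = 0"
        unfolding H'_eq using iZW[OF t0] iZW[OF st(1)] ZW[OF st(2)] ZW[OF order_refl] by simp
      have iH: "integrable (Pn n) (H e)"
        by (rule integrable_bounded_path[OF P(2) H_meas[OF e P(2)] Hb[OF e]])
      have Q_meas: "Q n \<in> borel_measurable (Pn n)"
        unfolding Q_def[abs_def]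
        by (intro path_prob_measurable[OF P(2), of _ "ennreal T"] progressive_integral_adapted progressive_mult
            progressive_cutoff T order_refl progressive_compose[OF progressive_coord] w_borel)
      have lw: "locally_bounded_borel (\<lambda>q. w n (coord q \<alpha>))" for \<alpha>
        unfolding w_def by (intro lbb_add lbb_abs lbb_diff lbb_mult lbb_clock lbb_compensator Cn.lbb_compensator
            lbb_rcll rcll_compose[OF rcll_coord] F_continuous Cn.F_continuous)
      have Q0: "0 \<le> Q n \<alpha>" for \<alpha> unfolding Q_def set_lebesgue_integral_def
        by (intro integral_nonneg_AE AE_I2) (simp add: indicator_def cutoff_nonneg w0)
      have Q1: "Q n \<alpha> \<le> (2 + 2 * B) * (real (k + 1) + 1)" for \<alpha>
      proof -
        have "Q n \<alpha> \<le> (LINT q:{0..T}|lborel. (2 + 2 * B) * (cutoff (k+1) 0 (path_integral c q \<alpha>) * c (coord q \<alpha>)))"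
          unfolding Q_def
        proof (intro lbb_mono lbb_mult[OF lbb_cutoff lw] lbb_mult[OF lbb_const lbb_mult[OF lbb_cutoff lbb_clock]] order_refl)
          fix q
          show "cutoff (k+1) 0 (path_integral c q \<alpha>) * w n (coord q \<alpha>) \<le> (2 + 2 * B) * (cutoff (k+1) 0 (path_integral c q \<alpha>) * c (coord q \<alpha>))"
            using mult_left_mono[OF wb cutoff_nonneg] by (simp add: ac_simps)
        qed
        also have "\<dots> = (2 + 2 * B) * (LINT q:{0..T}|lborel. cutoff (k+1) 0 (path_integral c q \<alpha>) * c (coord q \<alpha>))" by simp
        also have "\<dots> \<le> (2 + 2 * B) * (real (k + 1) + 1)"
          using B_nonneg by (intro mult_left_mono cutoff_clock_mass T) auto
        finally show ?thesis .
      qed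
      have iQ: "integrable (Pn n) (Q n)"
        by (rule integrable_bounded_path[where D="(2 + 2 * B) * (real (k + 1) + 1)", OF P(2) Q_meas])
           (use Q0 Q1 in \<open>simp add: abs_of_nonneg\<close>)
      have WW: "\<bar>W' a \<alpha> - W e a \<alpha>\<bar> \<le> (1 + T * (2 + 4 * real (Suc j))) * Q n \<alpha>" if a: "0 \<le> a" "a \<le> t" for a \<alpha>
        unfolding W'_def W_def N_def Q_def w_def
        by (rule damped_window_difference[OF Cn]) (use a e in \<open>auto simp: T_def\<close>)
      have HH: "\<bar>H e \<alpha> - H' \<alpha>\<bar> \<le> K * Q n \<alpha>" for \<alpha>
      proof -
        have "H e \<alpha> - H' \<alpha> = Zf e \<alpha> * ((W' s \<alpha> - W e s \<alpha>) - (W' t \<alpha> - W e t \<alpha>))"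
          by (simp add: H_def H'_def algebra_simps)
        then have "\<bar>H e \<alpha> - H' \<alpha>\<bar> \<le> \<bar>(W' s \<alpha> - W e s \<alpha>) - (W' t \<alpha> - W e t \<alpha>)\<bar>"
          using Z01[OF e, of \<alpha>] by (simp add: abs_mult mult_left_le_one_le)
        also have "\<dots> \<le> K * Q n \<alpha>"
          using WW[OF st, of \<alpha>] WW[OF t0 order_refl, of \<alpha>] by (simp add: K_def algebra_simps abs_if split: if_splits)
        finally show ?thesis .
      qed
      have "\<bar>\<integral>\<alpha>. H e \<alpha> \<partial>Pn n\<bar> = \<bar>\<integral>\<alpha>. H e \<alpha> - H' \<alpha> \<partial>Pn n\<bar>" using iH iH' EH' by simp
      also have "\<dots> \<le> (\<integral>\<alpha>. \<bar>H e \<alpha> - H' \<alpha>\<bar> \<partial>Pn n)" by (rule integral_abs_bound)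
      also have "\<dots> \<le> (\<integral>\<alpha>. K * Q n \<alpha> \<partial>Pn n)"
        using iH iH' iQ HH by (intro integral_mono) auto
      finally show ?thesis by simp
    qed
    have "(\<lambda>n. \<integral>\<alpha>. H e \<alpha> \<partial>Pn n) \<longlonglongrightarrow> 0"
    proof (rule Lim_null_comparison)
      show "\<forall>\<^sub>F n in sequentially. norm (\<integral>\<alpha>. H e \<alpha> \<partial>Pn n) \<le> K * (\<integral>\<alpha>. Q n \<alpha> \<partial>Pn n)" using bound by simp
      show "(\<lambda>n. K * (\<integral>\<alpha>. Q n \<alpha> \<partial>Pn n)) \<longlonglongrightarrow> 0" using tendsto_mult_left[OF Q_lim, of K] by simp
    qed
    then show ?thesis using LIMSEQ_unique[OF lim1] by simp
  qed
  define e where "e i = 1 / real (Suc i)" for i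
  have e: "e i > 0" for i by (simp add: e_def)
  have "(\<lambda>i. \<integral>\<alpha>. H (e i) \<alpha> / e i \<partial>P) \<longlonglongrightarrow> (\<integral>\<alpha>. (\<Prod>i\<in>J. f i (coord (r i) \<alpha>)) * (N t \<alpha> - N s \<alpha>) \<partial>P)"
  proof (rule integral_dominated_convergence[where w="\<lambda>_. 2 * D"])
    interpret prob_space P using P(1) by (simp add: path_prob_def)
    show "integrable P (\<lambda>_. 2 * D)" by simp
    show "(\<lambda>\<alpha>. H (e i) \<alpha> / e i) \<in> borel_measurable P" for i using H_meas[OF e P(1)] by measurable
    have coordP: "coord u \<in> borel_measurable P" if "0 \<le> u" for u
      using that by (intro path_prob_measurable[OF P(1) measurable_coord[of u "ennreal u"]]) auto
    show "(\<lambda>\<alpha>. (\<Prod>i\<in>J. f i (coord (r i) \<alpha>)) * (N t \<alpha> - N s \<alpha>)) \<in> borel_measurable P"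
      unfolding N_def
      by (intro borel_measurable_times borel_measurable_diff path_prob_measurable[OF P(1) damped_adapted] t0 st
          borel_measurable_prod measurable_compose[OF coordP] borel_measurable_continuous_onI f(1)) (use J(2) in auto)
    show "AE \<alpha> in P. (\<lambda>i. H (e i) \<alpha> / e i) \<longlonglongrightarrow> (\<Prod>i\<in>J. f i (coord (r i) \<alpha>)) * (N t \<alpha> - N s \<alpha>)"
    proof (rule AE_I2)
      fix \<alpha>
      have "(\<lambda>l. Zf (e l) \<alpha>) \<longlonglongrightarrow> (\<Prod>i\<in>J. f i (coord (r i) \<alpha>))"
        unfolding Zf_def
      proof (rule tendsto_prod)
        fix i assume i: "i \<in> J"
        have "(\<lambda>l. (LINT u:{r i + 0 * e l..r i + 0 * e l + e l}|lborel. f i (coord u \<alpha>)) / e l) \<longlonglongrightarrow> f i (coord (r i) \<alpha>)"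
          unfolding e_def by (rule window_average_tendsto[OF rcll_compose[OF rcll_coord f(1)[OF i]]]) (use J(2)[OF i] in auto)
        then show "(\<lambda>l. (LINT u:{r i..r i + e l}|lborel. f i (coord u \<alpha>)) / e l) \<longlonglongrightarrow> f i (coord (r i) \<alpha>)" by simp
      qed
      moreover have "(\<lambda>l. W (e l) a \<alpha> / e l) \<longlonglongrightarrow> N a \<alpha>" if "0 \<le> a" for a
        unfolding W_def e_def N_def by (rule window_average_tendsto[OF rcll_damped that]) simp
      ultimately have "(\<lambda>l. Zf (e l) \<alpha> * (W (e l) t \<alpha> / e l - W (e l) s \<alpha> / e l)) \<longlonglongrightarrow> (\<Prod>i\<in>J. f i (coord (r i) \<alpha>)) * (N t \<alpha> - N s \<alpha>)"
        using t0 st by (intro tendsto_mult tendsto_diff) auto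
      then show "(\<lambda>i. H (e i) \<alpha> / e i) \<longlonglongrightarrow> (\<Prod>i\<in>J. f i (coord (r i) \<alpha>)) * (N t \<alpha> - N s \<alpha>)"
        by (simp add: H_def diff_divide_distrib[symmetric])
    qed
    show "AE \<alpha> in P. norm (H (e i) \<alpha> / e i) \<le> 2 * D" for i
      using Hb[OF e, of i] e[of i] by (intro AE_I2) (simp add: abs_divide pos_divide_le_eq mult.assoc)
  qed
  moreover have "(\<lambda>i. \<integral>\<alpha>. H (e i) \<alpha> / e i \<partial>P) = (\<lambda>_. 0)" using EH[OF e] by simp
  ultimately have "(\<lambda>_::nat. 0) \<longlonglongrightarrow> (\<integral>\<alpha>. (\<Prod>i\<in>J. f i (coord (r i) \<alpha>)) * (N t \<alpha> - N s \<alpha>) \<partial>P)"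
    by (simp only:)
  from LIMSEQ_unique[OF this tendsto_const] show ?thesis unfolding N_def by simp
qed

text \<open>By dominated convergence the factors of the weak limit identity can be replaced by indicators
  of open sets, and these determine the conditional expectation.\<close>

theorem compensates_weak_limit:
  fixes Pn :: "nat \<Rightarrow> 'b::real_normed_vector cadlag_path measure"
  assumes P: "path_prob P" "\<And>n. path_prob (Pn n)" and conv: "weakly_converges Pn P"
    and F: "continuous_on UNIV F" and k: "continuous_on UNIV \<kappa>"
    and adm: "\<And>n. admissible_pair (Fn n) (\<kappa>n n)" and comp: "\<And>n. compensates (Pn n) (Fn n) (\<kappa>n n)"
    and bd: "\<And>n x. \<bar>Fn n x\<bar> \<le> B" "\<And>n x. \<bar>\<kappa>n n x\<bar> \<le> c0 x" "locally_bounded c0"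
    and lim: "\<And>S. compact S \<Longrightarrow> uniform_limit S (\<lambda>n x. \<bar>Fn n x - F x\<bar> + \<bar>\<kappa>n n x - \<kappa> x\<bar>) (\<lambda>_. 0) sequentially"
  shows "compensates P F \<kappa>" "admissible_pair F \<kappa>"
proof -
  obtain c where c: "continuous_on UNIV c" "locally_bounded c" "\<And>x. 1 \<le> c x" "\<And>x. \<bar>c0 x\<bar> \<le> c x"
    using exists_clock[OF bd(3)] by metis
  have kb: "\<bar>\<kappa>n n x\<bar> \<le> c x" for n x using bd(2)[of n x] c(4)[of x] by linarith
  have pw: "(\<lambda>n. \<bar>Fn n x - F x\<bar> + \<bar>\<kappa>n n x - \<kappa> x\<bar>) \<longlonglongrightarrow> 0" for x
    using tendsto_uniform_limitI[OF lim[of "{x}"], of x] by simp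
  have Fpw: "(\<lambda>n. Fn n x) \<longlonglongrightarrow> F x" for x
    by (rule Lim_transform2[OF tendsto_const]; rule Lim_null_comparison[OF _ pw[of x]]) (simp add: abs_minus_commute)
  have kpw: "(\<lambda>n. \<kappa>n n x) \<longlonglongrightarrow> \<kappa> x" for x
    by (rule Lim_transform2[OF tendsto_const]; rule Lim_null_comparison[OF _ pw[of x]]) (simp add: abs_minus_commute)
  have kb': "\<bar>\<kappa> x\<bar> \<le> c x" for x
    using tendsto_rabs[OF kpw] by (rule tendsto_upperbound) (use kb in auto)
  have Fb: "\<bar>F x\<bar> \<le> B" for x
    using tendsto_rabs[OF Fpw] by (rule tendsto_upperbound) (use bd(1) in auto)
  have Cn: "clocked c (Fn n) (\<kappa>n n) B" for n
    using adm[of n] by (intro clockedI c kb bd(1)) (auto simp: admissible_pair_def)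
  interpret C: clocked c F \<kappa> B by (intro clockedI c kb' Fb F borel_measurable_continuous_onI k)
  show "admissible_pair F \<kappa>"
    unfolding admissible_pair_def bounded_real using F C.compensator_borel C.compensator_locally_bounded Fb by auto
  show "compensates P F \<kappa>" unfolding compensates_def
  proof (rule C.local_martingale_of_damped[OF P(1)])
    fix i j s t and A :: "'b cadlag_path set"
    assume st: "0 \<le> s" "s \<le> t" and A: "A \<in> sets (path_filtration (ennreal s))"
    define Y where "Y \<alpha> = damped c F \<kappa> i j t \<alpha> - damped c F \<kappa> i j s \<alpha>" for \<alpha>
    have Nint: "integrable P (damped c F \<kappa> i j u)" if "0 \<le> u" for u
      by (rule integrable_bounded_path[OF P(1) path_prob_measurable[OF P(1) C.damped_adapted[OF that]] C.damped_bound[OF that]])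
    have Yint: "integrable P Y" unfolding Y_def[abs_def] using Nint[OF st(1)] Nint[of t] st by simp
    have "(\<integral>\<alpha>. indicator A \<alpha> * Y \<alpha> \<partial>P) = 0"
    proof (rule path_filtration_dynkin[OF P(1) Yint st(1) _ A])
      fix J :: "(real \<times> 'b set) set" assume J: "finite J" "J \<subseteq> {0..s} \<times> {U. open U}"
      have coordP: "coord u \<in> borel_measurable P" if "0 \<le> u" for u
        using that by (intro path_prob_measurable[OF P(1) measurable_coord[of u "ennreal u"]]) auto
      have prod_meas: "(\<lambda>\<alpha>. \<Prod>q\<in>J. bump (snd q) l (coord (fst q) \<alpha>)) \<in> borel_measurable P" for l
        by (intro borel_measurable_prod measurable_compose[OF coordP] borel_measurable_continuous_onI bump_continuous)
           (use J(2) in auto)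
      have ind: "(\<Prod>q\<in>J. indicat_real (snd q) (coord (fst q) \<alpha>)) = indicator {\<alpha>. \<forall>(r, U)\<in>J. coord r \<alpha> \<in> U} \<alpha>" for \<alpha>
      proof (cases "\<forall>(r, U)\<in>J. coord r \<alpha> \<in> U")
        case True
        then have "(\<Prod>q\<in>J. indicat_real (snd q) (coord (fst q) \<alpha>)) = 1" by (intro prod.neutral) auto
        then show ?thesis using True by simp
      next
        case False
        then obtain q where "q \<in> J" "coord (fst q) \<alpha> \<notin> snd q" by auto
        then have "(\<Prod>q\<in>J. indicat_real (snd q) (coord (fst q) \<alpha>)) = 0" using J(1) by (intro prod_zero bexI[of _ q]) auto
        then show ?thesis using False by simp
      qed
      have plim: "(\<lambda>l. \<Prod>q\<in>J. bump (snd q) l (coord (fst q) \<alpha>)) \<longlonglongrightarrow> indicator {\<alpha>. \<forall>(r, U)\<in>J. coord r \<alpha> \<in> U} \<alpha>" for \<alpha>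
        unfolding ind[symmetric] by (intro tendsto_prod bump_tendsto) (use J(2) in auto)
      have "(\<lambda>l. \<integral>\<alpha>. (\<Prod>q\<in>J. bump (snd q) l (coord (fst q) \<alpha>)) * Y \<alpha> \<partial>P)
         \<longlonglongrightarrow> (\<integral>\<alpha>. indicator {\<alpha>. \<forall>(r, U)\<in>J. coord r \<alpha> \<in> U} \<alpha> * Y \<alpha> \<partial>P)"
      proof (rule integral_dominated_convergence[where w="\<lambda>\<alpha>. \<bar>Y \<alpha>\<bar>"])
        show "(\<lambda>\<alpha>. (\<Prod>q\<in>J. bump (snd q) l (coord (fst q) \<alpha>)) * Y \<alpha>) \<in> borel_measurable P" for l
          using prod_meas Yint by (intro borel_measurable_times) auto
        show "(\<lambda>\<alpha>. indicator {\<alpha>. \<forall>(r, U)\<in>J. coord r \<alpha> \<in> U} \<alpha> * Y \<alpha>) \<in> borel_measurable P"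
          using borel_measurable_LIMSEQ_real[OF plim prod_meas] Yint by (intro borel_measurable_times) auto
        show "AE \<alpha> in P. (\<lambda>l. (\<Prod>q\<in>J. bump (snd q) l (coord (fst q) \<alpha>)) * Y \<alpha>)
          \<longlonglongrightarrow> indicator {\<alpha>. \<forall>(r, U)\<in>J. coord r \<alpha> \<in> U} \<alpha> * Y \<alpha>"
          by (intro AE_I2 tendsto_mult_right plim)
        show "AE \<alpha> in P. norm ((\<Prod>q\<in>J. bump (snd q) l (coord (fst q) \<alpha>)) * Y \<alpha>) \<le> \<bar>Y \<alpha>\<bar>" for l
        proof (rule AE_I2)
          fix \<alpha>
          have "0 \<le> (\<Prod>q\<in>J. bump (snd q) l (coord (fst q) \<alpha>))" "(\<Prod>q\<in>J. bump (snd q) l (coord (fst q) \<alpha>)) \<le> 1"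
            by (intro prod_unit_interval conjI bump_bounds)+
          then show "norm ((\<Prod>q\<in>J. bump (snd q) l (coord (fst q) \<alpha>)) * Y \<alpha>) \<le> \<bar>Y \<alpha>\<bar>"
            by (simp add: abs_mult mult_left_le_one_le)
        qed
      qed (use Yint in simp)
      moreover have "(\<integral>\<alpha>. (\<Prod>q\<in>J. bump (snd q) l (coord (fst q) \<alpha>)) * Y \<alpha> \<partial>P) = 0" for l
        unfolding Y_def
        by (rule C.weak_limit_identity[OF P conv k Cn comp lim st J(1)])
           (use J(2) in \<open>auto intro: bump_continuous simp: bump_bounds\<close>)
      ultimately show "(\<integral>\<alpha>. indicator {\<alpha>. \<forall>(r, U)\<in>J. coord r \<alpha> \<in> U} \<alpha> * Y \<alpha> \<partial>P) = 0"
        using LIMSEQ_unique[OF _ tendsto_const[of 0]] by simp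
    qed
    then show "(\<integral>\<alpha>. indicator A \<alpha> * damped c F \<kappa> i j t \<alpha> \<partial>P) = (\<integral>\<alpha>. indicator A \<alpha> * damped c F \<kappa> i j s \<alpha> \<partial>P)"
      using st C.integrable_damped[OF P(1) A] unfolding Y_def by (simp add: right_diff_distrib)
  qed
qed

section \<open>Functions of finitely many coordinates\<close>

text \<open>Derivatives are carried along explicitly, so that the rules of calculus compute them; \<open>g2 i j\<close> is
  the derivative in direction \<open>i\<close> of the derivative in direction \<open>j\<close>.\<close>

definition has_C2 :: "nat \<Rightarrow> ((nat \<Rightarrow> real) \<Rightarrow> real) \<Rightarrow> (nat \<Rightarrow> (nat \<Rightarrow> real) \<Rightarrow> real) \<Rightarrow>
    (nat \<Rightarrow> nat \<Rightarrow> (nat \<Rightarrow> real) \<Rightarrow> real) \<Rightarrow> bool" where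
  "has_C2 d g g1 g2 \<longleftrightarrow> depends_on_first d g \<and> continuous_on UNIV g \<and>
     (\<forall>i<d. continuous_on UNIV (g1 i) \<and> (\<forall>u. ((\<lambda>t. g (u(i := t))) has_real_derivative g1 i u) (at (u i)))) \<and>
     (\<forall>i<d. \<forall>j<d. continuous_on UNIV (g2 i j) \<and>
        (\<forall>u. ((\<lambda>t. g1 j (u(i := t))) has_real_derivative g2 i j u) (at (u i))))"

definition C2_bound :: "nat \<Rightarrow> ((nat \<Rightarrow> real) \<Rightarrow> real) \<Rightarrow> real \<Rightarrow> bool" where
  "C2_bound d g B \<longleftrightarrow> (\<forall>u. \<bar>g u\<bar> \<le> B) \<and> (\<forall>i<d. \<forall>u. \<bar>partial i g u\<bar> \<le> B) \<and>
     (\<forall>i<d. \<forall>j<d. \<forall>u. \<bar>partial i (partial j g) u\<bar> \<le> B)"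

lemma has_C2_partial:
  assumes "has_C2 d g g1 g2"
  shows "i < d \<Longrightarrow> partial i g = g1 i" "i < d \<Longrightarrow> j < d \<Longrightarrow> partial i (partial j g) = g2 i j"
proof -
  show 1: "partial i g = g1 i" if "i < d" for i
    using assms that unfolding has_C2_def partial_def by (auto intro!: DERIV_imp_deriv)
  show "partial i (partial j g) = g2 i j" if "i < d" "j < d" for i j
    unfolding 1[OF that(2)] using assms that unfolding has_C2_def partial_def by (auto intro!: DERIV_imp_deriv)
qed

lemma depends_on_first_partial:
  assumes "depends_on_first d g" shows "depends_on_first d (partial j g)"
  unfolding depends_on_first_def
proof (intro allI impI)
  fix u v :: "nat \<Rightarrow> real" assume uv: "\<forall>i<d. u i = v i"
  have "g (u(j := t)) = g (v(j := t))" for t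
    using assms[unfolded depends_on_first_def, rule_format, of "u(j := t)" "v(j := t)"] uv by simp
  moreover have "u j = v j \<or> (\<forall>t. g (v(j := t)) = g v)"
  proof (cases "j < d")
    case False
    have "g (v(j := t)) = g v" for t
      using assms[unfolded depends_on_first_def, rule_format, of "v(j := t)" v] False by auto
    then show ?thesis by blast
  qed (use uv in blast)
  ultimately show "partial j g u = partial j g v" unfolding partial_def by auto
qed

lemma has_C2_imp_C2_fun: assumes "has_C2 d g g1 g2" shows "C2_fun d g"
  unfolding C2_fun_def
proof
  have dep: "depends_on_first d g" using assms by (simp add: has_C2_def)
  have p: "\<And>i. i < d \<Longrightarrow> partial i g = g1 i" using has_C2_partial[OF assms] by blast
  show "C1_fun d g" unfolding C1_fun_def
    using assms dep p by (auto simp: has_C2_def real_differentiable_def)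
  show "\<forall>i<d. C1_fun d (partial i g)"
  proof (intro allI impI)
    fix i assume i: "i < d"
    show "C1_fun d (partial i g)" unfolding C1_fun_def
    proof (intro conjI allI impI)
      show "depends_on_first d (partial i g)" by (rule depends_on_first_partial[OF dep])
      show "continuous_on UNIV (partial i g)" using p[OF i] assms i by (simp add: has_C2_def)
      fix l assume l: "l < d"
      show "continuous_on UNIV (partial l (partial i g))"
        using has_C2_partial(2)[OF assms l i] assms i l by (simp add: has_C2_def)
      show "(\<lambda>t. partial i g (u(l := t))) differentiable at (u l)" for u
        unfolding p[OF i] real_differentiable_def using assms i l unfolding has_C2_def by blast
    qed
  qed
qed

lemma C2_fun_imp_has_C2:
  assumes "C2_fun d g" shows "has_C2 d g (\<lambda>i. partial i g) (\<lambda>i j. partial i (partial j g))"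
proof -
  have D: "((\<lambda>t. G (u(i := t))) has_real_derivative partial i G u) (at (u i))" if "C1_fun d G" "i < d" for G i u
    using that unfolding C1_fun_def partial_def DERIV_deriv_iff_real_differentiable by blast
  have G: "C1_fun d g" "\<And>i. i < d \<Longrightarrow> C1_fun d (partial i g)" using assms by (auto simp: C2_fun_def)
  show ?thesis unfolding has_C2_def
    using D[OF G(1)] D[OF G(2)] G by (auto simp: C1_fun_def)
qed

lemma Cb2_fun_bound: "Cb2_fun d g \<Longrightarrow> \<exists>B. C2_bound d g B"
proof -
  assume "Cb2_fun d g"
  then have b: "bounded (range g)" "\<And>i. i < d \<Longrightarrow> bounded (range (partial i g))"
    "\<And>i j. i < d \<Longrightarrow> j < d \<Longrightarrow> bounded (range (partial i (partial j g)))" by (auto simp: Cb2_fun_def)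
  have "bounded (range g \<union> (\<Union>i<d. range (partial i g)) \<union> (\<Union>i<d. \<Union>j<d. range (partial i (partial j g))))"
    using b by (auto intro!: bounded_UN)
  then obtain B where "\<forall>y\<in>range g \<union> (\<Union>i<d. range (partial i g)) \<union> (\<Union>i<d. \<Union>j<d. range (partial i (partial j g))). norm y \<le> B"
    unfolding bounded_iff by blast
  then show ?thesis unfolding C2_bound_def by (intro exI[of _ B]) fastforce
qed

lemma compact_support_bounded:
  assumes dep: "depends_on_first d G" and cont: "continuous_on UNIV G"
    and supp: "\<And>u. G u \<noteq> 0 \<Longrightarrow> \<forall>i<d. \<bar>u i\<bar> \<le> R"
  shows "bounded (range G)"
proof -
  define S where "S = (\<lambda>i. if i < d then {-R..R} else {0::real})"
  have "compactin (product_topology (\<lambda>_. euclidean) UNIV) (PiE UNIV S)"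
    unfolding compactin_PiE by (auto simp: S_def)
  then have "compact (PiE UNIV S)" by (simp add: euclidean_product_topology)
  then have "compact (G ` PiE UNIV S)" by (intro compact_continuous_image continuous_on_subset[OF cont]) auto
  then have "bounded (insert 0 (G ` PiE UNIV S))" by (simp add: compact_imp_bounded)
  moreover have "range G \<subseteq> insert 0 (G ` PiE UNIV S)"
  proof
    fix y assume "y \<in> range G"
    then obtain u where u: "y = G u" by blast
    define v where "v = (\<lambda>i. if i < d then u i else 0)"
    have "G u = G v" using dep unfolding depends_on_first_def v_def by auto
    moreover have "v \<in> PiE UNIV S" if "G u \<noteq> 0"
      using supp[OF that] by (auto simp: PiE_def S_def v_def abs_le_iff)
    ultimately show "y \<in> insert 0 (G ` PiE UNIV S)" using u by auto
  qed
  ultimately show ?thesis by (rule bounded_subset)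
qed

lemma partial_support:
  assumes supp: "\<And>u. G u \<noteq> 0 \<Longrightarrow> \<forall>i<d. \<bar>u i\<bar> \<le> R" and nz: "partial l G u \<noteq> 0" and l: "l < d"
  shows "\<forall>i<d. \<bar>u i\<bar> \<le> R"
proof (rule ccontr)
  assume "\<not> (\<forall>i<d. \<bar>u i\<bar> \<le> R)"
  then obtain i where i: "i < d" "R < \<bar>u i\<bar>" by force
  have "((\<lambda>t. G (u(l := t))) has_real_derivative 0) (at (u l))"
  proof (rule has_field_derivative_transform_within_open[of "\<lambda>_. 0"])
    show "open {t. R < \<bar>t\<bar> \<or> i \<noteq> l}"
      by (intro open_Collect_disj open_Collect_less open_Collect_const continuous_intros)
    fix t assume "t \<in> {t. R < \<bar>t\<bar> \<or> i \<noteq> l}"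
    then have "R < \<bar>(u(l := t)) i\<bar>" using i by auto
    then show "0 = G (u(l := t))" using supp[of "u(l := t)"] i by force
  qed (use i in auto)
  then have "partial l G u = 0" unfolding partial_def by (rule DERIV_imp_deriv)
  with nz show False by simp
qed

lemma Cc2_fun_imp_Cb2_fun: assumes "Cc2_fun d g" shows "Cb2_fun d g"
proof -
  have C2: "C2_fun d g" using assms by (simp add: Cc2_fun_def)
  then have C1: "C1_fun d g" "\<And>i. i < d \<Longrightarrow> C1_fun d (partial i g)" by (auto simp: C2_fun_def)
  obtain R where R: "\<And>u. g u \<noteq> 0 \<Longrightarrow> \<forall>i<d. \<bar>u i\<bar> \<le> R" using assms by (auto simp: Cc2_fun_def)
  have R1: "\<forall>i<d. \<bar>u i\<bar> \<le> R" if "l < d" "partial l g u \<noteq> 0" for l u using partial_support[OF R that(2,1)] .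
  have R2: "\<forall>i<d. \<bar>u i\<bar> \<le> R" if "l < d" "m < d" "partial m (partial l g) u \<noteq> 0" for l m u
    using partial_support[OF R1[OF that(1)] that(3,2)] .
  show ?thesis unfolding Cb2_fun_def
  proof (intro conjI allI impI C2)
    show "bounded (range g)"
      using C1(1) unfolding C1_fun_def by (intro compact_support_bounded[OF _ _ R]) auto
    show "bounded (range (partial i g))" if "i < d" for i
      using C1(2)[OF that] unfolding C1_fun_def by (intro compact_support_bounded[OF _ _ R1[OF that]]) auto
    show "bounded (range (partial i (partial j g)))" if ij: "i < d" "j < d" for i j
      using C1(2)[OF ij(2)] ij unfolding C1_fun_def
      by (intro compact_support_bounded[OF depends_on_first_partial _ R2[OF ij(2,1)]]) auto
  qed
qed

lemma mvt_increment:
  fixes f :: "real \<Rightarrow> real"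
  assumes "\<And>x. (f has_real_derivative f' x) (at x)"
  obtains \<xi> where "\<bar>\<xi> - a\<bar> \<le> \<bar>v\<bar>" "f (a + v) - f a = v * f' \<xi>"
proof -
  consider "v = 0" | "v > 0" | "v < 0" by linarith
  then show thesis
  proof cases
    case 1 then show ?thesis using that[of a] by simp
  next
    case 2
    then obtain z where "a < z" "z < a + v" "f (a + v) - f a = (a + v - a) * f' z"
      using MVT2[of a "a + v" f f'] assms by auto
    then show ?thesis using that[of z] by simp
  next
    case 3
    then obtain z where "a + v < z" "z < a" "f a - f (a + v) = (a - (a + v)) * f' z"
      using MVT2[of "a + v" a f f'] assms by auto
    then show ?thesis using that[of z] by (simp add: algebra_simps)
  qed
qed

text \<open>Replacing the coordinates one after the other reduces statements about increments to the
  mean value theorem in one variable.\<close>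

definition replaced :: "nat \<Rightarrow> (nat \<Rightarrow> real) \<Rightarrow> (nat \<Rightarrow> real) \<Rightarrow> nat \<Rightarrow> real" where
  "replaced k u v = (\<lambda>i. if i < k then u i + v i else u i)"

lemma coordinate_telescope:
  assumes dep: "depends_on_first d G" and D: "\<And>i u. i < d \<Longrightarrow> ((\<lambda>t. G (u(i := t))) has_real_derivative G1 i u) (at (u i))"
  shows "\<exists>\<xi>. (\<forall>k<d. \<bar>\<xi> k - u k\<bar> \<le> \<bar>v k\<bar>) \<and>
    G (\<lambda>i. u i + v i) - G u = (\<Sum>k<d. v k * G1 k ((replaced k u v)(k := \<xi> k)))"
proof -
  have "\<exists>\<xi>. \<bar>\<xi> - u k\<bar> \<le> \<bar>v k\<bar> \<and> G (replaced (Suc k) u v) - G (replaced k u v) = v k * G1 k ((replaced k u v)(k := \<xi>))"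
    if k: "k < d" for k
  proof -
    have "((\<lambda>t. G ((replaced k u v)(k := t))) has_real_derivative G1 k ((replaced k u v)(k := x))) (at x)" for x
      using D[OF k, of "(replaced k u v)(k := x)"] by simp
    from mvt_increment[OF this] obtain \<xi> where x: "\<bar>\<xi> - u k\<bar> \<le> \<bar>v k\<bar>"
      "G ((replaced k u v)(k := u k + v k)) - G ((replaced k u v)(k := u k)) = v k * G1 k ((replaced k u v)(k := \<xi>))"
      by metis
    moreover have "(replaced k u v)(k := u k + v k) = replaced (Suc k) u v" "(replaced k u v)(k := u k) = replaced k u v"
      by (auto simp: replaced_def fun_eq_iff)
    ultimately show ?thesis by auto
  qed
  then obtain \<xi> where x: "\<And>k. k < d \<Longrightarrow> \<bar>\<xi> k - u k\<bar> \<le> \<bar>v k\<bar>"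
    "\<And>k. k < d \<Longrightarrow> G (replaced (Suc k) u v) - G (replaced k u v) = v k * G1 k ((replaced k u v)(k := \<xi> k))" by metis
  have "G (\<lambda>i. u i + v i) = G (replaced d u v)" "replaced 0 u v = u"
    using dep unfolding depends_on_first_def replaced_def by auto
  then have "G (\<lambda>i. u i + v i) - G u = (\<Sum>k<d. G (replaced (Suc k) u v) - G (replaced k u v))"
    using sum_lessThan_telescope[of "\<lambda>k. G (replaced k u v)" d] by simp
  then show ?thesis using x by (intro exI[of _ \<xi>]) simp
qed

lemma increment_bound:
  assumes dep: "depends_on_first d G" and D: "\<And>i u. i < d \<Longrightarrow> ((\<lambda>t. G (u(i := t))) has_real_derivative G1 i u) (at (u i))"
    and b: "\<And>i u. i < d \<Longrightarrow> \<bar>G1 i u\<bar> \<le> B"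
  shows "\<bar>G u' - G u\<bar> \<le> B * (\<Sum>i<d. \<bar>u' i - u i\<bar>)"
proof -
  obtain \<xi> where
    "G (\<lambda>i. u i + (u' i - u i)) - G u = (\<Sum>k<d. (u' k - u k) * G1 k ((replaced k u (\<lambda>i. u' i - u i))(k := \<xi> k)))"
    using coordinate_telescope[OF dep D, of u "\<lambda>i. u' i - u i"] by blast
  then have "\<bar>G u' - G u\<bar> \<le> (\<Sum>k<d. \<bar>(u' k - u k) * G1 k ((replaced k u (\<lambda>i. u' i - u i))(k := \<xi> k))\<bar>)"
    by simp
  also have "\<dots> \<le> (\<Sum>k<d. \<bar>u' k - u k\<bar> * B)"
    unfolding abs_mult by (intro sum_mono mult_left_mono b) auto
  finally show ?thesis by (simp add: sum_distrib_left mult.commute)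
qed

lemma taylor_bound:
  assumes C: "has_C2 d g g1 g2" and b: "\<And>i j u. i < d \<Longrightarrow> j < d \<Longrightarrow> \<bar>g2 i j u\<bar> \<le> B"
  shows "\<bar>g (\<lambda>i. u i + v i) - g u - (\<Sum>i<d. v i * g1 i u)\<bar> \<le> B * (\<Sum>i<d. \<bar>v i\<bar>)\<^sup>2"
proof (cases "d = 0")
  case True
  then have "g (\<lambda>i. u i + v i) = g u" using C by (auto simp: has_C2_def depends_on_first_def)
  then show ?thesis using True by simp
next
  case False
  have B: "0 \<le> B" using b[of 0 0 u] False by (meson abs_ge_zero gr_zeroI order_trans)
  have dep: "depends_on_first d g" and D1: "\<And>i u. i < d \<Longrightarrow> ((\<lambda>t. g (u(i := t))) has_real_derivative g1 i u) (at (u i))"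
    and D2: "\<And>i j u. i < d \<Longrightarrow> j < d \<Longrightarrow> ((\<lambda>t. g1 j (u(i := t))) has_real_derivative g2 i j u) (at (u i))"
    using C by (auto simp: has_C2_def)
  have dep1: "depends_on_first d (g1 j)" if "j < d" for j
    using depends_on_first_partial[OF dep, of j] has_C2_partial(1)[OF C that] by simp
  define S where "S = (\<Sum>i<d. \<bar>v i\<bar>)"
  obtain \<xi> where x: "\<And>k. k < d \<Longrightarrow> \<bar>\<xi> k - u k\<bar> \<le> \<bar>v k\<bar>"
    "g (\<lambda>i. u i + v i) - g u = (\<Sum>k<d. v k * g1 k ((replaced k u v)(k := \<xi> k)))"
    using coordinate_telescope[OF dep D1, of u v] by blast
  have "\<bar>g1 k ((replaced k u v)(k := \<xi> k)) - g1 k u\<bar> \<le> B * S" if k: "k < d" for k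
  proof -
    have "\<bar>g1 k ((replaced k u v)(k := \<xi> k)) - g1 k u\<bar> \<le> B * (\<Sum>i<d. \<bar>((replaced k u v)(k := \<xi> k)) i - u i\<bar>)"
      by (rule increment_bound[OF dep1[OF k] D2[OF _ k] b[OF _ k]])
    also have "\<dots> \<le> B * S" unfolding S_def
      by (intro mult_left_mono sum_mono B) (use x(1) in \<open>auto simp: replaced_def\<close>)
    finally show ?thesis .
  qed
  then have "(\<Sum>k<d. \<bar>v k\<bar> * \<bar>g1 k ((replaced k u v)(k := \<xi> k)) - g1 k u\<bar>) \<le> (\<Sum>k<d. \<bar>v k\<bar> * (B * S))"
    by (intro sum_mono mult_left_mono) auto
  also have "\<dots> = B * S\<^sup>2" by (simp add: S_def sum_distrib_right[symmetric] power2_eq_square)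
  finally have "(\<Sum>k<d. \<bar>v k\<bar> * \<bar>g1 k ((replaced k u v)(k := \<xi> k)) - g1 k u\<bar>) \<le> B * S\<^sup>2" .
  moreover have "g (\<lambda>i. u i + v i) - g u - (\<Sum>i<d. v i * g1 i u) = (\<Sum>k<d. v k * (g1 k ((replaced k u v)(k := \<xi> k)) - g1 k u))"
    unfolding x(2) by (simp add: right_diff_distrib sum_subtractf)
  moreover have "\<bar>\<Sum>k<d. v k * (g1 k ((replaced k u v)(k := \<xi> k)) - g1 k u)\<bar> \<le> (\<Sum>k<d. \<bar>v k\<bar> * \<bar>g1 k ((replaced k u v)(k := \<xi> k)) - g1 k u\<bar>)"
    by (rule order_trans[OF sum_abs]) (simp add: abs_mult)
  ultimately show ?thesis by (simp add: S_def)
qed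

section \<open>Generators\<close>

definition coords :: "(nat \<Rightarrow> 'b::real_normed_vector \<Rightarrow>\<^sub>L real) \<Rightarrow> 'b \<Rightarrow> nat \<Rightarrow> real" where
  "coords \<phi> x = (\<lambda>i. dual_pair x (\<phi> i))"

definition drift_coeff :: "'b::real_normed_vector mp_params \<Rightarrow> ('b \<Rightarrow>\<^sub>L real) \<Rightarrow> 'b \<Rightarrow> real" where
  "drift_coeff p \<psi> x = dual_pair x (adjoint_op (lin_dom p) (lin_op p) \<psi>) + dual_pair (drift p x) \<psi>"

definition jump_integrand :: "('b::real_normed_vector \<Rightarrow> 'b) \<Rightarrow> nat \<Rightarrow> ((nat \<Rightarrow> real) \<Rightarrow> real) \<Rightarrow>
    (nat \<Rightarrow> 'b \<Rightarrow>\<^sub>L real) \<Rightarrow> 'b \<Rightarrow> 'b \<Rightarrow> real" where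
  "jump_integrand h d g \<phi> x y = g (coords \<phi> (x + y)) - g (coords \<phi> x)
     - (\<Sum>i<d. dual_pair (h y) (\<phi> i) * partial i g (coords \<phi> x))"

lemma generator_eq:
  "generator h p (d, g, \<phi>) x = (\<Sum>i<d. drift_coeff p (\<phi> i) x * partial i g (coords \<phi> x))
     + 1 / 2 * (\<Sum>i<d. \<Sum>j<d. dual_pair (blinfun_apply (diffusion p x) (\<phi> i)) (\<phi> j) * partial i (partial j g) (coords \<phi> x))
     + (\<integral>y. jump_integrand h d g \<phi> x y \<partial>(jump p x))"
  by (simp add: generator_def Let_def drift_coeff_def jump_integrand_def test_fun_def coords_def)

lemma test_fun_eq: "test_fun (d, g, \<phi>) x = g (coords \<phi> x)"
  by (simp add: test_fun_def coords_def)

lemma coords_add: "coords \<phi> (x + y) = (\<lambda>i. coords \<phi> x i + coords \<phi> y i)"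
  by (simp add: coords_def blinfun.add_right)

lemma continuous_coords: "continuous_on UNIV (coords \<phi>)"
  unfolding coords_def by (intro continuous_on_coordinatewise_then_product continuous_intros)

lemma continuous_test_fun: "continuous_on UNIV g \<Longrightarrow> continuous_on UNIV (test_fun (d, g, \<phi>))"
  unfolding test_fun_eq[abs_def] by (rule continuous_on_compose2[OF _ continuous_coords]) auto

text \<open>The jump integrand of a function with derivatives bounded by \<open>1\<close> is dominated by the
  following function: quadratic on small jumps, where \<open>h\<close> is the identity, and bounded otherwise.\<close>

definition jump_dominator :: "('b::real_normed_vector \<Rightarrow> 'b) \<Rightarrow> real \<Rightarrow> nat \<Rightarrow> (nat \<Rightarrow> 'b \<Rightarrow>\<^sub>L real) \<Rightarrow> real \<Rightarrow> 'b \<Rightarrow> real" where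
  "jump_dominator h \<epsilon> d \<phi> H y = (if norm y \<le> \<epsilon> then (\<Sum>i<d. \<bar>dual_pair y (\<phi> i)\<bar>)\<^sup>2 else 2 + H * (\<Sum>i<d. norm (\<phi> i)))"

locale generator_data =
  fixes h :: "'b::real_normed_vector \<Rightarrow> 'b" and p :: "'b mp_params" and d :: nat and \<phi> :: "nat \<Rightarrow> 'b \<Rightarrow>\<^sub>L real"
  assumes trunc: "truncation_function h" and params: "valid_params p"
begin

definition "jump_eps = (SOME \<epsilon>::real. \<epsilon> > 0 \<and> (\<forall>x. norm x \<le> \<epsilon> \<longrightarrow> h x = x))"
definition "trunc_bound = (SOME H::real. 0 \<le> H \<and> (\<forall>x. norm (h x) \<le> H))"

lemma jump_eps: "jump_eps > 0" "norm x \<le> jump_eps \<Longrightarrow> h x = x"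
proof -
  have "\<exists>\<epsilon>::real. \<epsilon> > 0 \<and> (\<forall>x. norm x \<le> \<epsilon> \<longrightarrow> h x = x)" using trunc by (auto simp: truncation_function_def)
  from someI_ex[OF this] show "jump_eps > 0" "norm x \<le> jump_eps \<Longrightarrow> h x = x" by (auto simp: jump_eps_def)
qed

lemma trunc_bound: "0 \<le> trunc_bound" "norm (h x) \<le> trunc_bound"
proof -
  obtain H where H: "\<forall>y\<in>range h. norm y \<le> H" using trunc by (auto simp: truncation_function_def bounded_iff)
  then have "norm (h 0) \<le> H" by blast
  then have "0 \<le> H" using norm_ge_zero[of "h 0"] by linarith
  with H have "0 \<le> H \<and> (\<forall>x. norm (h x) \<le> H)" by blast
  then have "\<exists>H::real. 0 \<le> H \<and> (\<forall>x. norm (h x) \<le> H)" by blast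
  from someI_ex[OF this] show "0 \<le> trunc_bound" "norm (h x) \<le> trunc_bound" by (auto simp: trunc_bound_def)
qed

lemma h_borel: "h \<in> borel_measurable borel" using trunc by (simp add: truncation_function_def)

abbreviation "dominator \<equiv> jump_dominator h jump_eps d \<phi> trunc_bound"

lemma sets_jump: "sets (jump p x) = sets borel"
  using params by (simp add: valid_params_def valid_jump_def)

lemma dominator_nonneg: "0 \<le> dominator y"
  unfolding jump_dominator_def using trunc_bound(1) by (auto intro!: add_nonneg_nonneg mult_nonneg_nonneg sum_nonneg)

lemma dominator_borel: "dominator \<in> borel_measurable borel"
proof -
  have [measurable]: "(\<lambda>y. dual_pair y (\<phi> i)) \<in> borel_measurable borel" for i
    by (intro borel_measurable_continuous_onI continuous_intros)
  show ?thesis unfolding jump_dominator_def[abs_def] by measurable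
qed

text \<open>The integrability assumptions on the jump kernel, applied to constant sequences of functionals.\<close>

lemma dominator_integral_locally_bounded:
  "\<exists>M. \<forall>x. norm x \<le> R \<longrightarrow> integrable (jump p x) dominator \<and> (\<integral>y. dominator y \<partial>jump p x) \<le> M"
proof -
  define C where "C = 2 + trunc_bound * (\<Sum>i<d. norm (\<phi> i))"
  have C: "0 \<le> C" unfolding C_def using trunc_bound(1) by (auto intro!: add_nonneg_nonneg mult_nonneg_nonneg sum_nonneg)
  define G where "G = {x :: 'b. norm x \<le> R}"
  have G: "bounded G" unfolding G_def bounded_iff by auto
  have vj: "valid_jump (jump p)" using params by (simp add: valid_params_def)
  define S where "S i = (SUP x\<in>G. \<integral>\<^sup>+ y\<in>{y. norm y \<le> jump_eps}. ennreal (\<bar>dual_pair y (\<phi> i)\<bar>\<^sup>2) \<partial>jump p x)" for i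
  define E where "E = (SUP x\<in>G. emeasure (jump p x) {z. jump_eps \<le> norm z})"
  have S: "S i < \<infinity>" for i
  proof -
    have "bounded (range (\<lambda>_::nat. \<phi> i))" by simp
    then have "(SUP n::nat. SUP x\<in>G. \<integral>\<^sup>+ y\<in>{y. norm y \<le> jump_eps}. ennreal (\<bar>dual_pair y (\<phi> i)\<bar>\<^sup>2) \<partial>jump p x) < \<infinity>"
      using vj G jump_eps(1) unfolding valid_jump_def by blast
    then show ?thesis by (simp add: S_def)
  qed
  have E: "E < \<infinity>"
  proof -
    have "bounded (range (\<lambda>_::nat. 0 :: 'b \<Rightarrow>\<^sub>L real))" by simp
    then show ?thesis using vj G jump_eps(1) unfolding valid_jump_def E_def by blast
  qed
  define M where "M = (\<Sum>i<d. ennreal (real d) * S i) + ennreal C * E"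
  have M: "M < \<infinity>" unfolding M_def using S E by (auto simp: ennreal_mult_less_top less_top[symmetric] ennreal_mult_eq_top_iff)
  have nn: "(\<integral>\<^sup>+ y. ennreal (dominator y) \<partial>jump p x) \<le> M" if x: "x \<in> G" for x
  proof -
    have [measurable_cong]: "sets (jump p x) = sets borel" by (rule sets_jump)
    have [measurable]: "(\<lambda>y. dual_pair y (\<phi> i)) \<in> borel_measurable borel" for i
      by (intro borel_measurable_continuous_onI continuous_intros)
    have "(\<integral>\<^sup>+ y. ennreal (dominator y) \<partial>jump p x) \<le>
       (\<integral>\<^sup>+ y. (\<Sum>i<d. ennreal (real d) * (ennreal (\<bar>dual_pair y (\<phi> i)\<bar>\<^sup>2) * indicator {y. norm y \<le> jump_eps} y))
          + ennreal C * indicator {z. jump_eps \<le> norm z} y \<partial>jump p x)"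
    proof (rule nn_integral_mono)
      fix y
      show "ennreal (dominator y) \<le> (\<Sum>i<d. ennreal (real d) * (ennreal (\<bar>dual_pair y (\<phi> i)\<bar>\<^sup>2) * indicator {y. norm y \<le> jump_eps} y))
          + ennreal C * indicator {z. jump_eps \<le> norm z} y"
      proof (cases "norm y \<le> jump_eps")
        case True
        have "dominator y \<le> (\<Sum>i<d. real d * (\<bar>dual_pair y (\<phi> i)\<bar>\<^sup>2))"
          using sum_squared_le_sum_of_squares[of "\<lambda>i. \<bar>dual_pair y (\<phi> i)\<bar>" "{..<d}"] True
          by (simp add: jump_dominator_def sum_distrib_left[symmetric] mult.commute)
        then have "ennreal (dominator y) \<le> ennreal (\<Sum>i<d. real d * (\<bar>dual_pair y (\<phi> i)\<bar>\<^sup>2))" by (rule ennreal_leI)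
        also have "\<dots> = (\<Sum>i<d. ennreal (real d) * ennreal (\<bar>dual_pair y (\<phi> i)\<bar>\<^sup>2))"
          by (simp add: sum_ennreal[symmetric] ennreal_mult)
        finally show ?thesis using True by (simp add: add_increasing2)
      next
        case False then show ?thesis by (simp add: jump_dominator_def C_def add_increasing)
      qed
    qed
    also have "\<dots> = (\<Sum>i<d. ennreal (real d) * (\<integral>\<^sup>+ y\<in>{y. norm y \<le> jump_eps}. ennreal (\<bar>dual_pair y (\<phi> i)\<bar>\<^sup>2) \<partial>jump p x))
        + ennreal C * emeasure (jump p x) {z. jump_eps \<le> norm z}"
      by (subst nn_integral_add; (subst nn_integral_sum)?; (subst nn_integral_cmult)?; (simp add: nn_integral_cmult nn_integral_cmult_indicator)?)
    also have "\<dots> \<le> M" unfolding M_def S_def E_def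
      using x by (intro add_mono sum_mono mult_left_mono SUP_upper) auto
    finally show ?thesis .
  qed
  show ?thesis
  proof (intro exI[of _ "enn2real M"] allI impI)
    fix x :: 'b assume "norm x \<le> R"
    then have x: "x \<in> G" by (simp add: G_def)
    have meas: "dominator \<in> borel_measurable (jump p x)"
      using dominator_borel measurable_cong_sets[OF sets_jump refl] by blast
    have "integrable (jump p x) dominator"
      by (rule integrableI_bounded[OF meas])
         (use nn[OF x] M dominator_nonneg in \<open>simp add: le_less_trans abs_of_nonneg\<close>)
    moreover have "(\<integral>y. dominator y \<partial>jump p x) \<le> enn2real M"
      unfolding integral_eq_nn_integral[OF meas AE_I2[OF dominator_nonneg]]
      using nn[OF x] M by (intro enn2real_mono) auto
    ultimately show "integrable (jump p x) dominator \<and> (\<integral>y. dominator y \<partial>jump p x) \<le> enn2real M" by blast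
  qed
qed

lemma integrable_dominator: "integrable (jump p x) dominator"
  using dominator_integral_locally_bounded[of "norm x"] by auto

text \<open>For small jumps this is the Taylor estimate, as \<open>h\<close> is the identity there.\<close>

lemma jump_integrand_bound:
  assumes C: "C2_fun d g" and B: "C2_bound d g B"
  shows "\<bar>jump_integrand h d g \<phi> x y\<bar> \<le> B * dominator y"
proof (cases "norm y \<le> jump_eps")
  case True
  have "\<bar>g (\<lambda>i. coords \<phi> x i + coords \<phi> y i) - g (coords \<phi> x) - (\<Sum>i<d. coords \<phi> y i * partial i g (coords \<phi> x))\<bar>
     \<le> B * (\<Sum>i<d. \<bar>coords \<phi> y i\<bar>)\<^sup>2"
    by (rule taylor_bound[OF C2_fun_imp_has_C2[OF C]]) (use B in \<open>simp add: C2_bound_def\<close>)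
  then show ?thesis using True jump_eps(2)[OF True]
    by (simp add: jump_integrand_def coords_add jump_dominator_def) (simp add: coords_def)
next
  case False
  have g: "\<bar>g u\<bar> \<le> B" for u using B by (simp add: C2_bound_def)
  have "\<bar>\<Sum>i<d. dual_pair (h y) (\<phi> i) * partial i g (coords \<phi> x)\<bar> \<le> (\<Sum>i<d. (trunc_bound * norm (\<phi> i)) * B)"
  proof (rule order_trans[OF sum_abs], rule sum_mono)
    fix i assume i: "i \<in> {..<d}"
    have "\<bar>dual_pair (h y) (\<phi> i)\<bar> \<le> norm (\<phi> i) * norm (h y)" using norm_blinfun[of "\<phi> i" "h y"] by simp
    also have "\<dots> \<le> norm (\<phi> i) * trunc_bound" by (intro mult_left_mono trunc_bound) auto
    finally have "\<bar>dual_pair (h y) (\<phi> i)\<bar> \<le> trunc_bound * norm (\<phi> i)" by (simp add: mult.commute)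
    moreover have "\<bar>partial i g (coords \<phi> x)\<bar> \<le> B" using B i by (simp add: C2_bound_def)
    ultimately show "\<bar>dual_pair (h y) (\<phi> i) * partial i g (coords \<phi> x)\<bar> \<le> (trunc_bound * norm (\<phi> i)) * B"
      unfolding abs_mult using trunc_bound(1) by (intro mult_mono) auto
  qed
  also have "\<dots> = B * (trunc_bound * (\<Sum>i<d. norm (\<phi> i)))" by (simp add: sum_distrib_left sum_distrib_right ac_simps)
  finally show ?thesis using False g[of "coords \<phi> (x + y)"] g[of "coords \<phi> x"]
    by (simp add: jump_integrand_def jump_dominator_def distrib_left)
qed

lemma jump_integrand_measurable:
  assumes "continuous_on UNIV g" shows "jump_integrand h d g \<phi> x \<in> borel_measurable (jump p x)"
proof -
  have [measurable]: "(\<lambda>y. g (coords \<phi> (x + y))) \<in> borel_measurable borel"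
    by (intro borel_measurable_continuous_onI continuous_on_compose2[OF assms] continuous_on_compose2[OF continuous_coords] continuous_intros) auto
  have [measurable]: "(\<lambda>y. dual_pair (h y) (\<phi> i)) \<in> borel_measurable borel" for i
    by (rule measurable_compose[OF h_borel]) (intro borel_measurable_continuous_onI continuous_intros)
  have "jump_integrand h d g \<phi> x \<in> borel_measurable borel" unfolding jump_integrand_def[abs_def] by measurable
  then show ?thesis using measurable_cong_sets[OF sets_jump refl] by blast
qed

lemma jump_integrable:
  assumes C: "C2_fun d g" and B: "C2_bound d g B" shows "integrable (jump p x) (jump_integrand h d g \<phi> x)"
proof (rule Bochner_Integration.integrable_bound[of _ "\<lambda>y. B * dominator y"])
  show "integrable (jump p x) (\<lambda>y. B * dominator y)" by (intro integrable_mult_right integrable_dominator)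
  show "jump_integrand h d g \<phi> x \<in> borel_measurable (jump p x)"
    using C by (intro jump_integrand_measurable) (simp add: C2_fun_def C1_fun_def)
  show "AE y in jump p x. norm (jump_integrand h d g \<phi> x y) \<le> norm (B * dominator y)"
    by (rule AE_I2) (use jump_integrand_bound[OF C B] in \<open>auto intro: order_trans[OF _ abs_ge_self]\<close>)
qed

text \<open>The local size of the generator per unit of the \<open>C\<^sup>2\<close> norm of the outer function.\<close>

definition generator_scale :: "'b \<Rightarrow> real" where
  "generator_scale x = (\<Sum>i<d. \<bar>drift_coeff p (\<phi> i) x\<bar>)
     + (\<Sum>i<d. \<Sum>j<d. \<bar>dual_pair (blinfun_apply (diffusion p x) (\<phi> i)) (\<phi> j)\<bar>) + (\<integral>y. dominator y \<partial>jump p x)"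

lemma generator_bound:
  assumes C: "C2_fun d g" and B: "C2_bound d g B"
  shows "\<bar>generator h p (d, g, \<phi>) x\<bar> \<le> B * generator_scale x"
proof -
  have 1: "\<bar>\<Sum>i<d. drift_coeff p (\<phi> i) x * partial i g (coords \<phi> x)\<bar> \<le> B * (\<Sum>i<d. \<bar>drift_coeff p (\<phi> i) x\<bar>)"
    unfolding sum_distrib_left using B
    by (intro order_trans[OF sum_abs] sum_mono) (auto simp: abs_mult C2_bound_def mult.commute[of B] intro!: mult_left_mono)
  have 2: "\<bar>\<Sum>i<d. \<Sum>j<d. dual_pair (blinfun_apply (diffusion p x) (\<phi> i)) (\<phi> j) * partial i (partial j g) (coords \<phi> x)\<bar>
     \<le> B * (\<Sum>i<d. \<Sum>j<d. \<bar>dual_pair (blinfun_apply (diffusion p x) (\<phi> i)) (\<phi> j)\<bar>)"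
    unfolding sum_distrib_left using B
    by (intro order_trans[OF sum_abs] sum_mono) (auto simp: abs_mult C2_bound_def mult.commute[of B] intro!: mult_left_mono)
  have 3: "\<bar>\<integral>y. jump_integrand h d g \<phi> x y \<partial>jump p x\<bar> \<le> B * (\<integral>y. dominator y \<partial>jump p x)"
  proof -
    have "\<bar>\<integral>y. jump_integrand h d g \<phi> x y \<partial>jump p x\<bar> \<le> (\<integral>y. \<bar>jump_integrand h d g \<phi> x y\<bar> \<partial>jump p x)"
      by (rule integral_abs_bound)
    also have "\<dots> \<le> (\<integral>y. B * dominator y \<partial>jump p x)"
      using jump_integrable[OF C B] integrable_dominator jump_integrand_bound[OF C B] by (intro integral_mono) auto
    finally show ?thesis by simp
  qed
  have tri: "\<bar>a + 1/2 * b + c\<bar> \<le> B * (x + y + z)" if "\<bar>a\<bar> \<le> B * x" "\<bar>b\<bar> \<le> B * y" "\<bar>c\<bar> \<le> B * z" for a b c x y z :: real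
  proof -
    have "\<bar>a + 1/2 * b + c\<bar> \<le> \<bar>a\<bar> + \<bar>b\<bar> + \<bar>c\<bar>" by linarith
    then show ?thesis using that by (simp add: distrib_left)
  qed
  show ?thesis unfolding generator_eq generator_scale_def by (rule tri[OF 1 2 3])
qed

end

section \<open>Bounded pointwise convergence with two derivatives\<close>

text \<open>Bounded pointwise convergence on \<open>X\<close> of functions of \<open>d\<close> coordinates together with their first
  and second partial derivatives, the mode of convergence under which generators converge.\<close>

definition bp_C2_on :: "(nat \<Rightarrow> real) set \<Rightarrow> nat \<Rightarrow> (nat \<Rightarrow> (nat \<Rightarrow> real) \<Rightarrow> real) \<Rightarrow> ((nat \<Rightarrow> real) \<Rightarrow> real) \<Rightarrow> bool" where
  "bp_C2_on X d gs g \<longleftrightarrow> C2_fun d g \<and> (\<forall>l. C2_fun d (gs l)) \<and>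
     (\<exists>B. \<forall>l. \<forall>u\<in>X. \<bar>gs l u\<bar> \<le> B \<and> (\<forall>i<d. \<bar>partial i (gs l) u\<bar> \<le> B) \<and>
        (\<forall>i<d. \<forall>j<d. \<bar>partial i (partial j (gs l)) u\<bar> \<le> B)) \<and>
     (\<forall>u\<in>X. (\<lambda>l. gs l u) \<longlonglongrightarrow> g u \<and> (\<forall>i<d. (\<lambda>l. partial i (gs l) u) \<longlonglongrightarrow> partial i g u) \<and>
        (\<forall>i<d. \<forall>j<d. (\<lambda>l. partial i (partial j (gs l)) u) \<longlonglongrightarrow> partial i (partial j g) u))"

lemma bp_C2_onI:
  assumes "has_C2 d g g1 g2" "\<And>l. has_C2 d (gs l) (gs1 l) (gs2 l)"
    and "\<And>l u. u \<in> X \<Longrightarrow> \<bar>gs l u\<bar> \<le> B"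
    and "\<And>l u i. u \<in> X \<Longrightarrow> i < d \<Longrightarrow> \<bar>gs1 l i u\<bar> \<le> B"
    and "\<And>l u i j. u \<in> X \<Longrightarrow> i < d \<Longrightarrow> j < d \<Longrightarrow> \<bar>gs2 l i j u\<bar> \<le> B"
    and "\<And>u. u \<in> X \<Longrightarrow> (\<lambda>l. gs l u) \<longlonglongrightarrow> g u"
    and "\<And>u i. u \<in> X \<Longrightarrow> i < d \<Longrightarrow> (\<lambda>l. gs1 l i u) \<longlonglongrightarrow> g1 i u"
    and "\<And>u i j. u \<in> X \<Longrightarrow> i < d \<Longrightarrow> j < d \<Longrightarrow> (\<lambda>l. gs2 l i j u) \<longlonglongrightarrow> g2 i j u"
  shows "bp_C2_on X d gs g"
  unfolding bp_C2_on_def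
  using assms(3-8) has_C2_partial[OF assms(1)] has_C2_partial[OF assms(2)] has_C2_imp_C2_fun[OF assms(1)] has_C2_imp_C2_fun[OF assms(2)]
  by (intro conjI allI exI[of _ B] ballI impI) simp_all

lemma bp_C2_onD:
  assumes "bp_C2_on X d gs g"
  shows "C2_fun d g" "C2_fun d (gs l)"
    "\<And>u. u \<in> X \<Longrightarrow> (\<lambda>l. gs l u) \<longlonglongrightarrow> g u"
    "\<And>u i. u \<in> X \<Longrightarrow> i < d \<Longrightarrow> (\<lambda>l. partial i (gs l) u) \<longlonglongrightarrow> partial i g u"
    "\<And>u i j. u \<in> X \<Longrightarrow> i < d \<Longrightarrow> j < d \<Longrightarrow> (\<lambda>l. partial i (partial j (gs l)) u) \<longlonglongrightarrow> partial i (partial j g) u"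
  using assms unfolding bp_C2_on_def by blast+

lemma bp_C2_on_bound:
  assumes "bp_C2_on UNIV d gs g" obtains B where "\<And>l. C2_bound d (gs l) B" "C2_bound d g B"
proof -
  obtain B where "\<forall>l. \<forall>u\<in>UNIV. \<bar>gs l u\<bar> \<le> B \<and> (\<forall>i<d. \<bar>partial i (gs l) u\<bar> \<le> B) \<and>
        (\<forall>i<d. \<forall>j<d. \<bar>partial i (partial j (gs l)) u\<bar> \<le> B)"
    using assms unfolding bp_C2_on_def by blast
  then have B: "C2_bound d (gs l) B" for l unfolding C2_bound_def by simp
  have lim: "\<bar>y\<bar> \<le> B" if "x \<longlonglongrightarrow> y" "\<And>l. \<bar>x l\<bar> \<le> B" for x y
    using tendsto_rabs[OF that(1)] by (rule tendsto_upperbound) (use that(2) in auto)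
  have "C2_bound d g B"
    unfolding C2_bound_def
  proof (intro conjI allI impI)
    show "\<bar>g u\<bar> \<le> B" for u
      by (rule lim[OF bp_C2_onD(3)[OF assms UNIV_I]]) (use B in \<open>simp add: C2_bound_def\<close>)
    show "\<bar>partial i g u\<bar> \<le> B" if "i < d" for i u
      by (rule lim[OF bp_C2_onD(4)[OF assms UNIV_I that]]) (use B that in \<open>simp add: C2_bound_def\<close>)
    show "\<bar>partial i (partial j g) u\<bar> \<le> B" if "i < d" "j < d" for i j u
      by (rule lim[OF bp_C2_onD(5)[OF assms UNIV_I that]]) (use B that in \<open>simp add: C2_bound_def\<close>)
  qed
  then show thesis using that B by blast
qed

lemma has_C2_const: "has_C2 d (\<lambda>_. a) (\<lambda>_ _. 0) (\<lambda>_ _ _. 0)"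
  by (auto simp: has_C2_def depends_on_first_def)

lemma has_C2_linear:
  assumes "has_C2 d f f1 f2" "has_C2 d g g1 g2"
  shows "has_C2 d (\<lambda>u. a * f u + b * g u) (\<lambda>i u. a * f1 i u + b * g1 i u) (\<lambda>i j u. a * f2 i j u + b * g2 i j u)"
proof -
  have dep: "depends_on_first d (\<lambda>u. a * f u + b * g u)"
    using assms unfolding has_C2_def depends_on_first_def by metis
  show ?thesis
    using assms unfolding has_C2_def
    by (intro conjI dep allI impI continuous_intros DERIV_add DERIV_cmult) auto
qed

lemma has_C2_mult:
  assumes "has_C2 d f f1 f2" "has_C2 d g g1 g2"
  shows "has_C2 d (\<lambda>u. f u * g u) (\<lambda>i u. f1 i u * g u + f u * g1 i u)
    (\<lambda>i j u. f2 i j u * g u + f1 j u * g1 i u + (f1 i u * g1 j u + f u * g2 i j u))"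
proof -
  have dep: "depends_on_first d (\<lambda>u. f u * g u)"
    using assms unfolding has_C2_def depends_on_first_def by metis
  have F: "((\<lambda>t. f (u(i := t))) has_real_derivative f1 i u) (at (u i))"
    "((\<lambda>t. g (u(i := t))) has_real_derivative g1 i u) (at (u i))" if "i < d" for i u
    using assms that by (auto simp: has_C2_def)
  have F2: "((\<lambda>t. f1 j (u(i := t))) has_real_derivative f2 i j u) (at (u i))"
    "((\<lambda>t. g1 j (u(i := t))) has_real_derivative g2 i j u) (at (u i))" if "i < d" "j < d" for i j u
    using assms that by (auto simp: has_C2_def)
  have D1: "((\<lambda>t. f (u(i := t)) * g (u(i := t))) has_real_derivative f1 i u * g u + f u * g1 i u) (at (u i))"
    if "i < d" for i u
    using DERIV_mult[OF F(1)[OF that, of u] F(2)[OF that, of u]] by (simp add: algebra_simps)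
  have D2: "((\<lambda>t. f1 j (u(i := t)) * g (u(i := t)) + f (u(i := t)) * g1 j (u(i := t))) has_real_derivative
     f2 i j u * g u + f1 j u * g1 i u + (f1 i u * g1 j u + f u * g2 i j u)) (at (u i))" if "i < d" "j < d" for i j u
    using DERIV_add[OF DERIV_mult[OF F2(1)[OF that, of u] F(2)[OF that(1), of u]] DERIV_mult[OF F(1)[OF that(1), of u] F2(2)[OF that, of u]]]
    by (simp add: algebra_simps)
  have ct: "continuous_on UNIV f" "continuous_on UNIV g" "\<And>i. i < d \<Longrightarrow> continuous_on UNIV (f1 i)" "\<And>i. i < d \<Longrightarrow> continuous_on UNIV (g1 i)"
    "\<And>i j. i < d \<Longrightarrow> j < d \<Longrightarrow> continuous_on UNIV (f2 i j)" "\<And>i j. i < d \<Longrightarrow> j < d \<Longrightarrow> continuous_on UNIV (g2 i j)"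
    using assms by (auto simp: has_C2_def)
  show ?thesis
    unfolding has_C2_def by (intro conjI dep allI impI continuous_on_add continuous_on_mult ct D1 D2) auto
qed

lemma C2_fun_linear:
  assumes "C2_fun d f" "C2_fun d g"
  shows "C2_fun d (\<lambda>u. a * f u + b * g u)"
    "i < d \<Longrightarrow> partial i (\<lambda>u. a * f u + b * g u) = (\<lambda>u. a * partial i f u + b * partial i g u)"
    "i < d \<Longrightarrow> j < d \<Longrightarrow> partial i (partial j (\<lambda>u. a * f u + b * g u)) = (\<lambda>u. a * partial i (partial j f) u + b * partial i (partial j g) u)"
  using has_C2_linear[OF C2_fun_imp_has_C2[OF assms(1)] C2_fun_imp_has_C2[OF assms(2)]]
    has_C2_imp_C2_fun has_C2_partial by blast+

lemma C2_fun_linear_second: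
  assumes "C2_fun d f" "C2_fun d g" "i < d" "j < d"
  shows "partial i (\<lambda>u. a * partial j f u + b * partial j g u) = (\<lambda>u. a * partial i (partial j f) u + b * partial i (partial j g) u)"
  using C2_fun_linear(3)[OF assms] unfolding C2_fun_linear(2)[OF assms(1,2,4)] .

lemma C2_bound_linear:
  assumes "C2_fun d f" "C2_fun d g" "C2_bound d f B" "C2_bound d g C"
  shows "C2_bound d (\<lambda>u. a * f u + b * g u) (\<bar>a\<bar> * B + \<bar>b\<bar> * C)"
proof -
  have *: "\<bar>a * x + b * y\<bar> \<le> \<bar>a\<bar> * B + \<bar>b\<bar> * C" if "\<bar>x\<bar> \<le> B" "\<bar>y\<bar> \<le> C" for x y
    using that by (intro order_trans[OF abs_triangle_ineq] add_mono) (auto simp: abs_mult intro: mult_left_mono)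
  show ?thesis unfolding C2_bound_def using assms(3,4)
    by (auto simp: C2_fun_linear[OF assms(1,2)] C2_fun_linear_second[OF assms(1,2)] C2_bound_def intro!: *)
qed

lemma bp_C2_mult:
  assumes bp: "bp_C2_on UNIV d gs g" and f: "C2_fun d f" "C2_bound d f C"
  shows "bp_C2_on UNIV d (\<lambda>l u. f u * gs l u) (\<lambda>u. f u * g u)"
proof -
  obtain B where B: "\<And>l. C2_bound d (gs l) B" using bp_C2_on_bound[OF bp] by blast
  have hf: "has_C2 d f (\<lambda>i. partial i f) (\<lambda>i j. partial i (partial j f))" by (rule C2_fun_imp_has_C2[OF f(1)])
  have hg: "has_C2 d g (\<lambda>i. partial i g) (\<lambda>i j. partial i (partial j g))" by (rule C2_fun_imp_has_C2[OF bp_C2_onD(1)[OF bp]])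
  have hgs: "has_C2 d (gs l) (\<lambda>i. partial i (gs l)) (\<lambda>i j. partial i (partial j (gs l)))" for l
    by (rule C2_fun_imp_has_C2[OF bp_C2_onD(2)[OF bp]])
  have fb: "\<bar>f u\<bar> \<le> C" "i < d \<Longrightarrow> \<bar>partial i f u\<bar> \<le> C" "i < d \<Longrightarrow> j < d \<Longrightarrow> \<bar>partial i (partial j f) u\<bar> \<le> C" for u i j
    using f(2) by (auto simp: C2_bound_def)
  have gb: "\<bar>gs l u\<bar> \<le> B" "i < d \<Longrightarrow> \<bar>partial i (gs l) u\<bar> \<le> B" "i < d \<Longrightarrow> j < d \<Longrightarrow> \<bar>partial i (partial j (gs l)) u\<bar> \<le> B" for l u i j
    using B[of l] by (auto simp: C2_bound_def)
  have m: "\<bar>x * y\<bar> \<le> C * B" if "\<bar>x\<bar> \<le> C" "\<bar>y\<bar> \<le> B" for x y :: real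
    unfolding abs_mult using that by (intro mult_mono) auto
  have CB: "0 \<le> C * B" using m[OF fb(1) gb(1)] abs_ge_zero order_trans by blast
  show ?thesis
  proof (rule bp_C2_onI[OF has_C2_mult[OF hf hg] has_C2_mult[OF hf hgs], where B="4 * (C * B)"])
    fix l u i j
    show "\<bar>f u * gs l u\<bar> \<le> 4 * (C * B)" using m[OF fb(1) gb(1), of u l u] CB by linarith
    assume i: "i < d"
    show "\<bar>partial i f u * gs l u + f u * partial i (gs l) u\<bar> \<le> 4 * (C * B)"
      using m[OF fb(2)[OF i] gb(1), of u l u] m[OF fb(1) gb(2)[OF i], of u l u] CB by linarith
    assume j: "j < d"
    show "\<bar>partial i (partial j f) u * gs l u + partial j f u * partial i (gs l) u
        + (partial i f u * partial j (gs l) u + f u * partial i (partial j (gs l)) u)\<bar> \<le> 4 * (C * B)"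
      using m[OF fb(3)[OF i j] gb(1), of u l u] m[OF fb(2)[OF j] gb(2)[OF i], of u l u]
        m[OF fb(2)[OF i] gb(2)[OF j], of u l u] m[OF fb(1) gb(3)[OF i j], of u l u] by linarith
  qed (intro tendsto_mult tendsto_add tendsto_const bp_C2_onD(3-5)[OF bp]; simp)+
qed

lemma has_C2_ridge:
  assumes q: "\<And>s. (q has_real_derivative q' s) (at s)" "\<And>s. (q' has_real_derivative q'' s) (at s)" and c: "continuous_on UNIV q''"
  shows "has_C2 d (\<lambda>u. q (\<Sum>i<d. lam i * u i)) (\<lambda>i u. lam i * q' (\<Sum>i<d. lam i * u i)) (\<lambda>i j u. lam i * lam j * q'' (\<Sum>i<d. lam i * u i))"
proof -
  have cq: "continuous_on UNIV q" "continuous_on UNIV q'" using q by (auto intro: DERIV_isCont continuous_at_imp_continuous_on)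
  have cs: "continuous_on UNIV (\<lambda>u :: nat \<Rightarrow> real. \<Sum>i<d. lam i * u i)" by (intro continuous_intros continuous_on_product_coordinates)
  have L: "((\<lambda>t. \<Sum>l<d. lam l * (u(i := t)) l) has_real_derivative lam i) (at (u i))" if "i < d" for i and u :: "nat \<Rightarrow> real"
  proof -
    have eq: "(\<Sum>l<d. lam l * (u(i := t)) l) = lam i * t + (\<Sum>l\<in>{..<d} - {i}. lam l * u l)" for t
      using that by (subst sum.remove[of _ i]) auto
    show ?thesis unfolding eq by (auto intro!: derivative_eq_intros)
  qed
  have ch: "((\<lambda>t. r (\<Sum>l<d. lam l * (u(i := t)) l)) has_real_derivative r' (\<Sum>l<d. lam l * u l) * lam i) (at (u i))"
    if r: "\<And>s. (r has_real_derivative r' s) (at s)" and i: "i < d" for r r' i and u :: "nat \<Rightarrow> real"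
    using DERIV_chain2[OF r L[OF i], of u] by simp
  have dep: "depends_on_first d (\<lambda>u. q (\<Sum>i<d. lam i * u i))"
    unfolding depends_on_first_def by (auto intro!: arg_cong[of _ _ q] sum.cong)
  show ?thesis unfolding has_C2_def
  proof (intro conjI allI impI dep)
    show "continuous_on UNIV (\<lambda>u. q (\<Sum>i<d. lam i * u i))"
      by (rule continuous_on_compose2[OF cq(1) cs]) auto
    show "continuous_on UNIV (\<lambda>u. lam i * q' (\<Sum>i<d. lam i * u i))" for i
      by (intro continuous_on_mult_left continuous_on_compose2[OF cq(2) cs]) auto
    show "continuous_on UNIV (\<lambda>u. lam i * lam j * q'' (\<Sum>i<d. lam i * u i))" for i j
      by (intro continuous_on_mult_left continuous_on_compose2[OF c cs]) auto
    fix i u assume i: "i < d"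
    show "((\<lambda>t. q (\<Sum>l<d. lam l * (u(i := t)) l)) has_real_derivative lam i * q' (\<Sum>i<d. lam i * u i)) (at (u i))"
      by (rule DERIV_cong[OF ch[of q q', OF q(1) i]]) (rule mult.commute)
    fix j
    show "((\<lambda>t. lam j * q' (\<Sum>l<d. lam l * (u(i := t)) l)) has_real_derivative lam i * lam j * q'' (\<Sum>i<d. lam i * u i)) (at (u i))"
      by (rule DERIV_cong[OF DERIV_cmult[OF ch[of q' q'', OF q(2) i, of u], of "lam j"]]) simp
  qed
qed

definition bell :: "real \<Rightarrow> real" where "bell s = (max 0 (1 - s\<^sup>2))^3"
definition bell' :: "real \<Rightarrow> real" where "bell' s = - 6 * s * (max 0 (1 - s\<^sup>2))\<^sup>2"
definition bell'' :: "real \<Rightarrow> real" where "bell'' s = - 6 * (max 0 (1 - s\<^sup>2))\<^sup>2 + 24 * s\<^sup>2 * max 0 (1 - s\<^sup>2)"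

lemma bell_DERIV: "(bell has_real_derivative bell' s) (at s)" "(bell' has_real_derivative bell'' s) (at s)"
proof -
  have 1: "((\<lambda>s::real. 1 - s\<^sup>2) has_real_derivative - 2 * s) (at s)" by (auto intro!: derivative_eq_intros)
  show "(bell has_real_derivative bell' s) (at s)"
    unfolding bell_def[abs_def] bell'_def
    by (rule DERIV_cong[OF DERIV_chain2[OF DERIV_max0_power3 1]]) simp
  show "(bell' has_real_derivative bell'' s) (at s)"
    unfolding bell'_def[abs_def] bell''_def
    by (rule DERIV_cong[OF DERIV_mult[OF _ DERIV_chain2[OF DERIV_max0_power2 1]], of _ "-6"])
       (auto intro!: derivative_eq_intros simp: power2_eq_square)
qed

lemma bell_continuous: "continuous_on UNIV bell" "continuous_on UNIV bell'" "continuous_on UNIV bell''"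
  unfolding bell_def[abs_def] bell'_def[abs_def] bell''_def[abs_def] by (intro continuous_intros)+

lemma bell_support: "\<bar>s\<bar> > 1 \<Longrightarrow> bell s = 0"
proof -
  assume "\<bar>s\<bar> > 1"
  then have "1 \<le> s\<^sup>2" by (simp add: abs_square_less_1 flip: not_less)
  then show ?thesis by (simp add: bell_def)
qed

lemma bell_bounds: "\<bar>bell s\<bar> \<le> 30" "\<bar>bell' s\<bar> \<le> 30" "\<bar>bell'' s\<bar> \<le> 30"
proof -
  define m where "m = max 0 (1 - s\<^sup>2)"
  have m: "0 \<le> m" "m \<le> 1" by (auto simp: m_def)
  have m2: "0 \<le> m\<^sup>2" "m\<^sup>2 \<le> 1" using m by (auto simp: power_le_one)
  have m3: "m^3 \<le> 1" "0 \<le> m^3" using m by (auto simp: power_le_one)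
  have s: "\<bar>s\<bar> \<le> 1" if "m \<noteq> 0"
  proof (rule ccontr)
    assume "\<not> \<bar>s\<bar> \<le> 1"
    then have "1 \<le> s\<^sup>2" by (simp add: abs_square_less_1 flip: not_less)
    then show False using that by (simp add: m_def)
  qed
  show "\<bar>bell s\<bar> \<le> 30" unfolding bell_def m_def[symmetric] using m3 by simp
  have "\<bar>s\<bar> * m\<^sup>2 \<le> 1" using s m2 by (cases "m = 0") (auto intro!: mult_le_one)
  then show "\<bar>bell' s\<bar> \<le> 30" unfolding bell'_def m_def[symmetric] by (simp add: abs_mult)
  have "s\<^sup>2 * m \<le> 1"
  proof (cases "m = 0")
    case False
    then have "s\<^sup>2 \<le> 1" using s by (simp add: abs_square_le_1)
    then show ?thesis using m by (intro mult_le_one) auto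
  qed simp
  moreover have "0 \<le> s\<^sup>2 * m" using m by simp
  moreover have "bell'' s = - 6 * m\<^sup>2 + 24 * (s\<^sup>2 * m)" unfolding bell''_def m_def[symmetric] by simp
  ultimately show "\<bar>bell'' s\<bar> \<le> 30" using m2 by linarith
qed

text \<open>Flat bell functions cut a function of one variable off outside growing intervals.\<close>

lemma bp_C2_bell: "bp_C2_on UNIV 1 (\<lambda>l u. bell (\<Sum>i<1. 1 / real (Suc l) * u i)) (\<lambda>_. 1)"
proof (rule bp_C2_onI[OF has_C2_const has_C2_ridge[OF bell_DERIV bell_continuous(3)], where B=30])
  have r: "0 \<le> 1 / real (Suc l)" "1 / real (Suc l) \<le> 1" for l by auto
  have lim0: "(\<lambda>l. 1 / real (Suc l)) \<longlonglongrightarrow> 0" using LIMSEQ_inverse_real_of_nat by (simp add: inverse_eq_divide)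
  have lims: "(\<lambda>l. \<Sum>i<1. 1 / real (Suc l) * u i) \<longlonglongrightarrow> 0" for u :: "nat \<Rightarrow> real"
    using tendsto_mult_right[OF lim0, of "u 0"] by simp
  have b: "(\<lambda>l. q (\<Sum>i<1. 1 / real (Suc l) * u i)) \<longlonglongrightarrow> q 0" if "continuous_on UNIV q" for q :: "real \<Rightarrow> real" and u :: "nat \<Rightarrow> real"
    by (rule continuous_on_tendsto_compose[OF that lims]) auto
  fix l i j :: nat and u :: "nat \<Rightarrow> real"
  show "\<bar>bell (\<Sum>i<1. 1 / real (Suc l) * u i)\<bar> \<le> 30" by (rule bell_bounds)
  have sc: "\<bar>a * x\<bar> \<le> 30" if "0 \<le> a" "a \<le> 1" "\<bar>x\<bar> \<le> 30" for a x :: real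
    unfolding abs_mult using mult_mono[of "\<bar>a\<bar>" 1 "\<bar>x\<bar>" 30] that by simp
  show "\<bar>1 / real (Suc l) * bell' (\<Sum>i<1. 1 / real (Suc l) * u i)\<bar> \<le> 30"
    by (intro sc r bell_bounds)
  show "\<bar>1 / real (Suc l) * (1 / real (Suc l)) * bell'' (\<Sum>i<1. 1 / real (Suc l) * u i)\<bar> \<le> 30"
    by (intro sc bell_bounds mult_nonneg_nonneg mult_le_one r)
  show "(\<lambda>l. bell (\<Sum>i<1. 1 / real (Suc l) * u i)) \<longlonglongrightarrow> 1"
    using b[OF bell_continuous(1), of u] by (simp add: bell_def)
  show "(\<lambda>l. 1 / real (Suc l) * bell' (\<Sum>i<1. 1 / real (Suc l) * u i)) \<longlonglongrightarrow> 0"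
    using tendsto_mult[OF lim0 b[OF bell_continuous(2), of u]] by simp
  show "(\<lambda>l. 1 / real (Suc l) * (1 / real (Suc l)) * bell'' (\<Sum>i<1. 1 / real (Suc l) * u i)) \<longlonglongrightarrow> 0"
    using tendsto_mult[OF tendsto_mult[OF lim0 lim0] b[OF bell_continuous(3), of u]] by simp
qed

section \<open>Limits, linear combinations and ridge functions under the generator\<close>

context generator_data begin

lemma generator_scale_locally_bounded: "locally_bounded generator_scale"
  unfolding locally_bounded_def
proof
  fix R :: real
  define G where "G = {x :: 'b. norm x \<le> R}"
  have G: "bounded G" unfolding G_def bounded_iff by auto
  have vp: "valid_drift (drift p)" "valid_diffusion (diffusion p)" using params by (simp_all add: valid_params_def)
  have "\<exists>b. \<forall>x\<in>G. \<bar>drift_coeff p (\<phi> i) x\<bar> \<le> b" for i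
  proof -
    define S where "S = (SUP x\<in>G. ennreal \<bar>dual_pair (drift p x) (\<phi> i)\<bar>)"
    have "bounded (range (\<lambda>_::nat. \<phi> i))" by simp
    then have "(SUP n::nat. SUP x\<in>G. ennreal \<bar>dual_pair (drift p x) (\<phi> i)\<bar>) < \<infinity>"
      using vp(1) G unfolding valid_drift_def by blast
    then have S: "S < \<infinity>" by (simp add: S_def)
    have "\<bar>drift_coeff p (\<phi> i) x\<bar> \<le> norm (adjoint_op (lin_dom p) (lin_op p) (\<phi> i)) * R + enn2real S" if x: "x \<in> G" for x
    proof -
      have "ennreal \<bar>dual_pair (drift p x) (\<phi> i)\<bar> \<le> S" unfolding S_def using x by (intro SUP_upper)
      then have "\<bar>dual_pair (drift p x) (\<phi> i)\<bar> \<le> enn2real S"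
        using enn2real_mono[of "ennreal \<bar>dual_pair (drift p x) (\<phi> i)\<bar>" S] S by simp
      moreover have "\<bar>dual_pair x (adjoint_op (lin_dom p) (lin_op p) (\<phi> i))\<bar> \<le> norm (adjoint_op (lin_dom p) (lin_op p) (\<phi> i)) * norm x"
        using norm_blinfun[of "adjoint_op (lin_dom p) (lin_op p) (\<phi> i)" x] by simp
      moreover have "\<dots> \<le> norm (adjoint_op (lin_dom p) (lin_op p) (\<phi> i)) * R" using x by (intro mult_left_mono) (auto simp: G_def)
      ultimately show ?thesis unfolding drift_coeff_def by linarith
    qed
    then show ?thesis by blast
  qed
  then obtain b where b: "\<And>i x. x \<in> G \<Longrightarrow> \<bar>drift_coeff p (\<phi> i) x\<bar> \<le> b i" by metis
  have "bounded (diffusion p ` G)" using vp(2) G unfolding valid_diffusion_def by blast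
  then obtain M where M: "\<forall>y\<in>diffusion p ` G. norm y \<le> M" unfolding bounded_iff by blast
  have a: "\<bar>dual_pair (blinfun_apply (diffusion p x) (\<phi> i)) (\<phi> j)\<bar> \<le> norm (\<phi> j) * (M * norm (\<phi> i))" if "x \<in> G" for x i j
  proof -
    have "\<bar>dual_pair (blinfun_apply (diffusion p x) (\<phi> i)) (\<phi> j)\<bar> \<le> norm (\<phi> j) * norm (blinfun_apply (diffusion p x) (\<phi> i))"
      using norm_blinfun[of "\<phi> j" "blinfun_apply (diffusion p x) (\<phi> i)"] by simp
    also have "\<dots> \<le> norm (\<phi> j) * (norm (diffusion p x) * norm (\<phi> i))" by (intro mult_left_mono norm_blinfun) auto
    also have "\<dots> \<le> norm (\<phi> j) * (M * norm (\<phi> i))" using M that by (intro mult_left_mono mult_right_mono) auto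
    finally show ?thesis .
  qed
  obtain J where J: "\<And>x. norm x \<le> R \<Longrightarrow> (\<integral>y. dominator y \<partial>jump p x) \<le> J" using dominator_integral_locally_bounded[of R] by blast
  define K where "K = (\<Sum>i<d. b i) + (\<Sum>i<d. \<Sum>j<d. norm (\<phi> j) * (M * norm (\<phi> i))) + J"
  have "\<bar>generator_scale x\<bar> \<le> K" if "norm x \<le> R" for x
  proof -
    have x: "x \<in> G" using that by (simp add: G_def)
    have "0 \<le> generator_scale x"
      unfolding generator_scale_def using dominator_nonneg by (intro add_nonneg_nonneg sum_nonneg integral_nonneg_AE AE_I2) auto
    moreover have "generator_scale x \<le> K"
      unfolding generator_scale_def K_def using b[OF x] a[OF x] J[OF that] by (intro add_mono sum_mono)
    ultimately show ?thesis by simp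
  qed
  then show "\<exists>B. \<forall>x. norm x \<le> R \<longrightarrow> \<bar>generator_scale x\<bar> \<le> B" by blast
qed

text \<open>The jump integrals converge by dominated convergence.\<close>

lemma generator_tendsto:
  assumes bp: "bp_C2_on UNIV d gs g"
  shows "(\<lambda>l. generator h p (d, gs l, \<phi>) x) \<longlonglongrightarrow> generator h p (d, g, \<phi>) x"
proof -
  obtain B where B: "\<And>l. C2_bound d (gs l) B" using bp_C2_on_bound[OF bp] by blast
  have lim: "(\<lambda>l. jump_integrand h d (gs l) \<phi> x y) \<longlonglongrightarrow> jump_integrand h d g \<phi> x y" for y
    unfolding jump_integrand_def
    by (intro tendsto_diff tendsto_sum tendsto_mult tendsto_const bp_C2_onD(3,4)[OF bp]) auto
  have "(\<lambda>l. \<integral>y. jump_integrand h d (gs l) \<phi> x y \<partial>jump p x) \<longlonglongrightarrow> (\<integral>y. jump_integrand h d g \<phi> x y \<partial>jump p x)"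
  proof (rule integral_dominated_convergence[where w="\<lambda>y. B * dominator y"])
    show "jump_integrand h d g \<phi> x \<in> borel_measurable (jump p x)"
      using bp_C2_onD(1)[OF bp] by (intro jump_integrand_measurable) (simp add: C2_fun_def C1_fun_def)
    show "jump_integrand h d (gs l) \<phi> x \<in> borel_measurable (jump p x)" for l
      using bp_C2_onD(2)[OF bp, of l] by (intro jump_integrand_measurable) (simp add: C2_fun_def C1_fun_def)
    show "integrable (jump p x) (\<lambda>y. B * dominator y)" by (intro integrable_mult_right integrable_dominator)
    show "AE y in jump p x. (\<lambda>l. jump_integrand h d (gs l) \<phi> x y) \<longlonglongrightarrow> jump_integrand h d g \<phi> x y"
      using lim by (rule AE_I2)
    show "AE y in jump p x. norm (jump_integrand h d (gs l) \<phi> x y) \<le> B * dominator y" for l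
      using jump_integrand_bound[OF bp_C2_onD(2)[OF bp] B] by simp
  qed
  then show ?thesis unfolding generator_eq
    by (intro tendsto_add tendsto_mult tendsto_sum tendsto_const bp_C2_onD(4,5)[OF bp]) auto
qed

lemma generator_linear:
  assumes f: "C2_fun d f" "C2_bound d f B" and g: "C2_fun d g" "C2_bound d g C"
  shows "generator h p (d, \<lambda>u. a * f u + b * g u, \<phi>) x = a * generator h p (d, f, \<phi>) x + b * generator h p (d, g, \<phi>) x"
proof -
  have "jump_integrand h d (\<lambda>u. a * f u + b * g u) \<phi> x y = a * jump_integrand h d f \<phi> x y + b * jump_integrand h d g \<phi> x y" for y
    unfolding jump_integrand_def
    by (simp add: C2_fun_linear[OF f(1) g(1)] algebra_simps sum.distrib sum_distrib_left)
  then have "(\<integral>y. jump_integrand h d (\<lambda>u. a * f u + b * g u) \<phi> x y \<partial>jump p x)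
    = a * (\<integral>y. jump_integrand h d f \<phi> x y \<partial>jump p x) + b * (\<integral>y. jump_integrand h d g \<phi> x y \<partial>jump p x)"
    using jump_integrable[OF f, of x] jump_integrable[OF g, of x] by simp
  then show ?thesis unfolding generator_eq
    by (simp add: C2_fun_linear[OF f(1) g(1)] C2_fun_linear_second[OF f(1) g(1)] algebra_simps sum.distrib sum_distrib_left)
qed

end

text \<open>Two continuous functionals that agree on a dense set are equal.\<close>

lemma adjoint_op_unique:
  assumes "densely_defined_closed_op D A" "\<forall>x\<in>D. dual_pair (A x) \<phi> = dual_pair x \<psi>"
  shows "adjoint_op D A \<phi> = \<psi>"
  unfolding adjoint_op_def
proof (rule the_equality)
  show "\<forall>x\<in>D. dual_pair (A x) \<phi> = dual_pair x \<psi>" by (rule assms)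
  fix \<chi>' assume chi: "\<forall>x\<in>D. dual_pair (A x) \<phi> = dual_pair x \<chi>'"
  show "\<chi>' = \<psi>"
  proof (rule blinfun_eqI)
    fix x
    have x: "x \<in> closure D" using assms(1) by (simp add: densely_defined_closed_op_def)
    have "dual_pair x \<chi>' - dual_pair x \<psi> = 0"
      by (rule continuous_constant_on_closure[of D "\<lambda>x. dual_pair x \<chi>' - dual_pair x \<psi>" 0, OF _ _ x])
         (use chi assms(2) in \<open>auto intro!: continuous_intros\<close>)
    then show "blinfun_apply \<chi>' x = blinfun_apply \<psi> x" by simp
  qed
qed

lemma adjoint_op_sum:
  assumes D: "densely_defined_closed_op D A" and phi: "\<And>i. i < d \<Longrightarrow> \<phi> i \<in> adjoint_dom D A"
  shows "(\<Sum>i<d. lam i *\<^sub>R \<phi> i) \<in> adjoint_dom D A"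
    "adjoint_op D A (\<Sum>i<d. lam i *\<^sub>R \<phi> i) = (\<Sum>i<d. lam i *\<^sub>R adjoint_op D A (\<phi> i))"
proof -
  have a: "dual_pair (A x) (\<phi> i) = dual_pair x (adjoint_op D A (\<phi> i))" if i: "i < d" and x: "x \<in> D" for i x
  proof -
    obtain \<psi> where psi: "\<forall>x\<in>D. dual_pair (A x) (\<phi> i) = dual_pair x \<psi>" using phi[OF i] by (auto simp: adjoint_dom_def)
    then show ?thesis using adjoint_op_unique[OF D psi] x by simp
  qed
  have s: "\<forall>x\<in>D. dual_pair (A x) (\<Sum>i<d. lam i *\<^sub>R \<phi> i) = dual_pair x (\<Sum>i<d. lam i *\<^sub>R adjoint_op D A (\<phi> i))"
    using a by (auto simp: blinfun.sum_left blinfun.scaleR_left intro!: sum.cong)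
  then show "(\<Sum>i<d. lam i *\<^sub>R \<phi> i) \<in> adjoint_dom D A" by (auto simp: adjoint_dom_def)
  show "adjoint_op D A (\<Sum>i<d. lam i *\<^sub>R \<phi> i) = (\<Sum>i<d. lam i *\<^sub>R adjoint_op D A (\<phi> i))"
    by (rule adjoint_op_unique[OF D s])
qed

text \<open>A function of a linear combination of the coordinates is a test function of one functional,
  and the generator does not see the difference.\<close>

lemma generator_ridge:
  fixes lam :: "nat \<Rightarrow> real"
  assumes D: "densely_defined_closed_op (lin_dom p) (lin_op p)"
    and phi: "\<And>i. i < d \<Longrightarrow> \<phi> i \<in> adjoint_dom (lin_dom p) (lin_op p)"
    and q: "\<And>s. (q has_real_derivative q' s) (at s)" "\<And>s. (q' has_real_derivative q'' s) (at s)" "continuous_on UNIV q''"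
  defines "\<psi> \<equiv> \<lambda>_::nat. \<Sum>i<d. lam i *\<^sub>R \<phi> i"
  shows "test_fun (d, \<lambda>u. q (\<Sum>i<d. lam i * u i), \<phi>) = test_fun (1, \<lambda>u. q (u 0), \<psi>)"
    "generator h p (d, \<lambda>u. q (\<Sum>i<d. lam i * u i), \<phi>) = generator h p (1, \<lambda>u. q (u 0), \<psi>)"
proof -
  have co: "coords \<psi> x 0 = (\<Sum>i<d. lam i * coords \<phi> x i)" for x
    by (simp add: \<psi>_def coords_def blinfun.sum_left blinfun.scaleR_left)
  show "test_fun (d, \<lambda>u. q (\<Sum>i<d. lam i * u i), \<phi>) = test_fun (1, \<lambda>u. q (u 0), \<psi>)"
    by (auto simp: test_fun_eq co)
  have H1: "has_C2 1 (\<lambda>u. q (u 0)) (\<lambda>i u. q' (u 0)) (\<lambda>i j u. q'' (u 0))"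
    using has_C2_ridge[OF q, of 1 "\<lambda>_. 1"] by simp
  have Hd: "has_C2 d (\<lambda>u. q (\<Sum>i<d. lam i * u i)) (\<lambda>i u. lam i * q' (\<Sum>i<d. lam i * u i)) (\<lambda>i j u. lam i * lam j * q'' (\<Sum>i<d. lam i * u i))"
    by (rule has_C2_ridge[OF q])
  have P1: "partial 0 (\<lambda>u. q (u 0)) = (\<lambda>u. q' (u 0))" "partial 0 (partial 0 (\<lambda>u. q (u 0))) = (\<lambda>u. q'' (u 0))"
    using has_C2_partial[OF H1] by auto
  note Pd = has_C2_partial[OF Hd]
  have Pd': "partial i (\<lambda>u. lam j * q' (\<Sum>i<d. lam i * u i)) = (\<lambda>u. lam i * lam j * q'' (\<Sum>i<d. lam i * u i))"
    if "i < d" "j < d" for i j using Pd(2)[OF that] unfolding Pd(1)[OF that(2)] .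
  have P1': "partial 0 (\<lambda>u. q' (u 0)) = (\<lambda>u. q'' (u 0))" using P1(2) unfolding P1(1) .
  have adj: "adjoint_op (lin_dom p) (lin_op p) (\<Sum>i<d. lam i *\<^sub>R \<phi> i)
      = (\<Sum>i<d. lam i *\<^sub>R adjoint_op (lin_dom p) (lin_op p) (\<phi> i))"
    by (rule adjoint_op_sum(2)[OF D]) (rule phi)
  have dr: "drift_coeff p (\<psi> 0) x = (\<Sum>i<d. lam i * drift_coeff p (\<phi> i) x)" for x
    unfolding drift_coeff_def \<psi>_def adj
    by (simp add: blinfun.sum_left blinfun.scaleR_left sum.distrib distrib_left)
  have df: "dual_pair (blinfun_apply (diffusion p x) (\<psi> 0)) (\<psi> 0)
     = (\<Sum>i<d. \<Sum>j<d. lam i * lam j * dual_pair (blinfun_apply (diffusion p x) (\<phi> i)) (\<phi> j))" for x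
    by (simp add: \<psi>_def blinfun.sum_left blinfun.scaleR_left blinfun.sum_right blinfun.scaleR_right sum_distrib_left mult.assoc)
  have ju: "jump_integrand h d (\<lambda>u. q (\<Sum>i<d. lam i * u i)) \<phi> x y = jump_integrand h 1 (\<lambda>u. q (u 0)) \<psi> x y" for x y
  proof -
    have "(\<Sum>i<d. dual_pair (h y) (\<phi> i) * (lam i * q' (coords \<psi> x 0))) = dual_pair (h y) (\<psi> 0) * q' (coords \<psi> x 0)"
      by (simp add: \<psi>_def blinfun.sum_left blinfun.scaleR_left sum_distrib_right ac_simps)
    then show ?thesis by (simp add: jump_integrand_def Pd P1 co[symmetric])
  qed
  show "generator h p (d, \<lambda>u. q (\<Sum>i<d. lam i * u i), \<phi>) = generator h p (1, \<lambda>u. q (u 0), \<psi>)"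
  proof
    fix x
    have "(\<Sum>i<d. drift_coeff p (\<phi> i) x * (lam i * q' (coords \<psi> x 0))) = drift_coeff p (\<psi> 0) x * q' (coords \<psi> x 0)"
      unfolding dr by (simp add: sum_distrib_left sum_distrib_right ac_simps)
    moreover have "(\<Sum>i<d. \<Sum>j<d. dual_pair (blinfun_apply (diffusion p x) (\<phi> i)) (\<phi> j) * (lam i * lam j * q'' (coords \<psi> x 0)))
       = dual_pair (blinfun_apply (diffusion p x) (\<psi> 0)) (\<psi> 0) * q'' (coords \<psi> x 0)"
      unfolding df by (simp add: sum_distrib_left sum_distrib_right ac_simps)
    ultimately show "generator h p (d, \<lambda>u. q (\<Sum>i<d. lam i * u i), \<phi>) x = generator h p (1, \<lambda>u. q (u 0), \<psi>) x"
      by (simp add: generator_eq Pd Pd' P1 P1' ju co[symmetric])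
  qed
qed

section \<open>Bernstein approximation with derivatives\<close>

definition bernstein_op :: "nat \<Rightarrow> (nat \<Rightarrow> real) \<Rightarrow> real \<Rightarrow> real" where
  "bernstein_op N F x = (\<Sum>m\<le>N. F m * Bernstein N m x)"

lemma Bernstein_Suc:
  "Bernstein (Suc N) (Suc k) x = x * Bernstein N k x + (1 - x) * Bernstein N (Suc k) x"
proof (cases "k < N")
  case True
  then have "N - k = Suc (N - Suc k)" by simp
  then have e: "(1 - x) ^ (N - k) = (1 - x) * (1 - x) ^ (N - Suc k)" by simp
  show ?thesis by (simp add: Bernstein_def e) (simp add: algebra_simps)
next
  case False
  then have "N choose Suc k = 0" by simp
  then show ?thesis using False by (simp add: Bernstein_def algebra_simps)
qed

text \<open>De Casteljau's recursion.\<close>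

lemma bernstein_op_Suc:
  "bernstein_op (Suc N) F x = x * bernstein_op N (\<lambda>m. F (Suc m)) x + (1 - x) * bernstein_op N F x"
proof -
  have 0: "Bernstein (Suc N) 0 x = (1 - x) * Bernstein N 0 x" by (simp add: Bernstein_def)
  have z: "Bernstein N (Suc N) x = 0" by (simp add: Bernstein_def)
  have "bernstein_op (Suc N) F x = F 0 * Bernstein (Suc N) 0 x + (\<Sum>k\<le>N. F (Suc k) * Bernstein (Suc N) (Suc k) x)"
    unfolding bernstein_op_def by (rule sum.atMost_Suc_shift)
  also have "\<dots> = x * (\<Sum>k\<le>N. F (Suc k) * Bernstein N k x)
      + (1 - x) * (F 0 * Bernstein N 0 x + (\<Sum>k\<le>N. F (Suc k) * Bernstein N (Suc k) x))"
    by (simp add: 0 Bernstein_Suc algebra_simps sum.distrib sum_distrib_left sum_subtractf)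
  also have "F 0 * Bernstein N 0 x + (\<Sum>k\<le>N. F (Suc k) * Bernstein N (Suc k) x) = (\<Sum>m\<le>Suc N. F m * Bernstein N m x)"
    by (rule sum.atMost_Suc_shift[symmetric])
  finally show ?thesis by (simp add: bernstein_op_def z)
qed

lemma bernstein_op_diff: "bernstein_op N (\<lambda>m. F m - G m) x = bernstein_op N F x - bernstein_op N G x"
  by (simp add: bernstein_op_def left_diff_distrib sum_subtractf)

lemma bernstein_op_cmult: "bernstein_op N (\<lambda>m. a * F m) x = a * bernstein_op N F x"
  by (simp add: bernstein_op_def sum_distrib_left mult.assoc)

lemma bernstein_op_DERIV:
  "(bernstein_op (Suc N) F has_real_derivative real (Suc N) * bernstein_op N (\<lambda>m. F (Suc m) - F m) x) (at x)"
proof (induction N arbitrary: F)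
  case 0
  have "bernstein_op (Suc 0) F = (\<lambda>x. x * F 1 + (1 - x) * F 0)"
    by (rule ext) (simp add: bernstein_op_Suc[of 0] bernstein_op_def[of 0] Bernstein_def)
  then show ?case by (auto intro!: derivative_eq_intros simp: bernstein_op_def Bernstein_def)
next
  case (Suc N)
  define S where "S = (\<lambda>m. F (Suc m))"
  define D where "D = (\<lambda>m. F (Suc m) - F m)"
  have eq: "bernstein_op (Suc (Suc N)) F = (\<lambda>x. x * bernstein_op (Suc N) S x + (1 - x) * bernstein_op (Suc N) F x)"
    unfolding S_def by (rule ext) (rule bernstein_op_Suc)
  define A where "A = bernstein_op N (\<lambda>m. S (Suc m) - S m) x"
  have d: "(bernstein_op (Suc (Suc N)) F has_real_derivative
      1 * bernstein_op (Suc N) S x + real (Suc N) * bernstein_op N (\<lambda>m. S (Suc m) - S m) x * x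
      + ((0 - 1) * bernstein_op (Suc N) F x + real (Suc N) * bernstein_op N D x * (1 - x))) (at x)"
    unfolding eq D_def by (intro DERIV_add DERIV_mult DERIV_ident DERIV_diff DERIV_const Suc.IH)
  have e1: "bernstein_op (Suc N) D x = bernstein_op (Suc N) S x - bernstein_op (Suc N) F x"
    unfolding D_def S_def by (rule bernstein_op_diff)
  have e2: "bernstein_op (Suc N) D x = x * A + (1 - x) * bernstein_op N D x"
    unfolding A_def D_def S_def by (rule bernstein_op_Suc)
  have "1 * bernstein_op (Suc N) S x + real (Suc N) * A * x
      + ((0 - 1) * bernstein_op (Suc N) F x + real (Suc N) * bernstein_op N D x * (1 - x))
    = (bernstein_op (Suc N) S x - bernstein_op (Suc N) F x) + real (Suc N) * (x * A + (1 - x) * bernstein_op N D x)"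
    by (simp add: algebra_simps)
  also have "\<dots> = real (Suc (Suc N)) * bernstein_op (Suc N) D x"
    unfolding e1[symmetric] e2[symmetric] by (simp add: algebra_simps)
  finally show ?case using d unfolding D_def[symmetric] A_def by simp
qed

lemma bernstein_op_bound:
  assumes "0 \<le> x" "x \<le> 1" "\<And>m. m \<le> N \<Longrightarrow> \<bar>F m\<bar> \<le> B"
  shows "\<bar>bernstein_op N F x\<bar> \<le> B"
proof -
  have "\<bar>bernstein_op N F x\<bar> \<le> (\<Sum>m\<le>N. B * Bernstein N m x)"
    unfolding bernstein_op_def
    by (intro order_trans[OF sum_abs] sum_mono) (use assms Bernstein_nonneg in \<open>auto simp: abs_mult intro!: mult_right_mono\<close>)
  also have "\<dots> = B" by (simp add: sum_distrib_left[symmetric])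
  finally show ?thesis .
qed

text \<open>The coefficients need not be values at the nodes: values at points that differ from the nodes
  by at most \<open>2 / (N + 1)\<close> will do. In this form the statement applies to the derivatives as well, whose
  coefficients are difference quotients.\<close>

lemma bernstein_op_tendsto:
  assumes c: "continuous_on {0..1} f" and x: "0 \<le> x" "x \<le> 1"
    and F: "\<And>N m. m \<le> N \<Longrightarrow> \<exists>\<xi>\<in>{0..1}. \<bar>\<xi> - real m / real N\<bar> \<le> 2 / real (N + 1) \<and> F N m = f \<xi>"
  shows "(\<lambda>N. bernstein_op N (F N) x) \<longlonglongrightarrow> f x"
proof (rule LIMSEQ_I)
  fix e :: real assume e: "e > 0"
  obtain N1 where N1: "\<And>N. N \<ge> N1 \<Longrightarrow> \<bar>f x - (\<Sum>k\<le>N. f (k/N) * Bernstein N k x)\<bar> < e/2"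
    using Bernstein_Weierstrass[OF c, of "e/2"] e x by auto
  have "uniformly_continuous_on {0..1} f" by (rule compact_uniformly_continuous[OF c]) simp
  then obtain d where d: "d > 0" "\<And>y z. y \<in> {0..1} \<Longrightarrow> z \<in> {0..1} \<Longrightarrow> dist z y < d \<Longrightarrow> dist (f z) (f y) < e/2"
    unfolding uniformly_continuous_on_def using e by (metis half_gt_zero)
  obtain N2 :: nat where N2: "2 / d < real N2" using reals_Archimedean2 by blast
  have "norm (bernstein_op N (F N) x - f x) < e" if N: "N \<ge> max N1 N2" for N
  proof -
    have "2 / d < real (N + 1)" using N2 N by simp
    then have small: "2 / real (N + 1) < d" using d(1) by (simp add: field_simps)
    have "\<bar>F N m - f (real m / real N)\<bar> \<le> e/2" if m: "m \<le> N" for m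
    proof -
      obtain \<xi> where "\<xi> \<in> {0..1}" "\<bar>\<xi> - real m / real N\<bar> \<le> 2 / real (N + 1)" "F N m = f \<xi>" using F[OF m] by blast
      moreover have "real m / real N \<in> {0..1}" using m by (cases "N = 0") auto
      ultimately show ?thesis using d(2)[of "real m / real N" \<xi>] small by (simp add: dist_real_def)
    qed
    then have "\<bar>bernstein_op N (\<lambda>m. F N m - f (real m / real N)) x\<bar> \<le> e/2" by (intro bernstein_op_bound x)
    moreover have "\<bar>f x - bernstein_op N (\<lambda>m. f (real m / real N)) x\<bar> < e/2"
      using N1[of N] N by (simp add: bernstein_op_def)
    ultimately show ?thesis unfolding bernstein_op_diff real_norm_def by linarith
  qed
  then show "\<exists>N0. \<forall>N\<ge>N0. norm (bernstein_op N (F N) x - f x) < e" by blast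
qed

text \<open>The operator of degree \<open>N + 2\<close> and its first two derivatives, written with the samples of the
  function and their differences.\<close>

definition bern0 :: "nat \<Rightarrow> (real \<Rightarrow> real) \<Rightarrow> real \<Rightarrow> real" where
  "bern0 N f = bernstein_op (N + 2) (\<lambda>m. f (real m / real (N + 2)))"
definition bern1 :: "nat \<Rightarrow> (real \<Rightarrow> real) \<Rightarrow> real \<Rightarrow> real" where
  "bern1 N f x = real (N + 2) * bernstein_op (N + 1) (\<lambda>m. f (real (Suc m) / real (N + 2)) - f (real m / real (N + 2))) x"
definition bern2 :: "nat \<Rightarrow> (real \<Rightarrow> real) \<Rightarrow> real \<Rightarrow> real" where
  "bern2 N f x = real (N + 2) * (real (N + 1) * bernstein_op N (\<lambda>m. (f (real (Suc (Suc m)) / real (N + 2)) - f (real (Suc m) / real (N + 2)))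
     - (f (real (Suc m) / real (N + 2)) - f (real m / real (N + 2)))) x)"

lemma bern_DERIV: "(bern0 N f has_real_derivative bern1 N f x) (at x)" "(bern1 N f has_real_derivative bern2 N f x) (at x)"
proof -
  show "(bern0 N f has_real_derivative bern1 N f x) (at x)"
    using bernstein_op_DERIV[of "N + 1" "\<lambda>m. f (real m / real (N + 2))" x] by (simp add: bern0_def bern1_def)
  show "(bern1 N f has_real_derivative bern2 N f x) (at x)"
    unfolding bern1_def[abs_def] bern2_def
    using DERIV_cmult[OF bernstein_op_DERIV[of N "\<lambda>m. f (real (Suc m) / real (N + 2)) - f (real m / real (N + 2))" x], of "real (N + 2)"] by simp
qed

text \<open>By the mean value theorem.\<close>

lemma bern_samples:
  assumes f: "\<And>s. (f has_real_derivative f' s) (at s)"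
  shows "m \<le> N + 1 \<Longrightarrow> \<exists>\<xi>\<in>{0..1}. \<bar>\<xi> - real m / real (N + 1)\<bar> \<le> 2 / real (N + 1 + 1) \<and>
      real (N + 2) * (f (real (Suc m) / real (N + 2)) - f (real m / real (N + 2))) = f' \<xi>"
    and "(\<And>s. (f' has_real_derivative f'' s) (at s)) \<Longrightarrow> m \<le> N \<Longrightarrow> \<exists>\<xi>\<in>{0..1}. \<bar>\<xi> - real m / real N\<bar> \<le> 2 / real (N + 1) \<and>
      real (N + 2) * (real (N + 2) * ((f (real (Suc (Suc m)) / real (N + 2)) - f (real (Suc m) / real (N + 2)))
        - (f (real (Suc m) / real (N + 2)) - f (real m / real (N + 2))))) = f'' \<xi>"
proof -
  define K where "K = real (N + 2)"
  have K: "K > 0" "K = real N + 2" by (simp_all add: K_def)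
  show "\<exists>\<xi>\<in>{0..1}. \<bar>\<xi> - real m / real (N + 1)\<bar> \<le> 2 / real (N + 1 + 1) \<and>
      real (N + 2) * (f (real (Suc m) / real (N + 2)) - f (real m / real (N + 2))) = f' \<xi>" if m: "m \<le> N + 1"
  proof -
    have lt: "real m / K < real (Suc m) / K" using K by (simp add: divide_strict_right_mono)
    obtain z where z: "real m / K < z" "z < real (Suc m) / K" "f (real (Suc m) / K) - f (real m / K) = (real (Suc m) / K - real m / K) * f' z"
      using MVT2[OF lt, of f f'] f by blast
    have "real (Suc m) / K - real m / K = 1 / K" by (simp add: diff_divide_distrib[symmetric])
    then have e: "K * (f (real (Suc m) / K) - f (real m / K)) = f' z" using z(3) K by simp
    have z0: "0 \<le> z" using z(1) K by (meson divide_nonneg_pos le_less_trans of_nat_0_le_iff less_imp_le)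
    have "real (Suc m) / K \<le> 1" using m K by simp
    then have z1: "z \<le> 1" using z(2) by simp
    have mN: "real m / K \<le> real m / real (N + 1)" using K by (intro divide_left_mono) auto
    have mN': "real m / real (N + 1) \<le> real (Suc m) / K"
      using m K by (simp add: divide_simps) (simp add: algebra_simps)
    have "real (Suc m) / K = real m / K + 1 / K" by (simp add: add_divide_distrib)
    then have "\<bar>z - real m / real (N + 1)\<bar> \<le> 1 / K" using z mN mN' by linarith
    also have "\<dots> \<le> 2 / real (N + 1 + 1)" using K by (simp add: divide_simps)
    finally show ?thesis using z0 z1 e unfolding K_def by auto
  qed
  show "\<exists>\<xi>\<in>{0..1}. \<bar>\<xi> - real m / real N\<bar> \<le> 2 / real (N + 1) \<and>
      real (N + 2) * (real (N + 2) * ((f (real (Suc (Suc m)) / real (N + 2)) - f (real (Suc m) / real (N + 2)))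
        - (f (real (Suc m) / real (N + 2)) - f (real m / real (N + 2))))) = f'' \<xi>"
    if f': "\<And>s. (f' has_real_derivative f'' s) (at s)" and m: "m \<le> N"
  proof -
    define g where "g s = f (s + 1 / K) - f s" for s
    have g: "(g has_real_derivative (f' (s + 1 / K) - f' s)) (at s)" for s
      unfolding g_def[abs_def] using f DERIV_shift[of f "f' (s + 1/K)" s "1/K"] by (auto intro!: derivative_intros)
    have s1: "real (Suc k) / K = real k / K + 1 / K" for k by (simp add: add_divide_distrib)
    have lt: "real m / K < real m / K + 1 / K" using K by simp
    obtain y where y: "real m / K < y" "y < real m / K + 1 / K" "g (real m / K + 1 / K) - g (real m / K) = (1 / K) * (f' (y + 1 / K) - f' y)"
      using MVT2[OF lt, of g "\<lambda>s. f' (s + 1 / K) - f' s"] g by auto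
    have lt2: "y < y + 1 / K" using K by simp
    obtain z where z: "y < z" "z < y + 1 / K" "f' (y + 1 / K) - f' y = (1 / K) * f'' z"
      using MVT2[OF lt2, of f' f''] f' by auto
    have gz: "g (real m / K + 1 / K) - g (real m / K) = (1 / K) * ((1 / K) * f'' z)" using y(3) z(3) by simp
    have gf: "g (real m / K + 1 / K) - g (real m / K) = (f (real (Suc (Suc m)) / K) - f (real (Suc m) / K)) - (f (real (Suc m) / K) - f (real m / K))"
      by (simp only: g_def s1)
    have e: "K * (K * ((f (real (Suc (Suc m)) / K) - f (real (Suc m) / K)) - (f (real (Suc m) / K) - f (real m / K)))) = f'' z"
      unfolding gf[symmetric] gz using K(1) by simp
    have up: "z < real m / K + 2 / K" using z y by (simp add: add_divide_distrib)
    have lo: "real m / K < z" using z y by simp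
    have z0: "0 \<le> z" using lo K by (meson divide_nonneg_pos le_less_trans of_nat_0_le_iff less_imp_le)
    have "real m / K + 2 / K \<le> 1" using m K by (simp add: add_divide_distrib[symmetric])
    then have z1: "z \<le> 1" using up by simp
    have "\<bar>z - real m / real N\<bar> \<le> 2 / K"
    proof (cases "N = 0")
      case True
      then show ?thesis using z0 z1 K by simp
    next
      case False
      have "real m / K \<le> real m / real N" using K False by (intro divide_left_mono) auto
      moreover have "real m / real N \<le> real m / K + 2 / K"
        using m K False by (simp add: add_divide_distrib[symmetric] divide_simps) (simp add: algebra_simps)
      ultimately show ?thesis using up lo by linarith
    qed
    also have "\<dots> \<le> 2 / real (N + 1)" using K by (intro divide_left_mono) auto
    finally show ?thesis using z0 z1 e unfolding K_def by auto
  qed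
qed

lemma continuous_DERIV: "(\<And>s. (f has_real_derivative f' s) (at s)) \<Longrightarrow> continuous_on S f"
  by (auto intro: DERIV_isCont continuous_at_imp_continuous_on)

lemma bern0_tendsto:
  assumes f: "continuous_on UNIV f" and x: "0 \<le> x" "x \<le> 1" shows "(\<lambda>N. bern0 N f x) \<longlonglongrightarrow> f x"
proof -
  have "(\<lambda>N. bernstein_op N (\<lambda>m. f (real m / real N)) x) \<longlonglongrightarrow> f x"
  proof (rule bernstein_op_tendsto[OF continuous_on_subset[OF f] x])
    fix N m :: nat assume "m \<le> N"
    then show "\<exists>\<xi>\<in>{0..1}. \<bar>\<xi> - real m / real N\<bar> \<le> 2 / real (N + 1) \<and> f (real m / real N) = f \<xi>"
      by (intro bexI[of _ "real m / real N"]) (cases "N = 0"; auto)+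
  qed simp
  from LIMSEQ_ignore_initial_segment[OF this, of 2] show ?thesis by (simp add: bern0_def)
qed

lemma bern1_tendsto:
  assumes f: "\<And>s. (f has_real_derivative f' s) (at s)" "continuous_on UNIV f'" and x: "0 \<le> x" "x \<le> 1"
  shows "(\<lambda>N. bern1 N f x) \<longlonglongrightarrow> f' x"
proof -
  define F where "F N m = (if N = 0 then f' 0 else real (N + 1) * (f (real (Suc m) / real (N + 1)) - f (real m / real (N + 1))))" for N m :: nat
  have "(\<lambda>N. bernstein_op N (F N) x) \<longlonglongrightarrow> f' x"
  proof (rule bernstein_op_tendsto[OF continuous_on_subset[OF f(2)] x])
    fix N m :: nat assume m: "m \<le> N"
    show "\<exists>\<xi>\<in>{0..1}. \<bar>\<xi> - real m / real N\<bar> \<le> 2 / real (N + 1) \<and> F N m = f' \<xi>"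
    proof (cases N)
      case 0 then show ?thesis by (intro bexI[of _ 0]) (auto simp: F_def)
    next
      case (Suc M)
      then show ?thesis using bern_samples(1)[OF f(1), of m M] m by (simp add: F_def)
    qed
  qed simp
  then have "(\<lambda>N. bernstein_op (N + 1) (F (N + 1)) x) \<longlonglongrightarrow> f' x" by (rule LIMSEQ_ignore_initial_segment)
  moreover have "F (N + 1) = (\<lambda>m. real (N + 2) * (f (real (Suc m) / real (N + 2)) - f (real m / real (N + 2))))" for N
    by (rule ext) (simp add: F_def)
  then have "bernstein_op (N + 1) (F (N + 1)) x = bern1 N f x" for N
    by (simp only: bern1_def bernstein_op_cmult)
  ultimately show ?thesis by simp
qed

lemma bern2_tendsto:
  assumes f: "\<And>s. (f has_real_derivative f' s) (at s)" "\<And>s. (f' has_real_derivative f'' s) (at s)" "continuous_on UNIV f''"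
    and x: "0 \<le> x" "x \<le> 1"
  shows "(\<lambda>N. bern2 N f x) \<longlonglongrightarrow> f'' x"
proof -
  define F where "F N m = real (N + 2) * (real (N + 2) * ((f (real (Suc (Suc m)) / real (N + 2)) - f (real (Suc m) / real (N + 2)))
        - (f (real (Suc m) / real (N + 2)) - f (real m / real (N + 2)))))" for N m :: nat
  have 1: "(\<lambda>N. bernstein_op N (F N) x) \<longlonglongrightarrow> f'' x"
    unfolding F_def by (rule bernstein_op_tendsto[OF continuous_on_subset[OF f(3)] x]) (use bern_samples(2)[OF f(1,2)] in auto)
  have 2: "(\<lambda>N. real (N + 1) / real (N + 2)) \<longlonglongrightarrow> 1"
  proof -
    have "(\<lambda>N. 1 - 1 / real (Suc (N + 1))) \<longlonglongrightarrow> 1 - 0"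
      using LIMSEQ_ignore_initial_segment[OF LIMSEQ_inverse_real_of_nat, of 1] by (intro tendsto_diff tendsto_const) (simp add: inverse_eq_divide)
    moreover have "1 - 1 / real (Suc (N + 1)) = real (N + 1) / real (N + 2)" for N by (simp add: field_simps)
    ultimately show ?thesis by simp
  qed
  have "bern2 N f x = real (N + 1) / real (N + 2) * bernstein_op N (F N) x" for N
    unfolding bern2_def F_def bernstein_op_cmult by simp
  then show ?thesis using tendsto_mult[OF 2 1] by simp
qed

lemma bern_bounds:
  assumes x: "0 \<le> x" "x \<le> 1"
  shows "(\<And>s. \<bar>f s\<bar> \<le> B) \<Longrightarrow> \<bar>bern0 N f x\<bar> \<le> B"
    and "(\<And>s. (f has_real_derivative f' s) (at s)) \<Longrightarrow> (\<And>s. \<bar>f' s\<bar> \<le> B) \<Longrightarrow> \<bar>bern1 N f x\<bar> \<le> B"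
    and "(\<And>s. (f has_real_derivative f' s) (at s)) \<Longrightarrow> (\<And>s. (f' has_real_derivative f'' s) (at s)) \<Longrightarrow> (\<And>s. \<bar>f'' s\<bar> \<le> B) \<Longrightarrow> \<bar>bern2 N f x\<bar> \<le> B"
proof -
  show "\<bar>bern0 N f x\<bar> \<le> B" if "\<And>s. \<bar>f s\<bar> \<le> B" unfolding bern0_def by (rule bernstein_op_bound[OF x that])
  show "\<bar>bern1 N f x\<bar> \<le> B" if f: "\<And>s. (f has_real_derivative f' s) (at s)" and b: "\<And>s. \<bar>f' s\<bar> \<le> B"
    unfolding bern1_def bernstein_op_cmult[symmetric]
  proof (rule bernstein_op_bound[OF x])
    fix m assume "m \<le> N + 1"
    from bern_samples(1)[OF f this] obtain \<xi> where "real (N + 2) * (f (real (Suc m) / real (N + 2)) - f (real m / real (N + 2))) = f' \<xi>" by blast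
    then show "\<bar>real (N + 2) * (f (real (Suc m) / real (N + 2)) - f (real m / real (N + 2)))\<bar> \<le> B" using b by simp
  qed
  show "\<bar>bern2 N f x\<bar> \<le> B" if f: "\<And>s. (f has_real_derivative f' s) (at s)" "\<And>s. (f' has_real_derivative f'' s) (at s)" and b: "\<And>s. \<bar>f'' s\<bar> \<le> B"
    unfolding bern2_def bernstein_op_cmult[symmetric]
  proof (rule bernstein_op_bound[OF x])
    fix m assume m: "m \<le> N"
    define D where "D = (f (real (Suc (Suc m)) / real (N + 2)) - f (real (Suc m) / real (N + 2))) - (f (real (Suc m) / real (N + 2)) - f (real m / real (N + 2)))"
    obtain \<xi> where "real (N + 2) * (real (N + 2) * D) = f'' \<xi>" using bern_samples(2)[OF f m] unfolding D_def by blast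
    then have "\<bar>real (N + 2) * (real (N + 2) * D)\<bar> \<le> B" using b by simp
    moreover have "\<bar>real (N + 2) * (real (N + 1) * D)\<bar> \<le> \<bar>real (N + 2) * (real (N + 2) * D)\<bar>"
      unfolding abs_mult by (intro mult_left_mono mult_right_mono) auto
    ultimately show "\<bar>real (N + 2) * (real (N + 1) * D)\<bar> \<le> B" by simp
  qed
qed

lemma bern_param_DERIV:
  assumes "\<And>s. ((\<lambda>t. F t s) has_real_derivative F' s) (at a)"
  shows "((\<lambda>t. bern0 N (F t) x) has_real_derivative bern0 N F' x) (at a)"
    and "((\<lambda>t. bern1 N (F t) x) has_real_derivative bern1 N F' x) (at a)"
proof -
  have T: "((\<lambda>t. bernstein_op M (G t) x) has_real_derivative bernstein_op M G' x) (at a)"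
    if "\<And>m. ((\<lambda>t. G t m) has_real_derivative G' m) (at a)" for M and G :: "real \<Rightarrow> nat \<Rightarrow> real" and G'
    unfolding bernstein_op_def by (intro DERIV_sum DERIV_cmult_right that)
  show "((\<lambda>t. bern0 N (F t) x) has_real_derivative bern0 N F' x) (at a)"
    unfolding bern0_def by (rule T) (rule assms)
  show "((\<lambda>t. bern1 N (F t) x) has_real_derivative bern1 N F' x) (at a)"
    unfolding bern1_def by (intro DERIV_cmult T DERIV_diff assms)
qed

lemma bern_param_continuous:
  assumes F: "\<And>s. continuous_on UNIV (\<lambda>u. F u s)" and x: "continuous_on UNIV x"
  shows "continuous_on UNIV (\<lambda>u. bern0 N (F u) (x u))" "continuous_on UNIV (\<lambda>u. bern1 N (F u) (x u))" "continuous_on UNIV (\<lambda>u. bern2 N (F u) (x u))"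
  unfolding bern0_def bern1_def bern2_def bernstein_op_def Bernstein_def
  by (intro continuous_on_sum continuous_on_mult continuous_on_diff continuous_on_const continuous_on_power F x)+

lemma continuous_fun_upd: "continuous_on UNIV (\<lambda>u::nat \<Rightarrow> real. u(n := s))"
proof (intro continuous_on_coordinatewise_then_product)
  show "continuous_on UNIV (\<lambda>u::nat \<Rightarrow> real. (u(n := s)) i)" for i by (cases "i = n") auto
qed

text \<open>Bernstein approximation in the coordinate \<open>n\<close>. Partial derivatives in the other coordinates pass
  to the samples.\<close>

lemma has_C2_bernstein:
  assumes k: "has_C2 d k k1 k2" and n: "n < d"
  shows "has_C2 d (\<lambda>u. bern0 N (\<lambda>s. k (u(n := s))) (u n))
    (\<lambda>i u. if i = n then bern1 N (\<lambda>s. k (u(n := s))) (u n) else bern0 N (\<lambda>s. k1 i (u(n := s))) (u n))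
    (\<lambda>i j u. if i = n then (if j = n then bern2 N (\<lambda>s. k (u(n := s))) (u n) else bern1 N (\<lambda>s. k1 j (u(n := s))) (u n))
       else (if j = n then bern1 N (\<lambda>s. k1 i (u(n := s))) (u n) else bern0 N (\<lambda>s. k2 i j (u(n := s))) (u n)))"
proof -
  have ct: "continuous_on UNIV k" "\<And>i. i < d \<Longrightarrow> continuous_on UNIV (k1 i)" "\<And>i j. i < d \<Longrightarrow> j < d \<Longrightarrow> continuous_on UNIV (k2 i j)"
    and D1: "\<And>i u. i < d \<Longrightarrow> ((\<lambda>t. k (u(i := t))) has_real_derivative k1 i u) (at (u i))"
    and D2: "\<And>i j u. i < d \<Longrightarrow> j < d \<Longrightarrow> ((\<lambda>t. k1 j (u(i := t))) has_real_derivative k2 i j u) (at (u i))"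
    and dep: "depends_on_first d k" using k by (auto simp: has_C2_def)
  have cc: "continuous_on UNIV (\<lambda>u. f (u(n := s)))" if "continuous_on UNIV f" for f :: "(nat \<Rightarrow> real) \<Rightarrow> real" and s
    by (rule continuous_on_compose2[OF that continuous_fun_upd]) auto
  have cn: "continuous_on UNIV (\<lambda>u::nat \<Rightarrow> real. u n)" by (rule continuous_on_product_coordinates)
  have par: "((\<lambda>t. f (u(i := t, n := s))) has_real_derivative f' (u(n := s))) (at (u i))"
    if "\<And>u. ((\<lambda>t. f (u(i := t))) has_real_derivative f' u) (at (u i))" "i \<noteq> n" for f f' :: "(nat \<Rightarrow> real) \<Rightarrow> real" and i u s
    using that(1)[of "u(n := s)"] that(2) by (simp add: fun_upd_twist)
  have dep': "depends_on_first d (\<lambda>u. bern0 N (\<lambda>s. k (u(n := s))) (u n))"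
    unfolding depends_on_first_def
  proof (intro allI impI)
    fix u v :: "nat \<Rightarrow> real" assume uv: "\<forall>i<d. u i = v i"
    have "k (u(n := s)) = k (v(n := s))" for s
      using dep[unfolded depends_on_first_def, rule_format, of "u(n := s)" "v(n := s)"] uv by simp
    then show "bern0 N (\<lambda>s. k (u(n := s))) (u n) = bern0 N (\<lambda>s. k (v(n := s))) (v n)" using uv n by simp
  qed
  show ?thesis unfolding has_C2_def
  proof (intro conjI allI impI dep')
    show "continuous_on UNIV (\<lambda>u. bern0 N (\<lambda>s. k (u(n := s))) (u n))"
      by (intro bern_param_continuous cc ct cn)
    fix i assume i: "i < d"
    show "continuous_on UNIV (\<lambda>u. if i = n then bern1 N (\<lambda>s. k (u(n := s))) (u n) else bern0 N (\<lambda>s. k1 i (u(n := s))) (u n))"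
      by (cases "i = n") (auto intro!: bern_param_continuous cc ct cn i)
    fix u :: "nat \<Rightarrow> real"
    show "((\<lambda>t. bern0 N (\<lambda>s. k (u(i := t, n := s))) ((u(i := t)) n)) has_real_derivative
        (if i = n then bern1 N (\<lambda>s. k (u(n := s))) (u n) else bern0 N (\<lambda>s. k1 i (u(n := s))) (u n))) (at (u i))"
    proof (cases "i = n")
      case True then show ?thesis using bern_DERIV(1) by simp
    next
      case False
      have "((\<lambda>t. k (u(i := t, n := s))) has_real_derivative k1 i (u(n := s))) (at (u i))" for s
        by (rule par[OF D1[OF i] False])
      from bern_param_DERIV(1)[OF this, where N=N and x="u n"] show ?thesis using False by simp
    qed
  next
    fix i j assume i: "i < d" and j: "j < d"
    show "continuous_on UNIV (\<lambda>u. if i = n then (if j = n then bern2 N (\<lambda>s. k (u(n := s))) (u n) else bern1 N (\<lambda>s. k1 j (u(n := s))) (u n))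
       else (if j = n then bern1 N (\<lambda>s. k1 i (u(n := s))) (u n) else bern0 N (\<lambda>s. k2 i j (u(n := s))) (u n)))"
      by (cases "i = n"; cases "j = n") (auto intro!: bern_param_continuous cc ct cn i j)
    fix u :: "nat \<Rightarrow> real"
    show "((\<lambda>t. if j = n then bern1 N (\<lambda>s. k (u(i := t, n := s))) ((u(i := t)) n) else bern0 N (\<lambda>s. k1 j (u(i := t, n := s))) ((u(i := t)) n))
      has_real_derivative (if i = n then (if j = n then bern2 N (\<lambda>s. k (u(n := s))) (u n) else bern1 N (\<lambda>s. k1 j (u(n := s))) (u n))
       else (if j = n then bern1 N (\<lambda>s. k1 i (u(n := s))) (u n) else bern0 N (\<lambda>s. k2 i j (u(n := s))) (u n)))) (at (u i))"
    proof (cases "i = n")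
      case True then show ?thesis using bern_DERIV by simp
    next
      case False
      have 1: "((\<lambda>t. k (u(i := t, n := s))) has_real_derivative k1 i (u(n := s))) (at (u i))" for s
        by (rule par[OF D1[OF i] False])
      have 2: "((\<lambda>t. k1 j (u(i := t, n := s))) has_real_derivative k2 i j (u(n := s))) (at (u i))" for s
        by (rule par[OF D2[OF i j] False])
      show ?thesis using False bern_param_DERIV(2)[OF 1, where N=N and x="u n"] bern_param_DERIV(1)[OF 2, where N=N and x="u n"] by simp
    qed
  qed
qed

text \<open>The mean value theorem in one coordinate after the other.\<close>

lemma has_C2_mixed_difference:
  assumes g: "has_C2 d g g1 g2" and i: "i < d" and j: "j < d" and ij: "i \<noteq> j"
  shows "\<exists>\<xi> \<eta>. \<bar>\<xi> - u i\<bar> \<le> \<bar>t\<bar> \<and> \<bar>\<eta> - u j\<bar> \<le> \<bar>t\<bar> \<and>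
    g (u(j := u j + t, i := u i + t)) - g (u(j := u j + t)) - (g (u(i := u i + t)) - g u) = t * (t * g2 i j (u(j := \<eta>, i := \<xi>)))"
proof -
  have D1: "\<And>u. ((\<lambda>t. g (u(j := t))) has_real_derivative g1 j u) (at (u j))"
    and D2: "\<And>u. ((\<lambda>t. g1 j (u(i := t))) has_real_derivative g2 i j u) (at (u i))"
    using g i j by (auto simp: has_C2_def)
  define p where "p y = g (u(j := y, i := u i + t)) - g (u(j := y))" for y
  have p: "(p has_real_derivative g1 j (u(j := y, i := u i + t)) - g1 j (u(j := y))) (at y)" for y
  proof -
    have "((\<lambda>y. g (u(j := y, i := u i + t))) has_real_derivative g1 j (u(j := y, i := u i + t))) (at y)"
      using D1[of "u(j := y, i := u i + t)"] ij by (simp add: fun_upd_twist[OF ij])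
    moreover have "((\<lambda>y. g (u(j := y))) has_real_derivative g1 j (u(j := y))) (at y)"
      using D1[of "u(j := y)"] by simp
    ultimately show ?thesis unfolding p_def[abs_def] by (rule DERIV_diff)
  qed
  obtain \<eta> where eta: "\<bar>\<eta> - u j\<bar> \<le> \<bar>t\<bar>" "p (u j + t) - p (u j) = t * (g1 j (u(j := \<eta>, i := u i + t)) - g1 j (u(j := \<eta>)))"
    by (rule mvt_increment[OF p])
  have q: "((\<lambda>x. g1 j (u(j := \<eta>, i := x))) has_real_derivative g2 i j (u(j := \<eta>, i := x))) (at x)" for x
    using D2[of "u(j := \<eta>, i := x)"] by simp
  obtain \<xi> where xi: "\<bar>\<xi> - u i\<bar> \<le> \<bar>t\<bar>" "g1 j (u(j := \<eta>, i := u i + t)) - g1 j (u(j := \<eta>, i := u i)) = t * g2 i j (u(j := \<eta>, i := \<xi>))"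
    by (rule mvt_increment[OF q])
  have "u(j := \<eta>, i := u i) = u(j := \<eta>)" using ij by (simp add: fun_eq_iff)
  then have "p (u j + t) - p (u j) = t * (t * g2 i j (u(j := \<eta>, i := \<xi>)))" using eta(2) xi(2) by simp
  then show ?thesis using eta(1) xi(1) by (intro exI[of _ \<xi>] exI[of _ \<eta>]) (simp add: p_def)
qed

text \<open>Schwarz's theorem: both mixed derivatives are limits of the same second difference quotient.\<close>

lemma has_C2_symmetric:
  assumes g: "has_C2 d g g1 g2" and i: "i < d" and j: "j < d"
  shows "g2 i j u = g2 j i u"
proof (cases "i = j")
  case False
  define t where "t l = 1 / real (Suc l)" for l
  have t: "t l \<noteq> 0" for l by (simp add: t_def)
  have t0: "t \<longlonglongrightarrow> 0" unfolding t_def using LIMSEQ_inverse_real_of_nat by (simp add: inverse_eq_divide)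
  have "\<exists>\<xi> \<eta> \<xi>' \<eta>'. \<bar>\<xi> - u i\<bar> \<le> \<bar>t l\<bar> \<and> \<bar>\<eta> - u j\<bar> \<le> \<bar>t l\<bar> \<and> \<bar>\<xi>' - u i\<bar> \<le> \<bar>t l\<bar> \<and> \<bar>\<eta>' - u j\<bar> \<le> \<bar>t l\<bar> \<and>
     g2 i j (u(j := \<eta>, i := \<xi>)) = g2 j i (u(j := \<eta>', i := \<xi>'))" for l
  proof -
    obtain \<xi> \<eta> where 1: "\<bar>\<xi> - u i\<bar> \<le> \<bar>t l\<bar>" "\<bar>\<eta> - u j\<bar> \<le> \<bar>t l\<bar>"
      "g (u(j := u j + t l, i := u i + t l)) - g (u(j := u j + t l)) - (g (u(i := u i + t l)) - g u) = t l * (t l * g2 i j (u(j := \<eta>, i := \<xi>)))"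
      using has_C2_mixed_difference[OF g i j False, of u "t l"] by blast
    obtain \<eta>' \<xi>' where 2: "\<bar>\<eta>' - u j\<bar> \<le> \<bar>t l\<bar>" "\<bar>\<xi>' - u i\<bar> \<le> \<bar>t l\<bar>"
      "g (u(i := u i + t l, j := u j + t l)) - g (u(i := u i + t l)) - (g (u(j := u j + t l)) - g u) = t l * (t l * g2 j i (u(i := \<xi>', j := \<eta>')))"
      using has_C2_mixed_difference[OF g j i False[symmetric], of u "t l"] by blast
    have tw: "u(i := a, j := b) = u(j := b, i := a)" for a b using False by (simp add: fun_upd_twist)
    have "t l * (t l * g2 i j (u(j := \<eta>, i := \<xi>))) = t l * (t l * g2 j i (u(j := \<eta>', i := \<xi>')))"
      using 1(3) 2(3) unfolding tw by linarith
    then have "g2 i j (u(j := \<eta>, i := \<xi>)) = g2 j i (u(j := \<eta>', i := \<xi>'))" using t by simp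
    then show ?thesis using 1(1,2) 2(1,2) by blast
  qed
  then obtain \<xi> \<eta> \<xi>' \<eta>' where x: "\<And>l. \<bar>\<xi> l - u i\<bar> \<le> \<bar>t l\<bar>" "\<And>l. \<bar>\<eta> l - u j\<bar> \<le> \<bar>t l\<bar>" "\<And>l. \<bar>\<xi>' l - u i\<bar> \<le> \<bar>t l\<bar>" "\<And>l. \<bar>\<eta>' l - u j\<bar> \<le> \<bar>t l\<bar>"
    and eq: "\<And>l. g2 i j (u(j := \<eta> l, i := \<xi> l)) = g2 j i (u(j := \<eta>' l, i := \<xi>' l))" by metis
  have lim: "s \<longlonglongrightarrow> a" if "\<And>l. \<bar>s l - a\<bar> \<le> \<bar>t l\<bar>" for s a
  proof (rule LIM_zero_cancel, rule Lim_null_comparison)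
    show "\<forall>\<^sub>F l in sequentially. norm (s l - a) \<le> \<bar>t l\<bar>" using that by simp
    show "(\<lambda>l. \<bar>t l\<bar>) \<longlonglongrightarrow> 0" using tendsto_rabs[OF t0] by simp
  qed
  have cont: "continuous_on UNIV (\<lambda>ab. u(j := fst ab, i := snd ab))"
  proof (intro continuous_on_coordinatewise_then_product)
    show "continuous_on UNIV (\<lambda>ab. (u(j := fst ab, i := snd ab)) l)" for l
      by (cases "l = i"; cases "l = j") (auto intro!: continuous_intros)
  qed
  have lim2: "(\<lambda>l. f (u(j := b l, i := a l))) \<longlonglongrightarrow> f u" if "continuous_on UNIV f" "a \<longlonglongrightarrow> u i" "b \<longlonglongrightarrow> u j"
    for f :: "(nat \<Rightarrow> real) \<Rightarrow> real" and a b
  proof -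
    have c: "continuous_on UNIV (\<lambda>ab. f (u(j := fst ab, i := snd ab)))" by (rule continuous_on_compose2[OF that(1) cont]) auto
    have "(\<lambda>l. (b l, a l)) \<longlonglongrightarrow> (u j, u i)" by (intro tendsto_Pair that)
    from continuous_on_tendsto_compose[OF c this] show ?thesis by simp
  qed
  have "continuous_on UNIV (g2 i j)" "continuous_on UNIV (g2 j i)" using g i j by (auto simp: has_C2_def)
  then have "(\<lambda>l. g2 i j (u(j := \<eta> l, i := \<xi> l))) \<longlonglongrightarrow> g2 i j u" "(\<lambda>l. g2 j i (u(j := \<eta>' l, i := \<xi>' l))) \<longlonglongrightarrow> g2 j i u"
    by (intro lim2 lim x; simp)+
  then show ?thesis unfolding eq by (rule LIMSEQ_unique)
qed simp

text \<open>The derivative in \<open>i\<close> of the derivative in \<open>n\<close> consists of differences, in direction \<open>n\<close>, of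
  derivatives of the samples in direction \<open>i\<close>. It tends to the second derivative in the opposite order.\<close>

lemma bp_C2_bernstein:
  assumes k: "C2_fun d k" "C2_bound d k B" and n: "n < d"
  shows "bp_C2_on {u. \<forall>i. 0 \<le> u i \<and> u i \<le> 1} d (\<lambda>N u. bern0 N (\<lambda>s. k (u(n := s))) (u n)) k"
proof -
  have h: "has_C2 d k (\<lambda>i. partial i k) (\<lambda>i j. partial i (partial j k))" by (rule C2_fun_imp_has_C2[OF k(1)])
  then have ct: "continuous_on UNIV k" "\<And>i. i < d \<Longrightarrow> continuous_on UNIV (partial i k)" "\<And>i j. i < d \<Longrightarrow> j < d \<Longrightarrow> continuous_on UNIV (partial i (partial j k))"
    and D1: "\<And>i u. i < d \<Longrightarrow> ((\<lambda>t. k (u(i := t))) has_real_derivative partial i k u) (at (u i))"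
    and D2: "\<And>i j u. i < d \<Longrightarrow> j < d \<Longrightarrow> ((\<lambda>t. partial j k (u(i := t))) has_real_derivative partial i (partial j k) u) (at (u i))"
    by (auto simp: has_C2_def)
  have b: "\<bar>k u\<bar> \<le> B" "i < d \<Longrightarrow> \<bar>partial i k u\<bar> \<le> B" "i < d \<Longrightarrow> j < d \<Longrightarrow> \<bar>partial i (partial j k) u\<bar> \<le> B" for u i j
    using k(2) by (auto simp: C2_bound_def)
  have cs: "continuous_on UNIV (\<lambda>s. f (u(n := s)))" if "continuous_on UNIV f" for f :: "(nat \<Rightarrow> real) \<Rightarrow> real" and u
  proof (rule continuous_on_compose2[OF that])
    show "continuous_on UNIV (\<lambda>s. u(n := s))"
    proof (intro continuous_on_coordinatewise_then_product)
      show "continuous_on UNIV (\<lambda>s. (u(n := s)) l)" for l by (cases "l = n") (auto intro!: continuous_intros)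
    qed
  qed auto
  have E1: "((\<lambda>s. k (u(n := s))) has_real_derivative partial n k (u(n := s))) (at s)" for u s
    using D1[OF n, of "u(n := s)"] by simp
  have E2: "((\<lambda>s. partial j k (u(n := s))) has_real_derivative partial n (partial j k) (u(n := s))) (at s)" if "j < d" for u s j
    using D2[OF n that, of "u(n := s)"] by simp
  have sym: "partial i (partial n k) u = partial n (partial i k) u" if "i < d" for i u
    using has_C2_symmetric[OF h that n, of u] .
  show ?thesis
  proof (rule bp_C2_onI[OF h has_C2_bernstein[OF h n], where B=B])
    fix N i j and u :: "nat \<Rightarrow> real" assume "u \<in> {u. \<forall>i. 0 \<le> u i \<and> u i \<le> 1}"
    then have x: "0 \<le> u n" "u n \<le> 1" by auto
    show "\<bar>bern0 N (\<lambda>s. k (u(n := s))) (u n)\<bar> \<le> B" by (rule bern_bounds(1)[OF x b(1)])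
    show "(\<lambda>N. bern0 N (\<lambda>s. k (u(n := s))) (u n)) \<longlonglongrightarrow> k u"
      using bern0_tendsto[OF cs[OF ct(1)] x, of u] by simp
    assume i: "i < d"
    show "\<bar>if i = n then bern1 N (\<lambda>s. k (u(n := s))) (u n) else bern0 N (\<lambda>s. partial i k (u(n := s))) (u n)\<bar> \<le> B"
    proof -
      have "\<bar>bern1 N (\<lambda>s. k (u(n := s))) (u n)\<bar> \<le> B" by (rule bern_bounds(2)[OF x E1 b(2)[OF n]])
      moreover have "\<bar>bern0 N (\<lambda>s. partial i k (u(n := s))) (u n)\<bar> \<le> B" by (rule bern_bounds(1)[OF x b(2)[OF i]])
      ultimately show ?thesis by simp
    qed
    show "(\<lambda>N. if i = n then bern1 N (\<lambda>s. k (u(n := s))) (u n) else bern0 N (\<lambda>s. partial i k (u(n := s))) (u n)) \<longlonglongrightarrow> partial i k u"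
      using bern1_tendsto[OF E1 cs[OF ct(2)[OF n]] x, of u] bern0_tendsto[OF cs[OF ct(2)[OF i]] x, of u] by (cases "i = n") simp_all
    assume j: "j < d"
    show "\<bar>if i = n then if j = n then bern2 N (\<lambda>s. k (u(n := s))) (u n) else bern1 N (\<lambda>s. partial j k (u(n := s))) (u n)
        else if j = n then bern1 N (\<lambda>s. partial i k (u(n := s))) (u n) else bern0 N (\<lambda>s. partial i (partial j k) (u(n := s))) (u n)\<bar> \<le> B"
    proof -
      have "\<bar>bern2 N (\<lambda>s. k (u(n := s))) (u n)\<bar> \<le> B" by (rule bern_bounds(3)[OF x E1 E2[OF n] b(3)[OF n n]])
      moreover have "\<bar>bern1 N (\<lambda>s. partial l k (u(n := s))) (u n)\<bar> \<le> B" if "l < d" for l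
        by (rule bern_bounds(2)[OF x E2[OF that] b(3)[OF n that]])
      moreover have "\<bar>bern0 N (\<lambda>s. partial i (partial j k) (u(n := s))) (u n)\<bar> \<le> B" by (rule bern_bounds(1)[OF x b(3)[OF i j]])
      ultimately show ?thesis using i j by simp
    qed
    show "(\<lambda>N. if i = n then if j = n then bern2 N (\<lambda>s. k (u(n := s))) (u n) else bern1 N (\<lambda>s. partial j k (u(n := s))) (u n)
        else if j = n then bern1 N (\<lambda>s. partial i k (u(n := s))) (u n) else bern0 N (\<lambda>s. partial i (partial j k) (u(n := s))) (u n))
        \<longlonglongrightarrow> partial i (partial j k) u"
      using bern2_tendsto[OF E1 E2[OF n] cs[OF ct(3)[OF n n]] x, of u] bern1_tendsto[OF E2[OF j] cs[OF ct(3)[OF n j]] x, of u]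
        bern1_tendsto[OF E2[OF i] cs[OF ct(3)[OF n i]] x, of u] bern0_tendsto[OF cs[OF ct(3)[OF i j]] x, of u] sym[OF i, of u]
      by (cases "i = n"; cases "j = n") simp_all
  qed
qed

section \<open>Composition with functions of the single coordinates\<close>

lemma has_C2_compose:
  fixes \<omega> \<omega>' \<omega>'' :: "nat \<Rightarrow> real \<Rightarrow> real"
  assumes g: "has_C2 d g g1 g2"
    and w: "\<And>i s. (\<omega> i has_real_derivative \<omega>' i s) (at s)" "\<And>i s. (\<omega>' i has_real_derivative \<omega>'' i s) (at s)"
      "\<And>i. continuous_on UNIV (\<omega>'' i)"
  shows "has_C2 d (\<lambda>u. g (\<lambda>i. \<omega> i (u i))) (\<lambda>i u. g1 i (\<lambda>i. \<omega> i (u i)) * \<omega>' i (u i))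
    (\<lambda>i j u. g2 i j (\<lambda>i. \<omega> i (u i)) * \<omega>' i (u i) * \<omega>' j (u j) + (if i = j then g1 i (\<lambda>i. \<omega> i (u i)) * \<omega>'' i (u i) else 0))"
proof -
  have ct: "continuous_on UNIV g" "\<And>i. i < d \<Longrightarrow> continuous_on UNIV (g1 i)" "\<And>i j. i < d \<Longrightarrow> j < d \<Longrightarrow> continuous_on UNIV (g2 i j)"
    and D1: "\<And>i u. i < d \<Longrightarrow> ((\<lambda>t. g (u(i := t))) has_real_derivative g1 i u) (at (u i))"
    and D2: "\<And>i j u. i < d \<Longrightarrow> j < d \<Longrightarrow> ((\<lambda>t. g1 j (u(i := t))) has_real_derivative g2 i j u) (at (u i))"
    and dep: "depends_on_first d g" using g by (auto simp: has_C2_def)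
  have cw: "continuous_on UNIV (\<omega> i)" "continuous_on UNIV (\<omega>' i)" for i
    by (rule continuous_DERIV[OF w(1)], rule continuous_DERIV[OF w(2)])
  have cn: "continuous_on UNIV (\<lambda>u. q (u i))" if "continuous_on UNIV q" for q :: "real \<Rightarrow> real" and i :: nat
    by (rule continuous_on_compose2[OF that continuous_on_product_coordinates]) auto
  have cW: "continuous_on UNIV (\<lambda>u i. \<omega> i (u i))" by (intro continuous_on_coordinatewise_then_product cn cw)
  have cg: "continuous_on UNIV (\<lambda>u. f (\<lambda>i. \<omega> i (u i)))" if "continuous_on UNIV f" for f :: "(nat \<Rightarrow> real) \<Rightarrow> real"
    by (rule continuous_on_compose2[OF that cW]) auto
  have upd: "(\<lambda>l. \<omega> l ((u(i := t)) l)) = (\<lambda>l. \<omega> l (u l))(i := \<omega> i t)" for u i t by auto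
  have ch: "((\<lambda>t. f (\<lambda>l. \<omega> l ((u(i := t)) l))) has_real_derivative f' (\<lambda>l. \<omega> l (u l)) * \<omega>' i (u i)) (at (u i))"
    if "\<And>u. ((\<lambda>t. f (u(i := t))) has_real_derivative f' u) (at (u i))" for f f' :: "(nat \<Rightarrow> real) \<Rightarrow> real" and i u
    unfolding upd using DERIV_chain2[OF that[of "\<lambda>l. \<omega> l (u l)"] w(1)[of i "u i"]] by simp
  have dep': "depends_on_first d (\<lambda>u. g (\<lambda>i. \<omega> i (u i)))"
    using dep unfolding depends_on_first_def by simp
  show ?thesis unfolding has_C2_def
  proof (intro conjI allI impI dep')
    show "continuous_on UNIV (\<lambda>u. g (\<lambda>i. \<omega> i (u i)))" by (rule cg[OF ct(1)])
    fix i assume i: "i < d"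
    show "continuous_on UNIV (\<lambda>u. g1 i (\<lambda>i. \<omega> i (u i)) * \<omega>' i (u i))" by (intro continuous_on_mult cg ct cn cw i)
    show "((\<lambda>t. g (\<lambda>l. \<omega> l ((u(i := t)) l))) has_real_derivative g1 i (\<lambda>i. \<omega> i (u i)) * \<omega>' i (u i)) (at (u i))" for u
      by (rule ch[OF D1[OF i]])
  next
    fix i j assume i: "i < d" and j: "j < d"
    show "continuous_on UNIV (\<lambda>u. g2 i j (\<lambda>i. \<omega> i (u i)) * \<omega>' i (u i) * \<omega>' j (u j) + (if i = j then g1 i (\<lambda>i. \<omega> i (u i)) * \<omega>'' i (u i) else 0))"
      by (cases "i = j") (auto intro!: continuous_on_mult continuous_on_add cg ct cn cw w(3) i j)
    fix u :: "nat \<Rightarrow> real"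
    show "((\<lambda>t. g1 j (\<lambda>l. \<omega> l ((u(i := t)) l)) * \<omega>' j ((u(i := t)) j)) has_real_derivative
       g2 i j (\<lambda>i. \<omega> i (u i)) * \<omega>' i (u i) * \<omega>' j (u j) + (if i = j then g1 i (\<lambda>i. \<omega> i (u i)) * \<omega>'' i (u i) else 0)) (at (u i))"
    proof (cases "i = j")
      case True
      have "((\<lambda>t. \<omega>' j ((u(i := t)) j)) has_real_derivative \<omega>'' i (u i)) (at (u i))"
        using w(2)[of i "u i"] True by simp
      from DERIV_mult[OF ch[OF D2[OF i j], of u] this] show ?thesis using True by (simp add: ac_simps)
    next
      case False
      from DERIV_cmult_right[OF ch[OF D2[OF i j], of u], of "\<omega>' j (u j)"] show ?thesis using False by simp
    qed
  qed
qed

lemma bp_C2_compose: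
  fixes \<omega> \<omega>' \<omega>'' :: "nat \<Rightarrow> real \<Rightarrow> real"
  assumes bp: "bp_C2_on X d gs g" and X: "\<And>u. (\<lambda>i. \<omega> i (u i)) \<in> X"
    and w: "\<And>i s. (\<omega> i has_real_derivative \<omega>' i s) (at s)" "\<And>i s. (\<omega>' i has_real_derivative \<omega>'' i s) (at s)"
      "\<And>i. continuous_on UNIV (\<omega>'' i)" "\<And>i s. \<bar>\<omega>' i s\<bar> \<le> W" "\<And>i s. \<bar>\<omega>'' i s\<bar> \<le> W"
  shows "bp_C2_on UNIV d (\<lambda>l u. gs l (\<lambda>i. \<omega> i (u i))) (\<lambda>u. g (\<lambda>i. \<omega> i (u i)))"
proof -
  have hg: "has_C2 d g (\<lambda>i. partial i g) (\<lambda>i j. partial i (partial j g))" by (rule C2_fun_imp_has_C2[OF bp_C2_onD(1)[OF bp]])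
  have hgs: "has_C2 d (gs l) (\<lambda>i. partial i (gs l)) (\<lambda>i j. partial i (partial j (gs l)))" for l
    by (rule C2_fun_imp_has_C2[OF bp_C2_onD(2)[OF bp]])
  obtain B where B0: "\<forall>l. \<forall>u\<in>X. \<bar>gs l u\<bar> \<le> B \<and> (\<forall>i<d. \<bar>partial i (gs l) u\<bar> \<le> B) \<and>
        (\<forall>i<d. \<forall>j<d. \<bar>partial i (partial j (gs l)) u\<bar> \<le> B)" using bp unfolding bp_C2_on_def by blast
  define v where "v u = (\<lambda>i. \<omega> i (u i))" for u
  have vX: "v u \<in> X" for u unfolding v_def by (rule X)
  have B: "\<bar>gs l (v u)\<bar> \<le> B" "i < d \<Longrightarrow> \<bar>partial i (gs l) (v u)\<bar> \<le> B"
    "i < d \<Longrightarrow> j < d \<Longrightarrow> \<bar>partial i (partial j (gs l)) (v u)\<bar> \<le> B" for l u i j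
    using B0 vX by blast+
  have Bp: "0 \<le> B" using B(1)[of 0 undefined] by linarith
  have W: "0 \<le> W" using w(4)[of 0 0] by linarith
  define K where "K = B + B * W + B * W * W"
  have p: "0 \<le> B * W" "0 \<le> B * W * W" using Bp W by auto
  have m: "\<bar>x * y\<bar> \<le> B * W" if "\<bar>x\<bar> \<le> B" "\<bar>y\<bar> \<le> W" for x y :: real
    unfolding abs_mult using that Bp by (intro mult_mono) auto
  have m2: "\<bar>x * y * z\<bar> \<le> B * W * W" if "\<bar>x\<bar> \<le> B" "\<bar>y\<bar> \<le> W" "\<bar>z\<bar> \<le> W" for x y z :: real
    unfolding abs_mult[of "x * y"] using that m[OF that(1,2)] p by (intro mult_mono) auto
  have hG: "has_C2 d (\<lambda>u. g (v u)) (\<lambda>i u. partial i g (v u) * \<omega>' i (u i)) (\<lambda>i j u. partial i (partial j g) (v u) * \<omega>' i (u i) * \<omega>' j (u j)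
      + (if i = j then partial i g (v u) * \<omega>'' i (u i) else 0))"
    unfolding v_def by (rule has_C2_compose[OF hg w(1-3)])
  have hGs: "has_C2 d (\<lambda>u. gs l (v u)) (\<lambda>i u. partial i (gs l) (v u) * \<omega>' i (u i)) (\<lambda>i j u. partial i (partial j (gs l)) (v u) * \<omega>' i (u i) * \<omega>' j (u j)
      + (if i = j then partial i (gs l) (v u) * \<omega>'' i (u i) else 0))" for l
    unfolding v_def by (rule has_C2_compose[OF hgs w(1-3)])
  show ?thesis unfolding v_def[symmetric]
  proof (rule bp_C2_onI[OF hG hGs, where B=K])
    fix l i j and u :: "nat \<Rightarrow> real"
    show "\<bar>gs l (v u)\<bar> \<le> K" using B(1)[of l u] p by (simp add: K_def)
    show "(\<lambda>l. gs l (v u)) \<longlonglongrightarrow> g (v u)" by (rule bp_C2_onD(3)[OF bp vX])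
    assume i: "i < d"
    show "\<bar>partial i (gs l) (v u) * \<omega>' i (u i)\<bar> \<le> K"
      using m[OF B(2)[OF i] w(4), of l u i "u i"] p Bp by (simp add: K_def)
    show "(\<lambda>l. partial i (gs l) (v u) * \<omega>' i (u i)) \<longlonglongrightarrow> partial i g (v u) * \<omega>' i (u i)"
      by (intro tendsto_mult_right bp_C2_onD(4)[OF bp vX i])
    assume j: "j < d"
    show "\<bar>partial i (partial j (gs l)) (v u) * \<omega>' i (u i) * \<omega>' j (u j) + (if i = j then partial i (gs l) (v u) * \<omega>'' i (u i) else 0)\<bar> \<le> K"
    proof -
      have "\<bar>partial i (partial j (gs l)) (v u) * \<omega>' i (u i) * \<omega>' j (u j)\<bar> \<le> B * W * W" by (rule m2[OF B(3)[OF i j] w(4) w(4)])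
      moreover have "\<bar>if i = j then partial i (gs l) (v u) * \<omega>'' i (u i) else 0\<bar> \<le> B * W"
        using m[OF B(2)[OF i] w(5), of l u i "u i"] p(1) by (cases "i = j") (simp_all only: if_True if_False refl abs_zero)
      ultimately show ?thesis using Bp unfolding K_def by (intro order_trans[OF abs_triangle_ineq]) linarith
    qed
    show "(\<lambda>l. partial i (partial j (gs l)) (v u) * \<omega>' i (u i) * \<omega>' j (u j) + (if i = j then partial i (gs l) (v u) * \<omega>'' i (u i) else 0))
      \<longlonglongrightarrow> partial i (partial j g) (v u) * \<omega>' i (u i) * \<omega>' j (u j) + (if i = j then partial i g (v u) * \<omega>'' i (u i) else 0)"
      using bp_C2_onD(5)[OF bp vX i j, of u] bp_C2_onD(4)[OF bp vX i, of u]
      by (cases "i = j") (auto intro!: tendsto_add tendsto_mult_right)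
  qed
qed

lemma bp_C2_constant:
  assumes "C2_fun d g" "C2_bound d g B" shows "bp_C2_on UNIV d (\<lambda>_. g) g"
  using assms unfolding bp_C2_on_def C2_bound_def by (auto intro!: exI[of _ B])

lemma sine_scale_DERIV:
  fixes a :: real assumes "a \<noteq> 0"
  shows "((\<lambda>s. sin (a * s) / a) has_real_derivative cos (a * s)) (at s)"
    "((\<lambda>s. cos (a * s)) has_real_derivative - a * sin (a * s)) (at s)"
  using assms by (auto intro!: derivative_eq_intros)

text \<open>As \<open>a\<close> tends to \<open>0\<close>, \<open>sin (a s) / a\<close> tends to \<open>s\<close>, with bounded derivatives; so every
  bounded \<open>C\<^sup>2\<close> function is a limit of functions of the sines of the coordinates.\<close>

lemma bp_C2_sine:
  assumes g: "C2_fun d g" "C2_bound d g B"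
  shows "bp_C2_on UNIV d (\<lambda>l u. g (\<lambda>i. sin (1 / real (Suc l) * u i) / (1 / real (Suc l)))) g"
proof -
  define a where "a l = 1 / real (Suc l)" for l
  have a: "a l \<noteq> 0" "0 \<le> a l" "a l \<le> 1" for l by (auto simp: a_def)
  have a0: "a \<longlonglongrightarrow> 0" unfolding a_def using LIMSEQ_inverse_real_of_nat by (simp add: inverse_eq_divide)
  have h: "has_C2 d g (\<lambda>i. partial i g) (\<lambda>i j. partial i (partial j g))" by (rule C2_fun_imp_has_C2[OF g(1)])
  have b: "\<bar>g u\<bar> \<le> B" "i < d \<Longrightarrow> \<bar>partial i g u\<bar> \<le> B" "i < d \<Longrightarrow> j < d \<Longrightarrow> \<bar>partial i (partial j g) u\<bar> \<le> B" for u i j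
    using g(2) by (auto simp: C2_bound_def)
  have B: "0 \<le> B" using b(1)[of undefined] by linarith
  define v where "v l u = (\<lambda>i::nat. sin (a l * u i) / a l)" for l u
  have v_lim: "(\<lambda>l. f (v l u)) \<longlonglongrightarrow> f u" if "continuous_on UNIV f" for f :: "(nat \<Rightarrow> real) \<Rightarrow> real" and u
  proof -
    define \<Theta> where "\<Theta> t = (\<lambda>i. u i * sinc (t * u i))" for t
    have "continuous_on UNIV \<Theta>" unfolding \<Theta>_def
      by (intro continuous_on_coordinatewise_then_product continuous_intros continuous_on_sinc)
    then have "continuous_on UNIV (\<lambda>t. f (\<Theta> t))" by (rule continuous_on_compose2[OF that]) auto
    from continuous_on_tendsto_compose[OF this a0] have "(\<lambda>l. f (\<Theta> (a l))) \<longlonglongrightarrow> f (\<Theta> 0)" by simp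
    moreover have "\<Theta> (a l) = v l u" for l using a(1)[of l] by (auto simp: \<Theta>_def v_def)
    moreover have "\<Theta> 0 = u" by (simp add: \<Theta>_def)
    ultimately show ?thesis by simp
  qed
  have ct: "continuous_on UNIV g" "\<And>i. i < d \<Longrightarrow> continuous_on UNIV (partial i g)" "\<And>i j. i < d \<Longrightarrow> j < d \<Longrightarrow> continuous_on UNIV (partial i (partial j g))"
    using h by (auto simp: has_C2_def)
  have cw: "continuous_on UNIV (\<lambda>s. - a l * sin (a l * s))" for l by (intro continuous_intros)
  have hv: "has_C2 d (\<lambda>u. g (v l u)) (\<lambda>i u. partial i g (v l u) * cos (a l * u i))
    (\<lambda>i j u. partial i (partial j g) (v l u) * cos (a l * u i) * cos (a l * u j) + (if i = j then partial i g (v l u) * (- a l * sin (a l * u i)) else 0))" for l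
    unfolding v_def by (rule has_C2_compose[OF h sine_scale_DERIV[OF a(1)[of l]] cw])
  have lim_cos: "(\<lambda>l. cos (a l * s)) \<longlonglongrightarrow> 1" for s
    using tendsto_cos[OF tendsto_mult_right[OF a0, of s]] by simp
  have lim_sin: "(\<lambda>l. - a l * sin (a l * s)) \<longlonglongrightarrow> 0" for s
    using tendsto_mult[OF tendsto_minus[OF a0] tendsto_sin[OF tendsto_mult_right[OF a0, of s]]] by simp
  have c1: "\<bar>x * cos y\<bar> \<le> B" if "\<bar>x\<bar> \<le> B" for x y
    using mult_mono[OF that abs_cos_le_one[of y] B] by (simp add: abs_mult)
  show ?thesis unfolding a_def[symmetric] v_def[symmetric]
  proof (rule bp_C2_onI[OF h hv, where B="2 * B"])
    fix l i j and u :: "nat \<Rightarrow> real"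
    show "\<bar>g (v l u)\<bar> \<le> 2 * B" using b(1)[of "v l u"] B by linarith
    show "(\<lambda>l. g (v l u)) \<longlonglongrightarrow> g u" by (rule v_lim[OF ct(1)])
    assume i: "i < d"
    show "\<bar>partial i g (v l u) * cos (a l * u i)\<bar> \<le> 2 * B" using c1[OF b(2)[OF i], of "v l u" "a l * u i"] B by linarith
    show "(\<lambda>l. partial i g (v l u) * cos (a l * u i)) \<longlonglongrightarrow> partial i g u"
      using tendsto_mult[OF v_lim[OF ct(2)[OF i]] lim_cos] by simp
    assume j: "j < d"
    have "\<bar>partial i (partial j g) (v l u) * cos (a l * u i) * cos (a l * u j)\<bar> \<le> B" by (intro c1 b i j)
    moreover have "\<bar>if i = j then partial i g (v l u) * (- a l * sin (a l * u i)) else 0\<bar> \<le> B"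
    proof -
      have "\<bar>- a l * sin (a l * u i)\<bar> \<le> 1" unfolding abs_mult using a[of l] abs_sin_le_one by (intro mult_le_one) auto
      then have "\<bar>partial i g (v l u) * (- a l * sin (a l * u i))\<bar> \<le> B"
        using mult_mono[OF b(2)[OF i], of "\<bar>- a l * sin (a l * u i)\<bar>" 1 "v l u"] B unfolding abs_mult[of "partial i g (v l u)"] by simp
      then show ?thesis using B by (cases "i = j") (simp_all only: if_True if_False refl abs_zero)
    qed
    ultimately show "\<bar>partial i (partial j g) (v l u) * cos (a l * u i) * cos (a l * u j) + (if i = j then partial i g (v l u) * (- a l * sin (a l * u i)) else 0)\<bar> \<le> 2 * B"
      by (intro order_trans[OF abs_triangle_ineq]) linarith
    show "(\<lambda>l. partial i (partial j g) (v l u) * cos (a l * u i) * cos (a l * u j) + (if i = j then partial i g (v l u) * (- a l * sin (a l * u i)) else 0)) \<longlonglongrightarrow> partial i (partial j g) u"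
    proof -
      have "(\<lambda>l. partial i (partial j g) (v l u) * cos (a l * u i) * cos (a l * u j)) \<longlonglongrightarrow> partial i (partial j g) u * 1 * 1"
        by (intro tendsto_mult v_lim ct i j lim_cos)
      moreover have "(\<lambda>l. if i = j then partial i g (v l u) * (- a l * sin (a l * u i)) else 0) \<longlonglongrightarrow> 0"
      proof (cases "i = j")
        case True
        have "(\<lambda>l. partial i g (v l u) * (- a l * sin (a l * u i))) \<longlonglongrightarrow> partial i g u * 0"
          by (rule tendsto_mult[OF v_lim[OF ct(2)[OF i]] lim_sin])
        then show ?thesis using True by (simp only: if_True mult_zero_right refl)
      qed simp
      ultimately show ?thesis using tendsto_add by fastforce
    qed
  qed
qed

section \<open>From one functional to several\<close>

text \<open>The martingale property for a function \<open>g\<close> of the functionals \<open>\<phi> 0, ..., \<phi> (d - 1)\<close>, together with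
  the regularity that makes the property stable under limits.\<close>

definition solves_for :: "'b::real_normed_vector cadlag_path measure \<Rightarrow> ('b \<Rightarrow> 'b) \<Rightarrow> 'b mp_params \<Rightarrow> nat \<Rightarrow>
    (nat \<Rightarrow> 'b \<Rightarrow>\<^sub>L real) \<Rightarrow> ((nat \<Rightarrow> real) \<Rightarrow> real) \<Rightarrow> bool" where
  "solves_for P h p d \<phi> g \<longleftrightarrow> C2_fun d g \<and> (\<exists>B. C2_bound d g B) \<and>
     admissible_pair (test_fun (d, g, \<phi>)) (generator h p (d, g, \<phi>)) \<and>
     compensates P (test_fun (d, g, \<phi>)) (generator h p (d, g, \<phi>))"

context generator_data begin

lemma solves_for_linear:
  assumes P: "path_prob P" and f: "solves_for P h p d \<phi> f" and g: "solves_for P h p d \<phi> g"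
  shows "solves_for P h p d \<phi> (\<lambda>u. a * f u + b * g u)"
proof -
  obtain B C where B: "C2_bound d f B" "C2_bound d g C" and C2: "C2_fun d f" "C2_fun d g"
    using f g by (auto simp: solves_for_def)
  have G: "generator h p (d, \<lambda>u. a * f u + b * g u, \<phi>) = (\<lambda>x. a * generator h p (d, f, \<phi>) x + b * generator h p (d, g, \<phi>) x)"
    using generator_linear[OF C2(1) B(1) C2(2) B(2)] by auto
  have T: "test_fun (d, \<lambda>u. a * f u + b * g u, \<phi>) = (\<lambda>x. a * test_fun (d, f, \<phi>) x + b * test_fun (d, g, \<phi>) x)"
    by (auto simp: test_fun_eq)
  have bd: "C2_bound d (\<lambda>u. a * f u + b * g u) (\<bar>a\<bar> * B + \<bar>b\<bar> * C)" by (rule C2_bound_linear[OF C2 B])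
  have c2: "C2_fun d (\<lambda>u. a * f u + b * g u)" by (rule C2_fun_linear(1)[OF C2])
  have "admissible_pair (test_fun (d, \<lambda>u. a * f u + b * g u, \<phi>)) (generator h p (d, \<lambda>u. a * f u + b * g u, \<phi>))"
    unfolding admissible_pair_def
  proof (intro conjI)
    show "continuous_on UNIV (test_fun (d, \<lambda>u. a * f u + b * g u, \<phi>))"
      using c2 by (intro continuous_test_fun) (simp add: C2_fun_def C1_fun_def)
    show "bounded (range (test_fun (d, \<lambda>u. a * f u + b * g u, \<phi>)))"
      unfolding bounded_real test_fun_eq using bd by (auto simp: C2_bound_def)
    show "generator h p (d, \<lambda>u. a * f u + b * g u, \<phi>) \<in> borel_measurable borel"
      unfolding G using f g by (auto simp: solves_for_def admissible_pair_def)
    show "locally_bounded (generator h p (d, \<lambda>u. a * f u + b * g u, \<phi>))"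
      by (rule locally_bounded_le[OF locally_bounded_cmult[OF generator_scale_locally_bounded, of "\<bar>a\<bar> * B + \<bar>b\<bar> * C"]])
         (rule order_trans[OF generator_bound[OF c2 bd] abs_ge_self])
  qed
  moreover have "compensates P (test_fun (d, \<lambda>u. a * f u + b * g u, \<phi>)) (generator h p (d, \<lambda>u. a * f u + b * g u, \<phi>))"
    unfolding T G using f g by (intro compensates_linear[OF P]) (auto simp: solves_for_def)
  ultimately show ?thesis unfolding solves_for_def using c2 bd by blast
qed

lemma solves_for_limit:
  assumes P: "path_prob P" and bp: "bp_C2_on UNIV d gs g" and gs: "\<And>l. solves_for P h p d \<phi> (gs l)"
  shows "solves_for P h p d \<phi> g"
proof -
  obtain B where B: "\<And>l. C2_bound d (gs l) B" "C2_bound d g B" using bp_C2_on_bound[OF bp] by blast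
  have "compensates P (test_fun (d, g, \<phi>)) (generator h p (d, g, \<phi>))" "admissible_pair (test_fun (d, g, \<phi>)) (generator h p (d, g, \<phi>))"
  proof -
    have 1: "continuous_on UNIV (test_fun (d, g, \<phi>))"
      using bp_C2_onD(1)[OF bp] by (intro continuous_test_fun) (simp add: C2_fun_def C1_fun_def)
    have 2: "(\<lambda>l. test_fun (d, gs l, \<phi>) x) \<longlonglongrightarrow> test_fun (d, g, \<phi>) x" for x
      unfolding test_fun_eq by (rule bp_C2_onD(3)[OF bp UNIV_I])
    have 3: "\<bar>test_fun (d, gs l, \<phi>) x\<bar> \<le> B" for l x unfolding test_fun_eq using B(1)[of l] by (simp add: C2_bound_def)
    have adm: "admissible_pair (test_fun (d, gs l, \<phi>)) (generator h p (d, gs l, \<phi>))"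
      and com: "compensates P (test_fun (d, gs l, \<phi>)) (generator h p (d, gs l, \<phi>))" for l
      using gs[of l] by (auto simp: solves_for_def)
    note L = compensates_bounded_limit[OF P adm com 1 2 3 generator_tendsto[OF bp]
        locally_bounded_cmult[OF generator_scale_locally_bounded, of B] generator_bound[OF bp_C2_onD(2)[OF bp] B(1)]]
    show "compensates P (test_fun (d, g, \<phi>)) (generator h p (d, g, \<phi>))" by (rule L(1))
    show "admissible_pair (test_fun (d, g, \<phi>)) (generator h p (d, g, \<phi>))" by (rule L(2))
  qed
  then show ?thesis unfolding solves_for_def using bp_C2_onD(1)[OF bp] B(2) by blast
qed

end

text \<open>Multiplication with flatter and flatter bell functions.\<close>

lemma solves_for_of_compact_support:
  assumes gd: "generator_data h p" and P: "path_prob P" and Cc: "\<And>g. Cc2_fun 1 g \<Longrightarrow> solves_for P h p 1 \<phi> g" and g: "Cb2_fun 1 g"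
  shows "solves_for P h p 1 \<phi> g"
proof -
  interpret generator_data h p 1 \<phi> by (rule gd)
  have C2: "C2_fun 1 g" using g by (simp add: Cb2_fun_def)
  obtain B where B: "C2_bound 1 g B" using Cb2_fun_bound[OF g] by blast
  have bp: "bp_C2_on UNIV 1 (\<lambda>l u. g u * bell (\<Sum>i<1. 1 / real (Suc l) * u i)) g"
    using bp_C2_mult[OF bp_C2_bell C2 B] by simp
  show ?thesis
  proof (rule solves_for_limit[OF P bp Cc])
    fix l
    have "\<forall>i<1. \<bar>u i\<bar> \<le> real (Suc l)" if "g u * bell (\<Sum>i<1. 1 / real (Suc l) * u i) \<noteq> 0" for u :: "nat \<Rightarrow> real"
    proof -
      have "\<not> \<bar>u 0 / real (Suc l)\<bar> > 1" using that bell_support[of "u 0 / real (Suc l)"] by auto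
      then show ?thesis by (simp add: abs_divide)
    qed
    then show "Cc2_fun 1 (\<lambda>u. g u * bell (\<Sum>i<1. 1 / real (Suc l) * u i))"
      unfolding Cc2_fun_def using bp_C2_onD(2)[OF bp, of l] by blast
  qed
qed

text \<open>The martingale property for functions of one functional, to be extended to functions of the
  functionals \<open>\<phi> 0, ..., \<phi> (d - 1)\<close>.\<close>

locale several_functionals = generator_data h p d \<phi> for h :: "'b::real_normed_vector \<Rightarrow> 'b" and p d \<phi> +
  fixes P
  assumes P: "path_prob P" and functionals: "\<And>i. i < d \<Longrightarrow> \<phi> i \<in> adjoint_dom (lin_dom p) (lin_op p)"
    and one_functional: "\<And>\<psi> g. \<psi> \<in> adjoint_dom (lin_dom p) (lin_op p) \<Longrightarrow> Cc2_fun 1 g \<Longrightarrow> solves_for P h p 1 (\<lambda>_. \<psi>) g"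
begin

definition wave :: "(nat \<Rightarrow> real) \<Rightarrow> real \<Rightarrow> (nat \<Rightarrow> real) \<Rightarrow> real" where
  "wave lam b u = cos ((\<Sum>i<d. lam i * u i) + b)"

lemma cos_shift_DERIV: "((\<lambda>s. cos (s + b)) has_real_derivative - sin (s + b)) (at s)"
  "((\<lambda>s. - sin (s + b)) has_real_derivative - cos (s + b)) (at (s::real))"
  by (auto intro!: derivative_eq_intros)

lemma continuous_cos_shift: "continuous_on UNIV (\<lambda>s::real. - cos (s + b))" by (intro continuous_intros)

lemma wave_C2: "has_C2 d (wave lam b) (\<lambda>i u. lam i * - sin ((\<Sum>i<d. lam i * u i) + b)) (\<lambda>i j u. lam i * lam j * - cos ((\<Sum>i<d. lam i * u i) + b))"
  unfolding wave_def[abs_def] by (rule has_C2_ridge[OF cos_shift_DERIV continuous_cos_shift])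

lemma wave_bounded: "C2_fun d (wave lam b)" "\<exists>B. C2_bound d (wave lam b) B"
proof -
  show "C2_fun d (wave lam b)" by (rule has_C2_imp_C2_fun[OF wave_C2])
  define L where "L = 1 + (\<Sum>i<d. \<bar>lam i\<bar>)"
  have L: "\<bar>lam i\<bar> \<le> L" if "i < d" for i unfolding L_def
    using member_le_sum[of i "{..<d}" "\<lambda>i. \<bar>lam i\<bar>"] that by simp
  have L1: "1 \<le> L" by (simp add: L_def sum_nonneg)
  have LL: "L \<le> L * L" using L1 by simp
  have 2: "\<bar>x * s\<bar> \<le> L" if "\<bar>x\<bar> \<le> L" "\<bar>s\<bar> \<le> 1" for x s :: real
    using mult_mono[OF that] L1 by (simp add: abs_mult)
  have 3: "\<bar>x * y * s\<bar> \<le> L * L" if "\<bar>x\<bar> \<le> L" "\<bar>y\<bar> \<le> L" "\<bar>s\<bar> \<le> 1" for x y s :: real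
    unfolding mult.assoc abs_mult[of x] using that 2[OF that(2,3)] L1 by (intro mult_mono) auto
  have "C2_bound d (wave lam b) (L * L)"
    unfolding C2_bound_def
  proof (intro conjI allI impI)
    show "\<bar>wave lam b u\<bar> \<le> L * L" for u using abs_cos_le_one[of "(\<Sum>i<d. lam i * u i) + b"] LL L1 unfolding wave_def by linarith
    show "\<bar>partial i (wave lam b) u\<bar> \<le> L * L" if "i < d" for i u
      unfolding has_C2_partial(1)[OF wave_C2 that] by (rule order_trans[OF 2[OF L[OF that]] LL]) simp
    show "\<bar>partial i (partial j (wave lam b)) u\<bar> \<le> L * L" if "i < d" "j < d" for i j u
      unfolding has_C2_partial(2)[OF wave_C2 that] by (rule 3[OF L[OF that(1)] L[OF that(2)]]) simp
  qed
  then show "\<exists>B. C2_bound d (wave lam b) B" by blast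
qed

text \<open>A plane wave is a bounded function of one functional, a linear combination of the \<open>\<phi> i\<close>.\<close>

lemma solves_for_wave: "solves_for P h p d \<phi> (wave lam b)"
proof -
  define \<psi> where "\<psi> = (\<Sum>i<d. lam i *\<^sub>R \<phi> i)"
  have D: "densely_defined_closed_op (lin_dom p) (lin_op p)" using params by (simp add: valid_params_def)
  have psi: "\<psi> \<in> adjoint_dom (lin_dom p) (lin_op p)" unfolding \<psi>_def by (rule adjoint_op_sum(1)[OF D functionals])
  have "has_C2 1 (\<lambda>u. cos (u 0 + b)) (\<lambda>i u. - sin (u 0 + b)) (\<lambda>i j u. - cos (u 0 + b))"
    using has_C2_ridge[OF cos_shift_DERIV continuous_cos_shift, of 1 "\<lambda>_. 1" b] by simp
  note H = has_C2_imp_C2_fun[OF this] has_C2_partial[OF this]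
  have "Cb2_fun 1 (\<lambda>u. cos (u 0 + b))"
    unfolding Cb2_fun_def
  proof (intro conjI allI impI H(1))
    show "bounded (range (\<lambda>u::nat \<Rightarrow> real. cos (u 0 + b)))" unfolding bounded_real by (intro exI[of _ 1]) auto
    show "bounded (range (partial i (\<lambda>u. cos (u 0 + b))))" if "i < 1" for i
      unfolding H(2)[OF that] bounded_real by (intro exI[of _ 1]) auto
    show "bounded (range (partial i (partial j (\<lambda>u. cos (u 0 + b)))))" if "i < 1" "j < 1" for i j
      unfolding H(3)[OF that] bounded_real by (intro exI[of _ 1]) auto
  qed
  from solves_for_of_compact_support[OF generator_data_axioms P one_functional[OF psi] this]
  have g1: "solves_for P h p 1 (\<lambda>_. \<psi>) (\<lambda>u. cos (u 0 + b))" .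
  have eq: "test_fun (d, wave lam b, \<phi>) = test_fun (1, \<lambda>u. cos (u 0 + b), \<lambda>_. \<psi>)"
    "generator h p (d, wave lam b, \<phi>) = generator h p (1, \<lambda>u. cos (u 0 + b), \<lambda>_. \<psi>)"
    unfolding wave_def[abs_def] \<psi>_def
    by (rule generator_ridge[OF D functionals cos_shift_DERIV continuous_cos_shift], assumption)+
  show ?thesis using g1 wave_bounded unfolding solves_for_def eq by blast
qed

text \<open>The functions whose products with all plane waves have the martingale property. This class is
  closed under products with plane waves, because a product of cosines is a sum of cosines.\<close>

definition wave_multiplier :: "((nat \<Rightarrow> real) \<Rightarrow> real) \<Rightarrow> bool" where
  "wave_multiplier g \<longleftrightarrow> C2_fun d g \<and> (\<exists>B. C2_bound d g B) \<and> (\<forall>lam b. solves_for P h p d \<phi> (\<lambda>u. wave lam b u * g u))"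

lemma wave_multiplier_solves_for: "wave_multiplier g \<Longrightarrow> solves_for P h p d \<phi> g"
proof -
  assume "wave_multiplier g"
  then have "solves_for P h p d \<phi> (\<lambda>u. wave (\<lambda>_. 0) 0 u * g u)" by (simp add: wave_multiplier_def)
  then show ?thesis by (simp add: wave_def)
qed

lemma wave_multiplier_one: "wave_multiplier (\<lambda>_. 1)"
proof -
  have h: "has_C2 d (\<lambda>_. 1) (\<lambda>_ _. 0) (\<lambda>_ _ _. 0)" by (rule has_C2_const)
  have "C2_bound d (\<lambda>_. 1) 1" unfolding C2_bound_def using has_C2_partial[OF h] by simp
  then show ?thesis unfolding wave_multiplier_def using has_C2_imp_C2_fun[OF h] solves_for_wave by auto
qed

lemma wave_multiplier_linear:
  assumes "wave_multiplier f" "wave_multiplier g" shows "wave_multiplier (\<lambda>u. a * f u + b * g u)"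
  unfolding wave_multiplier_def
proof (intro conjI allI)
  obtain B C where B: "C2_bound d f B" "C2_bound d g C" and C2: "C2_fun d f" "C2_fun d g"
    using assms by (auto simp: wave_multiplier_def)
  show "C2_fun d (\<lambda>u. a * f u + b * g u)" by (rule C2_fun_linear(1)[OF C2])
  show "\<exists>B. C2_bound d (\<lambda>u. a * f u + b * g u) B" using C2_bound_linear[OF C2 B] by blast
  fix lam c
  have "solves_for P h p d \<phi> (\<lambda>u. a * (wave lam c u * f u) + b * (wave lam c u * g u))"
    using assms by (intro solves_for_linear[OF P]) (auto simp: wave_multiplier_def)
  then show "solves_for P h p d \<phi> (\<lambda>u. wave lam c u * (a * f u + b * g u))" by (simp add: algebra_simps)
qed

lemma wave_multiplier_limit:
  assumes bp: "bp_C2_on UNIV d gs g" and gs: "\<And>l. wave_multiplier (gs l)" shows "wave_multiplier g"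
  unfolding wave_multiplier_def
proof (intro conjI allI)
  show "C2_fun d g" by (rule bp_C2_onD(1)[OF bp])
  show "\<exists>B. C2_bound d g B" using bp_C2_on_bound[OF bp] by blast
  fix lam b
  obtain C where C: "C2_bound d (wave lam b) C" using wave_bounded(2) by blast
  show "solves_for P h p d \<phi> (\<lambda>u. wave lam b u * g u)"
    by (rule solves_for_limit[OF P bp_C2_mult[OF bp wave_bounded(1) C]]) (use gs in \<open>simp add: wave_multiplier_def\<close>)
qed

lemma wave_multiplier_wave:
  assumes g: "wave_multiplier g" shows "wave_multiplier (\<lambda>u. wave lam b u * g u)"
  unfolding wave_multiplier_def
proof (intro conjI allI)
  obtain C where C: "C2_bound d (wave lam b) C" using wave_bounded(2) by blast
  obtain B where B: "C2_bound d g B" "C2_fun d g" using g unfolding wave_multiplier_def by blast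
  note bp = bp_C2_mult[OF bp_C2_constant[OF B(2,1)] wave_bounded(1) C]
  show "C2_fun d (\<lambda>u. wave lam b u * g u)" by (rule bp_C2_onD(1)[OF bp])
  show "\<exists>B. C2_bound d (\<lambda>u. wave lam b u * g u) B" using bp_C2_on_bound[OF bp] by blast
  fix lam' b'
  have "wave lam' b' u * (wave lam b u * g u) = 1/2 * (wave (\<lambda>i. lam' i - lam i) (b' - b) u * g u) + 1/2 * (wave (\<lambda>i. lam' i + lam i) (b' + b) u * g u)" for u
  proof -
    define x y where "x = (\<Sum>i<d. lam' i * u i) + b'" and "y = (\<Sum>i<d. lam i * u i) + b"
    have "wave (\<lambda>i. lam' i - lam i) (b' - b) u = cos (x - y)" "wave (\<lambda>i. lam' i + lam i) (b' + b) u = cos (x + y)"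
      by (simp_all add: wave_def x_def y_def algebra_simps sum.distrib sum_subtractf)
    moreover have "wave lam' b' u = cos x" "wave lam b u = cos y" by (simp_all add: wave_def x_def y_def)
    moreover have "cos x * (cos y * r) = 1/2 * (cos (x - y) * r) + 1/2 * (cos (x + y) * r)" for r
      by (simp add: cos_add cos_diff algebra_simps)
    ultimately show ?thesis by (simp only:)
  qed
  moreover have "solves_for P h p d \<phi> (\<lambda>u. 1/2 * (wave (\<lambda>i. lam' i - lam i) (b' - b) u * g u) + 1/2 * (wave (\<lambda>i. lam' i + lam i) (b' + b) u * g u))"
    using g by (intro solves_for_linear[OF P]) (auto simp: wave_multiplier_def)
  ultimately show "solves_for P h p d \<phi> (\<lambda>u. wave lam' b' u * (wave lam b u * g u))" by simp
qed

text \<open>The sine rescaled to the interval \<open>[0,1]\<close>, on which Bernstein polynomials approximate.\<close>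

definition unit_sine :: "real \<Rightarrow> real \<Rightarrow> real" where "unit_sine a s = 1/2 + 1/2 * sin (a * s)"

lemma wave_multiplier_unit_sine:
  assumes g: "wave_multiplier g" and n: "n < d"
  shows "wave_multiplier (\<lambda>u. unit_sine a (u n) * g u)" "wave_multiplier (\<lambda>u. (1 - unit_sine a (u n)) * g u)"
proof -
  define lam where "lam i = (if i = n then a else 0)" for i
  have s: "wave lam (- (pi/2)) u = sin (a * u n)" for u
  proof -
    have "(\<Sum>i<d. lam i * u i) = (\<Sum>i<d. if i = n then a * u n else 0)" by (intro sum.cong) (auto simp: lam_def)
    then have "(\<Sum>i<d. lam i * u i) = a * u n" using n by simp
    then show ?thesis by (simp add: wave_def cos_diff)
  qed
  have w: "wave_multiplier (\<lambda>u. wave lam (- (pi/2)) u * g u)" by (rule wave_multiplier_wave[OF g])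
  show "wave_multiplier (\<lambda>u. unit_sine a (u n) * g u)"
    using wave_multiplier_linear[OF g w, of "1/2" "1/2"] unfolding s by (simp add: unit_sine_def algebra_simps)
  show "wave_multiplier (\<lambda>u. (1 - unit_sine a (u n)) * g u)"
    using wave_multiplier_linear[OF g w, of "1/2" "-1/2"] unfolding s by (simp add: unit_sine_def algebra_simps)
qed

lemma wave_multiplier_bernstein:
  assumes g: "wave_multiplier g" and n: "n < d"
  shows "wave_multiplier (\<lambda>u. g u * Bernstein N m (unit_sine a (u n)))"
proof -
  have 1: "wave_multiplier (\<lambda>u. unit_sine a (u n) ^ k * f u)" if "wave_multiplier f" for f k
    by (induction k) (use that wave_multiplier_unit_sine(1)[OF _ n, of _ a] in \<open>simp_all add: mult.assoc\<close>)
  have 2: "wave_multiplier (\<lambda>u. (1 - unit_sine a (u n)) ^ k * f u)" if "wave_multiplier f" for f k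
    by (induction k) (use that wave_multiplier_unit_sine(2)[OF _ n, of _ a] in \<open>simp_all add: mult.assoc\<close>)
  have "wave_multiplier (\<lambda>u. unit_sine a (u n) ^ m * ((1 - unit_sine a (u n)) ^ (N - m) * g u))"
    by (rule 1[OF 2[OF g]])
  from wave_multiplier_linear[OF this this, of "real (N choose m)" 0] show ?thesis
    by (simp add: Bernstein_def ac_simps)
qed

lemma wave_multiplier_sum:
  assumes "\<And>m. m \<le> (N::nat) \<Longrightarrow> wave_multiplier (f m)" shows "wave_multiplier (\<lambda>u. \<Sum>m\<le>N. f m u)"
  using assms
proof (induction N)
  case (Suc N)
  then have "wave_multiplier (\<lambda>u. 1 * (\<Sum>m\<le>N. f m u) + 1 * f (Suc N) u)" by (intro wave_multiplier_linear) auto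
  then show ?case by simp
qed simp

lemma unit_sine_DERIV:
  "((unit_sine a) has_real_derivative a / 2 * cos (a * s)) (at s)"
  "((\<lambda>s. a / 2 * cos (a * s)) has_real_derivative - (a * a) / 2 * sin (a * s)) (at s)"
  unfolding unit_sine_def[abs_def] by (auto intro!: derivative_eq_intros)

lemma unit_sine_range: "0 \<le> unit_sine a s" "unit_sine a s \<le> 1"
  using sin_ge_minus_one[of "a * s"] sin_le_one[of "a * s"] unfolding unit_sine_def by linarith+

text \<open>Induction on the number of coordinates: Bernstein approximation in the last coordinate
  expresses a function by functions of the earlier coordinates and polynomials in the sine of the last.\<close>

lemma wave_multiplier_of_sines:
  assumes "n \<le> d" "C2_fun d k" "C2_bound d k B" "depends_on_first n k"
  shows "wave_multiplier (\<lambda>u. k (\<lambda>i. unit_sine a (u i)))"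
  using assms
proof (induction n arbitrary: k B)
  case 0
  then have "k u = k (\<lambda>_. 0)" for u by (simp add: depends_on_first_def)
  then have "(\<lambda>u. k (\<lambda>i. unit_sine a (u i))) = (\<lambda>u. k (\<lambda>_. 0) * 1 + 0 * 1)" by auto
  then show ?case using wave_multiplier_linear[OF wave_multiplier_one wave_multiplier_one, of "k (\<lambda>_. 0)" 0] by simp
next
  case (Suc n)
  then have n: "n < d" "n \<le> d" by auto
  define W where "W = \<bar>a\<bar> + \<bar>a * a\<bar>"
  have W: "\<bar>a / 2 * cos (a * s)\<bar> \<le> W" "\<bar>- (a * a) / 2 * sin (a * s)\<bar> \<le> W" for s
  proof -
    have "\<bar>a / 2 * cos (a * s)\<bar> \<le> \<bar>a / 2\<bar>" unfolding abs_mult using abs_cos_le_one by (intro mult_left_le) auto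
    also have "\<dots> \<le> W" unfolding W_def abs_divide using abs_ge_zero[of "a * a"] abs_ge_zero[of a] by simp
    finally show "\<bar>a / 2 * cos (a * s)\<bar> \<le> W" .
    have "\<bar>- (a * a) / 2 * sin (a * s)\<bar> \<le> \<bar>- (a * a) / 2\<bar>" unfolding abs_mult[of "- (a * a) / 2"] using abs_sin_le_one by (intro mult_left_le) auto
    also have "\<dots> = \<bar>a * a\<bar> / 2" by (simp only: abs_divide abs_minus_cancel abs_numeral)
    also have "\<dots> \<le> W" unfolding W_def using abs_ge_zero[of "a * a"] abs_ge_zero[of a] by linarith
    finally show "\<bar>- (a * a) / 2 * sin (a * s)\<bar> \<le> W" .
  qed
  have bp: "bp_C2_on UNIV d (\<lambda>N u. bern0 N (\<lambda>s. k ((\<lambda>i. unit_sine a (u i))(n := s))) (unit_sine a (u n))) (\<lambda>u. k (\<lambda>i. unit_sine a (u i)))"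
  proof (rule bp_C2_compose[OF bp_C2_bernstein[OF Suc.prems(2,3) n(1)], where \<omega>="\<lambda>_. unit_sine a", OF _ unit_sine_DERIV _ W])
    show "(\<lambda>i. unit_sine a (u i)) \<in> {u. \<forall>i. 0 \<le> u i \<and> u i \<le> 1}" for u :: "nat \<Rightarrow> real" by (simp add: unit_sine_range)
    show "continuous_on UNIV (\<lambda>s. - (a * a) / 2 * sin (a * s))" by (intro continuous_intros) auto
  qed
  show ?case
  proof (rule wave_multiplier_limit[OF bp])
    fix N
    have "wave_multiplier (\<lambda>u. k ((\<lambda>i. unit_sine a (u i))(n := r)) * Bernstein (N + 2) m (unit_sine a (u n)))" for m r
    proof (rule wave_multiplier_bernstein[OF _ n(1)])
      define k' where "k' u = k (u(n := r))" for u
      define \<omega> where "\<omega> i = (if i = n then \<lambda>_. r else (\<lambda>s. s))" for i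
      have k': "k' u = k (\<lambda>i. \<omega> i (u i))" for u unfolding k'_def \<omega>_def by (rule arg_cong[of _ _ k]) auto
      have bp': "bp_C2_on UNIV d (\<lambda>_ u. k (\<lambda>i. \<omega> i (u i))) (\<lambda>u. k (\<lambda>i. \<omega> i (u i)))"
      proof (rule bp_C2_compose[OF bp_C2_constant[OF Suc.prems(2,3)], where \<omega>'="\<lambda>i s. if i = n then 0 else 1" and \<omega>''="\<lambda>_ _. 0" and W=1])
        show "(\<omega> i has_real_derivative (if i = n then 0 else 1)) (at s)" for i s
          unfolding \<omega>_def by (cases "i = n") auto
      qed auto
      obtain C where C: "C2_bound d k' C" using bp_C2_on_bound[OF bp'] unfolding k'[symmetric] by blast
      have "C2_fun d k'" using bp_C2_onD(1)[OF bp'] unfolding k'[symmetric] .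
      moreover have "depends_on_first n k'"
        unfolding depends_on_first_def
      proof (intro allI impI)
        fix u v :: "nat \<Rightarrow> real" assume "\<forall>i<n. u i = v i"
        then have "\<forall>i<Suc n. (u(n := r)) i = (v(n := r)) i" by (auto simp: less_Suc_eq)
        then show "k' u = k' v" using Suc.prems(4) unfolding depends_on_first_def k'_def by blast
      qed
      ultimately have "wave_multiplier (\<lambda>u. k' (\<lambda>i. unit_sine a (u i)))" using Suc.IH[OF n(2) _ C] by blast
      then show "wave_multiplier (\<lambda>u. k ((\<lambda>i. unit_sine a (u i))(n := r)))" unfolding k'_def .
    qed
    then show "wave_multiplier (\<lambda>u. bern0 N (\<lambda>s. k ((\<lambda>i. unit_sine a (u i))(n := s))) (unit_sine a (u n)))"
      unfolding bern0_def bernstein_op_def by (intro wave_multiplier_sum)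
  qed
qed

theorem solves_for_several:
  assumes g: "Cb2_fun d g" shows "solves_for P h p d \<phi> g"
proof -
  have C2: "C2_fun d g" using g by (simp add: Cb2_fun_def)
  obtain B where B: "C2_bound d g B" using Cb2_fun_bound[OF g] by blast
  show ?thesis
  proof (rule solves_for_limit[OF P bp_C2_sine[OF C2 B]])
    fix l
    define a where "a = 1 / real (Suc l)"
    have a: "a \<noteq> 0" "a > 0" by (simp_all add: a_def)
    \<comment> \<open>for \<open>w = unit_sine a s\<close> the number \<open>(2 w - 1) / a\<close> is \<open>sin (a s) / a\<close>\<close>
    define k where "k w = g (\<lambda>i. (2 * w i - 1) / a)" for w :: "nat \<Rightarrow> real"
    have bp: "bp_C2_on UNIV d (\<lambda>_ w. g (\<lambda>i. (2 * w i - 1) / a)) (\<lambda>w. g (\<lambda>i. (2 * w i - 1) / a))"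
    proof (rule bp_C2_compose[OF bp_C2_constant[OF C2 B], where \<omega>="\<lambda>_ s. (2 * s - 1) / a" and \<omega>'="\<lambda>_ _. 2 / a" and \<omega>''="\<lambda>_ _. 0" and W="2 / a"])
      show "((\<lambda>s. (2 * s - 1) / a) has_real_derivative 2 / a) (at s)" for s
        using a by (auto intro!: derivative_eq_intros)
    qed (use a in auto)
    obtain C where C: "C2_bound d k C" using bp_C2_on_bound[OF bp] unfolding k_def[abs_def] by blast
    have kC: "C2_fun d k" using bp_C2_onD(1)[OF bp] unfolding k_def[abs_def] .
    then have "depends_on_first d k" by (simp add: C2_fun_def C1_fun_def)
    from wave_multiplier_solves_for[OF wave_multiplier_of_sines[OF order_refl kC C this, of a]]
    have "solves_for P h p d \<phi> (\<lambda>u. k (\<lambda>i. unit_sine a (u i)))" .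
    then show "solves_for P h p d \<phi> (\<lambda>u. g (\<lambda>i. sin (1 / real (Suc l) * u i) / (1 / real (Suc l))))"
      unfolding k_def unit_sine_def a_def[symmetric] by (simp add: algebra_simps)
  qed
qed

end

section \<open>The martingale problem\<close>

text \<open>A path differs from its left limits at countably many times.\<close>

lemma generator_path_integral_left:
  fixes \<alpha> :: "'b::real_normed_vector cadlag_path"
  assumes k: "\<kappa> \<in> borel_measurable borel"
  shows "(LINT s:{0..t}|lborel. \<kappa> (coord_left s \<alpha>)) = path_integral \<kappa> t \<alpha>"
proof -
  define X where "X = {t. \<not> isCont (\<lambda>u. coord u \<alpha>) t}"
  have X: "countable X" unfolding X_def by (rule rcll_countable_discontinuities[OF rcll_coord])
  have eq: "coord_left s \<alpha> = coord s \<alpha>" if "s \<notin> X" for s using that coord_left_eq by (auto simp: X_def)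
  have m1: "(\<lambda>s. coord s \<alpha>) \<in> borel_measurable borel" by (rule rcll_borel_measurable[OF rcll_coord])
  have m2: "(\<lambda>s. coord_left s \<alpha>) \<in> borel_measurable borel"
    by (rule measurable_discrete_difference[OF m1 X]) (auto simp: eq)
  show ?thesis unfolding path_integral_def set_lebesgue_integral_def
  proof (rule integral_cong_AE)
    have [measurable]: "(\<lambda>s. \<kappa> (coord_left s \<alpha>)) \<in> borel_measurable borel" "(\<lambda>s. \<kappa> (coord s \<alpha>)) \<in> borel_measurable borel"
      using measurable_compose[OF m2 k] measurable_compose[OF m1 k] by auto
    show "(\<lambda>s. indicat_real {0..t} s *\<^sub>R \<kappa> (coord_left s \<alpha>)) \<in> borel_measurable lborel" by measurable
    show "(\<lambda>s. indicat_real {0..t} s *\<^sub>R \<kappa> (coord s \<alpha>)) \<in> borel_measurable lborel" by measurable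
    have "AE s in lborel. s \<notin> X" by (intro AE_not_in countable_imp_null_set_lborel X)
    then show "AE s in lborel. indicat_real {0..t} s *\<^sub>R \<kappa> (coord_left s \<alpha>) = indicat_real {0..t} s *\<^sub>R \<kappa> (coord s \<alpha>)"
      by eventually_elim (simp add: eq)
  qed
qed

lemma mp_process_compensates:
  assumes "generator h p f \<in> borel_measurable borel"
  shows "local_martingale P path_filtration (mp_process h p f) \<longleftrightarrow> compensates P (test_fun f) (generator h p f)"
proof -
  have "mp_process h p f = (\<lambda>t \<alpha>. compensated (test_fun f) (generator h p f) t \<alpha> - test_fun f (coord 0 \<alpha>))"
    by (intro ext) (simp add: mp_process_def compensated_def generator_path_integral_left[OF assms])
  then show ?thesis by (simp add: compensates_def)
qed

text \<open>The measurability of the generator in the state is contained in the adaptedness of the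
  process: on the path with constant value \<open>x\<close>, the process at time \<open>1\<close> is minus the generator at \<open>x\<close>.\<close>

lemma generator_borel_of_adapted:
  fixes P :: "'b::real_normed_vector cadlag_path measure"
  assumes "local_martingale P path_filtration (mp_process h p f)"
  shows "generator h p f \<in> borel_measurable borel"
proof -
  define \<iota> where "\<iota> x = (Abs_cadlag_path (\<lambda>_. x) :: 'b cadlag_path)" for x
  have path: "path_at (\<iota> x) = (\<lambda>_. x)" for x
    unfolding \<iota>_def by (rule Abs_cadlag_path_inverse) (auto simp: cadlag_def)
  have c: "coord t (\<iota> x) = x" "coord_left t (\<iota> x) = x" for t x
    by (simp_all add: coord_def coord_left_def path tendsto_Lim)
  have m: "\<iota> \<in> measurable borel (path_filtration (ennreal 1))"
    unfolding path_filtration_def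
  proof (rule measurable_measure_of)
    fix y assume "y \<in> {coord s -` G |s G. 0 \<le> s \<and> ennreal s \<le> ennreal 1 \<and> (G :: 'b set) \<in> sets borel}"
    then obtain s G where y: "y = coord s -` G" "G \<in> sets borel" by blast
    have "\<iota> -` y \<inter> space borel = G" using c(1) by (auto simp: y(1))
    then show "\<iota> -` y \<inter> space borel \<in> sets borel" using y(2) by simp
  qed auto
  have "\<forall>t\<ge>0. mp_process h p f t \<in> borel_measurable (path_filtration (ennreal t))"
    using assms unfolding local_martingale_def by (rule conjunct1)
  then have "mp_process h p f 1 \<in> borel_measurable (path_filtration (ennreal 1))" using zero_le_one by blast
  from measurable_compose[OF m this] have "(\<lambda>x. mp_process h p f 1 (\<iota> x)) \<in> borel_measurable borel" .
  moreover have "mp_process h p f 1 (\<iota> x) = - generator h p f x" for x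
    by (simp add: mp_process_def c set_integral_const_Icc)
  ultimately have "(\<lambda>x. - (- generator h p f x)) \<in> borel_measurable borel" by (intro borel_measurable_uminus) simp
  then show ?thesis by simp
qed

text \<open>Indicators of open sets are limits of continuous functions.\<close>

lemma measure_eq_of_continuous_integrals:
  fixes M N :: "'b::metric_space measure"
  assumes M: "prob_space M" "sets M = sets borel" and N: "prob_space N" "sets N = sets borel"
    and eq: "\<And>f :: 'b \<Rightarrow> real. continuous_on UNIV f \<Longrightarrow> bounded (range f) \<Longrightarrow> integral\<^sup>L M f = integral\<^sup>L N f"
  shows "M = N"
proof -
  interpret M: prob_space M by (rule M(1))
  interpret N: prob_space N by (rule N(1))
  have lim: "(\<lambda>l. integral\<^sup>L Q (bump U l)) \<longlonglongrightarrow> measure Q U" if Q: "prob_space Q" "sets Q = sets borel" and U: "open U" for Q U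
  proof -
    interpret Q: prob_space Q by (rule Q(1))
    have UQ: "U \<in> sets Q" using U Q(2) by simp
    have bm: "bump U l \<in> borel_measurable Q" for l
      using borel_measurable_continuous_onI[OF bump_continuous, of U l] Q(2) measurable_cong_sets by blast
    have "(\<lambda>l. integral\<^sup>L Q (bump U l)) \<longlonglongrightarrow> integral\<^sup>L Q (indicator U)"
    proof (rule integral_dominated_convergence[where w="\<lambda>_. 1"])
      show "AE x in Q. norm (bump U l x) \<le> 1" for l using bump_bounds[of U l] by simp
      show "AE x in Q. (\<lambda>l. bump U l x) \<longlonglongrightarrow> indicator U x" using bump_tendsto[OF U] by simp
    qed (use bm UQ in auto)
    then show ?thesis using UQ by (simp add: measure_def)
  qed
  have *: "emeasure M U = emeasure N U" if U: "open U" for U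
  proof -
    have "integral\<^sup>L M (bump U l) = integral\<^sup>L N (bump U l)" for l
    proof (rule eq[OF bump_continuous])
      have "\<bar>bump U l x\<bar> \<le> 1" for x using bump_bounds[of U l x] by simp
      then show "bounded (range (bump U l))" unfolding bounded_real by blast
    qed
    then have "measure M U = measure N U" using LIMSEQ_unique[OF lim[OF M U]] lim[OF N U] by simp
    then show ?thesis by (simp add: M.emeasure_eq_measure N.emeasure_eq_measure)
  qed
  have gen: "sets (borel :: 'b measure) = sigma_sets UNIV {U. open U}" by (simp add: borel_def sets_measure_of_conv)
  show ?thesis
  proof (rule measure_eqI_generator_eq[where E="{U. open U}" and \<Omega>=UNIV and A="\<lambda>_::nat. UNIV"])
    show "Int_stable {U :: 'b set. open U}" by (auto simp: Int_stable_def)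
  qed (use * gen M(2) N(2) M.emeasure_finite in auto)
qed

text \<open>The approximating functions are bounded rather than compactly supported, but a solution is
  tested with compactly supported functions only.\<close>

lemma solution_solves_for:
  assumes h: "truncation_function h" and p: "valid_params p" and sol: "solves_mp h p P"
    and f: "(1, g, \<phi>) \<in> test_B p"
  shows "solves_for P h p 1 \<phi> g"
proof (rule solves_for_of_compact_support)
  show gd: "generator_data h p" using h p by (rule generator_data.intro)
  interpret generator_data h p 1 \<phi> by (rule gd)
  show "path_prob P" using sol by (simp add: solves_mp_def)
  show "Cb2_fun 1 g" using f by (simp add: test_B_def)
  fix g' assume g': "Cc2_fun 1 g'"
  have "(1, g', \<phi>) \<in> test_C p" using f g' by (simp add: test_B_def test_C_def)
  then have lm: "local_martingale P path_filtration (mp_process h p (1, g', \<phi>))"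
    using sol unfolding solves_mp_def by blast
  note borel = generator_borel_of_adapted[OF lm]
  have b: "Cb2_fun 1 g'" by (rule Cc2_fun_imp_Cb2_fun[OF g'])
  have C2: "C2_fun 1 g'" using b by (simp add: Cb2_fun_def)
  obtain B where B: "C2_bound 1 g' B" using Cb2_fun_bound[OF b] by blast
  have "bounded (range (test_fun (1, g', \<phi>)))"
    unfolding bounded_real test_fun_eq using B by (intro exI[of _ B]) (auto simp: C2_bound_def)
  moreover have "continuous_on UNIV (test_fun (1, g', \<phi>))"
    using C2 by (intro continuous_test_fun) (simp add: C2_fun_def C1_fun_def)
  moreover have "locally_bounded (generator h p (1, g', \<phi>))"
    by (rule locally_bounded_le[OF locally_bounded_cmult[OF generator_scale_locally_bounded] order_trans[OF generator_bound[OF C2 B] abs_ge_self]])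
  ultimately show "solves_for P h p 1 \<phi> g'"
    unfolding solves_for_def admissible_pair_def using C2 B borel lm mp_process_compensates[OF borel] by blast
qed

lemma ennreal_SUP_bound:
  fixes f :: "nat \<Rightarrow> 'a \<Rightarrow> real"
  assumes "(SUP n. SUP x\<in>S. ennreal \<bar>f n x\<bar>) < \<infinity>"
  shows "\<exists>B. \<forall>n. \<forall>x\<in>S. \<bar>f n x\<bar> \<le> B"
proof (intro exI allI ballI)
  fix n x assume x: "x \<in> S"
  have "ennreal \<bar>f n x\<bar> \<le> (SUP x\<in>S. ennreal \<bar>f n x\<bar>)" by (rule SUP_upper[OF x])
  also have "\<dots> \<le> (SUP n. SUP x\<in>S. ennreal \<bar>f n x\<bar>)" by (rule SUP_upper) simp
  finally have "enn2real (ennreal \<bar>f n x\<bar>) \<le> enn2real (SUP n. SUP x\<in>S. ennreal \<bar>f n x\<bar>)"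
    using assms by (intro enn2real_mono) auto
  then show "\<bar>f n x\<bar> \<le> enn2real (SUP n. SUP x\<in>S. ennreal \<bar>f n x\<bar>)" by simp
qed

text \<open>On the shell between the radii \<open>m - 1\<close> and \<open>m\<close>, take the bound for the ball of radius \<open>m\<close>.\<close>

lemma common_locally_bounded_majorant:
  fixes f :: "nat \<Rightarrow> 'b::real_normed_vector \<Rightarrow> real"
  assumes "\<And>m::nat. \<exists>B. \<forall>n. \<forall>x\<in>{x. norm x \<le> real m}. \<bar>f n x\<bar> \<le> B"
  shows "\<exists>c. locally_bounded c \<and> (\<forall>n x. \<bar>f n x\<bar> \<le> c x)"
proof -
  obtain B where B: "\<And>m n x. norm x \<le> real m \<Longrightarrow> \<bar>f n x\<bar> \<le> B m" using assms by (metis mem_Collect_eq)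
  define c where "c x = B (nat \<lceil>norm x\<rceil>)" for x :: 'b
  have "\<bar>c x\<bar> \<le> (\<Sum>m\<le>nat \<lceil>R\<rceil>. \<bar>B m\<bar>)" if "norm x \<le> R" for x R
  proof -
    have "nat \<lceil>norm x\<rceil> \<le> nat \<lceil>R\<rceil>" using that by (intro nat_mono ceiling_mono)
    then show ?thesis unfolding c_def by (intro member_le_sum[where f="\<lambda>m. \<bar>B m\<bar>"]) auto
  qed
  then have "locally_bounded c" unfolding locally_bounded_def by blast
  moreover have "\<bar>f n x\<bar> \<le> c x" for n x unfolding c_def by (rule B) linarith
  ultimately show ?thesis by blast
qed

lemma weak_limit_unique:
  fixes M N :: "'b::metric_space measure"
  assumes M: "prob_space M" "sets M = sets borel" and N: "prob_space N" "sets N = sets borel"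
    and lim: "weakly_converges Q M" "weakly_converges Q N"
  shows "M = N"
proof (rule measure_eq_of_continuous_integrals[OF M N])
  fix f :: "'b \<Rightarrow> real" assume "continuous_on UNIV f" "bounded (range f)"
  then show "integral\<^sup>L M f = integral\<^sup>L N f"
    using LIMSEQ_unique lim unfolding weakly_converges_def by blast
qed

lemma coord_0_borel: "path_prob P \<Longrightarrow> coord 0 \<in> measurable P borel"
proof -
  assume "path_prob P"
  then have "sets P = sets (path_filtration \<infinity>)" by (simp add: path_prob_def)
  moreover have "coord 0 \<in> measurable (path_filtration \<infinity>) borel" by (rule measurable_coord) auto
  ultimately show ?thesis by (subst measurable_cong_sets[OF _ refl])
qed

lemma initial_law_of_limit:
  fixes Pn :: "nat \<Rightarrow> 'b::metric_space cadlag_path measure"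
  assumes "path_prob P" "\<And>n. path_prob (Pn n)" "weakly_converges Pn P"
  shows "weakly_converges (\<lambda>n. distr (Pn n) borel (coord 0)) (distr P borel (coord 0))"
  unfolding weakly_converges_def
proof (intro allI impI)
  fix f :: "'b \<Rightarrow> real" assume f: "continuous_on UNIV f \<and> bounded (range f)"
  have fb: "f \<in> borel_measurable borel" using f by (intro borel_measurable_continuous_onI) simp
  have "continuous_on UNIV (coord 0 :: 'b cadlag_path \<Rightarrow> 'b)"
    by (rule continuous_on_path_space) (rule skorokhod_conv_pointwise, auto)
  then have "continuous_on UNIV (\<lambda>\<alpha>. f (coord 0 \<alpha>))" by (rule continuous_on_compose2[OF conjunct1[OF f]]) auto
  moreover have "bounded (range (\<lambda>\<alpha>. f (coord 0 \<alpha>)))" by (rule bounded_subset[of "range f"]) (use f in auto)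
  ultimately have "(\<lambda>n. \<integral>\<alpha>. f (coord 0 \<alpha>) \<partial>Pn n) \<longlonglongrightarrow> (\<integral>\<alpha>. f (coord 0 \<alpha>) \<partial>P)"
    using assms(3) unfolding weakly_converges_def by blast
  then show "(\<lambda>n. integral\<^sup>L (distr (Pn n) borel (coord 0)) f) \<longlonglongrightarrow> integral\<^sup>L (distr P borel (coord 0)) f"
    by (simp add: integral_distr[OF coord_0_borel[OF assms(1)] fb] integral_distr[OF coord_0_borel[OF assms(2)] fb])
qed

theorem theorem1:
  fixes h :: "'b::{banach, second_countable_topology} \<Rightarrow> 'b"
    and p :: "'b mp_params"
    and pn :: "nat \<Rightarrow> 'b mp_params"
    and Pn :: "nat \<Rightarrow> 'b cadlag_path measure"
    and P :: "'b cadlag_path measure"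
  assumes reflexive: "reflexive_space TYPE('b)"
    and trunc: "truncation_function h"
    and params: "valid_params p" "\<And>n. valid_params (pn n)"
    and sol: "\<And>n. solves_mp h (pn n) (Pn n)"
    and M1: "\<And>f. f \<in> test_D p \<Longrightarrow> continuous_on UNIV (generator h p f)"
    and M2: "\<And>f. f \<in> test_D p \<Longrightarrow>
      \<exists>fn. (\<forall>n. fn n \<in> test_B (pn n)) \<and>
        (\<forall>m::nat.
          (SUP n. SUP x. ennreal \<bar>test_fun (fn n) x\<bar>)
          + (SUP n. SUP x\<in>{x. norm x \<le> real m}. ennreal \<bar>generator h (pn n) (fn n) x\<bar>) < \<infinity>) \<and>
        (\<forall>S. compact S \<longrightarrow>
          uniform_limit S
            (\<lambda>n x. \<bar>test_fun (fn n) x - test_fun f x\<bar>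
                   + \<bar>generator h (pn n) (fn n) x - generator h p f x\<bar>)
            (\<lambda>_. 0) sequentially)"
    and M3: "weakly_converges (\<lambda>n. init (pn n)) (init p)"
    and prob: "path_prob P"
    and conv: "weakly_converges Pn P"
  shows "solves_mp h p P"
proof -
  have Pn: "path_prob (Pn n)" for n using sol[of n] by (simp add: solves_mp_def)
  have gd: "generator_data h p" using trunc params(1) by (rule generator_data.intro)
  have one_functional: "solves_for P h p 1 (\<lambda>_. \<psi>) g"
    if psi: "\<psi> \<in> adjoint_dom (lin_dom p) (lin_op p)" and g: "Cc2_fun 1 g" for \<psi> g
  proof -
    let ?f = "(1, g, \<lambda>_. \<psi>)"
    have D: "?f \<in> test_D p" using psi g by (simp add: test_D_def)
    obtain fn where fn: "\<And>n. fn n \<in> test_B (pn n)"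
      and bd: "\<And>m::nat. (SUP n. SUP x. ennreal \<bar>test_fun (fn n) x\<bar>)
          + (SUP n. SUP x\<in>{x. norm x \<le> real m}. ennreal \<bar>generator h (pn n) (fn n) x\<bar>) < \<infinity>"
      and lim: "\<And>S. compact S \<Longrightarrow> uniform_limit S (\<lambda>n x. \<bar>test_fun (fn n) x - test_fun ?f x\<bar>
          + \<bar>generator h (pn n) (fn n) x - generator h p ?f x\<bar>) (\<lambda>_. 0) sequentially"
      using M2[OF D] by blast
    have "\<exists>B. \<forall>n. \<forall>x\<in>UNIV. \<bar>test_fun (fn n) x\<bar> \<le> B"
      by (rule ennreal_SUP_bound) (rule le_less_trans[OF add_increasing2 bd[of 0]], auto)
    then obtain B where B: "\<And>n x. \<bar>test_fun (fn n) x\<bar> \<le> B" by blast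
    have "\<exists>B. \<forall>n. \<forall>x\<in>{x. norm x \<le> real m}. \<bar>generator h (pn n) (fn n) x\<bar> \<le> B" for m
      by (rule ennreal_SUP_bound) (rule le_less_trans[OF add_increasing bd[of m]], auto)
    from common_locally_bounded_majorant[OF this] obtain c where
      c: "locally_bounded c" "\<And>n x. \<bar>generator h (pn n) (fn n) x\<bar> \<le> c x" by blast
    have sg: "admissible_pair (test_fun (fn n)) (generator h (pn n) (fn n))"
      "compensates (Pn n) (test_fun (fn n)) (generator h (pn n) (fn n))" for n
    proof -
      obtain d k \<phi> where f: "fn n = (d, k, \<phi>)" by (cases "fn n")
      have d: "d = 1" using fn[of n] by (simp add: f test_B_def)
      have "solves_for (Pn n) h (pn n) 1 \<phi> k" by (rule solution_solves_for[OF trunc params(2) sol]) (use fn[of n] f d in simp)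
      then show "admissible_pair (test_fun (fn n)) (generator h (pn n) (fn n))"
        "compensates (Pn n) (test_fun (fn n)) (generator h (pn n) (fn n))" by (simp_all add: solves_for_def f d)
    qed
    have b: "Cb2_fun 1 g" by (rule Cc2_fun_imp_Cb2_fun[OF g])
    have C2: "C2_fun 1 g" using b by (simp add: Cb2_fun_def)
    have ct: "continuous_on UNIV (test_fun ?f)" using C2 by (intro continuous_test_fun) (simp add: C2_fun_def C1_fun_def)
    note W = compensates_weak_limit[OF prob Pn conv ct M1[OF D] sg B c(2,1) lim]
    show ?thesis unfolding solves_for_def using W C2 Cb2_fun_bound[OF b] by blast
  qed
  have "local_martingale P path_filtration (mp_process h p f)" if "f \<in> test_C p" for f
  proof -
    obtain d g \<phi> where f: "f = (d, g, \<phi>)" by (cases f)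
    have g: "Cc2_fun d g" and phi: "\<And>i. i < d \<Longrightarrow> \<phi> i \<in> adjoint_dom (lin_dom p) (lin_op p)"
      using that by (auto simp: f test_C_def)
    have "several_functionals h p d \<phi> P"
      by (rule several_functionals.intro[OF gd]) (unfold_locales, use prob phi one_functional in auto)
    then have "solves_for P h p d \<phi> g" by (rule several_functionals.solves_for_several[OF _ Cc2_fun_imp_Cb2_fun[OF g]])
    then show ?thesis unfolding f solves_for_def admissible_pair_def using mp_process_compensates by blast
  qed
  moreover have "distr P borel (coord 0) = init p"
  proof (rule weak_limit_unique)
    have "distr (Pn n) borel (coord 0) = init (pn n)" for n using sol[of n] by (simp add: solves_mp_def)
    then show "weakly_converges (\<lambda>n. init (pn n)) (distr P borel (coord 0))"
      using initial_law_of_limit[OF prob Pn conv] by simp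
    show "prob_space (distr P borel (coord 0))"
      using prob by (intro prob_space.prob_space_distr coord_0_borel) (auto simp: path_prob_def)
  qed (use M3 params(1) in \<open>auto simp: valid_params_def\<close>)
  ultimately show ?thesis unfolding solves_mp_def using prob by blast
qed

end
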